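(* Let $d\ge3$ and let $n(d)=2^{(d+1)/2}$ if $d$ is odd, $n(d)=2^{d/2}$ if $d$ is even. Let $A\in L^2_{\mathrm{loc}}(\mathbb{R}^d;\mathbb{R}^d)$ be such that $\mathbf B\in L^2_{\mathrm{loc}}(\mathbb{R}^d;\mathbb{R}^{d\times d})$. Assume that there exists a number $c\in[0,1)$ satisfying $$\frac{2d}{d-2}\,c<1\qquad\text{and}\qquad 2c+\frac{d(2d-3)}{d-2}\,c+\frac{\sqrt2}{\sqrt{d-2}}\Big(\frac d2c\Big)^{3/2}<1$$ such that, for all $n(d)$-vectors $u$ with components in $C_0^\infty(\mathbb{R}^d)$, $$\int_{\mathbb{R}^d}r^2|\mathbf B|^2|u|^2\le c^2\int_{\mathbb{R}^d}|\nabla_{\!A}u|^2 .$$ If in addition $A\in W^{1,d}_{\mathrm{loc}}(\mathbb{R}^d)$, then the purely magnetic Dirac operator $H_{\mathrm D}(A)$ in $L^2(\mathbb{R}^d;\mathbb{C}^{n(d)})$ has no eigenvalues, i.e. $\sigma_{\mathrm p}(H_{\mathrm D}(A))=\varnothing$.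
   Context: Notation: $r(x):=|x|$; $\nabla_{\!A}:=\nabla+iA$ acts componentwise; $|\nabla_{\!A}u|^2:=\sum_j|\nabla_{\!A}u_j|^2$. $\mathbf B:=(\nabla A)-(\nabla A)^t$, i.e. $\mathbf B_{jk}=\partial_jA_k-\partial_kA_j$; $|\mathbf B|$ is the operator norm. $\sigma_{\mathrm p}$ is the set of all eigenvalues. Dirac matrices. The $n(d)\times n(d)$ Hermitian matrices $\boldsymbol\alpha^{(d)}_1,\dots,\boldsymbol\alpha^{(d)}_d$ and $\boldsymbol\beta^{(d)}=:\boldsymbol\alpha^{(d)}_{d+1}$ (standard representation) are defined iteratively, starting from the $1\times1$ matrix $\boldsymbol\alpha^{(0)}_1=(1)$, by $$\boldsymbol\alpha_\mu=\begin{pmatrix}\mathbf 0&\mathbf a_\mu^*\\ \mathbf a_\mu&\mathbf 0\end{pmatrix},\ \mu=1,\dots,d,\qquad \boldsymbol\beta=\begin{pmatrix}\mathbf I_{\mathbb{C}^{n(d)/2}}&\mathbf 0\\ \mathbf 0&-\mathbf I_{\mathbb{C}^{n(d)/2}}\end{pmatrix},$$ where, for $d$ odd, $\mathbf a_\mu=\boldsymbol\alpha^{(d-1)}_\mu$ for $\mu=1,\dots,d$ and, for $d$ even, $\mathbf a_1=\mathbf I_{\mathbb{C}^{n(d-2)}}$ and $\mathbf a_{\mu+1}=i\boldsymbol\alpha^{(d-2)}_\mu$ for $\mu=1,\dots,d-1$. They satisfy $\boldsymbol\alpha_\mu\boldsymbol\alpha_\nu+\boldsymbol\alpha_\nu\boldsymbol\alpha_\mu=2\delta_{\mu\nu}\mathbf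 I$, $\boldsymbol\alpha_\mu\boldsymbol\beta+\boldsymbol\beta\boldsymbol\alpha_\mu=\mathbf 0$, $\boldsymbol\beta^2=\mathbf I$. Dirac operator. $H_{\mathrm D}(A):=-i\sum_{\mu=1}^d\boldsymbol\alpha_\mu(\partial_\mu+iA_\mu)+\frac12\boldsymbol\beta$, with domain the magnetic Sobolev space $H^1_A(\mathbb{R}^d;\mathbb{C}^{n(d)})=\{u\in L^2:(\partial_j+iA_j)u\in L^2,\ j=1,\dots,d\}$; under the stated assumptions it is a closed symmetric operator. *)

theory Defs
  imports "HOL-Analysis.Analysis" "Jordan_Normal_Form.Schur_Decomposition"
begin

(* Both libraries use "$" for component selection: it is kept for the Euclidean vectors
   real ^ 'd, and the components of a spinor in Matrix.vec are written u $v k. *)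
no_notation Matrix.vec_index (infixl "$" 100)
notation Matrix.vec_index (infixl "$v" 100)

section \<open>Test functions, local Lebesgue spaces and weak derivatives\<close>

abbreviation pderiv_at :: "'d \<Rightarrow> (real ^ 'd \<Rightarrow> 'b::real_normed_vector) \<Rightarrow> real ^ 'd \<Rightarrow> 'b" where
  "pderiv_at j f x \<equiv> frechet_derivative f (at x) (axis j 1)"

primrec Ck :: "nat \<Rightarrow> (real ^ 'd::finite \<Rightarrow> 'b::real_normed_vector) \<Rightarrow> bool" where
  "Ck 0 f \<longleftrightarrow> continuous_on UNIV f"
| "Ck (Suc k) f \<longleftrightarrow> (\<forall>x. f differentiable (at x)) \<and> (\<forall>j. Ck k (pderiv_at j f))"

definition test_function :: "(real ^ 'd::finite \<Rightarrow> 'b::real_normed_vector) \<Rightarrow> bool" where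
  "test_function \<phi> \<longleftrightarrow> (\<forall>k. Ck k \<phi>) \<and> compact (closure {x. \<phi> x \<noteq> 0})"

definition Lp_loc :: "nat \<Rightarrow> (real ^ 'd::finite \<Rightarrow> 'b::euclidean_space) \<Rightarrow> bool" where
  "Lp_loc p f \<longleftrightarrow> f \<in> borel_measurable lebesgue \<and>
     (\<forall>K. compact K \<longrightarrow> set_integrable lebesgue K (\<lambda>x. norm (f x) ^ p))"

definition weak_pderiv ::
  "'d \<Rightarrow> (real ^ 'd::finite \<Rightarrow> 'b::euclidean_space) \<Rightarrow> (real ^ 'd \<Rightarrow> 'b) \<Rightarrow> bool" where
  "weak_pderiv j f g \<longleftrightarrow> Lp_loc 1 f \<and> Lp_loc 1 g \<and>
     (\<forall>\<phi> :: real ^ 'd \<Rightarrow> real. test_function \<phi> \<longrightarrow>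
        (LINT x|lebesgue. \<phi> x *\<^sub>R g x) = - (LINT x|lebesgue. pderiv_at j \<phi> x *\<^sub>R f x))"

definition W1p_loc :: "nat \<Rightarrow> (real ^ 'd::finite \<Rightarrow> real ^ 'd) \<Rightarrow> bool" where
  "W1p_loc p A \<longleftrightarrow> Lp_loc p A \<and>
     (\<forall>j k. \<exists>g. Lp_loc p g \<and> weak_pderiv j (\<lambda>x. A x $ k) g)"

section \<open>Magnetic field and magnetic gradient\<close>

(* B x $ j $ k = d_j A_k - d_k A_j in the sense of distributions.  For A merely in L^2_loc only
   this difference, not the two derivatives separately, is required to be a function. *)
definition magnetic_field :: "(real ^ 'd::finite \<Rightarrow> real ^ 'd) \<Rightarrow> (real ^ 'd \<Rightarrow> real ^ 'd ^ 'd) \<Rightarrow> bool" where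
  "magnetic_field A B \<longleftrightarrow> Lp_loc 1 A \<and> Lp_loc 1 B \<and>
     (\<forall>j k. \<forall>\<phi> :: real ^ 'd \<Rightarrow> real. test_function \<phi> \<longrightarrow>
        (LINT x|lebesgue. \<phi> x * B x $ j $ k)
          = - (LINT x|lebesgue. pderiv_at j \<phi> x * A x $ k - pderiv_at k \<phi> x * A x $ j))"

(* The distribution (d_j + i A_j) f is represented by the locally integrable function g. *)
definition weak_magnetic_pderiv ::
  "(real ^ 'd::finite \<Rightarrow> real ^ 'd) \<Rightarrow> 'd \<Rightarrow> (real ^ 'd \<Rightarrow> complex) \<Rightarrow> (real ^ 'd \<Rightarrow> complex) \<Rightarrow> bool" where
  "weak_magnetic_pderiv A j f g \<longleftrightarrow>
     Lp_loc 1 f \<and> Lp_loc 1 (\<lambda>x. complex_of_real (A x $ j) * f x) \<and> Lp_loc 1 g \<and>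
     (\<forall>\<phi> :: real ^ 'd \<Rightarrow> real. test_function \<phi> \<longrightarrow>
        (LINT x|lebesgue. \<phi> x *\<^sub>R g x)
          = - (LINT x|lebesgue. pderiv_at j \<phi> x *\<^sub>R f x)
            + (LINT x|lebesgue. \<phi> x *\<^sub>R (\<i> * complex_of_real (A x $ j) * f x)))"

definition magnetic_pderiv ::
  "(real ^ 'd::finite \<Rightarrow> real ^ 'd) \<Rightarrow> 'd \<Rightarrow> (real ^ 'd \<Rightarrow> complex) \<Rightarrow> real ^ 'd \<Rightarrow> complex" where
  "magnetic_pderiv A j f x = pderiv_at j f x + \<i> * complex_of_real (A x $ j) * f x"

section \<open>Dirac matrices\<close>

definition spinor_dim :: "nat \<Rightarrow> nat" where
  "spinor_dim d = (if odd d then 2 ^ ((d + 1) div 2) else 2 ^ (d div 2))"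

(* Indices 1, ..., d give the matrices alpha_mu, index d + 1 gives beta; other indices are
   meaningless.  The lower left block of alpha_mu is a_mu. *)
fun dirac_matrix :: "nat \<Rightarrow> nat \<Rightarrow> complex mat" where
  "dirac_matrix d \<mu> =
     (if d = 0 then 1\<^sub>m 1
      else let m = spinor_dim d div 2 in
        if \<mu> = d + 1 then four_block_mat (1\<^sub>m m) (0\<^sub>m m m) (0\<^sub>m m m) (- 1\<^sub>m m)
        else let a = (if odd d then dirac_matrix (d - 1) \<mu>
                      else if \<mu> = 1 then 1\<^sub>m m
                      else \<i> \<cdot>\<^sub>m dirac_matrix (d - 2) (\<mu> - 1))
             in four_block_mat (0\<^sub>m m m) (mat_adjoint a) a (0\<^sub>m m m))"

declare dirac_matrix.simps [simp del]

section \<open>The Dirac operator\<close>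

(* Elements of L^2(R^d; C^n) are represented by functions; equality in L^2 is equality almost
   everywhere.  An unbounded operator is its graph, a set of pairs (u, f) with f = T u. *)

definition L2_spinor :: "nat \<Rightarrow> (real ^ 'd::finite \<Rightarrow> complex Matrix.vec) set" where
  "L2_spinor n = {u. (\<forall>x. u x \<in> carrier_vec n) \<and>
     (\<forall>k<n. (\<lambda>x. u x $v k) \<in> borel_measurable lebesgue \<and>
             integrable lebesgue (\<lambda>x. (cmod (u x $v k))\<^sup>2))}"

(* w j = (d_j + i A_j) u, with all components of w j square integrable *)
definition L2_magnetic_gradient :: "nat \<Rightarrow> (real ^ 'd::finite \<Rightarrow> real ^ 'd)
    \<Rightarrow> (real ^ 'd \<Rightarrow> complex Matrix.vec) \<Rightarrow> ('d \<Rightarrow> real ^ 'd \<Rightarrow> complex Matrix.vec) \<Rightarrow> bool" where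
  "L2_magnetic_gradient n A u w \<longleftrightarrow>
     (\<forall>j. w j \<in> L2_spinor n \<and>
          (\<forall>k<n. weak_magnetic_pderiv A j (\<lambda>x. u x $v k) (\<lambda>x. w j x $v k)))"

definition magnetic_sobolev ::
  "nat \<Rightarrow> (real ^ 'd::finite \<Rightarrow> real ^ 'd) \<Rightarrow> (real ^ 'd \<Rightarrow> complex Matrix.vec) set" where
  "magnetic_sobolev n A = {u \<in> L2_spinor n. \<exists>w. L2_magnetic_gradient n A u w}"

(* The map e numbers the coordinates of real ^ 'd by 1, ..., d, so that alpha_mu is paired with
   the coordinate e mu. *)
definition dirac_operator :: "(nat \<Rightarrow> 'd) \<Rightarrow> (real ^ 'd::finite \<Rightarrow> real ^ 'd)
    \<Rightarrow> ((real ^ 'd \<Rightarrow> complex Matrix.vec) \<times> (real ^ 'd \<Rightarrow> complex Matrix.vec)) set" where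
  "dirac_operator e A = (let d = CARD('d); n = spinor_dim d in
     {(u, f). u \<in> magnetic_sobolev n A \<and> f \<in> L2_spinor n \<and>
        (\<exists>w. L2_magnetic_gradient n A u w \<and>
           (AE x in lebesgue. \<forall>k<n.
              f x $v k = - \<i> * (\<Sum>\<mu>=1..d. (dirac_matrix d \<mu> *\<^sub>v w (e \<mu>) x) $v k)
                         + 1 / 2 * (dirac_matrix d (d + 1) *\<^sub>v u x) $v k))})"

definition point_spectrum ::
  "nat \<Rightarrow> ((real ^ 'd::finite \<Rightarrow> complex Matrix.vec) \<times> (real ^ 'd \<Rightarrow> complex Matrix.vec)) set
    \<Rightarrow> complex set" where
  "point_spectrum n T =
     {z. \<exists>u. (u, \<lambda>x. z \<cdot>\<^sub>v u x) \<in> T \<and> \<not> (AE x in lebesgue. u x = 0\<^sub>v n)}"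

end

theory Submission
  imports Defs
begin

text \<open>Write \<open>\<nabla>\<^sub>A\<close> for the magnetic gradient and \<open>D = \<Sum>\<^sub>j \<alpha>\<^sub>j (\<partial>\<^sub>j + i A\<^sub>j)\<close>.  An eigenfunction \<open>u\<close> for \<open>z\<close> satisfies
  \<open>D u = i M u\<close> with the constant diagonal matrix \<open>M = z - \<beta> / 2\<close>.  Let \<open>\<phi>\<close> and \<open>\<chi>\<close> be the parts of \<open>u\<close>
  on which \<open>\<beta>\<close> is \<open>1\<close> and \<open>-1\<close>.  Every \<open>\<alpha>\<^sub>j\<close> exchanges the two parts, so
  \<open>D \<phi> = i (z + 1/2) \<chi>\<close> and \<open>D \<chi> = i (z - 1/2) \<phi>\<close>.  Three facts are played against each other.

  \<^item> \<^emph>\<open>Symmetry.\<close>  Integration by parts gives \<open>(z + 1/2) \<parallel>\<chi>\<parallel>\<^sup>2 = (cnj z - 1/2) \<parallel>\<phi>\<parallel>\<^sup>2\<close>.  Hence \<open>z\<close> is real, and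
    \<open>\<langle>u, M u\<rangle> = 2 (z + 1/2) \<parallel>\<chi>\<parallel>\<^sup>2\<close>.
  \<^item> \<^emph>\<open>Coercivity.\<close>  Since the \<open>\<alpha>\<^sub>j\<close> anticommute, \<open>\<parallel>D v\<parallel>\<^sup>2\<close> differs from \<open>\<parallel>\<nabla>\<^sub>A v\<parallel>\<^sup>2\<close> only by the commutators of
    the components of \<open>\<nabla>\<^sub>A\<close>, that is, by a form in \<open>B\<close> of size at most \<open>(d/2) \<integral> \<bar>B\<bar> \<bar>v\<bar>\<^sup>2\<close>.  The hypothesis on
    \<open>r \<bar>B\<bar>\<close> and Hardy's inequality for \<open>v / r\<close> bound it by \<open>d c / (d - 2) \<parallel>\<nabla>\<^sub>A v\<parallel>\<^sup>2\<close>, and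
    \<open>d c / (d - 2) < 1/2\<close>.
  \<^item> \<^emph>\<open>A virial identity.\<close>  The commutator of \<open>D\<close> with the dilation derivative \<open>x \<cdot> \<nabla>\<^sub>A\<close> consists, up to factors \<open>i\<close>,
    of \<open>D\<close> itself and of \<open>\<Sum>\<^sub>j \<alpha>\<^sub>j (B x)\<^sub>j\<close>.  Tested with \<open>u\<close>, the terms in which \<open>M\<close> meets \<open>x \<cdot> \<nabla>\<^sub>A u\<close> cancel, because
    \<open>M\<close> is constant and Hermitian, and \<open>\<langle>u, M u\<rangle> = - \<integral> \<langle>u, \<alpha> \<cdot> (B x) u\<rangle>\<close> remains.  The right-hand side couples only
    \<open>\<phi>\<close> to \<open>\<chi>\<close>, so it is at most \<open>2 \<parallel>r \<bar>B\<bar> \<phi>\<parallel> \<parallel>\<chi>\<parallel> \<le> 2 c \<parallel>\<nabla>\<^sub>A \<phi>\<parallel> \<parallel>\<chi>\<parallel>\<close>.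

  Symmetry and the virial identity give \<open>\<bar>z + 1/2\<bar> \<parallel>\<chi>\<parallel> \<le> c \<parallel>\<nabla>\<^sub>A \<phi>\<parallel>\<close>, while coercivity for \<open>\<phi>\<close> gives
  \<open>\<parallel>\<nabla>\<^sub>A \<phi>\<parallel>\<^sup>2 \<le> 2 (z + 1/2)\<^sup>2 \<parallel>\<chi>\<parallel>\<^sup>2\<close>.  As \<open>c < 1/2\<close>, both sides vanish; then \<open>\<phi> = 0\<close> by Hardy's inequality,
  so \<open>D \<chi> = 0\<close>, and coercivity for \<open>\<chi>\<close> gives \<open>\<chi> = 0\<close>.  This is \<open>no_eigenfunction\<close>, proved from
  \<open>symmetric_relation\<close>, \<open>part_coercivity\<close> and \<open>virial_inequality\<close>.

  The difficulty is regularity: \<open>u\<close> is only known to lie in the magnetic Sobolev space, and \<open>A\<close> is only locally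
  square integrable.  The identities are therefore put in a form that contains first derivatives only, with \<open>B\<close>
  entering through products \<open>p q\<close> of two weights that are bounded relative to the form \<open>\<parallel>\<nabla>\<^sub>A f\<parallel>\<^sup>2 + \<parallel>f\<parallel>\<^sup>2\<close>.  In
  this form both sides are continuous in the graph norm, and it suffices to verify them for test functions
  (\<open>magnetic_pderiv_by_parts\<close>, \<open>magnetic_commutator\<close>).  Test functions are dense (\<open>test_functions_dense\<close>) by
  cutting off, truncating the values and mollifying.  The unbounded field \<open>x\<close> is replaced by
  \<open>x / (1 + \<epsilon> r\<^sup>2)\<close>, and \<open>\<epsilon>\<close> tends to zero only in the terms without \<open>B\<close>.\<close>

section \<open>Smooth functions\<close>

abbreviation smooth :: "(real ^ 'd::finite \<Rightarrow> 'b::real_normed_vector) \<Rightarrow> bool" where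
  "smooth f \<equiv> \<forall>k. Ck k f"

lemma pderiv_at_eqI: "(f has_derivative f') (at x) \<Longrightarrow> pderiv_at j f x = f' (axis j 1)"
  by (metis frechet_derivative_at)

lemma Ck_SucD: "Ck (Suc k) f \<Longrightarrow> Ck k f"
proof (induction k arbitrary: f)
  case 0
  then have "f differentiable_on UNIV" by (simp add: differentiable_on_def)
  then show ?case using differentiable_imp_continuous_on by simp
next
  case (Suc k)
  have "Ck (Suc k) (pderiv_at j f)" for j using Suc.prems unfolding Ck.simps(2)[of "Suc k"] by blast
  then have "Ck k (pderiv_at j f)" for j using Suc.IH by blast
  moreover have "\<forall>x. f differentiable (at x)" using Suc.prems unfolding Ck.simps(2)[of "Suc k"] by blast
  ultimately show ?case unfolding Ck.simps(2) by blast
qed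

lemma CkD_differentiable: "Ck (Suc k) f \<Longrightarrow> f differentiable (at x)"
  by simp

lemma smooth_differentiable: "smooth f \<Longrightarrow> f differentiable (at x)"
  using CkD_differentiable by blast

lemma smooth_pderiv: "smooth f \<Longrightarrow> smooth (pderiv_at j f)"
  using Ck.simps(2) by blast

lemma smooth_continuous: "smooth f \<Longrightarrow> continuous_on UNIV f"
  using Ck.simps(1) by blast

lemma smooth_has_derivative:
  "smooth f \<Longrightarrow> (f has_derivative (frechet_derivative f (at x))) (at x)"
  using smooth_differentiable frechet_derivative_works by blast

lemma pderiv_at_const [simp]: "pderiv_at j (\<lambda>x. c) = (\<lambda>x. 0)"
  by (rule ext) (rule pderiv_at_eqI, rule has_derivative_const)

lemma Ck_const [simp]: "Ck k (\<lambda>x. c)"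
  by (induction k arbitrary: c) auto

lemma pderiv_at_linear:
  assumes "bounded_linear L" "f differentiable (at x)"
  shows "pderiv_at j (\<lambda>x. L (f x)) x = L (pderiv_at j f x)"
proof -
  have "((\<lambda>x. L (f x)) has_derivative (\<lambda>h. L (frechet_derivative f (at x) h))) (at x)"
    using bounded_linear.has_derivative[OF assms(1)] assms(2) frechet_derivative_works by blast
  then show ?thesis by (simp add: pderiv_at_eqI)
qed

lemma Ck_linear: "bounded_linear L \<Longrightarrow> Ck k f \<Longrightarrow> Ck k (\<lambda>x. L (f x))"
proof (induction k arbitrary: f)
  case 0
  then show ?case by (auto intro: bounded_linear.continuous_on)
next
  case (Suc k)
  have d: "\<And>x. f differentiable (at x)" using Suc.prems by simp
  have "pderiv_at j (\<lambda>x. L (f x)) = (\<lambda>x. L (pderiv_at j f x))" for j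
    using pderiv_at_linear[OF Suc.prems(1) d] by blast
  moreover have "(\<lambda>x. L (f x)) differentiable (at x)" for x
    using bounded_linear.has_derivative[OF Suc.prems(1)] d[of x] unfolding differentiable_def by blast
  ultimately show ?case using Suc by simp
qed

lemma pderiv_at_add:
  assumes "f differentiable (at x)" "g differentiable (at x)"
  shows "pderiv_at j (\<lambda>x. f x + g x) x = pderiv_at j f x + pderiv_at j g x"
  by (rule pderiv_at_eqI[OF has_derivative_add[OF assms[unfolded frechet_derivative_works]]])

lemma Ck_add: "Ck k f \<Longrightarrow> Ck k g \<Longrightarrow> Ck k (\<lambda>x. f x + g x)"
proof (induction k arbitrary: f g)
  case 0
  then show ?case by (auto intro: continuous_on_add)
next
  case (Suc k)
  have "pderiv_at j (\<lambda>x. f x + g x) = (\<lambda>x. pderiv_at j f x + pderiv_at j g x)" for j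
    using Suc.prems by (intro ext pderiv_at_add) auto
  then show ?case using Suc by simp
qed

lemma Ck_sum: "(\<And>i. i \<in> I \<Longrightarrow> Ck k (f i)) \<Longrightarrow> Ck k (\<lambda>x. \<Sum>i\<in>I. f i x)"
  by (induction I rule: infinite_finite_induct) (auto intro: Ck_add)

lemma pderiv_at_bilinear:
  assumes "bounded_bilinear p" "f differentiable (at x)" "g differentiable (at x)"
  shows "pderiv_at j (\<lambda>x. p (f x) (g x)) x = p (f x) (pderiv_at j g x) + p (pderiv_at j f x) (g x)"
  by (rule pderiv_at_eqI[OF bounded_bilinear.FDERIV[OF assms(1)
      assms(2)[unfolded frechet_derivative_works] assms(3)[unfolded frechet_derivative_works]]])

lemma Ck_bilinear: "bounded_bilinear p \<Longrightarrow> Ck k f \<Longrightarrow> Ck k g \<Longrightarrow> Ck k (\<lambda>x. p (f x) (g x))"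
proof (induction k arbitrary: f g)
  case 0
  then show ?case by (auto intro: bounded_bilinear.continuous_on)
next
  case (Suc k)
  have d: "\<And>x. f differentiable (at x)" "\<And>x. g differentiable (at x)" using Suc.prems by auto
  have "pderiv_at j (\<lambda>x. p (f x) (g x))
      = (\<lambda>x. p (f x) (pderiv_at j g x) + p (pderiv_at j f x) (g x))" for j
    using pderiv_at_bilinear[OF Suc.prems(1) d] by blast
  moreover have "(\<lambda>x. p (f x) (g x)) differentiable (at x)" for x
    using bounded_bilinear.FDERIV[OF Suc.prems(1)] d[of x] unfolding differentiable_def by blast
  moreover have "Ck k f" "Ck k g" using Suc.prems Ck_SucD by blast+
  ultimately show ?case using Suc by (auto intro!: Ck_add)
qed

lemmas Ck_mult = Ck_bilinear[OF bounded_bilinear_mult]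
lemmas Ck_scaleR = Ck_bilinear[OF bounded_bilinear_scaleR]
lemmas pderiv_at_mult = pderiv_at_bilinear[OF bounded_bilinear_mult]
lemmas pderiv_at_scaleR = pderiv_at_bilinear[OF bounded_bilinear_scaleR]
lemmas Ck_Re = Ck_linear[OF bounded_linear_Re]
lemmas Ck_Im = Ck_linear[OF bounded_linear_Im]
lemmas Ck_of_real = Ck_linear[OF bounded_linear_of_real]
lemmas pderiv_at_cnj = pderiv_at_linear[OF bounded_linear_cnj]
lemmas pderiv_at_Re = pderiv_at_linear[OF bounded_linear_Re]
lemmas pderiv_at_Im = pderiv_at_linear[OF bounded_linear_Im]

lemma Ck_nth: "Ck k (\<lambda>x :: real ^ 'd::finite. x $ j)"
proof (cases k)
  case 0
  then show ?thesis by (auto intro: continuous_intros)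
next
  case (Suc m)
  have bl: "bounded_linear (\<lambda>x::real^'d. x $ j)" by (rule bounded_linear_vec_nth)
  have "pderiv_at i (\<lambda>x::real^'d. x $ j) = (\<lambda>x. axis i 1 $ j)" for i
    by (rule ext) (rule pderiv_at_eqI, rule bounded_linear_imp_has_derivative[OF bl])
  then show ?thesis using Suc bounded_linear_imp_differentiable[OF bl] by simp
qed

lemma Ck_affine:
  fixes f :: "real ^ 'd::finite \<Rightarrow> 'b::real_normed_vector"
  shows "Ck k f \<Longrightarrow> Ck k (\<lambda>x. f (a + s *\<^sub>R x))"
  and "Ck (Suc k) f \<Longrightarrow> pderiv_at j (\<lambda>x. f (a + s *\<^sub>R x)) = (\<lambda>x. s *\<^sub>R pderiv_at j f (a + s *\<^sub>R x))"
proof -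
  have D: "((\<lambda>x. f (a + s *\<^sub>R x)) has_derivative
        (\<lambda>h. frechet_derivative f (at (a + s *\<^sub>R x)) (s *\<^sub>R h))) (at x)"
    if "\<And>x. f differentiable (at x)" for f :: "real ^ 'd::finite \<Rightarrow> 'b" and x
  proof -
    have "((\<lambda>x. a + s *\<^sub>R x) has_derivative (\<lambda>h. s *\<^sub>R h)) (at x)"
      by (auto intro!: derivative_eq_intros)
    moreover have "(f has_derivative frechet_derivative f (at (a + s *\<^sub>R x))) (at (a + s *\<^sub>R x))"
      using that frechet_derivative_works by blast
    ultimately show ?thesis using has_derivative_compose by blast
  qed
  have E: "pderiv_at j (\<lambda>x. f (a + s *\<^sub>R x)) = (\<lambda>x. s *\<^sub>R pderiv_at j f (a + s *\<^sub>R x))"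
    if d: "\<And>x. f differentiable (at x)" for f :: "real ^ 'd::finite \<Rightarrow> 'b" and j
  proof
    fix x
    have "linear (frechet_derivative f (at (a + s *\<^sub>R x)))" using d linear_frechet_derivative by blast
    then show "pderiv_at j (\<lambda>x. f (a + s *\<^sub>R x)) x = s *\<^sub>R pderiv_at j f (a + s *\<^sub>R x)"
      using pderiv_at_eqI[OF D[OF d]] by (simp add: linear_scale)
  qed
  show "Ck (Suc k) f \<Longrightarrow> pderiv_at j (\<lambda>x. f (a + s *\<^sub>R x)) = (\<lambda>x. s *\<^sub>R pderiv_at j f (a + s *\<^sub>R x))"
    using E by simp
  show "Ck k f \<Longrightarrow> Ck k (\<lambda>x. f (a + s *\<^sub>R x))"
  proof (induction k arbitrary: f)
    case 0
    then have c: "continuous_on UNIV f" by simp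
    show ?case unfolding Ck.simps
      by (rule continuous_on_compose2[OF c]) (auto intro!: continuous_intros)
  next
    case (Suc k)
    have d: "\<And>x. f differentiable (at x)" using Suc.prems by simp
    have "Ck k (pderiv_at j f)" for j using Suc.prems by simp
    then have "Ck k (\<lambda>x. pderiv_at j f (a + s *\<^sub>R x))" for j using Suc.IH by blast
    then have "Ck k (\<lambda>x. s *\<^sub>R pderiv_at j f (a + s *\<^sub>R x))" for j
      by (intro Ck_linear[OF bounded_linear_scaleR_right])
    moreover have "(\<lambda>x. f (a + s *\<^sub>R x)) differentiable (at x)" for x
      using D[OF d] unfolding differentiable_def by blast
    ultimately show ?case by (simp add: E[OF d])
  qed
qed

lemma pderiv_at_inverse:
  fixes q :: "real ^ 'd::finite \<Rightarrow> real"
  assumes "q differentiable (at x)" "q x \<noteq> 0"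
  shows "pderiv_at j (\<lambda>x. inverse (q x)) x = - pderiv_at j q x * (inverse (q x))\<^sup>2"
  by (subst pderiv_at_eqI[OF Deriv.has_derivative_inverse[OF assms(2) assms(1)[unfolded frechet_derivative_works]]])
     (simp add: power2_eq_square)

lemma Ck_inverse:
  fixes q :: "real ^ 'd::finite \<Rightarrow> real"
  assumes q: "smooth q" and nz: "\<And>x. q x \<noteq> 0"
  shows "Ck k (\<lambda>x. inverse (q x))"
proof (induction k)
  case 0
  then show ?case using smooth_continuous[OF q] nz by (auto intro: continuous_on_inverse)
next
  case (Suc k)
  have "pderiv_at j (\<lambda>x. inverse (q x)) = (\<lambda>x. (- 1 * pderiv_at j q x) * (inverse (q x) * inverse (q x)))" for j
    using pderiv_at_inverse[OF smooth_differentiable[OF q] nz] by (auto simp: power2_eq_square)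
  moreover have "Ck k (\<lambda>x. (- 1 * pderiv_at j q x) * (inverse (q x) * inverse (q x)))" for j
    by (intro Ck_mult Ck_const Suc smooth_pderiv[OF q, rule_format])
  moreover have "(\<lambda>x. inverse (q x)) differentiable (at x)" for x
    using differentiable_inverse[OF smooth_differentiable[OF q] nz] by simp
  ultimately show ?case unfolding Ck.simps(2) by simp
qed

lemma norm_sq_eq_sum: "(norm x)\<^sup>2 = (\<Sum>j\<in>UNIV. x $ j * x $ j)" for x :: "real ^ 'd::finite"
  by (simp add: norm_vec_def L2_set_def sum_nonneg power2_eq_square)

lemma smooth_norm_sq: "Ck k (\<lambda>x :: real ^ 'd::finite. (norm x)\<^sup>2)"
  unfolding norm_sq_eq_sum by (intro Ck_sum Ck_mult Ck_nth)

lemma has_derivative_norm_sq: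
  "((\<lambda>x :: real ^ 'd::finite. (norm x)\<^sup>2) has_derivative (\<lambda>h. 2 * inner x h)) (at x)"
  unfolding power2_norm_eq_inner
  by (auto intro!: derivative_eq_intros simp: inner_commute)

lemma pderiv_at_norm_sq: "pderiv_at j (\<lambda>x :: real ^ 'd::finite. (norm x)\<^sup>2) x = 2 * x $ j"
  by (subst pderiv_at_eqI[OF has_derivative_norm_sq]) (simp add: inner_axis)

section \<open>A smooth bump function\<close>

text \<open>The derivative of \<open>flat_exp m\<close> is a combination of \<open>flat_exp (m + 1)\<close> and \<open>flat_exp (m + 2)\<close>; the parameter
  makes the family closed under differentiation, so that smoothness follows by induction.\<close>

definition flat_exp :: "nat \<Rightarrow> real \<Rightarrow> real" where
  "flat_exp m t = (if t > 0 then exp (- inverse t) * inverse t ^ m else 0)"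

lemma flat_exp_small: "((\<lambda>t. flat_exp m t) \<longlongrightarrow> 0) (at 0)"
proof -
  have "((\<lambda>s::real. s ^ m / exp s) \<longlongrightarrow> 0) at_top"
    by (rule tendsto_power_div_exp_0)
  then have "((\<lambda>t. inverse t ^ m / exp (inverse t)) \<longlongrightarrow> (0::real)) (at_right 0)"
    by (rule filterlim_compose[OF _ filterlim_inverse_at_top_right])
  then have "(flat_exp m \<longlongrightarrow> 0) (at_right 0)"
    by (rule Lim_transform_eventually)
       (auto simp: eventually_at_filter flat_exp_def exp_minus field_simps)
  moreover have "(flat_exp m \<longlongrightarrow> 0) (at_left 0)"
    by (rule Lim_transform_eventually[of "\<lambda>_. 0"])
       (auto simp: eventually_at_filter flat_exp_def)
  ultimately show ?thesis by (auto intro: filterlim_split_at)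
qed

lemma flat_exp_deriv:
  "(flat_exp m has_real_derivative (- real m * flat_exp (Suc m) t + flat_exp (Suc (Suc m)) t)) (at t)"
proof -
  consider "t > 0" | "t = 0" | "t < 0" by linarith
  then show ?thesis
  proof cases
    case 1
    have "((\<lambda>t. exp (- inverse t) * inverse t ^ m) has_real_derivative
       (- real m * flat_exp (Suc m) t + flat_exp (Suc (Suc m)) t)) (at t)"
    proof -
      have i: "((\<lambda>t. inverse t) has_real_derivative - (inverse t * inverse t)) (at t)"
        using DERIV_inverse[of t UNIV] 1 by (simp add: power2_eq_square)
      have e: "((\<lambda>t. exp (- inverse t)) has_real_derivative exp (- inverse t) * - (- (inverse t * inverse t))) (at t)"
        by (rule DERIV_fun_exp[OF DERIV_minus[OF i]])
      have eq: "real m * (- (inverse t * inverse t) * inverse t ^ (m - Suc 0)) = - real m * inverse t ^ Suc m"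
        by (cases m) (simp_all add: algebra_simps)
      have p: "((\<lambda>t. inverse t ^ m) has_real_derivative - real m * inverse t ^ Suc m) (at t)"
        using DERIV_power[OF i, of m] unfolding eq .
      show ?thesis using DERIV_mult'[OF e p] 1 by (simp add: flat_exp_def mult_ac add.commute)
    qed
    moreover have "\<forall>\<^sub>F s in nhds t. s > 0" using 1 eventually_nhds_in_open[of "{0<..}" t] by simp
    ultimately show ?thesis
      by (subst DERIV_cong_ev[of t t _ "\<lambda>t. exp (- inverse t) * inverse t ^ m"])
         (auto elim!: eventually_mono simp: flat_exp_def)
  next
    case 2
    have "((\<lambda>h. flat_exp (Suc m) h) \<longlongrightarrow> 0) (at 0)" by (rule flat_exp_small)
    then have "((\<lambda>h. (flat_exp m (0 + h) - flat_exp m 0) / h) \<longlongrightarrow> 0) (at 0)"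
      by (rule Lim_transform_eventually) (auto simp: eventually_at_filter flat_exp_def field_simps)
    then show ?thesis using 2 by (simp add: DERIV_def) (simp add: flat_exp_def)
  next
    case 3
    have "((\<lambda>t. 0) has_real_derivative (- real m * flat_exp (Suc m) t + flat_exp (Suc (Suc m)) t)) (at t)"
      using 3 by (auto simp: flat_exp_def)
    moreover have "\<forall>\<^sub>F s in nhds t. s < 0" using 3 eventually_nhds_in_open[of "{..<0}" t] by simp
    ultimately show ?thesis
      by (subst DERIV_cong_ev[of t t _ "\<lambda>t. 0"])
         (auto elim!: eventually_mono simp: flat_exp_def)
  qed
qed

lemma Ck_flat_exp_compose:
  fixes q :: "real ^ 'd::finite \<Rightarrow> real"
  assumes q: "smooth q"
  shows "Ck k (\<lambda>x. flat_exp m (q x))"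
proof (induction k arbitrary: m)
  case 0
  have "continuous_on UNIV (flat_exp m)"
    by (intro continuous_at_imp_continuous_on ballI DERIV_isCont[OF flat_exp_deriv])
  then show ?case using smooth_continuous[OF q] by (auto intro: continuous_on_compose2)
next
  case (Suc k)
  have D: "((\<lambda>x. flat_exp m (q x)) has_derivative (\<lambda>h. frechet_derivative q (at x) h *
       (- real m * flat_exp (Suc m) (q x) + flat_exp (Suc (Suc m)) (q x)))) (at x)" for x
    using DERIV_compose_FDERIV[OF flat_exp_deriv smooth_has_derivative[OF q]] by (simp add: mult.commute)
  have "pderiv_at j (\<lambda>x. flat_exp m (q x)) = (\<lambda>x. pderiv_at j q x *
       (- real m * flat_exp (Suc m) (q x) + flat_exp (Suc (Suc m)) (q x)))" for j
    using pderiv_at_eqI[OF D] by blast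
  moreover have "Ck k (\<lambda>x. pderiv_at j q x *
       (- real m * flat_exp (Suc m) (q x) + flat_exp (Suc (Suc m)) (q x)))" for j
    by (intro Ck_mult Ck_add Ck_const Suc smooth_pderiv[OF q, rule_format])
  moreover have "(\<lambda>x. flat_exp m (q x)) differentiable (at x)" for x
    using D unfolding differentiable_def by blast
  ultimately show ?case unfolding Ck.simps(2) by simp
qed

definition bump :: "real ^ 'd::finite \<Rightarrow> real" where
  "bump x = flat_exp 0 (1 - (norm x)\<^sup>2)"

lemma bump_nonneg: "0 \<le> bump x" and bump_le_1: "bump x \<le> 1"
  by (auto simp: bump_def flat_exp_def)

lemma bump_eq_0: "norm x \<ge> 1 \<Longrightarrow> bump x = 0"
  by (auto simp: bump_def flat_exp_def not_less)

lemma bump_0_pos: "bump 0 > 0"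
  by (auto simp: bump_def flat_exp_def)

lemma smooth_bump: "Ck k bump"
proof -
  have "smooth (\<lambda>x :: real ^ 'd. 1 + (-1) * (norm x)\<^sup>2)"
    by (intro allI Ck_add Ck_mult Ck_const smooth_norm_sq)
  from Ck_flat_exp_compose[OF this] show ?thesis
    by (simp add: bump_def[abs_def])
qed

section \<open>Test functions\<close>

lemma test_function_smooth: "test_function f \<Longrightarrow> smooth f"
  by (simp add: test_function_def)

text \<open>Supports are tracked by radii: this avoids closures of sets in the later estimates.\<close>

lemma test_functionI:
  fixes f :: "real ^ 'd::finite \<Rightarrow> 'b::real_normed_vector"
  assumes "smooth f" "\<And>x. norm x > R \<Longrightarrow> f x = 0"
  shows "test_function f"
proof -
  have "{x. f x \<noteq> 0} \<subseteq> cball 0 R" using assms(2) by (force simp: not_less[symmetric])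
  then have "bounded {x. f x \<noteq> 0}" using bounded_subset bounded_cball by blast
  then show ?thesis using assms(1) by (simp add: test_function_def)
qed

lemma test_function_bounded_support:
  fixes f :: "real ^ 'd::finite \<Rightarrow> 'b::real_normed_vector"
  assumes "test_function f"
  shows "\<exists>R>0. \<forall>x. norm x > R \<longrightarrow> f x = 0"
proof -
  have "bounded (closure {x. f x \<noteq> 0})"
    using assms compact_imp_bounded unfolding test_function_def by blast
  then have "bounded {x. f x \<noteq> 0}"
    using bounded_subset closure_subset by blast
  then obtain R where R: "R > 0" "\<forall>x\<in>{x. f x \<noteq> 0}. norm x \<le> R"
    unfolding bounded_pos by blast
  then have "f x = 0" if "norm x > R" for x using that by force
  with R(1) show ?thesis by blast
qed

lemma test_function_bilinear:
  fixes f :: "real ^ 'd::finite \<Rightarrow> 'a::real_normed_vector" and g :: "real ^ 'd::finite \<Rightarrow> 'b::real_normed_vector"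
  assumes "bounded_bilinear p" "test_function f" "smooth g"
  shows "test_function (\<lambda>x. p (f x) (g x))"
proof -
  obtain R where R: "R > 0" "\<And>x. norm x > R \<Longrightarrow> f x = 0"
    using test_function_bounded_support[OF assms(2)] by blast
  have "smooth (\<lambda>x. p (f x) (g x))"
    using Ck_bilinear[OF assms(1)] test_function_smooth[OF assms(2)] assms(3) by blast
  moreover have "p (f x) (g x) = 0" if "norm x > R" for x
    using R(2)[OF that] bounded_bilinear.zero_left[OF assms(1)] by simp
  ultimately show ?thesis by (rule test_functionI)
qed

lemma test_function_linear:
  fixes f :: "real ^ 'd::finite \<Rightarrow> 'b::real_normed_vector"
  assumes "bounded_linear L" "test_function f"
  shows "test_function (\<lambda>x. L (f x))"
proof -
  obtain R where R: "R > 0" "\<And>x. norm x > R \<Longrightarrow> f x = 0"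
    using test_function_bounded_support[OF assms(2)] by blast
  have "smooth (\<lambda>x. L (f x))"
    using Ck_linear[OF assms(1)] test_function_smooth[OF assms(2)] by blast
  moreover have "L (f x) = 0" if "norm x > R" for x
    using R(2)[OF that] linear_0[OF bounded_linear.linear[OF assms(1)]] by simp
  ultimately show ?thesis by (rule test_functionI)
qed

lemma pderiv_at_zero_outside:
  fixes f :: "real ^ 'd::finite \<Rightarrow> 'b::real_normed_vector"
  assumes "\<And>x. norm x > R \<Longrightarrow> f x = 0" "norm x > R"
  shows "pderiv_at j f x = 0"
proof -
  have "open {x :: real ^ 'd. norm x > R}" by (intro open_Collect_less continuous_intros)
  then have ev: "\<forall>\<^sub>F y in at x. f y = 0"
    using assms by (metis (mono_tags, lifting) eventually_at_topological mem_Collect_eq)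
  have "(f has_derivative (\<lambda>h. 0)) (at x)"
    by (rule has_derivative_transform_eventually[where f="\<lambda>x. 0", OF has_derivative_const])
       (use ev assms in \<open>auto elim: eventually_mono\<close>)
  from pderiv_at_eqI[OF this] show ?thesis by simp
qed

lemma test_function_pderiv:
  fixes f :: "real ^ 'd::finite \<Rightarrow> 'b::real_normed_vector"
  assumes "test_function f"
  shows "test_function (pderiv_at j f)"
proof -
  obtain R where R: "R > 0" "\<And>x. norm x > R \<Longrightarrow> f x = 0"
    using test_function_bounded_support[OF assms] by blast
  show ?thesis
    by (rule test_functionI[OF smooth_pderiv[OF test_function_smooth[OF assms]] pderiv_at_zero_outside[OF R(2)]])
qed

section \<open>Integration\<close>

lemma integrable_compact_support_lborel:
  fixes f :: "real ^ 'd::finite \<Rightarrow> 'b::{banach, second_countable_topology}"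
  assumes c: "continuous_on UNIV f" and z: "\<And>x. norm x > R \<Longrightarrow> f x = 0"
  shows "integrable lborel f"
proof -
  have "integrable lborel (\<lambda>x. indicator (cball 0 R) x *\<^sub>R f x)"
    by (rule borel_integrable_compact[OF compact_cball continuous_on_subset[OF c subset_UNIV]])
  moreover have "(\<lambda>x. indicator (cball 0 R) x *\<^sub>R f x) = f"
    using z by (auto simp: indicator_def fun_eq_iff not_le)
  ultimately show ?thesis by simp
qed

lemma borel_measurable_lebesgueI:
  fixes f :: "real ^ 'd::finite \<Rightarrow> 'b::topological_space"
  shows "f \<in> borel_measurable borel \<Longrightarrow> f \<in> borel_measurable lebesgue"
  by (rule measurable_completion) (simp only: measurable_lborel1 measurable_lborel2)

lemma continuous_measurable_lebesgue:
  fixes f :: "real ^ 'd::finite \<Rightarrow> 'b::topological_space"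
  shows "continuous_on UNIV f \<Longrightarrow> f \<in> borel_measurable lebesgue"
  by (intro borel_measurable_lebesgueI borel_measurable_continuous_onI)

lemma integrable_compact_support:
  fixes f :: "real ^ 'd::finite \<Rightarrow> 'b::{banach, second_countable_topology}"
  assumes c: "continuous_on UNIV f" and z: "\<And>x. norm x > R \<Longrightarrow> f x = 0"
  shows "integrable lebesgue f"
proof -
  have "f \<in> borel_measurable lborel" using borel_measurable_continuous_onI[OF c] by simp
  from integrable_completion[OF this] show ?thesis using integrable_compact_support_lborel[OF assms] by simp
qed

lemma bounded_compact_support:
  fixes f :: "real ^ 'd::finite \<Rightarrow> 'b::real_normed_vector"
  assumes c: "continuous_on UNIV f" and z: "\<And>x. norm x > R \<Longrightarrow> f x = 0"
  shows "\<exists>C\<ge>0. \<forall>x. norm (f x) \<le> C"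
proof -
  have "compact (f ` cball 0 R)"
    by (rule compact_continuous_image[OF continuous_on_subset[OF c subset_UNIV] compact_cball])
  then obtain C where C: "C > 0" "\<forall>y\<in>f ` cball 0 R. norm y \<le> C"
    using compact_imp_bounded bounded_pos by metis
  have "norm (f x) \<le> C" for x
    using C z[of x] by (cases "norm x > R") auto
  with C(1) show ?thesis by (intro exI[of _ C]) auto
qed

lemma integrable_translate:
  fixes f :: "real ^ 'd::finite \<Rightarrow> 'b::{banach, second_countable_topology}"
  assumes "integrable lborel f"
  shows "integrable lborel (\<lambda>x. f (a + x))" "(LINT x|lborel. f (a + x)) = (LINT x|lborel. f x)"
proof -
  have m: "(+) a \<in> measurable lborel borel" by simp
  have f: "f \<in> borel_measurable borel" using borel_measurable_integrable[OF assms] by simp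
  show "integrable lborel (\<lambda>x. f (a + x))"
    using assms integrable_distr_eq[OF m f] by (simp add: lborel_distr_plus)
  show "(LINT x|lborel. f (a + x)) = (LINT x|lborel. f x)"
    using integral_distr[OF m f] by (simp add: lborel_distr_plus)
qed

lemma differentiable_line_bound:
  fixes f :: "real ^ 'd::finite \<Rightarrow> 'b::real_normed_vector"
  assumes d: "\<And>x. f differentiable (at x)" and b: "\<And>x. norm (pderiv_at j f x) \<le> C" and h: "0 \<le> h"
  shows "norm (f (x + h *\<^sub>R axis j 1) - f x) \<le> C * h"
proof -
  define g where "g t = f (x + t *\<^sub>R axis j 1)" for t
  have C: "C \<ge> 0" using b[of 0] norm_ge_zero order_trans by blast
  have g: "(g has_derivative (\<lambda>s. s *\<^sub>R pderiv_at j f (x + t *\<^sub>R axis j 1))) (at t within {0..h})" for t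
  proof -
    have 1: "((\<lambda>t. x + t *\<^sub>R axis j 1) has_derivative (\<lambda>s. s *\<^sub>R axis j 1)) (at t within {0..h})"
      by (auto intro!: derivative_eq_intros)
    have 2: "(f has_derivative frechet_derivative f (at (x + t *\<^sub>R axis j 1))) (at (x + t *\<^sub>R axis j 1))"
      using d frechet_derivative_works by blast
    have "frechet_derivative f (at (x + t *\<^sub>R axis j 1)) (s *\<^sub>R axis j 1)
        = s *\<^sub>R pderiv_at j f (x + t *\<^sub>R axis j 1)" for s
      using linear_scale[OF linear_frechet_derivative[OF d]] by blast
    then show ?thesis using has_derivative_compose[OF 1 2] by (simp add: g_def[abs_def])
  qed
  have o: "onorm (\<lambda>s. s *\<^sub>R pderiv_at j f (x + t *\<^sub>R axis j 1)) \<le> C" for t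
    by (rule onorm_bound[OF C]) (simp add: mult.commute[of C] mult_left_mono[OF b])
  have "norm (g h - g 0) \<le> C * norm (h - 0)"
    by (rule differentiable_bound[OF convex_real_interval(5) g o]) (use h in auto)
  then show ?thesis using h by (simp add: g_def)
qed

text \<open>The derivative is approximated along the fixed sequence of step sizes \<open>1 / (m + 1)\<close>, which makes the dominated
  convergence theorem for sequences applicable.\<close>

definition diff_quotient :: "'d \<Rightarrow> nat \<Rightarrow> (real ^ 'd::finite \<Rightarrow> 'b::real_normed_vector) \<Rightarrow> real ^ 'd \<Rightarrow> 'b" where
  "diff_quotient j m f x = real (Suc m) *\<^sub>R (f (inverse (real (Suc m)) *\<^sub>R axis j 1 + x) - f x)"

lemma diff_quotient_tendsto:
  fixes f :: "real ^ 'd::finite \<Rightarrow> 'b::real_normed_vector"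
  assumes d: "f differentiable (at x)"
  shows "(\<lambda>m. diff_quotient j m f x) \<longlonglongrightarrow> pderiv_at j f x"
proof -
  define h where "h m = inverse (real (Suc m))" for m
  have h: "0 < h m" for m by (simp add: h_def)
  have "((\<lambda>k. norm (f (x + k) - f x - frechet_derivative f (at x) k) / norm k) \<longlongrightarrow> 0) (at 0)"
    using d unfolding frechet_derivative_works has_derivative_at by blast
  moreover have "filterlim (\<lambda>m. h m *\<^sub>R (axis j 1 :: real ^ 'd)) (at 0) sequentially"
  proof -
    have "h \<longlonglongrightarrow> 0" unfolding h_def using LIMSEQ_inverse_real_of_nat .
    then have "(\<lambda>m. h m *\<^sub>R (axis j 1 :: real ^ 'd)) \<longlonglongrightarrow> 0 *\<^sub>R axis j 1" by (intro tendsto_intros)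
    moreover have "h m *\<^sub>R (axis j 1 :: real ^ 'd) \<noteq> 0" for m using h[of m] by (simp add: axis_eq_0_iff)
    ultimately show ?thesis by (simp add: filterlim_at)
  qed
  ultimately have "((\<lambda>m. norm (f (x + h m *\<^sub>R axis j 1) - f x - frechet_derivative f (at x) (h m *\<^sub>R axis j 1))
      / norm (h m *\<^sub>R (axis j 1 :: real ^ 'd))) \<longlongrightarrow> 0) sequentially"
    by (rule filterlim_compose)
  moreover have "norm (f (x + h m *\<^sub>R axis j 1) - f x - frechet_derivative f (at x) (h m *\<^sub>R axis j 1))
      / norm (h m *\<^sub>R (axis j 1 :: real ^ 'd)) = norm (diff_quotient j m f x - pderiv_at j f x)" for m
  proof -
    have r: "real (Suc m) = inverse (h m)" by (simp add: h_def)
    have "frechet_derivative f (at x) (h m *\<^sub>R axis j 1) = h m *\<^sub>R pderiv_at j f x"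
      using linear_scale[OF linear_frechet_derivative[OF d]] by blast
    then have "diff_quotient j m f x - pderiv_at j f x = inverse (h m) *\<^sub>R
        (f (x + h m *\<^sub>R axis j 1) - f x - frechet_derivative f (at x) (h m *\<^sub>R axis j 1))"
      using h[of m] unfolding diff_quotient_def h_def[symmetric] r by (simp add: scaleR_diff_right add.commute)
    then show ?thesis using h[of m] by (simp add: divide_inverse mult.commute)
  qed
  ultimately have "(\<lambda>m. norm (diff_quotient j m f x - pderiv_at j f x)) \<longlonglongrightarrow> 0" by simp
  then show ?thesis using Lim_null tendsto_norm_zero_iff by blast
qed

lemma diff_quotient_bound:
  fixes f :: "real ^ 'd::finite \<Rightarrow> 'b::real_normed_vector"
  assumes "\<And>x. f differentiable (at x)" "\<And>x. norm (pderiv_at j f x) \<le> C"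
  shows "norm (diff_quotient j m f x) \<le> C"
proof -
  define h where "h = inverse (real (Suc m))"
  have h: "h > 0" by (simp add: h_def)
  have "norm (diff_quotient j m f x) = inverse h * norm (f (x + h *\<^sub>R axis j 1) - f x)"
    unfolding diff_quotient_def h_def[symmetric] using h by (simp add: h_def add.commute)
  also have "\<dots> \<le> inverse h * (C * h)"
    using differentiable_line_bound[OF assms, of h x] h by (intro mult_left_mono) auto
  also have "\<dots> = C" using h by simp
  finally show ?thesis .
qed

lemma diff_quotient_outside:
  fixes f :: "real ^ 'd::finite \<Rightarrow> 'b::real_normed_vector"
  assumes z: "\<And>x. norm x > R \<Longrightarrow> f x = 0" and x: "norm x > R + 1"
  shows "diff_quotient j m f x = 0"
proof -
  have "norm x \<le> norm (inverse (real (Suc m)) *\<^sub>R axis j 1 + x) + norm (inverse (real (Suc m)) *\<^sub>R (axis j 1 :: real ^ 'd))"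
    using norm_triangle_ineq4[of "inverse (real (Suc m)) *\<^sub>R axis j 1 + x" "inverse (real (Suc m)) *\<^sub>R (axis j 1 :: real ^ 'd)"] by simp
  also have "norm (inverse (real (Suc m)) *\<^sub>R (axis j 1 :: real ^ 'd)) \<le> 1"
    using inverse_le_1_iff[of "real (Suc m)"] by simp
  finally have "norm (inverse (real (Suc m)) *\<^sub>R axis j 1 + x) > R" using x by simp
  then show ?thesis using z x by (simp add: diff_quotient_def)
qed

text \<open>A difference quotient integrates to zero by translation invariance, and difference
  quotients converge boundedly to the derivative.\<close>

lemma integral_pderiv_eq_0:
  fixes f :: "real ^ 'd::finite \<Rightarrow> 'b::euclidean_space"
  assumes ck: "Ck (Suc 0) f" and z: "\<And>x. norm x > R \<Longrightarrow> f x = 0"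
  shows "(LINT x|lebesgue. pderiv_at j f x) = 0"
proof -
  have d: "\<And>x. f differentiable (at x)" using ck by simp
  have cf: "continuous_on UNIV f" using Ck_SucD[OF ck] by simp
  have cp: "continuous_on UNIV (pderiv_at j f)" using ck by simp
  have pz: "pderiv_at j f x = 0" if "norm x > R" for x
    by (rule pderiv_at_zero_outside[OF _ that]) (rule z)
  obtain C where C: "C \<ge> 0" "\<And>x. norm (pderiv_at j f x) \<le> C"
    using bounded_compact_support[of "pderiv_at j f" R] cp pz by blast
  have fi: "integrable lborel f" by (rule integrable_compact_support_lborel[OF cf]) (rule z)
  have int_q: "(LINT x|lborel. diff_quotient j m f x) = 0" for m
    unfolding diff_quotient_def using integrable_translate[OF fi] fi by simp
  have lim: "(\<lambda>m. LINT x|lborel. diff_quotient j m f x) \<longlonglongrightarrow> (LINT x|lborel. pderiv_at j f x)"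
  proof (rule integral_dominated_convergence)
    show "pderiv_at j f \<in> borel_measurable lborel"
      using borel_measurable_continuous_onI[OF cp] by simp
    show "diff_quotient j m f \<in> borel_measurable lborel" for m
      unfolding diff_quotient_def by (intro borel_measurable_integrable integrable_scaleR_right Bochner_Integration.integrable_diff
          integrable_translate(1) fi)
    show "integrable lborel (\<lambda>x :: real ^ 'd. C * indicator (cball 0 (R + 1)) x)"
      by (intro integrable_mult_right integrable_real_indicator emeasure_lborel_cball_finite) auto
    show "AE x in lborel. (\<lambda>m. diff_quotient j m f x) \<longlonglongrightarrow> pderiv_at j f x"
      by (rule AE_I2) (rule diff_quotient_tendsto[OF d])
    show "AE x in lborel. norm (diff_quotient j m f x) \<le> C * indicator (cball 0 (R + 1)) x" for m
    proof (rule AE_I2)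
      fix x
      show "norm (diff_quotient j m f x) \<le> C * indicator (cball 0 (R + 1)) x"
      proof (cases "norm x \<le> R + 1")
        case True
        then show ?thesis using diff_quotient_bound[OF d C(2)] by simp
      next
        case False
        then show ?thesis using diff_quotient_outside[OF z, where x=x and j=j and m=m] C(1) by simp
      qed
    qed
  qed
  have "(LINT x|lborel. pderiv_at j f x) = 0"
    using LIMSEQ_unique[OF lim] int_q by simp
  moreover have "pderiv_at j f \<in> borel_measurable lborel"
    using borel_measurable_continuous_onI[OF cp] by simp
  ultimately show ?thesis using integral_completion by metis
qed

section \<open>Square integrable functions\<close>

definition L2 :: "(real ^ 'd::finite \<Rightarrow> complex) \<Rightarrow> bool" where
  "L2 f \<longleftrightarrow> f \<in> borel_measurable lebesgue \<and> integrable lebesgue (\<lambda>x. (cmod (f x))\<^sup>2)"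

definition sqint :: "(real ^ 'd::finite \<Rightarrow> complex) \<Rightarrow> real" where
  "sqint f = (LINT x|lebesgue. (cmod (f x))\<^sup>2)"

lemma L2_measurable [measurable_dest]: "L2 f \<Longrightarrow> f \<in> borel_measurable lebesgue"
  and L2_integrable: "L2 f \<Longrightarrow> integrable lebesgue (\<lambda>x. (cmod (f x))\<^sup>2)"
  by (auto simp: L2_def)

lemma sqint_nonneg: "0 \<le> sqint f"
  by (simp add: sqint_def)

lemma cmod_add_sq_le: "(cmod (a + b))\<^sup>2 \<le> 2 * (cmod a)\<^sup>2 + 2 * (cmod b)\<^sup>2"
proof -
  have "(cmod (a + b))\<^sup>2 \<le> (cmod a + cmod b)\<^sup>2" by (intro power_mono norm_triangle_ineq) auto
  also have "\<dots> \<le> 2 * (cmod a)\<^sup>2 + 2 * (cmod b)\<^sup>2"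
    using zero_le_power2[of "cmod a - cmod b"] by (simp add: power2_eq_square algebra_simps)
  finally show ?thesis .
qed

lemma cmod_mult_le_squares: "2 * (cmod a * cmod b) \<le> (cmod a)\<^sup>2 + (cmod b)\<^sup>2"
  using zero_le_power2[of "cmod a - cmod b"] by (simp add: power2_eq_square algebra_simps)

lemma L2_bound:
  assumes "L2 f" "g \<in> borel_measurable lebesgue" "AE x in lebesgue. cmod (g x) \<le> C * cmod (f x)"
  shows "L2 g"
  unfolding L2_def
proof
  show "integrable lebesgue (\<lambda>x. (cmod (g x))\<^sup>2)"
  proof (rule Bochner_Integration.integrable_bound)
    show "integrable lebesgue (\<lambda>x. C\<^sup>2 * (cmod (f x))\<^sup>2)" using L2_integrable[OF assms(1)] by simp
    show "AE x in lebesgue. norm ((cmod (g x))\<^sup>2) \<le> norm (C\<^sup>2 * (cmod (f x))\<^sup>2)"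
      using assms(3) by (rule AE_mp) (auto intro!: AE_I2 power_mono simp flip: power_mult_distrib)
  qed (use assms(2) in measurable)
qed fact

lemma L2_add: assumes "L2 f" "L2 g" shows "L2 (\<lambda>x. f x + g x)"
  unfolding L2_def
proof
  show m: "(\<lambda>x. f x + g x) \<in> borel_measurable lebesgue" using assms L2_measurable by measurable
  show "integrable lebesgue (\<lambda>x. (cmod (f x + g x))\<^sup>2)"
  proof (rule Bochner_Integration.integrable_bound)
    show "integrable lebesgue (\<lambda>x. 2 * (cmod (f x))\<^sup>2 + 2 * (cmod (g x))\<^sup>2)"
      using assms L2_integrable by (intro Bochner_Integration.integrable_add integrable_mult_right) auto
    show "AE x in lebesgue. norm ((cmod (f x + g x))\<^sup>2) \<le> norm (2 * (cmod (f x))\<^sup>2 + 2 * (cmod (g x))\<^sup>2)"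
      using cmod_add_sq_le by (intro AE_I2) auto
  qed (use m in measurable)
qed

lemma L2_mult_bounded:
  assumes "L2 f" "b \<in> borel_measurable lebesgue" "\<And>x. cmod (b x) \<le> C"
  shows "L2 (\<lambda>x. b x * f x)"
  by (rule L2_bound[OF assms(1), of _ C])
     (use assms in \<open>auto intro!: borel_measurable_times L2_measurable mult_right_mono simp: norm_mult\<close>)

lemma L2_cmult: "L2 f \<Longrightarrow> L2 (\<lambda>x. a * f x)"
  using L2_mult_bounded[of f "\<lambda>_. a" "cmod a"] by simp

lemma L2_diff: "L2 f \<Longrightarrow> L2 g \<Longrightarrow> L2 (\<lambda>x. f x - g x)"
  using L2_add[of f "\<lambda>x. - 1 * g x"] L2_cmult[of g "- 1"] by simp

lemma L2_zero: "L2 (\<lambda>x. 0)"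
  by (simp add: L2_def)

lemma L2_sum: "(\<And>i. i \<in> I \<Longrightarrow> L2 (f i)) \<Longrightarrow> L2 (\<lambda>x. \<Sum>i\<in>I. f i x)"
  by (induction I rule: infinite_finite_induct) (auto intro: L2_add L2_zero)

lemma sqint_cong_AE:
  assumes "L2 f" "L2 g" "AE x in lebesgue. f x = g x" shows "sqint f = sqint g"
  unfolding sqint_def
  by (rule integral_cong_AE)
     (use assms in \<open>auto elim!: eventually_mono intro!: borel_measurable_integrable L2_integrable\<close>)

lemma sqint_mono:
  assumes "L2 f" "L2 g" "\<And>x. cmod (f x) \<le> C * cmod (g x)"
  shows "sqint f \<le> C\<^sup>2 * sqint g"
proof -
  have "sqint f \<le> (LINT x|lebesgue. C\<^sup>2 * (cmod (g x))\<^sup>2)"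
    unfolding sqint_def
    using assms by (intro integral_mono L2_integrable integrable_mult_right)
       (auto intro!: power_mono simp flip: power_mult_distrib)
  then show ?thesis by (simp add: sqint_def)
qed

lemma sqint_cmult: "sqint (\<lambda>x. a * f x) = (cmod a)\<^sup>2 * sqint f"
  by (simp add: sqint_def norm_mult power_mult_distrib)

lemma sqint_add_le:
  assumes "L2 f" "L2 g" shows "sqint (\<lambda>x. f x + g x) \<le> 2 * sqint f + 2 * sqint g"
proof -
  have "sqint (\<lambda>x. f x + g x) \<le> (LINT x|lebesgue. 2 * (cmod (f x))\<^sup>2 + 2 * (cmod (g x))\<^sup>2)"
    unfolding sqint_def
    using L2_integrable[OF assms(1)] L2_integrable[OF assms(2)] L2_integrable[OF L2_add[OF assms]] cmod_add_sq_le
    by (intro integral_mono) auto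
  also have "\<dots> = 2 * sqint f + 2 * sqint g"
    using L2_integrable[OF assms(1)] L2_integrable[OF assms(2)] by (simp add: sqint_def)
  finally show ?thesis .
qed

lemma L2_mult_integrable:
  assumes "L2 f" "L2 g"
  shows "integrable lebesgue (\<lambda>x. f x * g x)"
proof (rule Bochner_Integration.integrable_bound)
  show "integrable lebesgue (\<lambda>x. (cmod (f x))\<^sup>2 + (cmod (g x))\<^sup>2)"
    using assms L2_integrable by (intro Bochner_Integration.integrable_add) auto
  show "AE x in lebesgue. norm (f x * g x) \<le> norm ((cmod (f x))\<^sup>2 + (cmod (g x))\<^sup>2)"
  proof (rule AE_I2)
    fix x
    have "0 \<le> cmod (f x) * cmod (g x)" by simp
    then show "norm (f x * g x) \<le> norm ((cmod (f x))\<^sup>2 + (cmod (g x))\<^sup>2)"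
      using cmod_mult_le_squares[of "f x" "g x"] unfolding norm_mult real_norm_def by linarith
  qed
qed (use assms L2_measurable in measurable)

lemma L2_cnj: "L2 f \<Longrightarrow> L2 (\<lambda>x. cnj (f x))"
  unfolding L2_def by (auto intro!: measurable_compose[OF _ borel_measurable_continuous_onI[of cnj]] continuous_intros)

lemma L2_cnj_mult_integrable:
  "L2 f \<Longrightarrow> L2 g \<Longrightarrow> integrable lebesgue (\<lambda>x. cnj (f x) * g x)"
  using L2_mult_integrable L2_cnj by blast

text \<open>Optimising over \<open>t\<close> turns the inequality of the arithmetic and geometric means into the Cauchy-Schwarz
  inequality.\<close>

lemma scaled_mean_imp_geometric:
  fixes p a b :: real
  assumes "\<And>t. t > 0 \<Longrightarrow> 2 * p \<le> t * a + b / t" and "a \<ge> 0" "b \<ge> 0"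
  shows "p \<le> sqrt a * sqrt b"
proof (rule field_le_epsilon)
  fix e :: real assume e: "e > 0"
  define f where "f s = sqrt (a + s) * sqrt (b + s)" for s
  have "(f \<longlongrightarrow> f 0) (at_right 0)"
    unfolding f_def by (intro tendsto_intros)
  then have "\<forall>\<^sub>F s in at_right 0. f s < f 0 + e"
    by (rule order_tendstoD) (use e in simp)
  then have "\<forall>\<^sub>F s in at_right 0. f s < f 0 + e \<and> s > (0::real)"
    using eventually_at_right_less by (rule eventually_conj)
  then obtain s where s: "f s < f 0 + e" "s > 0"
    using eventually_happens[of _ "at_right (0::real)"] by auto
  define t where "t = sqrt (b + s) / sqrt (a + s)"
  have pos: "sqrt (a + s) > 0" "sqrt (b + s) > 0" using s assms by auto
  have "2 * p \<le> t * a + b / t" using assms(1)[of t] pos by (simp add: t_def)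
  also have "\<dots> \<le> t * (a + s) + (b + s) / t"
    using s pos by (intro add_mono mult_left_mono divide_right_mono) (auto simp: t_def)
  also have "t * (a + s) = sqrt (b + s) * ((a + s) / sqrt (a + s))"
    by (simp add: t_def)
  also have "\<dots> = f s" using s assms by (simp add: f_def real_div_sqrt)
  also have "(b + s) / t = sqrt (a + s) * ((b + s) / sqrt (b + s))"
    by (simp add: t_def)
  also have "\<dots> = f s" using s assms by (simp add: f_def real_div_sqrt)
  finally show "p \<le> sqrt a * sqrt b + e" using s(1) by (simp add: f_def)
qed

lemma L2_Cauchy_Schwarz_norm:
  assumes "L2 f" "L2 g"
  shows "(LINT x|lebesgue. cmod (f x) * cmod (g x)) \<le> sqrt (sqint f) * sqrt (sqint g)"
proof (rule scaled_mean_imp_geometric)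
  fix t :: real assume t: "t > 0"
  have int: "integrable lebesgue (\<lambda>x. cmod (f x) * cmod (g x))"
    using integrable_norm[OF L2_mult_integrable[OF assms]] by (simp add: norm_mult)
  have "2 * (LINT x|lebesgue. cmod (f x) * cmod (g x)) = (LINT x|lebesgue. 2 * (cmod (f x) * cmod (g x)))"
    by simp
  also have "\<dots> \<le> (LINT x|lebesgue. t * (cmod (f x))\<^sup>2 + (cmod (g x))\<^sup>2 / t)"
  proof (rule integral_mono)
    show "integrable lebesgue (\<lambda>x. 2 * (cmod (f x) * cmod (g x)))" using int by simp
    show "integrable lebesgue (\<lambda>x. t * (cmod (f x))\<^sup>2 + (cmod (g x))\<^sup>2 / t)"
      using assms L2_integrable by (intro Bochner_Integration.integrable_add) auto
    fix x
    have "0 \<le> (t * cmod (f x) - cmod (g x))\<^sup>2 / t" using t by simp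
    also have "\<dots> = t * (cmod (f x))\<^sup>2 + (cmod (g x))\<^sup>2 / t - 2 * (cmod (f x) * cmod (g x))"
      using t by (simp add: power2_eq_square field_simps)
    finally show "2 * (cmod (f x) * cmod (g x)) \<le> t * (cmod (f x))\<^sup>2 + (cmod (g x))\<^sup>2 / t" by simp
  qed
  also have "\<dots> = t * sqint f + sqint g / t"
    using L2_integrable[OF assms(1)] L2_integrable[OF assms(2)] by (simp add: sqint_def)
  finally show "2 * (LINT x|lebesgue. cmod (f x) * cmod (g x)) \<le> t * sqint f + sqint g / t" .
qed (auto simp: sqint_nonneg)

lemma L2_Cauchy_Schwarz:
  assumes "L2 f" "L2 g"
  shows "cmod (LINT x|lebesgue. f x * g x) \<le> sqrt (sqint f) * sqrt (sqint g)"
proof -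
  have "cmod (LINT x|lebesgue. f x * g x) \<le> (LINT x|lebesgue. cmod (f x) * cmod (g x))"
    using integral_norm_bound[of lebesgue "\<lambda>x. f x * g x"] by (simp add: norm_mult)
  also have "\<dots> \<le> sqrt (sqint f) * sqrt (sqint g)" by (rule L2_Cauchy_Schwarz_norm[OF assms])
  finally show ?thesis .
qed

lemma sqint_cnj [simp]: "sqint (\<lambda>x. cnj (f x)) = sqint f"
  by (simp add: sqint_def)

lemma sqint_tendsto_bounded:
  assumes "\<And>m. L2 (f m)" "L2 f0" "(\<lambda>m. sqint (\<lambda>x. f m x - f0 x)) \<longlonglongrightarrow> 0"
  shows "\<exists>C\<ge>0. \<forall>m. sqint (f m) \<le> C"
proof -
  obtain K where K: "\<forall>m. norm (sqint (\<lambda>x. f m x - f0 x)) \<le> K"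
    using convergent_imp_Bseq[OF convergentI[OF assms(3)]] unfolding Bseq_def by blast
  have "sqint (f m) \<le> 2 * K + 2 * sqint f0" for m
  proof -
    have "sqint (f m) \<le> 2 * sqint (\<lambda>x. f m x - f0 x) + 2 * sqint f0"
      using sqint_add_le[OF L2_diff[OF assms(1,2)] assms(2)] by simp
    then show ?thesis using K[rule_format, of m] by simp
  qed
  moreover from this[of 0] have "0 \<le> 2 * K + 2 * sqint f0" using sqint_nonneg order_trans by blast
  ultimately show ?thesis by blast
qed

text \<open>The difference of the products is a sum of two products with one small factor each; the other factors are bounded
  in \<open>L\<^sup>2\<close>.\<close>

lemma L2_tendsto_mult:
  assumes f: "\<And>m. L2 (f m)" "L2 f0" "(\<lambda>m. sqint (\<lambda>x. f m x - f0 x)) \<longlonglongrightarrow> 0"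
    and g: "\<And>m. L2 (g m)" "L2 g0" "(\<lambda>m. sqint (\<lambda>x. g m x - g0 x)) \<longlonglongrightarrow> 0"
  shows "(\<lambda>m. LINT x|lebesgue. f m x * g m x) \<longlonglongrightarrow> (LINT x|lebesgue. f0 x * g0 x)"
proof -
  obtain C where C: "C \<ge> 0" "\<And>m. sqint (g m) \<le> C" using sqint_tendsto_bounded[OF g] by blast
  have "(\<lambda>m. (LINT x|lebesgue. f m x * g m x) - (LINT x|lebesgue. f0 x * g0 x)) \<longlonglongrightarrow> 0"
  proof (rule Lim_null_comparison)
    show "(\<lambda>m. sqrt (sqint (\<lambda>x. f m x - f0 x)) * sqrt C + sqrt (sqint f0) * sqrt (sqint (\<lambda>x. g m x - g0 x))) \<longlonglongrightarrow> 0"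
      using tendsto_add[OF tendsto_mult_right[OF tendsto_real_sqrt[OF f(3)], of "sqrt C"]
        tendsto_mult_left[OF tendsto_real_sqrt[OF g(3)], of "sqrt (sqint f0)"]] by simp
    show "\<forall>\<^sub>F m in sequentially. norm ((LINT x|lebesgue. f m x * g m x) - (LINT x|lebesgue. f0 x * g0 x))
        \<le> sqrt (sqint (\<lambda>x. f m x - f0 x)) * sqrt C + sqrt (sqint f0) * sqrt (sqint (\<lambda>x. g m x - g0 x))"
    proof (rule always_eventually, rule allI)
      fix m
      have df: "L2 (\<lambda>x. f m x - f0 x)" and dg: "L2 (\<lambda>x. g m x - g0 x)"
        using L2_diff[OF f(1,2)] L2_diff[OF g(1,2)] by auto
      have "(LINT x|lebesgue. f m x * g m x) - (LINT x|lebesgue. f0 x * g0 x)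
          = (LINT x|lebesgue. f m x * g m x - f0 x * g0 x)"
        by (rule Bochner_Integration.integral_diff[symmetric, OF L2_mult_integrable[OF f(1) g(1)] L2_mult_integrable[OF f(2) g(2)]])
      also have "\<dots> = (LINT x|lebesgue. (f m x - f0 x) * g m x + f0 x * (g m x - g0 x))"
        by (simp add: algebra_simps)
      also have "\<dots> = (LINT x|lebesgue. (f m x - f0 x) * g m x) + (LINT x|lebesgue. f0 x * (g m x - g0 x))"
        using L2_mult_integrable[OF df g(1)] L2_mult_integrable[OF f(2) dg]
        by (rule Bochner_Integration.integral_add)
      finally have "norm ((LINT x|lebesgue. f m x * g m x) - (LINT x|lebesgue. f0 x * g0 x))
          \<le> cmod (LINT x|lebesgue. (f m x - f0 x) * g m x) + cmod (LINT x|lebesgue. f0 x * (g m x - g0 x))"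
        by (simp only: norm_triangle_ineq)
      also have "\<dots> \<le> sqrt (sqint (\<lambda>x. f m x - f0 x)) * sqrt (sqint (g m))
          + sqrt (sqint f0) * sqrt (sqint (\<lambda>x. g m x - g0 x))"
        by (intro add_mono L2_Cauchy_Schwarz df dg f g)
      also have "\<dots> \<le> sqrt (sqint (\<lambda>x. f m x - f0 x)) * sqrt C + sqrt (sqint f0) * sqrt (sqint (\<lambda>x. g m x - g0 x))"
        using C(2)[of m] by (intro add_mono mult_left_mono) (auto simp: sqint_nonneg)
      finally show "norm ((LINT x|lebesgue. f m x * g m x) - (LINT x|lebesgue. f0 x * g0 x))
        \<le> sqrt (sqint (\<lambda>x. f m x - f0 x)) * sqrt C + sqrt (sqint f0) * sqrt (sqint (\<lambda>x. g m x - g0 x))" .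
    qed
  qed
  then show ?thesis by (simp add: Lim_null[symmetric])
qed

lemma sqint_eq_integral_cnj: "complex_of_real (sqint f) = (LINT x|lebesgue. cnj (f x) * f x)"
proof -
  have "(LINT x|lebesgue. cnj (f x) * f x) = (LINT x|lebesgue. complex_of_real ((cmod (f x))\<^sup>2))"
    unfolding complex_norm_square by (simp only: mult.commute)
  then show ?thesis by (simp only: sqint_def integral_complex_of_real)
qed

lemma sqint_tendsto:
  assumes f: "\<And>m. L2 (f m)" "L2 f0" "(\<lambda>m. sqint (\<lambda>x. f m x - f0 x)) \<longlonglongrightarrow> 0"
  shows "(\<lambda>m. sqint (f m)) \<longlonglongrightarrow> sqint f0"
proof -
  have "(\<lambda>m. sqint (\<lambda>x. cnj (f m x) - cnj (f0 x))) \<longlonglongrightarrow> 0"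
    using f(3) unfolding complex_cnj_diff[symmetric] sqint_cnj .
  from L2_tendsto_mult[OF L2_cnj[OF f(1)] L2_cnj[OF f(2)] this f]
  have "(\<lambda>m. complex_of_real (sqint (f m))) \<longlonglongrightarrow> complex_of_real (sqint f0)"
    by (simp add: sqint_eq_integral_cnj)
  then show ?thesis using tendsto_of_real_iff by blast
qed

text \<open>The limit obeys the same bound, so the squared errors are dominated by \<open>4 \<bar>h\<bar>\<^sup>2\<close>.\<close>

lemma L2_dominated_convergence:
  fixes h f0 :: "real ^ 'd::finite \<Rightarrow> complex"
  assumes f: "\<And>m. L2 (f m)" "L2 f0" and h: "L2 h"
    and lim: "AE x in lebesgue. (\<lambda>m. f m x) \<longlonglongrightarrow> f0 x"
    and bd: "\<And>m. AE x in lebesgue. cmod (f m x) \<le> cmod (h x)"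
  shows "(\<lambda>m. sqint (\<lambda>x. f m x - f0 x)) \<longlonglongrightarrow> 0"
proof -
  have bd0: "AE x in lebesgue. cmod (f0 x) \<le> cmod (h x)"
  proof -
    have "AE x in lebesgue. \<forall>m. cmod (f m x) \<le> cmod (h x)" using bd by (simp add: AE_all_countable)
    with lim show ?thesis
    proof eventually_elim
      case (elim x)
      then show ?case by (intro LIMSEQ_le_const2[OF tendsto_norm[of _ "f0 x"]]) auto
    qed
  qed
  have "(\<lambda>m. LINT x|lebesgue. (cmod (f m x - f0 x))\<^sup>2) \<longlonglongrightarrow> (LINT (x :: real ^ 'd)|lebesgue. (0::real))"
  proof (rule integral_dominated_convergence[where M=lebesgue and f="\<lambda>_. 0" and s="\<lambda>m x. (cmod (f m x - f0 x))\<^sup>2" and w="\<lambda>x. 4 * (cmod (h x))\<^sup>2"])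
    show "integrable lebesgue (\<lambda>x. 4 * (cmod (h x))\<^sup>2)" using L2_integrable[OF h] by simp
    show "(\<lambda>x. (cmod (f m x - f0 x))\<^sup>2) \<in> borel_measurable lebesgue" for m
      using L2_integrable[OF L2_diff[OF f]] by (rule borel_measurable_integrable)
    show "AE x in lebesgue. (\<lambda>m. (cmod (f m x - f0 x))\<^sup>2) \<longlonglongrightarrow> 0"
      using lim
    proof (eventually_elim)
      case (elim x)
      have "(\<lambda>m. (cmod (f m x - f0 x))\<^sup>2) \<longlonglongrightarrow> (cmod (f0 x - f0 x))\<^sup>2"
        by (intro tendsto_intros elim)
      then show ?case by simp
    qed
    show "AE x in lebesgue. norm ((cmod (f m x - f0 x))\<^sup>2) \<le> 4 * (cmod (h x))\<^sup>2" for m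
      using bd[of m] bd0
    proof eventually_elim
      case (elim x)
      have "cmod (f m x - f0 x) \<le> 2 * cmod (h x)"
        using norm_triangle_ineq4[of "f m x" "f0 x"] elim by simp
      then have "(cmod (f m x - f0 x))\<^sup>2 \<le> (2 * cmod (h x))\<^sup>2" by (intro power_mono) auto
      then show ?case by (simp add: power_mult_distrib)
    qed
  qed simp
  then show ?thesis by (simp add: sqint_def)
qed

section \<open>Translations in the mean\<close>

text \<open>Outer regularity of the complement yields inner regularity by closed sets; continuity from above of the measure
  on the parts of \<open>A\<close> outside large balls makes the inner set compact.\<close>

lemma finite_measure_sandwich:
  fixes A :: "(real ^ 'd::finite) set"
  assumes A: "A \<in> sets borel" "emeasure lborel A < \<infinity>" and e: "e > (0::real)"
  obtains K U where "compact K" "open U" "K \<subseteq> A" "A \<subseteq> U" "emeasure lborel (U - K) < ennreal e"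
proof -
  have e3: "e / 3 > 0" using e by simp
  obtain U where U: "open U" "A \<subseteq> U" "emeasure lborel (U - A) < ennreal (e / 3)"
    using outer_regular_lborel[OF A(1) e3] by blast
  have cA: "- A \<in> sets borel" using A(1) by auto
  obtain V where V: "open V" "- A \<subseteq> V" "emeasure lborel (V - - A) < ennreal (e / 3)"
    using outer_regular_lborel[OF cA e3] by blast
  define D where "D n = A - cball 0 (real n)" for n
  have D: "D n \<in> sets lborel" for n using A(1) by (auto simp: D_def)
  have fin: "emeasure lborel (D n) \<noteq> \<infinity>" for n
  proof -
    have "emeasure lborel (D n) \<le> emeasure lborel A"
      by (rule emeasure_mono) (use A in \<open>auto simp: D_def\<close>)
    then show ?thesis using A(2) by auto
  qed
  have dec: "decseq D" by (auto simp: D_def decseq_def)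
  have "(\<Inter>n. D n) = {}"
  proof -
    have "\<exists>n. x \<notin> D n" for x
      using real_arch_simple[of "norm x"] by (auto simp: D_def)
    then show ?thesis by blast
  qed
  moreover have "(\<lambda>n. emeasure lborel (D n)) \<longlonglongrightarrow> emeasure lborel (\<Inter>n. D n)"
    by (rule Lim_emeasure_decseq) (use D dec fin in auto)
  ultimately have "(\<lambda>n. emeasure lborel (D n)) \<longlonglongrightarrow> 0" by simp
  then have "\<forall>\<^sub>F n in sequentially. emeasure lborel (D n) < ennreal (e / 3)"
    by (rule order_tendstoD) (use e3 in simp)
  then obtain n where n: "emeasure lborel (D n) < ennreal (e / 3)"
    using eventually_happens[of _ sequentially] by auto
  define K where "K = cball 0 (real n) - V"
  have "compact K" unfolding K_def using V(1) by (intro compact_diff compact_cball)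
  moreover have "K \<subseteq> A" using V(2) by (auto simp: K_def)
  moreover have "emeasure lborel (U - K) < ennreal e"
  proof -
    have "emeasure lborel (U - K) \<le> emeasure lborel ((U - A) \<union> ((V - - A) \<union> D n))"
      by (rule emeasure_mono) (use A U(1) V(1) D[of n] in \<open>auto simp: K_def D_def\<close>)
    also have "\<dots> \<le> emeasure lborel (U - A) + emeasure lborel ((V - - A) \<union> D n)"
      by (rule emeasure_subadditive) (use A U(1) V(1) D[of n] in auto)
    also have "\<dots> \<le> emeasure lborel (U - A) + (emeasure lborel (V - - A) + emeasure lborel (D n))"
      by (intro add_mono order_refl emeasure_subadditive) (use A V(1) D[of n] in auto)
    also have "\<dots> < ennreal (e / 3) + (ennreal (e / 3) + ennreal (e / 3))"
      by (intro add_strict_mono U V n)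
    also have "\<dots> = ennreal e" using e by (simp flip: ennreal_plus)
    finally show ?thesis .
  qed
  ultimately show ?thesis using that U by blast
qed

lemma integrable_translate_diff:
  fixes f :: "real ^ 'd::finite \<Rightarrow> 'b::{banach, second_countable_topology}"
  assumes "integrable lborel f"
  shows "integrable lborel (\<lambda>x. norm (f (z + x) - f x))"
  by (intro integrable_norm Bochner_Integration.integrable_diff integrable_translate(1) assms)

text \<open>The translation error is subadditive, so it is enough to control it on indicator functions,
  where regularity of the measure traps it between a compact and an open set.\<close>

lemma L1_translation_continuous:
  fixes f :: "real ^ 'd::finite \<Rightarrow> 'b::{banach, second_countable_topology}"
  assumes "integrable lborel f"
  shows "\<forall>e>0. \<exists>\<delta>>0. \<forall>z. norm z < \<delta> \<longrightarrow> (LINT x|lborel. norm (f (z + x) - f x)) < e"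
  using assms
proof (induction rule: integrable_induct)
  case (base A c)
  show ?case
  proof (intro allI impI)
    fix e :: real assume e: "e > 0"
    \<comment> \<open>One is added to \<open>norm c\<close> because \<open>c\<close> may vanish.\<close>
    define e' where "e' = e / (2 * (norm c + 1))"
    have "e' > 0" using e by (simp add: e'_def add_nonneg_pos)
    moreover have A: "A \<in> sets borel" "emeasure lborel A < \<infinity>" using base by auto
    ultimately obtain K U where KU: "compact K" "open U" "K \<subseteq> A" "A \<subseteq> U" "emeasure lborel (U - K) < ennreal e'"
      using finite_measure_sandwich[of A e'] by metis
    have UK: "U - K \<in> sets borel" using KU by (auto intro: compact_imp_closed borel_closed borel_open)
    have fin: "emeasure lborel (U - K) \<noteq> \<infinity>" using KU(5) by auto
    then have m: "measure lborel (U - K) < e'"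
      using KU(5) by (simp add: emeasure_eq_ennreal_measure ennreal_less_iff)
    have "closed (- U)" using KU(2) by (simp add: closed_Compl)
    moreover have "K \<inter> - U = {}" using KU(3,4) by blast
    ultimately obtain \<delta> where \<delta>: "\<delta> > 0" "\<forall>x\<in>K. \<forall>y\<in>- U. \<delta> \<le> dist x y"
      using separate_compact_closed[OF KU(1), of "- U"] by blast
    have ind: "integrable lborel (\<lambda>x. indicator (U - K) x :: real)"
      using UK fin by (intro integrable_real_indicator) (simp_all add: infinity_ennreal_def less_top)
    show "\<exists>\<delta>>0. \<forall>z. norm z < \<delta> \<longrightarrow> (LINT x|lborel. norm (indicator A (z + x) *\<^sub>R c - indicator A x *\<^sub>R c)) < e"
    proof (intro exI[of _ \<delta>] conjI \<delta>(1) allI impI)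
      fix z :: "real ^ 'd" assume z: "norm z < \<delta>"
      have fA: "integrable lborel (\<lambda>x. indicator A x *\<^sub>R c)"
        using A by (intro integrable_scaleR_left integrable_real_indicator) auto
      have "(LINT x|lborel. norm (indicator A (z + x) *\<^sub>R c - indicator A x *\<^sub>R c))
          \<le> (LINT x|lborel. norm c * (indicator (U - K) (z + x) + indicator (U - K) x))"
      proof (rule integral_mono)
        show "integrable lborel (\<lambda>x. norm (indicator A (z + x) *\<^sub>R c - indicator A x *\<^sub>R c))"
          using integrable_translate_diff[OF fA, of z] .
        show "integrable lborel (\<lambda>x. norm c * (indicator (U - K) (z + x) + indicator (U - K) x))"
          using integrable_translate(1)[OF ind, of z] ind
          by (intro integrable_mult_right Bochner_Integration.integrable_add) auto
        fix x
        have 1: "x \<in> U" if "z + x \<in> K"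
        proof (rule ccontr)
          assume "x \<notin> U"
          then have "\<delta> \<le> dist (z + x) x" using \<delta>(2) that by auto
          then show False using z by (simp add: dist_norm)
        qed
        have 2: "z + x \<in> U" if "x \<in> K"
        proof (rule ccontr)
          assume "z + x \<notin> U"
          then have "\<delta> \<le> dist x (z + x)" using \<delta>(2) that by auto
          then show False using z by (simp add: dist_norm)
        qed
        have "\<bar>indicator A (z + x) - indicator A x\<bar> \<le> (indicator (U - K) (z + x) + indicator (U - K) x :: real)"
          using 1 2 KU(3,4) by (auto simp: indicator_def split: if_splits)
        then have "norm c * \<bar>indicator A (z + x) - indicator A x\<bar>
            \<le> norm c * (indicator (U - K) (z + x) + indicator (U - K) x)"
          by (intro mult_left_mono) auto
        then show "norm (indicator A (z + x) *\<^sub>R c - indicator A x *\<^sub>R c)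
            \<le> norm c * (indicator (U - K) (z + x) + indicator (U - K) x)"
          by (simp add: scaleR_diff_left[symmetric] mult.commute)
      qed
      also have "\<dots> = norm c * (2 * measure lborel (U - K))"
        using integrable_translate[OF ind, of z] ind UK by simp
      also have "\<dots> \<le> norm c * (2 * e')" using m by (intro mult_left_mono) auto
      also have "\<dots> < (norm c + 1) * (2 * e')" using \<open>e' > 0\<close> by simp
      also have "\<dots> = e"
      proof -
        have "norm c + 1 \<noteq> 0" using norm_ge_zero[of c] by linarith
        then show ?thesis by (simp add: e'_def field_simps)
      qed
      finally show "(LINT x|lborel. norm (indicator A (z + x) *\<^sub>R c - indicator A x *\<^sub>R c)) < e" .
    qed
  qed
next
  case (add f g)
  show ?case
  proof (intro allI impI)
    fix e :: real assume "e > 0"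
    then have e2: "e / 2 > 0" by simp
    obtain d1 where d1: "d1 > 0" "\<forall>z. norm z < d1 \<longrightarrow> (LINT x|lborel. norm (f (z + x) - f x)) < e / 2"
      using add.IH(1) e2 by blast
    obtain d2 where d2: "d2 > 0" "\<forall>z. norm z < d2 \<longrightarrow> (LINT x|lborel. norm (g (z + x) - g x)) < e / 2"
      using add.IH(2) e2 by blast
    show "\<exists>\<delta>>0. \<forall>z. norm z < \<delta> \<longrightarrow> (LINT x|lborel. norm (f (z + x) + g (z + x) - (f x + g x))) < e"
    proof (intro exI[of _ "min d1 d2"] conjI allI impI)
      show "min d1 d2 > 0" using d1 d2 by simp
      fix z :: "real ^ 'd" assume z: "norm z < min d1 d2"
      have "(LINT x|lborel. norm (f (z + x) + g (z + x) - (f x + g x)))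
         \<le> (LINT x|lborel. norm (f (z + x) - f x) + norm (g (z + x) - g x))"
      proof (rule integral_mono)
        show "integrable lborel (\<lambda>x. norm (f (z + x) + g (z + x) - (f x + g x)))"
          using integrable_translate_diff[of "\<lambda>x. f x + g x" z] add.hyps by simp
        show "integrable lborel (\<lambda>x. norm (f (z + x) - f x) + norm (g (z + x) - g x))"
          using integrable_translate_diff add.hyps by (intro Bochner_Integration.integrable_add) auto
        show "norm (f (z + x) + g (z + x) - (f x + g x)) \<le> norm (f (z + x) - f x) + norm (g (z + x) - g x)" for x
          using norm_triangle_ineq[of "f (z + x) - f x" "g (z + x) - g x"] by (simp add: algebra_simps)
      qed
      also have "\<dots> = (LINT x|lborel. norm (f (z + x) - f x)) + (LINT x|lborel. norm (g (z + x) - g x))"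
        by (rule Bochner_Integration.integral_add[OF integrable_translate_diff[OF add.hyps(1)] integrable_translate_diff[OF add.hyps(2)]])
      also have "\<dots> < e / 2 + e / 2" using d1(2) d2(2) z by (intro add_strict_mono) auto
      finally show "(LINT x|lborel. norm (f (z + x) + g (z + x) - (f x + g x))) < e" by simp
    qed
  qed
next
  case (lim f s)
  show ?case
  proof (intro allI impI)
    fix e :: real assume "e > 0"
    then have e3: "e / 3 > 0" by simp
    have "(\<lambda>i. LINT x|lborel. norm (s i x - f x)) \<longlonglongrightarrow> (LINT (x :: real ^ 'd)|lborel. (0::real))"
    proof (rule integral_dominated_convergence)
      show "integrable lborel (\<lambda>x. 3 * norm (f x))" using lim.hyps by simp
      show "(\<lambda>x. norm (s i x - f x)) \<in> borel_measurable lborel" for i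
        using lim.hyps by (intro borel_measurable_integrable integrable_norm Bochner_Integration.integrable_diff) auto
      show "AE x in lborel. (\<lambda>i. norm (s i x - f x)) \<longlonglongrightarrow> 0"
        using lim.hyps(2) by (intro AE_I2) (simp add: LIM_zero_iff tendsto_norm_zero_iff)
      show "AE x in lborel. norm (norm (s i x - f x)) \<le> 3 * norm (f x)" for i
      proof (rule AE_I2)
        fix x
        have "norm (s i x - f x) \<le> norm (s i x) + norm (f x)" by (rule norm_triangle_ineq4)
        then show "norm (norm (s i x - f x)) \<le> 3 * norm (f x)" using lim.hyps(3)[of x i] by simp
      qed
    qed simp
    then have "\<forall>\<^sub>F i in sequentially. (LINT x|lborel. norm (s i x - f x)) < e / 3"
      by (intro order_tendstoD) (use e3 in auto)
    then obtain i where i: "(LINT x|lborel. norm (s i x - f x)) < e / 3"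
      using eventually_happens[of _ sequentially] by auto
    obtain \<delta> where \<delta>: "\<delta> > 0" "\<forall>z. norm z < \<delta> \<longrightarrow> (LINT x|lborel. norm (s i (z + x) - s i x)) < e / 3"
      using lim.IH[of i] e3 by blast
    have si: "integrable lborel (s i)" and fi: "integrable lborel f" using lim.hyps by auto
    have di: "integrable lborel (\<lambda>x. norm (s i x - f x))"
      by (intro integrable_norm Bochner_Integration.integrable_diff si fi)
    show "\<exists>\<delta>>0. \<forall>z. norm z < \<delta> \<longrightarrow> (LINT x|lborel. norm (f (z + x) - f x)) < e"
    proof (intro exI[of _ \<delta>] conjI allI impI \<delta>(1))
      fix z :: "real ^ 'd" assume z: "norm z < \<delta>"
      have "(LINT x|lborel. norm (f (z + x) - f x))
         \<le> (LINT x|lborel. norm (s i (z + x) - f (z + x)) + (norm (s i (z + x) - s i x) + norm (s i x - f x)))"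
      proof (rule integral_mono)
        show "integrable lborel (\<lambda>x. norm (f (z + x) - f x))" by (rule integrable_translate_diff[OF fi])
        show "integrable lborel (\<lambda>x. norm (s i (z + x) - f (z + x)) + (norm (s i (z + x) - s i x) + norm (s i x - f x)))"
          by (intro Bochner_Integration.integrable_add integrable_translate(1)[OF di] integrable_translate_diff[OF si] di)
        fix x
        have "f (z + x) - f x = - (s i (z + x) - f (z + x)) + ((s i (z + x) - s i x) + (s i x - f x))" by simp
        also have "norm \<dots> \<le> norm (- (s i (z + x) - f (z + x))) + (norm (s i (z + x) - s i x) + norm (s i x - f x))"
          by (meson add_left_mono norm_triangle_ineq order_trans)
        finally show "norm (f (z + x) - f x) \<le> norm (s i (z + x) - f (z + x)) + (norm (s i (z + x) - s i x) + norm (s i x - f x))"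
          by (simp only: norm_minus_cancel)
      qed
      also have "\<dots> = (LINT x|lborel. norm (s i x - f x)) + ((LINT x|lborel. norm (s i (z + x) - s i x)) + (LINT x|lborel. norm (s i x - f x)))"
        using integrable_translate[OF di, of z] integrable_translate_diff[OF si, of z] di by simp
      also have "\<dots> < e / 3 + (e / 3 + e / 3)" using i \<delta>(2) z by (intro add_strict_mono) auto
      finally show "(LINT x|lborel. norm (f (z + x) - f x)) < e" by simp
    qed
  qed
qed

text \<open>For square integrable \<open>f\<close> the part where \<open>\<bar>f\<bar>\<close> is large is small in \<open>L\<^sup>2\<close>,
  and on bounded functions the \<open>L\<^sup>1\<close> error controls the \<open>L\<^sup>2\<close> error.\<close>

lemma L2_translation_continuous:
  fixes f :: "real ^ 'd::finite \<Rightarrow> complex"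
  assumes f: "integrable lborel f" and f2: "integrable lborel (\<lambda>x. (cmod (f x))\<^sup>2)" and e: "e > 0"
  shows "\<exists>\<delta>>0. \<forall>z. norm z < \<delta> \<longrightarrow> (LINT x|lborel. (cmod (f (z + x) - f x))\<^sup>2) < e"
proof -
  have fm [measurable]: "f \<in> borel_measurable borel" using borel_measurable_integrable[OF f] by simp
  define g where "g M x = (if cmod (f x) \<le> real M then f x else 0)" for M x
  define r where "r M x = f x - g M x" for M x
  have gm [measurable]: "g M \<in> borel_measurable borel" for M unfolding g_def by measurable
  have rm [measurable]: "r M \<in> borel_measurable borel" for M unfolding r_def by measurable
  have gi: "integrable lborel (g M)" for M
    by (rule Bochner_Integration.integrable_bound[OF f]) (auto simp: g_def)
  have rb: "(cmod (r M x))\<^sup>2 \<le> (cmod (f x))\<^sup>2" for M x by (simp add: r_def g_def)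
  have r2: "integrable lborel (\<lambda>x. (cmod (r M x))\<^sup>2)" for M
    by (rule Bochner_Integration.integrable_bound[OF f2]) (use rb in auto)
  have "(\<lambda>M. LINT x|lborel. (cmod (r M x))\<^sup>2) \<longlonglongrightarrow> (LINT (x :: real ^ 'd)|lborel. (0::real))"
  proof (rule integral_dominated_convergence[where w="\<lambda>x. (cmod (f x))\<^sup>2"])
    show "AE x in lborel. (\<lambda>M. (cmod (r M x))\<^sup>2) \<longlonglongrightarrow> 0"
    proof (rule AE_I2, rule tendsto_eventually)
      fix x
      obtain N where N: "cmod (f x) \<le> real N" using real_arch_simple by blast
      show "\<forall>\<^sub>F M in sequentially. (cmod (r M x))\<^sup>2 = 0"
        using eventually_ge_at_top[of N] by eventually_elim (use N in \<open>auto simp: r_def g_def\<close>)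
    qed
  qed (use f2 rb in auto)
  then have "\<forall>\<^sub>F M in sequentially. (LINT x|lborel. (cmod (r M x))\<^sup>2) < e / 16"
    by (intro order_tendstoD) (use e in auto)
  then obtain M where M: "(LINT x|lborel. (cmod (r M x))\<^sup>2) < e / 16"
    using eventually_happens[of _ sequentially] by auto
  have "e / (8 * (real M + 1)) > 0" using e by simp
  then obtain \<delta> where \<delta>: "\<delta> > 0"
    "\<forall>z. norm z < \<delta> \<longrightarrow> (LINT x|lborel. norm (g M (z + x) - g M x)) < e / (8 * (real M + 1))"
    using L1_translation_continuous[OF gi[of M]] by blast
  show ?thesis
  proof (intro exI[of _ \<delta>] conjI allI impI \<delta>(1))
    fix z :: "real ^ 'd" assume z: "norm z < \<delta>"
    have gd: "integrable lborel (\<lambda>x. norm (g M (z + x) - g M x))" by (rule integrable_translate_diff[OF gi])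
    have rt: "integrable lborel (\<lambda>x. (cmod (r M (z + x)))\<^sup>2)" by (rule integrable_translate(1)[OF r2])
    have bound: "(cmod (f (z + x) - f x))\<^sup>2 \<le> 4 * (real M * norm (g M (z + x) - g M x))
        + (4 * (cmod (r M (z + x)))\<^sup>2 + 4 * (cmod (r M x))\<^sup>2)" for x
    proof -
      let ?a = "g M (z + x) - g M x" and ?b = "r M (z + x) - r M x"
      have "f (z + x) - f x = ?a + ?b" by (simp add: r_def)
      then have "(cmod (f (z + x) - f x))\<^sup>2 \<le> 2 * (cmod ?a)\<^sup>2 + 2 * (cmod ?b)\<^sup>2"
        using cmod_add_sq_le[of ?a ?b] by simp
      moreover have "(cmod ?a)\<^sup>2 \<le> 2 * (real M * cmod ?a)"
      proof -
        have "cmod ?a \<le> cmod (g M (z + x)) + cmod (g M x)" by (rule norm_triangle_ineq4)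
        also have "\<dots> \<le> 2 * real M" by (simp add: g_def)
        finally have "cmod ?a * cmod ?a \<le> 2 * real M * cmod ?a" by (intro mult_right_mono) auto
        then show ?thesis by (simp add: power2_eq_square)
      qed
      moreover have "(cmod ?b)\<^sup>2 \<le> 2 * (cmod (r M (z + x)))\<^sup>2 + 2 * (cmod (r M x))\<^sup>2"
        using cmod_add_sq_le[of "r M (z + x)" "- r M x"] by simp
      ultimately show ?thesis by linarith
    qed
    have int: "integrable lborel (\<lambda>x. 4 * (real M * norm (g M (z + x) - g M x))
        + (4 * (cmod (r M (z + x)))\<^sup>2 + 4 * (cmod (r M x))\<^sup>2))"
      using gd rt r2[of M] by (intro Bochner_Integration.integrable_add integrable_mult_right)
    have "(LINT x|lborel. (cmod (f (z + x) - f x))\<^sup>2) \<le> (LINT x|lborel. 4 * (real M * norm (g M (z + x) - g M x))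
        + (4 * (cmod (r M (z + x)))\<^sup>2 + 4 * (cmod (r M x))\<^sup>2))"
      by (rule integral_mono'[OF int bound]) (auto)
    also have "\<dots> = 4 * (real M * (LINT x|lborel. norm (g M (z + x) - g M x))) + 8 * (LINT x|lborel. (cmod (r M x))\<^sup>2)"
      using gd rt r2[of M] integrable_translate(2)[OF r2[of M], of z] by simp
    also have "4 * (real M * (LINT x|lborel. norm (g M (z + x) - g M x)))
        \<le> 4 * ((real M + 1) * (e / (8 * (real M + 1))))"
      using \<delta>(2) z by (intro mult_left_mono mult_mono) (auto intro!: Bochner_Integration.integral_nonneg less_imp_le)
    also have "\<dots> = e / 2" by (simp add: field_simps)
    finally show "(LINT x|lborel. (cmod (f (z + x) - f x))\<^sup>2) < e" using M by simp
  qed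
qed

section \<open>Mollification\<close>

lemma uniformly_continuous_compact_support:
  fixes f :: "real ^ 'd::finite \<Rightarrow> real"
  assumes c: "continuous_on UNIV f" and z: "\<And>x. norm x > R \<Longrightarrow> f x = 0" and e: "e > 0"
  shows "\<exists>\<delta>>0. \<forall>x y. norm (y - x) < \<delta> \<longrightarrow> \<bar>f y - f x\<bar> < e"
proof -
  have "uniformly_continuous_on (cball 0 (R + 1)) f"
    by (rule compact_uniformly_continuous[OF continuous_on_subset[OF c subset_UNIV] compact_cball])
  then obtain d where d: "d > 0"
    "\<forall>x\<in>cball 0 (R + 1). \<forall>y\<in>cball 0 (R + 1). dist y x < d \<longrightarrow> dist (f y) (f x) < e"
    unfolding uniformly_continuous_on_def using e by blast
  show ?thesis
  proof (intro exI[of _ "min d 1"] conjI allI impI)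
    show "min d 1 > 0" using d by simp
    fix x y :: "real ^ 'd" assume xy: "norm (y - x) < min d 1"
    show "\<bar>f y - f x\<bar> < e"
    proof (cases "norm x \<le> R + 1 \<and> norm y \<le> R + 1")
      case True
      then have "x \<in> cball 0 (R + 1)" "y \<in> cball 0 (R + 1)" by auto
      then have "dist (f y) (f x) < e" using d(2) xy by (simp add: dist_norm)
      then show ?thesis by (simp add: dist_real_def)
    next
      case False
      have "norm x \<le> norm y + norm (y - x)" using norm_triangle_sub[of x y] by (simp add: norm_minus_commute)
      moreover have "norm y \<le> norm x + norm (y - x)" using norm_triangle_sub[of y x] by simp
      ultimately have "norm x > R" "norm y > R" using False xy by linarith+
      then show ?thesis using z e by simp
    qed
  qed
qed

lemma frechet_derivative_eq_sum:
  fixes f :: "real ^ 'd::finite \<Rightarrow> 'b::real_normed_vector"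
  assumes "f differentiable (at x)"
  shows "frechet_derivative f (at x) h = (\<Sum>j\<in>UNIV. h $ j *\<^sub>R pderiv_at j f x)"
proof -
  have lin: "linear (frechet_derivative f (at x))" using linear_frechet_derivative[OF assms] .
  have "h = (\<Sum>j\<in>UNIV. h $ j *\<^sub>R axis j 1)"
    using basis_expansion[of h] by (simp add: scalar_mult_eq_scaleR)
  then have "frechet_derivative f (at x) h = frechet_derivative f (at x) (\<Sum>j\<in>UNIV. h $ j *\<^sub>R axis j 1)"
    by simp
  also have "\<dots> = (\<Sum>j\<in>UNIV. h $ j *\<^sub>R pderiv_at j f x)"
    by (simp add: linear_sum[OF lin] linear_scale[OF lin])
  finally show ?thesis .
qed

text \<open>The error of the linear approximation is uniform in the base point; this allows differentiation under the
  integral sign for kernels applied to merely integrable functions.\<close>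

lemma uniform_linear_approximation:
  fixes \<rho> :: "real ^ 'd::finite \<Rightarrow> real"
  assumes \<rho>: "test_function \<rho>" and e: "e > 0"
  shows "\<exists>\<delta>>0. \<forall>z h. norm h < \<delta> \<longrightarrow>
    \<bar>\<rho> (z + h) - \<rho> z - (\<Sum>j\<in>UNIV. h $ j * pderiv_at j \<rho> z)\<bar> \<le> e * norm h"
proof -
  obtain R where R: "R > 0" "\<And>x. norm x > R \<Longrightarrow> \<rho> x = 0"
    using test_function_bounded_support[OF \<rho>] by blast
  define e' where "e' = e / real CARD('d)"
  have e': "e' > 0" using e by (simp add: e'_def)
  have "\<exists>\<delta>>0. \<forall>x y. norm (y - x) < \<delta> \<longrightarrow> \<bar>pderiv_at j \<rho> y - pderiv_at j \<rho> x\<bar> < e'" for j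
    by (rule uniformly_continuous_compact_support[of _ R])
       (auto intro: e' smooth_continuous[OF smooth_pderiv[OF test_function_smooth[OF \<rho>]]] pderiv_at_zero_outside[OF R(2)])
  then have "\<forall>j. \<exists>\<delta>>0. \<forall>x y. norm (y - x) < \<delta> \<longrightarrow> \<bar>pderiv_at j \<rho> y - pderiv_at j \<rho> x\<bar> < e'"
    by (rule allI)
  from choice[OF this] obtain \<delta> where
    "\<forall>j. \<delta> j > 0 \<and> (\<forall>x y. norm (y - x) < \<delta> j \<longrightarrow> \<bar>pderiv_at j \<rho> y - pderiv_at j \<rho> x\<bar> < e')" ..
  note \<delta> = conjunct1[OF spec[OF this]] conjunct2[OF spec[OF this], rule_format]
  define d where "d = Min (range \<delta>)"
  have d: "d > 0" "\<And>j. d \<le> \<delta> j" unfolding d_def using \<delta>(1) by simp_all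
  show ?thesis
  proof (intro exI[of _ d] conjI allI impI d(1))
    fix z h :: "real ^ 'd" assume h: "norm h < d"
    define f where "f y = \<rho> y - (\<Sum>j\<in>UNIV. (y - z) $ j * pderiv_at j \<rho> z)" for y
    define f' where "f' y k = (\<Sum>j\<in>UNIV. k $ j * (pderiv_at j \<rho> y - pderiv_at j \<rho> z))" for y k :: "real ^ 'd"
    have der: "(f has_derivative f' y) (at y within ball z d)" for y
    proof -
      have "(\<rho> has_derivative (\<lambda>k. \<Sum>j\<in>UNIV. k $ j *\<^sub>R pderiv_at j \<rho> y)) (at y)"
        by (rule has_derivative_eq_rhs[OF smooth_has_derivative[OF test_function_smooth[OF \<rho>]]])
           (rule ext, rule frechet_derivative_eq_sum[OF smooth_differentiable[OF test_function_smooth[OF \<rho>]]])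
      moreover have "((\<lambda>y. \<Sum>j\<in>UNIV. (y - z) $ j * pderiv_at j \<rho> z) has_derivative
          (\<lambda>k. \<Sum>j\<in>UNIV. k $ j * pderiv_at j \<rho> z)) (at y)"
        by (rule has_derivative_sum) (auto intro!: derivative_eq_intros bounded_linear.has_derivative[OF bounded_linear_vec_nth])
      ultimately have "(f has_derivative (\<lambda>k. (\<Sum>j\<in>UNIV. k $ j *\<^sub>R pderiv_at j \<rho> y)
          - (\<Sum>j\<in>UNIV. k $ j * pderiv_at j \<rho> z))) (at y)"
        unfolding f_def by (rule has_derivative_diff)
      moreover have "(\<lambda>k. (\<Sum>j\<in>UNIV. k $ j *\<^sub>R pderiv_at j \<rho> y)
          - (\<Sum>j\<in>UNIV. k $ j * pderiv_at j \<rho> z)) = f' y"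
        by (simp add: f'_def fun_eq_iff sum_subtractf right_diff_distrib)
      ultimately have "(f has_derivative f' y) (at y)" by simp
      then show ?thesis by (rule has_derivative_at_withinI)
    qed
    have on: "onorm (f' y) \<le> e" if "y \<in> ball z d" for y
    proof (rule onorm_bound)
      fix k :: "real ^ 'd"
      have "norm (f' y k) \<le> (\<Sum>j\<in>UNIV. \<bar>k $ j * (pderiv_at j \<rho> y - pderiv_at j \<rho> z)\<bar>)"
        unfolding f'_def real_norm_def by (rule sum_abs)
      also have "\<dots> \<le> (\<Sum>j\<in>(UNIV :: 'd set). norm k * e')"
      proof (rule sum_mono)
        fix j
        have "norm (y - z) < \<delta> j" using that d(2)[of j] by (simp add: dist_norm norm_minus_commute)
        then have "\<bar>pderiv_at j \<rho> y - pderiv_at j \<rho> z\<bar> \<le> e'" by (rule less_imp_le[OF \<delta>(2)])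
        then show "\<bar>k $ j * (pderiv_at j \<rho> y - pderiv_at j \<rho> z)\<bar> \<le> norm k * e'"
          unfolding abs_mult using component_le_norm_cart[of k j] e' by (intro mult_mono) auto
      qed
      also have "\<dots> = e * norm k" by (simp add: e'_def)
      finally show "norm (f' y k) \<le> e * norm k" .
    qed (use e in simp)
    have "norm (f (z + h) - f z) \<le> e * norm (z + h - z)"
      by (rule differentiable_bound[OF convex_ball[of z d] der on]) (use h d in \<open>auto simp: dist_norm\<close>)
    then show "\<bar>\<rho> (z + h) - \<rho> z - (\<Sum>j\<in>UNIV. h $ j * pderiv_at j \<rho> z)\<bar> \<le> e * norm h"
      by (simp add: f_def)
  qed
qed

text \<open>The kernel is reflected, \<open>(\<rho> \<star> f)(x) = \<integral> \<rho>(y - x) f(y) dy = \<integral> \<rho>(z) f(x + z) dz\<close>: only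
  translations are needed, and differentiation moves to the kernel with a minus sign, which is the
  sign in the definition of a weak derivative.\<close>

definition mollify :: "(real ^ 'd::finite \<Rightarrow> real) \<Rightarrow> (real ^ 'd \<Rightarrow> complex) \<Rightarrow> real ^ 'd \<Rightarrow> complex" where
  "mollify \<rho> f x = (LINT y|lebesgue. \<rho> (y - x) *\<^sub>R f y)"

lemma integrable_bounded_scaleR:
  fixes f :: "real ^ 'd::finite \<Rightarrow> 'b::{banach, second_countable_topology}"
  assumes f: "integrable M f" and b: "b \<in> borel_measurable M" "\<And>x. \<bar>b x\<bar> \<le> C"
  shows "integrable M (\<lambda>x. b x *\<^sub>R f x)"
proof (rule Bochner_Integration.integrable_bound)
  show "integrable M (\<lambda>x. C *\<^sub>R f x)" using f by simp
  show "(\<lambda>x. b x *\<^sub>R f x) \<in> borel_measurable M"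
    using borel_measurable_integrable[OF f] b(1) by measurable
  show "AE x in M. norm (b x *\<^sub>R f x) \<le> norm (C *\<^sub>R f x)"
    using b(2) by (intro AE_I2) (auto intro!: mult_right_mono order_trans[OF b(2) abs_ge_self])
qed

lemma mollify_integrand_integrable:
  fixes \<rho> :: "real ^ 'd::finite \<Rightarrow> real" and f :: "real ^ 'd \<Rightarrow> complex"
  assumes \<rho>: "continuous_on UNIV \<rho>" "\<And>x. norm x > R \<Longrightarrow> \<rho> x = 0" and f: "integrable lebesgue f"
  shows "integrable lebesgue (\<lambda>y. \<rho> (y - x) *\<^sub>R f y)"
proof -
  obtain C where C: "\<forall>x. norm (\<rho> x) \<le> C" using bounded_compact_support[of \<rho> R] \<rho> by blast
  have "continuous_on UNIV (\<lambda>y. \<rho> (y - x))"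
    by (rule continuous_on_compose2[OF \<rho>(1)]) (auto intro!: continuous_intros)
  then show ?thesis
    using C by (intro integrable_bounded_scaleR[OF f, of _ C] continuous_measurable_lebesgue) auto
qed

lemma test_function_uminus_pderiv:
  fixes \<rho> :: "real ^ 'd::finite \<Rightarrow> real"
  shows "test_function \<rho> \<Longrightarrow> test_function (\<lambda>z. - pderiv_at j \<rho> z)"
  using test_function_linear[OF bounded_linear_minus[OF bounded_linear_ident] test_function_pderiv] by blast

text \<open>A difference quotient of \<open>mollify \<rho> f\<close> is an integral of \<open>f\<close> against a difference quotient of \<open>\<rho>\<close>, and these
  converge uniformly; integrability of \<open>f\<close> is then enough.\<close>

lemma mollify_has_derivative:
  fixes \<rho> :: "real ^ 'd::finite \<Rightarrow> real" and f :: "real ^ 'd \<Rightarrow> complex"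
  assumes \<rho>: "test_function \<rho>" and f: "integrable lebesgue f"
  shows "(mollify \<rho> f has_derivative (\<lambda>h. \<Sum>j\<in>UNIV. h $ j *\<^sub>R mollify (\<lambda>z. - pderiv_at j \<rho> z) f x)) (at x)"
  unfolding has_derivative_at_alt
proof (intro conjI allI impI)
  show "bounded_linear (\<lambda>h. \<Sum>j\<in>UNIV. h $ j *\<^sub>R mollify (\<lambda>z. - pderiv_at j \<rho> z) f x)"
    by (intro bounded_linear_sum bounded_linear_compose[OF bounded_linear_scaleR_left bounded_linear_vec_nth])
  fix e :: real assume e: "e > 0"
  define N where "N = (LINT y|lebesgue. norm (f y))"
  have N: "N \<ge> 0" by (simp add: N_def)
  define e' where "e' = e / (N + 1)"
  have e': "e' > 0" using e N by (simp add: e'_def)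
  obtain \<delta> where \<delta>: "\<delta> > 0" "\<forall>z h. norm h < \<delta> \<longrightarrow>
    \<bar>\<rho> (z + h) - \<rho> z - (\<Sum>j\<in>UNIV. h $ j * pderiv_at j \<rho> z)\<bar> \<le> e' * norm h"
    using uniform_linear_approximation[OF \<rho> e'] by blast
  obtain R where R: "R > 0" "\<And>x. norm x > R \<Longrightarrow> \<rho> x = 0"
    using test_function_bounded_support[OF \<rho>] by blast
  have i0: "integrable lebesgue (\<lambda>y. \<rho> (y - x) *\<^sub>R f y)" for x
    by (rule mollify_integrand_integrable[OF smooth_continuous[OF test_function_smooth[OF \<rho>]] R(2) f])
  have i1: "integrable lebesgue (\<lambda>y. (- pderiv_at j \<rho> (y - x)) *\<^sub>R f y)" for x j
    by (rule mollify_integrand_integrable[where \<rho>="\<lambda>z. - pderiv_at j \<rho> z" and R=R,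
          OF smooth_continuous[OF test_function_smooth[OF test_function_uminus_pderiv[OF \<rho>]]] _ f])
       (simp add: pderiv_at_zero_outside[OF R(2)])
  show "\<exists>d>0. \<forall>y. norm (y - x) < d \<longrightarrow> norm (mollify \<rho> f y - mollify \<rho> f x
      - (\<Sum>j\<in>UNIV. (y - x) $ j *\<^sub>R mollify (\<lambda>z. - pderiv_at j \<rho> z) f x)) \<le> e * norm (y - x)"
  proof (intro exI[of _ \<delta>] conjI allI impI \<delta>(1))
    fix x' :: "real ^ 'd" assume "norm (x' - x) < \<delta>"
    define h where "h = x' - x"
    have h: "norm (- h) < \<delta>" "x' = x + h" using \<open>norm (x' - x) < \<delta>\<close> by (simp_all add: h_def norm_minus_commute)
    define G where "G y = (\<rho> (y - x + - h) - \<rho> (y - x) - (\<Sum>j\<in>UNIV. (- h) $ j * pderiv_at j \<rho> (y - x))) *\<^sub>R f y" for y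
    have G: "G y = \<rho> (y - x') *\<^sub>R f y - \<rho> (y - x) *\<^sub>R f y
        - (\<Sum>j\<in>UNIV. h $ j *\<^sub>R ((- pderiv_at j \<rho> (y - x)) *\<^sub>R f y))" for y
    proof -
      have "y - x + - h = y - x'" using h(2) by (simp add: algebra_simps)
      moreover have "(\<Sum>j\<in>UNIV. h $ j *\<^sub>R ((- pderiv_at j \<rho> (y - x)) *\<^sub>R f y))
          = (\<Sum>j\<in>UNIV. (- h) $ j * pderiv_at j \<rho> (y - x)) *\<^sub>R f y"
        by (simp add: scaleR_sum_left)
      ultimately show ?thesis by (simp only: G_def scaleR_diff_left)
    qed
    have iG: "integrable lebesgue G"
      unfolding G by (intro Bochner_Integration.integrable_diff Bochner_Integration.integrable_sum integrable_scaleR_right i0 i1)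
    have "mollify \<rho> f x' - mollify \<rho> f x - (\<Sum>j\<in>UNIV. h $ j *\<^sub>R mollify (\<lambda>z. - pderiv_at j \<rho> z) f x)
        = (LINT y|lebesgue. G y)"
      unfolding G mollify_def
      by (simp only: Bochner_Integration.integral_diff Bochner_Integration.integral_sum Bochner_Integration.integrable_diff
          Bochner_Integration.integrable_sum integrable_scaleR_right i0 i1 integral_scaleR_right)
    also have "norm \<dots> \<le> (LINT y|lebesgue. norm (G y))" by (rule integral_norm_bound)
    also have "\<dots> \<le> (LINT y|lebesgue. (e' * norm h) * norm (f y))"
    proof (rule integral_mono)
      show "integrable lebesgue (\<lambda>y. norm (G y))" using iG by simp
      show "integrable lebesgue (\<lambda>y. (e' * norm h) * norm (f y))" using f by simp
      fix y
      have "\<bar>\<rho> (y - x + - h) - \<rho> (y - x) - (\<Sum>j\<in>UNIV. (- h) $ j * pderiv_at j \<rho> (y - x))\<bar> \<le> e' * norm (- h)"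
        using \<delta>(2) h(1) by blast
      then show "norm (G y) \<le> (e' * norm h) * norm (f y)"
        unfolding G_def norm_scaleR by (intro mult_right_mono) auto
    qed
    also have "\<dots> = e' * norm h * N" by (simp add: N_def)
    also have "\<dots> \<le> e * norm h"
    proof -
      have "e' * N \<le> e' * (N + 1)" using e' by (intro mult_left_mono) auto
      also have "\<dots> = e" using N by (simp add: e'_def)
      finally have "e' * N * norm h \<le> e * norm h" by (intro mult_right_mono) auto
      then show ?thesis by (simp add: mult_ac)
    qed
    finally show "norm (mollify \<rho> f x' - mollify \<rho> f x
      - (\<Sum>j\<in>UNIV. (x' - x) $ j *\<^sub>R mollify (\<lambda>z. - pderiv_at j \<rho> z) f x)) \<le> e * norm (x' - x)"
      by (simp add: h_def)
  qed
qed

lemma pderiv_at_mollify: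
  assumes "test_function \<rho>" "integrable lebesgue f"
  shows "pderiv_at j (mollify \<rho> f) x = mollify (\<lambda>z. - pderiv_at j \<rho> z) f x"
proof -
  have "pderiv_at j (mollify \<rho> f) x = (\<Sum>i\<in>UNIV. axis j 1 $ i *\<^sub>R mollify (\<lambda>z. - pderiv_at i \<rho> z) f x)"
    by (rule pderiv_at_eqI[OF mollify_has_derivative[OF assms]])
  also have "\<dots> = (\<Sum>i\<in>UNIV. if j = i then mollify (\<lambda>z. - pderiv_at i \<rho> z) f x else 0)"
    by (rule sum.cong) (auto simp: axis_def)
  also have "\<dots> = mollify (\<lambda>z. - pderiv_at j \<rho> z) f x" by simp
  finally show ?thesis .
qed

lemma smooth_mollify:
  assumes "test_function \<rho>" "integrable lebesgue f"
  shows "Ck k (mollify \<rho> f)"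
  using assms
proof (induction k arbitrary: \<rho>)
  case 0
  have "isCont (mollify \<rho> f) x" for x
    by (rule has_derivative_continuous[OF mollify_has_derivative[OF 0]])
  then show ?case by (simp add: continuous_at_imp_continuous_on)
next
  case (Suc k)
  have "pderiv_at j (mollify \<rho> f) = mollify (\<lambda>z. - pderiv_at j \<rho> z) f" for j
    using pderiv_at_mollify[OF Suc.prems] by blast
  moreover have "Ck k (mollify (\<lambda>z. - pderiv_at j \<rho> z) f)" for j
    by (rule Suc.IH[OF test_function_uminus_pderiv[OF Suc.prems(1)] Suc.prems(2)])
  moreover have "mollify \<rho> f differentiable (at x)" for x
    using mollify_has_derivative[OF Suc.prems] unfolding differentiable_def by blast
  ultimately show ?case unfolding Ck.simps(2) by simp
qed

lemma test_function_translate: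
  fixes \<rho> :: "real ^ 'd::finite \<Rightarrow> 'b::real_normed_vector"
  assumes "test_function \<rho>"
  shows "test_function (\<lambda>y. \<rho> (y - x))" "pderiv_at j (\<lambda>y. \<rho> (y - x)) y = pderiv_at j \<rho> (y - x)"
proof -
  obtain R where R: "R > 0" "\<And>x. norm x > R \<Longrightarrow> \<rho> x = 0"
    using test_function_bounded_support[OF assms] by blast
  have eq: "(\<lambda>y. \<rho> (y - x)) = (\<lambda>y. \<rho> (- x + 1 *\<^sub>R y))" by simp
  have s: "smooth \<rho>" using test_function_smooth[OF assms] .
  show "test_function (\<lambda>y. \<rho> (y - x))"
  proof (rule test_functionI)
    show "smooth (\<lambda>y. \<rho> (y - x))" unfolding eq using Ck_affine(1)[of _ \<rho> "- x" 1] s by blast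
    show "\<rho> (y - x) = 0" if "norm y > R + norm x" for y
      using that norm_triangle_ineq2[of y x] by (intro R(2)) simp
  qed
  have "Ck (Suc 0) \<rho>" using s by blast
  from fun_cong[OF Ck_affine(2)[OF this, where a="- x" and s=1], where x=y]
  show "pderiv_at j (\<lambda>y. \<rho> (y - x)) y = pderiv_at j \<rho> (y - x)" by simp
qed

text \<open>The translated kernel is itself a test function, so the definition of a weak derivative applies to it.\<close>

lemma pderiv_at_mollify_weak:
  fixes f g :: "real ^ 'd::finite \<Rightarrow> complex"
  assumes \<rho>: "test_function \<rho>" and f: "integrable lebesgue f"
    and w: "\<And>\<phi> :: real ^ 'd \<Rightarrow> real. test_function \<phi> \<Longrightarrow>
      (LINT x|lebesgue. \<phi> x *\<^sub>R g x) = - (LINT x|lebesgue. pderiv_at j \<phi> x *\<^sub>R f x)"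
  shows "pderiv_at j (mollify \<rho> f) x = mollify \<rho> g x"
proof -
  have "mollify \<rho> g x = - (LINT y|lebesgue. pderiv_at j \<rho> (y - x) *\<^sub>R f y)"
    unfolding mollify_def w[OF test_function_translate(1)[OF \<rho>]] test_function_translate(2)[OF \<rho>] ..
  also have "\<dots> = mollify (\<lambda>z. - pderiv_at j \<rho> z) f x" by (simp add: mollify_def)
  finally show ?thesis by (simp add: pderiv_at_mollify[OF \<rho> f])
qed

lemma mollify_outside:
  assumes "\<And>x. norm x > r \<Longrightarrow> \<rho> x = 0" "\<And>x. norm x > S \<Longrightarrow> f x = 0" "norm x > r + S"
  shows "mollify \<rho> f x = 0"
proof -
  have eq: "\<rho> (y - x) *\<^sub>R f y = 0" for y
  proof (cases "norm y > S")
    case False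
    have "norm (y - x) > r" using norm_triangle_ineq2[of x y] assms(3) False by (simp add: norm_minus_commute)
    then show ?thesis using assms(1) by simp
  qed (use assms(2) in simp)
  show ?thesis by (simp only: mollify_def eq Bochner_Integration.integral_zero)
qed

lemma test_function_mollify:
  assumes \<rho>: "test_function \<rho>" and f: "integrable lebesgue f" "\<And>x. norm x > S \<Longrightarrow> f x = 0"
  shows "test_function (mollify \<rho> f)"
proof -
  obtain R where R: "R > 0" "\<And>x. norm x > R \<Longrightarrow> \<rho> x = 0"
    using test_function_bounded_support[OF \<rho>] by blast
  have "smooth (mollify \<rho> f)" using smooth_mollify[OF \<rho> f(1)] by blast
  then show ?thesis by (rule test_functionI[OF _ mollify_outside[OF R(2) f(2)]])
qed

section \<open>Convergence of mollified functions\<close>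

lemma lebesgue_borel_version:
  fixes f :: "real ^ 'd::finite \<Rightarrow> complex"
  assumes f: "f \<in> borel_measurable lebesgue"
  shows "\<exists>g \<in> borel_measurable borel. AE x in lebesgue. f x = g x"
proof -
  have "(\<lambda>x. Re (f x)) \<in> borel_measurable lebesgue" "(\<lambda>x. Im (f x)) \<in> borel_measurable lebesgue"
    using f by auto
  from this[THEN completion_ex_borel_measurable_real]
  obtain a b where a: "a \<in> borel_measurable lborel" "AE x in lborel. Re (f x) = a x"
    and b: "b \<in> borel_measurable lborel" "AE x in lborel. Im (f x) = b x" by blast
  have "AE x in lborel. f x = Complex (a x) (b x)"
    using a(2) b(2) by eventually_elim (simp add: complex_eq_iff)
  then have "AE x in lebesgue. f x = Complex (a x) (b x)" by (rule AE_completion)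
  moreover have "(\<lambda>x. Complex (a x) (b x)) \<in> borel_measurable borel"
    using a(1) b(1) unfolding Complex_eq by measurable
  ultimately show ?thesis by (intro bexI[of _ "\<lambda>x. Complex (a x) (b x)"])
qed

lemma jensen_square:
  fixes h w :: "'a \<Rightarrow> real"
  assumes w: "integrable M w" "\<And>x. w x \<ge> 0" "(LINT x|M. w x) = 1"
    and h: "integrable M (\<lambda>x. w x * h x)" "integrable M (\<lambda>x. w x * (h x)\<^sup>2)"
  shows "(LINT x|M. w x * h x)\<^sup>2 \<le> (LINT x|M. w x * (h x)\<^sup>2)"
proof -
  define c where "c = (LINT x|M. w x * h x)"
  have "0 \<le> (LINT x|M. w x * (h x - c)\<^sup>2)"
    using w(2) by (intro Bochner_Integration.integral_nonneg) simp
  also have "(\<lambda>x. w x * (h x - c)\<^sup>2) = (\<lambda>x. w x * (h x)\<^sup>2 - 2 * c * (w x * h x) + c\<^sup>2 * w x)"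
    by (simp add: fun_eq_iff power2_eq_square algebra_simps)
  also have "(LINT x|M. w x * (h x)\<^sup>2 - 2 * c * (w x * h x) + c\<^sup>2 * w x)
      = (LINT x|M. w x * (h x)\<^sup>2) - 2 * c * c + c\<^sup>2"
    using w h by (simp add: c_def)
  finally show ?thesis unfolding c_def[symmetric] by (simp add: power2_eq_square)
qed

text \<open>A mollified function is an average of translates; by Tonelli's theorem its error in the mean is an average of
  translation errors.  The lemma is stated for a general error density \<open>h\<close> to cover both \<open>L\<^sup>1\<close> and \<open>L\<^sup>2\<close>.\<close>

lemma weighted_translation_error:
  fixes \<rho> :: "real ^ 'd::finite \<Rightarrow> real" and h :: "real ^ 'd \<Rightarrow> real ^ 'd \<Rightarrow> ennreal"
  assumes \<rho>: "\<rho> \<in> borel_measurable borel" "(\<integral>\<^sup>+ z. ennreal (\<rho> z) \<partial>lborel) = 1"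
      "\<And>z. norm z > r \<Longrightarrow> \<rho> z = 0"
    and h: "case_prod h \<in> borel_measurable (borel \<Otimes>\<^sub>M borel)"
    and e: "\<And>z. norm z \<le> r \<Longrightarrow> (\<integral>\<^sup>+ x. h x z \<partial>lborel) \<le> e"
    and g: "\<And>x. g x \<le> (\<integral>\<^sup>+ z. ennreal (\<rho> z) * h x z \<partial>lborel)"
  shows "(\<integral>\<^sup>+ x. g x \<partial>lborel) \<le> e"
proof -
  note \<rho>(1)[measurable] h[measurable]
  have "(\<integral>\<^sup>+ x. g x \<partial>lborel) \<le> (\<integral>\<^sup>+ x. \<integral>\<^sup>+ z. ennreal (\<rho> z) * h x z \<partial>lborel \<partial>lborel)"
    using g by (intro nn_integral_mono) auto
  also have "\<dots> = (\<integral>\<^sup>+ z. \<integral>\<^sup>+ x. ennreal (\<rho> z) * h x z \<partial>lborel \<partial>lborel)"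
    by (rule lborel_pair.Fubini'[symmetric]) simp
  also have "\<dots> = (\<integral>\<^sup>+ z. ennreal (\<rho> z) * (\<integral>\<^sup>+ x. h x z \<partial>lborel) \<partial>lborel)"
    by (intro nn_integral_cong nn_integral_cmult) simp
  also have "\<dots> \<le> (\<integral>\<^sup>+ z. ennreal (\<rho> z) * e \<partial>lborel)"
  proof (intro nn_integral_mono)
    fix z
    show "ennreal (\<rho> z) * (\<integral>\<^sup>+ x. h x z \<partial>lborel) \<le> ennreal (\<rho> z) * e"
      using e[of z] \<rho>(3)[of z] by (cases "norm z \<le> r") (auto intro: mult_left_mono)
  qed
  also have "\<dots> = e" using \<rho>(1,2) by (subst nn_integral_multc) auto
  finally show ?thesis .
qed

locale mollifier_kernel =
  fixes \<rho> :: "real ^ 'd::finite \<Rightarrow> real" and r :: real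
  assumes continuous: "continuous_on UNIV \<rho>"
    and support: "\<And>x. norm x > r \<Longrightarrow> \<rho> x = 0"
    and nonneg: "\<And>x. \<rho> x \<ge> 0"
    and normalized: "(LINT x|lborel. \<rho> x) = 1"
begin

lemma kernel_integrable: "integrable lborel \<rho>"
  by (rule integrable_compact_support_lborel[OF continuous support])

lemma kernel_measurable [measurable]: "\<rho> \<in> borel_measurable borel"
  by (rule borel_measurable_continuous_onI[OF continuous])

lemma kernel_nn_integral: "(\<integral>\<^sup>+ z. ennreal (\<rho> z) \<partial>lborel) = 1"
  using nn_integral_eq_integral[OF kernel_integrable] nonneg normalized by simp

lemma kernel_bounded: "\<exists>C. \<forall>x. \<bar>\<rho> x\<bar> \<le> C"
  using bounded_compact_support[of \<rho> r, OF continuous support] by auto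

lemma kernel_mult_integrable:
  fixes h :: "real ^ 'd \<Rightarrow> 'b::{banach, second_countable_topology}"
  assumes "integrable lborel h" shows "integrable lborel (\<lambda>z. \<rho> z *\<^sub>R h z)"
proof -
  obtain C where "\<forall>x. \<bar>\<rho> x\<bar> \<le> C" using kernel_bounded by blast
  then show ?thesis by (intro integrable_bounded_scaleR[OF assms, of _ C]) auto
qed

lemma mollify_minus_self:
  fixes f :: "real ^ 'd \<Rightarrow> complex"
  assumes f: "integrable lborel f"
  shows "integrable lborel (\<lambda>z. \<rho> z *\<^sub>R (f (x + z) - f x))"
    "mollify \<rho> f x - f x = (LINT z|lborel. \<rho> z *\<^sub>R (f (x + z) - f x))"
proof -
  have ft: "integrable lborel (\<lambda>z. f (x + z))" by (rule integrable_translate(1)[OF f])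
  have i1: "integrable lborel (\<lambda>z. \<rho> z *\<^sub>R f (x + z))" by (rule kernel_mult_integrable[OF ft])
  have i2: "integrable lborel (\<lambda>z. \<rho> z *\<^sub>R f x)" using kernel_integrable by simp
  have i3: "integrable lborel (\<lambda>y. \<rho> (y - x) *\<^sub>R f y)"
    using integrable_translate(1)[OF i1, of "- x"] by simp
  have "mollify \<rho> f x = (LINT y|lborel. \<rho> (y - x) *\<^sub>R f y)"
    unfolding mollify_def by (rule integral_completion[OF borel_measurable_integrable[OF i3]])
  also have "\<dots> = (LINT z|lborel. \<rho> z *\<^sub>R f (x + z))"
    using integrable_translate(2)[OF i3, of x] by simp
  finally have eq: "mollify \<rho> f x = (LINT z|lborel. \<rho> z *\<^sub>R f (x + z))" .
  have *: "\<rho> z *\<^sub>R (f (x + z) - f x) = \<rho> z *\<^sub>R f (x + z) - \<rho> z *\<^sub>R f x" for z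
    by (rule scaleR_diff_right)
  show "integrable lborel (\<lambda>z. \<rho> z *\<^sub>R (f (x + z) - f x))"
    unfolding * by (rule Bochner_Integration.integrable_diff[OF i1 i2])
  show "mollify \<rho> f x - f x = (LINT z|lborel. \<rho> z *\<^sub>R (f (x + z) - f x))"
    unfolding * Bochner_Integration.integral_diff[OF i1 i2] eq
    by (simp only: integral_scaleR_left[OF kernel_integrable] normalized scaleR_one)
qed

lemma mollify_L1_error:
  fixes f :: "real ^ 'd \<Rightarrow> complex"
  assumes f: "integrable lborel f"
    and e: "\<And>z. norm z \<le> r \<Longrightarrow> (LINT x|lborel. norm (f (z + x) - f x)) \<le> e"
  shows "(\<integral>\<^sup>+ x. ennreal (norm (mollify \<rho> f x - f x)) \<partial>lborel) \<le> ennreal e"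
proof (rule weighted_translation_error[where \<rho>=\<rho> and r=r and h="\<lambda>x z. ennreal (norm (f (x + z) - f x))"])
  have [measurable]: "f \<in> borel_measurable borel" using borel_measurable_integrable[OF f] by simp
  show "(\<lambda>(x, z). ennreal (norm (f (x + z) - f x))) \<in> borel_measurable (borel \<Otimes>\<^sub>M borel)" by measurable
  show "(\<integral>\<^sup>+ x. ennreal (norm (f (x + z) - f x)) \<partial>lborel) \<le> ennreal e" if "norm z \<le> r" for z
    using nn_integral_eq_integral[OF integrable_translate_diff[OF f, of z]] e[OF that]
    by (simp add: add.commute ennreal_leI)
  show "ennreal (norm (mollify \<rho> f x - f x)) \<le> (\<integral>\<^sup>+ z. ennreal (\<rho> z) * ennreal (norm (f (x + z) - f x)) \<partial>lborel)" for x
  proof -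
    have "norm (mollify \<rho> f x - f x) \<le> (LINT z|lborel. norm (\<rho> z *\<^sub>R (f (x + z) - f x)))"
      unfolding mollify_minus_self(2)[OF f] by (rule integral_norm_bound)
    also have "ennreal \<dots> = (\<integral>\<^sup>+ z. ennreal (norm (\<rho> z *\<^sub>R (f (x + z) - f x))) \<partial>lborel)"
      by (rule nn_integral_eq_integral[OF integrable_norm[OF mollify_minus_self(1)[OF f]], symmetric]) simp
    finally show ?thesis using nonneg by (simp add: ennreal_mult'' ennreal_mult ennreal_leI)
  qed
qed (use kernel_nn_integral support in auto)

text \<open>Jensen's inequality moves the square inside the average over translates.\<close>

lemma mollify_L2_error:
  fixes f :: "real ^ 'd \<Rightarrow> complex"
  assumes f: "integrable lborel f" and f2: "integrable lborel (\<lambda>x. (cmod (f x))\<^sup>2)"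
    and e: "\<And>z. norm z \<le> r \<Longrightarrow> (LINT x|lborel. (cmod (f (z + x) - f x))\<^sup>2) \<le> e"
  shows "(\<integral>\<^sup>+ x. ennreal ((cmod (mollify \<rho> f x - f x))\<^sup>2) \<partial>lborel) \<le> ennreal e"
proof (rule weighted_translation_error[where \<rho>=\<rho> and r=r and h="\<lambda>x z. ennreal ((cmod (f (x + z) - f x))\<^sup>2)"])
  have [measurable]: "f \<in> borel_measurable borel" using borel_measurable_integrable[OF f] by simp
  show "(\<lambda>(x, z). ennreal ((cmod (f (x + z) - f x))\<^sup>2)) \<in> borel_measurable (borel \<Otimes>\<^sub>M borel)" by measurable
  have sq: "integrable lborel (\<lambda>x. (cmod (f (z + x) - f x))\<^sup>2)" for z
  proof (rule Bochner_Integration.integrable_bound)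
    show "integrable lborel (\<lambda>x. 2 * (cmod (f (z + x)))\<^sup>2 + 2 * (cmod (f x))\<^sup>2)"
      using integrable_translate(1)[OF f2, of z] f2 by simp
    show "AE x in lborel. norm ((cmod (f (z + x) - f x))\<^sup>2) \<le> norm (2 * (cmod (f (z + x)))\<^sup>2 + 2 * (cmod (f x))\<^sup>2)"
    proof (rule AE_I2)
      fix x show "norm ((cmod (f (z + x) - f x))\<^sup>2) \<le> norm (2 * (cmod (f (z + x)))\<^sup>2 + 2 * (cmod (f x))\<^sup>2)"
        using cmod_add_sq_le[of "f (z + x)" "- f x"] by simp
    qed
  qed measurable
  show "(\<integral>\<^sup>+ x. ennreal ((cmod (f (x + z) - f x))\<^sup>2) \<partial>lborel) \<le> ennreal e" if "norm z \<le> r" for z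
    using nn_integral_eq_integral[OF sq[of z]] e[OF that] by (simp add: add.commute ennreal_leI)
  show "ennreal ((cmod (mollify \<rho> f x - f x))\<^sup>2)
      \<le> (\<integral>\<^sup>+ z. ennreal (\<rho> z) * ennreal ((cmod (f (x + z) - f x))\<^sup>2) \<partial>lborel)" for x
  proof -
    have i1: "integrable lborel (\<lambda>z. \<rho> z * cmod (f (x + z) - f x))"
      using integrable_norm[OF mollify_minus_self(1)[OF f, of x]] nonneg by simp
    have i2: "integrable lborel (\<lambda>z. \<rho> z * (cmod (f (x + z) - f x))\<^sup>2)"
    proof (rule Bochner_Integration.integrable_bound)
      show "integrable lborel (\<lambda>z. 2 * (\<rho> z * (cmod (f (x + z)))\<^sup>2) + 2 * (cmod (f x))\<^sup>2 * \<rho> z)"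
        using kernel_mult_integrable[OF integrable_translate(1)[OF f2, of x]] kernel_integrable by simp
      show "AE z in lborel. norm (\<rho> z * (cmod (f (x + z) - f x))\<^sup>2)
          \<le> norm (2 * (\<rho> z * (cmod (f (x + z)))\<^sup>2) + 2 * (cmod (f x))\<^sup>2 * \<rho> z)"
      proof (rule AE_I2)
        fix z
        have "\<rho> z * (cmod (f (x + z) - f x))\<^sup>2 \<le> \<rho> z * (2 * (cmod (f (x + z)))\<^sup>2 + 2 * (cmod (f x))\<^sup>2)"
          using cmod_add_sq_le[of "f (x + z)" "- f x"] nonneg by (intro mult_left_mono) simp_all
        then show "norm (\<rho> z * (cmod (f (x + z) - f x))\<^sup>2)
          \<le> norm (2 * (\<rho> z * (cmod (f (x + z)))\<^sup>2) + 2 * (cmod (f x))\<^sup>2 * \<rho> z)"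
          using nonneg[of z] by (simp add: algebra_simps)
      qed
    qed measurable
    have "cmod (mollify \<rho> f x - f x) \<le> (LINT z|lborel. norm (\<rho> z *\<^sub>R (f (x + z) - f x)))"
      unfolding mollify_minus_self(2)[OF f] by (rule integral_norm_bound)
    also have "\<dots> = (LINT z|lborel. \<rho> z * cmod (f (x + z) - f x))" using nonneg by simp
    finally have "(cmod (mollify \<rho> f x - f x))\<^sup>2 \<le> (LINT z|lborel. \<rho> z * cmod (f (x + z) - f x))\<^sup>2"
      by (intro power_mono) auto
    also have "\<dots> \<le> (LINT z|lborel. \<rho> z * (cmod (f (x + z) - f x))\<^sup>2)"
      by (rule jensen_square[OF kernel_integrable nonneg normalized i1 i2])
    also have "ennreal \<dots> = (\<integral>\<^sup>+ z. ennreal (\<rho> z * (cmod (f (x + z) - f x))\<^sup>2) \<partial>lborel)"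
      using nonneg by (intro nn_integral_eq_integral[symmetric] i2) auto
    finally show ?thesis using nonneg by (simp add: ennreal_mult ennreal_leI)
  qed
qed (use kernel_nn_integral support in auto)

end

definition mollifier :: "nat \<Rightarrow> real ^ 'd::finite \<Rightarrow> real" where
  "mollifier m x = inverse (LINT y|lborel. bump (real (Suc m) *\<^sub>R (y :: real ^ 'd))) * bump (real (Suc m) *\<^sub>R x)"

lemma
  shows test_function_mollifier: "test_function (mollifier m :: real ^ 'd::finite \<Rightarrow> real)"
    and mollifier_kernel: "mollifier_kernel (mollifier m :: real ^ 'd::finite \<Rightarrow> real) (inverse (real (Suc m)))"
proof -
  define b :: "real ^ 'd \<Rightarrow> real" where "b x = bump (real (Suc m) *\<^sub>R x)" for x
  have "b = (\<lambda>x. bump (0 + real (Suc m) *\<^sub>R x))" by (simp add: b_def fun_eq_iff)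
  then have "Ck k b" for k by (simp only: Ck_affine(1)[OF smooth_bump])
  then have sb: "smooth b" by blast
  have zb: "b x = 0" if "norm x > inverse (real (Suc m))" for x
  proof -
    have "norm (real (Suc m) *\<^sub>R x) \<ge> 1" using that unfolding norm_scaleR
      by (simp add: inverse_eq_divide pos_divide_less_eq mult.commute del: of_nat_Suc)
    then show ?thesis unfolding b_def by (rule bump_eq_0)
  qed
  have ib: "integrable lborel b" by (rule integrable_compact_support_lborel[OF smooth_continuous[OF sb] zb])
  have nb: "b x \<ge> 0" for x by (simp add: b_def bump_nonneg)
  have "(LINT x|lborel. b x) \<noteq> 0"
  proof
    assume "(LINT x|lborel. b x) = 0"
    then have ae: "AE x in lborel. b x = 0"
      using integral_nonneg_eq_0_iff_AE[OF ib] nb by simp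
    have op: "open {x. b x \<noteq> 0}"
      using smooth_continuous[OF sb] by (intro open_Collect_neq) auto
    have "{x. b x \<noteq> 0} \<in> null_sets lborel"
      using AE_iff_null[of lborel "\<lambda>x. b x = 0"] ae op by simp
    then have "negligible {x. b x \<noteq> 0}"
      using null_sets_completionI negligible_iff_null_sets by blast
    moreover have "0 \<in> {x. b x \<noteq> 0}" using bump_0_pos[where 'a='d] by (simp add: b_def)
    ultimately show False using open_not_negligible[OF op] by blast
  qed
  moreover have mol: "mollifier m = (\<lambda>x. inverse (LINT x|lborel. b x) * b x)"
    by (simp add: mollifier_def b_def fun_eq_iff)
  moreover have "(LINT x|lborel. b x) \<ge> 0" using nb by (intro Bochner_Integration.integral_nonneg)
  ultimately show "mollifier_kernel (mollifier m :: real ^ 'd::finite \<Rightarrow> real) (inverse (real (Suc m)))"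
    using smooth_continuous[OF sb] zb nb
    by unfold_locales (auto intro!: continuous_intros mult_nonneg_nonneg)
  show "test_function (mollifier m :: real ^ 'd::finite \<Rightarrow> real)"
    unfolding mol
    by (rule test_functionI[of _ "inverse (real (Suc m))"]) (use zb sb in \<open>auto intro!: Ck_mult\<close>)
qed

lemma integral_le_nn_bound:
  fixes g :: "'a \<Rightarrow> real"
  assumes m: "g \<in> borel_measurable M" "\<And>x. g x \<ge> 0" and b: "(\<integral>\<^sup>+ x. ennreal (g x) \<partial>M) \<le> ennreal e" and e: "e \<ge> 0"
  shows "integrable M g" "(LINT x|M. g x) \<le> e"
proof -
  show i: "integrable M g"
    using m b by (intro integrableI_nonneg) (auto intro: le_less_trans)
  have "ennreal (LINT x|M. g x) \<le> ennreal e"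
    using nn_integral_eq_integral[OF i] m b by simp
  then show "(LINT x|M. g x) \<le> e" using e by (simp add: ennreal_le_iff)
qed

lemma mollify_cong_AE:
  assumes "f \<in> borel_measurable lebesgue" "g \<in> borel_measurable lebesgue" "AE x in lebesgue. f x = g x"
    and \<rho>: "continuous_on UNIV \<rho>"
  shows "mollify \<rho> f = mollify \<rho> g"
proof
  fix x
  have "continuous_on UNIV (\<lambda>y. \<rho> (y - x))"
    by (rule continuous_on_compose2[OF \<rho>]) (auto intro!: continuous_intros)
  then have [measurable]: "(\<lambda>y. \<rho> (y - x)) \<in> borel_measurable lebesgue" by (rule continuous_measurable_lebesgue)
  note assms(1,2)[measurable]
  show "mollify \<rho> f x = mollify \<rho> g x"
    unfolding mollify_def
  proof (rule integral_cong_AE)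
    show "AE y in lebesgue. \<rho> (y - x) *\<^sub>R f y = \<rho> (y - x) *\<^sub>R g y"
      using assms(3) by eventually_elim simp
  qed measurable
qed

lemma eventually_inverse_less:
  "\<delta> > 0 \<Longrightarrow> \<forall>\<^sub>F m in sequentially. inverse (real (Suc m)) < \<delta>"
  using order_tendstoD(2)[OF LIMSEQ_inverse_real_of_nat] .

lemma mollify_L1_tendsto:
  fixes f :: "real ^ 'd::finite \<Rightarrow> complex"
  assumes f: "integrable lebesgue f"
  shows "integrable lebesgue (\<lambda>x. norm (mollify (mollifier m) f x - f x))"
    "(\<lambda>m. LINT x|lebesgue. norm (mollify (mollifier m) f x - f x)) \<longlonglongrightarrow> 0"
proof -
  obtain g where g: "g \<in> borel_measurable borel" "AE x in lebesgue. f x = g x"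
    using lebesgue_borel_version[OF borel_measurable_integrable[OF f]] by blast
  have fm: "f \<in> borel_measurable lebesgue" using borel_measurable_integrable[OF f] .
  have gm: "g \<in> borel_measurable lebesgue" using borel_measurable_lebesgueI[OF g(1)] .
  have "integrable lebesgue g" using integrable_cong_AE[OF fm gm g(2)] f by simp
  then have gi: "integrable lborel g" using g(1) by (subst integrable_completion[symmetric]) auto
  have ck: "continuous_on UNIV (mollifier m :: real ^ 'd \<Rightarrow> real)" for m
    by (rule smooth_continuous[OF test_function_smooth[OF test_function_mollifier]])
  have mg: "mollify (mollifier m) f = mollify (mollifier m) g" for m
    by (rule mollify_cong_AE[OF fm gm g(2) ck])
  have mm: "mollify (mollifier m) f \<in> borel_measurable lebesgue" for m
    by (rule continuous_measurable_lebesgue[OF smooth_continuous]) (use smooth_mollify[OF test_function_mollifier f] in blast)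
  have meas: "(\<lambda>x. norm (mollify (mollifier m) f x - f x)) \<in> borel_measurable lebesgue" for m
    using mm[of m] fm by measurable
  have err: "(\<integral>\<^sup>+ x. ennreal (norm (mollify (mollifier m) f x - f x)) \<partial>lebesgue) \<le> ennreal e"
    if "\<And>z. norm z \<le> inverse (real (Suc m)) \<Longrightarrow> (LINT x|lborel. norm (g (z + x) - g x)) \<le> e" for m e
  proof -
    have "(\<integral>\<^sup>+ x. ennreal (norm (mollify (mollifier m) f x - f x)) \<partial>lebesgue)
        = (\<integral>\<^sup>+ x. ennreal (norm (mollify (mollifier m) g x - g x)) \<partial>lebesgue)"
      unfolding mg using g(2) by (intro nn_integral_cong_AE) (auto elim: eventually_mono)
    also have "\<dots> \<le> ennreal e"
      unfolding nn_integral_completion by (rule mollifier_kernel.mollify_L1_error[OF mollifier_kernel gi that])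
    finally show ?thesis .
  qed
  show "integrable lebesgue (\<lambda>x. norm (mollify (mollifier m) f x - f x))" for m
  proof -
    define e where "e = 2 * (LINT x|lborel. norm (g x))"
    have "(LINT x|lborel. norm (g (z + x) - g x)) \<le> e" for z
    proof -
      have "(LINT x|lborel. norm (g (z + x) - g x)) \<le> (LINT x|lborel. norm (g (z + x)) + norm (g x))"
        using integrable_translate_diff[OF gi] integrable_norm[OF integrable_translate(1)[OF gi]] gi norm_triangle_ineq4
        by (intro integral_mono Bochner_Integration.integrable_add) auto
      also have "\<dots> = e"
        using integrable_translate[OF integrable_norm[OF gi], of z] gi by (simp add: e_def)
      finally show ?thesis .
    qed
    then show ?thesis
      by (intro integral_le_nn_bound(1)[OF meas _ err]) (auto simp: e_def)
  qed
  show "(\<lambda>m. LINT x|lebesgue. norm (mollify (mollifier m) f x - f x)) \<longlonglongrightarrow> 0"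
  proof (rule order_tendstoI)
    fix a :: real assume "a < 0"
    then show "\<forall>\<^sub>F m in sequentially. a < (LINT x|lebesgue. norm (mollify (mollifier m) f x - f x))"
      by (intro always_eventually allI) (auto intro: less_le_trans)
  next
    fix a :: real assume a: "0 < a"
    then have "a / 2 > 0" by simp
    then obtain \<delta> where \<delta>: "\<delta> > 0" "\<forall>z. norm z < \<delta> \<longrightarrow> (LINT x|lborel. norm (g (z + x) - g x)) < a / 2"
      using L1_translation_continuous[OF gi] by blast
    show "\<forall>\<^sub>F m in sequentially. (LINT x|lebesgue. norm (mollify (mollifier m) f x - f x)) < a"
      using eventually_inverse_less[OF \<delta>(1)]
    proof eventually_elim
      case (elim m)
      have "(LINT x|lborel. norm (g (z + x) - g x)) \<le> a / 2" if "norm z \<le> inverse (real (Suc m))" for z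
        using \<delta>(2)[rule_format, of z] that elim by linarith
      then have "(LINT x|lebesgue. norm (mollify (mollifier m) f x - f x)) \<le> a / 2"
        using a by (intro integral_le_nn_bound(2)[OF meas _ err]) auto
      then show ?case using a by simp
    qed
  qed
qed

lemma mollify_L2_tendsto:
  fixes f :: "real ^ 'd::finite \<Rightarrow> complex"
  assumes f: "integrable lebesgue f" and f2: "L2 f"
  shows "\<forall>\<^sub>F m in sequentially. L2 (\<lambda>x. mollify (mollifier m) f x - f x)"
    "(\<lambda>m. sqint (\<lambda>x. mollify (mollifier m) f x - f x)) \<longlonglongrightarrow> 0"
proof -
  obtain g where g: "g \<in> borel_measurable borel" "AE x in lebesgue. f x = g x"
    using lebesgue_borel_version[OF borel_measurable_integrable[OF f]] by blast
  have fm: "f \<in> borel_measurable lebesgue" using borel_measurable_integrable[OF f] .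
  have gm: "g \<in> borel_measurable lebesgue" using borel_measurable_lebesgueI[OF g(1)] .
  have "integrable lebesgue g" using integrable_cong_AE[OF fm gm g(2)] f by simp
  then have gi: "integrable lborel g" using g(1) by (subst integrable_completion[symmetric]) auto
  have sm: "(\<lambda>x. (cmod (g x))\<^sup>2) \<in> borel_measurable borel" using g(1) by measurable
  have "L2 g"
    by (rule L2_bound[OF f2 gm, of 1]) (use g(2) in \<open>auto elim: eventually_mono\<close>)
  then have g2: "integrable lborel (\<lambda>x. (cmod (g x))\<^sup>2)"
    using L2_integrable[of g] sm by (subst integrable_completion[symmetric]) auto
  have ck: "continuous_on UNIV (mollifier m :: real ^ 'd \<Rightarrow> real)" for m
    by (rule smooth_continuous[OF test_function_smooth[OF test_function_mollifier]])
  have mg: "mollify (mollifier m) f = mollify (mollifier m) g" for m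
    by (rule mollify_cong_AE[OF fm gm g(2) ck])
  have mm: "mollify (mollifier m) f \<in> borel_measurable lebesgue" for m
    by (rule continuous_measurable_lebesgue[OF smooth_continuous]) (use smooth_mollify[OF test_function_mollifier f] in blast)
  have meas0: "(\<lambda>x. mollify (mollifier m) f x - f x) \<in> borel_measurable lebesgue" for m
    using mm[of m] fm by measurable
  have meas: "(\<lambda>x. (cmod (mollify (mollifier m) f x - f x))\<^sup>2) \<in> borel_measurable lebesgue" for m
    using mm[of m] fm by measurable
  have err: "(\<integral>\<^sup>+ x. ennreal ((cmod (mollify (mollifier m) f x - f x))\<^sup>2) \<partial>lebesgue) \<le> ennreal e"
    if "\<And>z. norm z \<le> inverse (real (Suc m)) \<Longrightarrow> (LINT x|lborel. (cmod (g (z + x) - g x))\<^sup>2) \<le> e" for m e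
  proof -
    have "(\<integral>\<^sup>+ x. ennreal ((cmod (mollify (mollifier m) f x - f x))\<^sup>2) \<partial>lebesgue)
        = (\<integral>\<^sup>+ x. ennreal ((cmod (mollify (mollifier m) g x - g x))\<^sup>2) \<partial>lebesgue)"
      unfolding mg using g(2) by (intro nn_integral_cong_AE) (auto elim: eventually_mono)
    also have "\<dots> \<le> ennreal e"
      unfolding nn_integral_completion by (rule mollifier_kernel.mollify_L2_error[OF mollifier_kernel gi g2 that])
    finally show ?thesis .
  qed
  have ev: "\<forall>\<^sub>F m in sequentially. L2 (\<lambda>x. mollify (mollifier m) f x - f x) \<and>
      sqint (\<lambda>x. mollify (mollifier m) f x - f x) < a" if a: "a > 0" for a
  proof -
    have "a / 2 > 0" using a by simp
    from L2_translation_continuous[OF gi g2 this]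
    obtain \<delta> where \<delta>: "\<delta> > 0" "\<forall>z. norm z < \<delta> \<longrightarrow> (LINT x|lborel. (cmod (g (z + x) - g x))\<^sup>2) < a / 2"
      by blast
    show ?thesis
      using eventually_inverse_less[OF \<delta>(1)]
    proof eventually_elim
      case (elim m)
      have "(LINT x|lborel. (cmod (g (z + x) - g x))\<^sup>2) \<le> a / 2" if "norm z \<le> inverse (real (Suc m))" for z
        using \<delta>(2)[rule_format, of z] that elim by linarith
      note * = integral_le_nn_bound[OF meas _ err[OF this]]
      have "integrable lebesgue (\<lambda>x. (cmod (mollify (mollifier m) f x - f x))\<^sup>2)"
        by (rule *(1)) (use a in auto)
      moreover have "(LINT x|lebesgue. (cmod (mollify (mollifier m) f x - f x))\<^sup>2) \<le> a / 2"
        by (rule *(2)) (use a in auto)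
      ultimately show ?case using a meas0[of m] by (simp add: L2_def sqint_def)
    qed
  qed
  show "\<forall>\<^sub>F m in sequentially. L2 (\<lambda>x. mollify (mollifier m) f x - f x)"
    using ev[of 1] by (auto elim: eventually_mono)
  show "(\<lambda>m. sqint (\<lambda>x. mollify (mollifier m) f x - f x)) \<longlonglongrightarrow> 0"
  proof (rule order_tendstoI)
    fix a :: real assume "a < 0"
    then show "\<forall>\<^sub>F m in sequentially. a < sqint (\<lambda>x. mollify (mollifier m) f x - f x)"
      by (intro always_eventually allI) (auto intro: less_le_trans sqint_nonneg)
  next
    fix a :: real assume "0 < a"
    from ev[OF this] show "\<forall>\<^sub>F m in sequentially. sqint (\<lambda>x. mollify (mollifier m) f x - f x) < a"
      by (rule eventually_mono) simp
  qed
qed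

section \<open>The truncation\<close>

text \<open>A smooth truncation of the values: \<open>trunc a\<close> is bounded for \<open>a \<noteq> 0\<close> and tends to the identity as \<open>a \<rightarrow> 0\<close>, with
  derivatives bounded uniformly in \<open>a\<close>.  Its derivative at \<open>z\<close> is \<open>dtrunc a z\<close>.\<close>

definition trunc :: "real \<Rightarrow> complex \<Rightarrow> complex" where
  "trunc a z = inverse (1 + a\<^sup>2 * (cmod z)\<^sup>2) *\<^sub>R z"

definition dtrunc :: "real \<Rightarrow> complex \<Rightarrow> complex \<Rightarrow> complex" where
  "dtrunc a z h = inverse (1 + a\<^sup>2 * (cmod z)\<^sup>2) *\<^sub>R h
     - (2 * a\<^sup>2 * inner z h * (inverse (1 + a\<^sup>2 * (cmod z)\<^sup>2))\<^sup>2) *\<^sub>R z"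

lemma trunc_denom: "1 + a\<^sup>2 * (cmod z)\<^sup>2 > 0" "1 \<le> 1 + a\<^sup>2 * (cmod z)\<^sup>2"
  by (rule add_pos_nonneg) simp_all

lemma trunc_denom_inverse_le_1: "inverse (1 + a\<^sup>2 * (cmod z)\<^sup>2) \<le> 1" "0 < inverse (1 + a\<^sup>2 * (cmod z)\<^sup>2)"
  unfolding inverse_le_1_iff inverse_positive_iff_positive using trunc_denom by blast+

lemma has_derivative_trunc: "(trunc a has_derivative dtrunc a z) (at z)"
proof -
  have n: "((\<lambda>z. (cmod z)\<^sup>2) has_derivative (\<lambda>h. 2 * inner z h)) (at z)"
    unfolding power2_norm_eq_inner by (auto intro!: derivative_eq_intros simp: inner_commute)
  have q: "((\<lambda>z. 1 + a\<^sup>2 * (cmod z)\<^sup>2) has_derivative (\<lambda>h. a\<^sup>2 * (2 * inner z h))) (at z)"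
    using has_derivative_add[OF has_derivative_const has_derivative_mult_right[OF n]] by simp
  have i: "((\<lambda>z. inverse (1 + a\<^sup>2 * (cmod z)\<^sup>2)) has_derivative
      (\<lambda>h. - (inverse (1 + a\<^sup>2 * (cmod z)\<^sup>2) * (a\<^sup>2 * (2 * inner z h)) * inverse (1 + a\<^sup>2 * (cmod z)\<^sup>2)))) (at z)"
    by (rule Deriv.has_derivative_inverse[OF _ q]) (use trunc_denom(1)[of a z] in simp)
  show ?thesis
    unfolding trunc_def[abs_def]
    by (rule has_derivative_eq_rhs[OF has_derivative_scaleR[OF i has_derivative_ident]])
       (auto simp: fun_eq_iff dtrunc_def power2_eq_square mult_ac)
qed

lemma trunc_norm_le: "cmod (trunc a z) \<le> cmod z"
  using trunc_denom_inverse_le_1[of a z] by (simp add: trunc_def mult_left_le_one_le)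

lemma trunc_bounded: "a > 0 \<Longrightarrow> cmod (trunc a z) \<le> inverse a"
proof -
  assume a: "a > 0"
  have "0 \<le> (a * cmod z - 1)\<^sup>2" by simp
  then have "2 * (a * cmod z) \<le> 1 + a\<^sup>2 * (cmod z)\<^sup>2" by (simp add: power2_eq_square algebra_simps)
  then have "a * cmod z \<le> 1 + a\<^sup>2 * (cmod z)\<^sup>2" using a by (smt (verit) mult_nonneg_nonneg norm_ge_zero)
  then have "a * cmod z * inverse (1 + a\<^sup>2 * (cmod z)\<^sup>2) \<le> 1"
    using trunc_denom(1)[of a z] by (simp add: field_simps)
  then have "cmod z * inverse (1 + a\<^sup>2 * (cmod z)\<^sup>2) \<le> inverse a"
    using a by (simp add: field_simps)
  then show ?thesis using trunc_denom_inverse_le_1[of a z] by (simp add: trunc_def mult.commute)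
qed

lemma dtrunc_norm_le: "cmod (dtrunc a z h) \<le> 3 * cmod h"
proof -
  define q where "q = inverse (1 + a\<^sup>2 * (cmod z)\<^sup>2)"
  have q: "0 < q" "q \<le> 1" using trunc_denom_inverse_le_1[of a z] by (auto simp: q_def)
  have qz: "a\<^sup>2 * (cmod z)\<^sup>2 * q \<le> 1"
    using trunc_denom(1)[of a z] by (simp add: q_def field_simps)
  have "cmod (dtrunc a z h) \<le> cmod (q *\<^sub>R h) + cmod ((2 * a\<^sup>2 * inner z h * q\<^sup>2) *\<^sub>R z)"
    unfolding dtrunc_def q_def[symmetric] by (rule norm_triangle_ineq4)
  also have "cmod (q *\<^sub>R h) \<le> cmod h" using q by (simp add: mult_left_le_one_le)
  also have "cmod ((2 * a\<^sup>2 * inner z h * q\<^sup>2) *\<^sub>R z) = 2 * a\<^sup>2 * \<bar>inner z h\<bar> * q\<^sup>2 * cmod z"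
    by (simp add: abs_mult)
  also have "\<dots> \<le> 2 * a\<^sup>2 * (cmod z * cmod h) * q\<^sup>2 * cmod z"
    using Cauchy_Schwarz_ineq2[of z h] by (intro mult_right_mono mult_left_mono) auto
  also have "\<dots> = (a\<^sup>2 * (cmod z)\<^sup>2 * q) * q * (2 * cmod h)" by (simp add: power2_eq_square mult_ac)
  also have "\<dots> \<le> 1 * 1 * (2 * cmod h)"
    using qz q by (intro mult_right_mono mult_mono) auto
  finally show ?thesis by simp
qed

text \<open>The truncation commutes with phase rotations; infinitesimally it maps \<open>i z\<close> to
  \<open>i trunc z\<close>, so the vector potential passes through the chain rule unchanged.\<close>

lemma dtrunc_rotation: "dtrunc a z (\<i> * complex_of_real t * z) = \<i> * complex_of_real t * trunc a z"
proof -
  have "inner z (\<i> * complex_of_real t * z) = 0" by (simp add: inner_complex_def algebra_simps)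
  then show ?thesis by (simp add: dtrunc_def trunc_def)
qed

lemma dtrunc_diff: "dtrunc a z (h - k) = dtrunc a z h - dtrunc a z k"
  using linear_diff[OF has_derivative_linear[OF has_derivative_trunc]] .

lemma trunc_lipschitz: "cmod (trunc a z - trunc a w) \<le> 3 * cmod (z - w)"
proof (rule differentiable_bound[of UNIV _ "dtrunc a"])
  show "(trunc a has_derivative dtrunc a x) (at x within UNIV)" for x using has_derivative_trunc by simp
  show "onorm (dtrunc a x) \<le> 3" for x by (rule onorm_bound) (simp_all add: dtrunc_norm_le)
qed auto

lemma continuous_trunc: "continuous_on UNIV (trunc a)"
  by (intro continuous_at_imp_continuous_on ballI has_derivative_continuous[OF has_derivative_trunc])

lemma trunc_measurable [measurable]: "trunc a \<in> borel_measurable borel"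
  by (rule borel_measurable_continuous_onI[OF continuous_trunc])

lemma dtrunc_measurable [measurable (raw)]:
  assumes [measurable]: "f \<in> borel_measurable M" "g \<in> borel_measurable M"
  shows "(\<lambda>x. dtrunc a (f x) (g x)) \<in> borel_measurable M"
  unfolding dtrunc_def by measurable

lemma tendsto_dtrunc:
  assumes "(f \<longlongrightarrow> z) F"
  shows "((\<lambda>x. dtrunc a (f x) h) \<longlongrightarrow> dtrunc a z h) F"
  unfolding dtrunc_def using trunc_denom(1)[of a z] by (intro tendsto_intros assms) simp_all

lemma trunc_tendsto:
  shows "(\<lambda>m. trunc (inverse (real (Suc m))) z) \<longlonglongrightarrow> z"
    and "(\<lambda>m. dtrunc (inverse (real (Suc m))) z h) \<longlonglongrightarrow> h"
proof -
  have l: "(\<lambda>m. inverse (real (Suc m))) \<longlonglongrightarrow> 0" by (rule LIMSEQ_inverse_real_of_nat)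
  have "(\<lambda>m. trunc (inverse (real (Suc m))) z) \<longlonglongrightarrow> inverse (1 + 0\<^sup>2 * (cmod z)\<^sup>2) *\<^sub>R z"
    unfolding trunc_def by (intro tendsto_intros l) simp
  then show "(\<lambda>m. trunc (inverse (real (Suc m))) z) \<longlonglongrightarrow> z" by simp
  have "(\<lambda>m. dtrunc (inverse (real (Suc m))) z h) \<longlonglongrightarrow> inverse (1 + 0\<^sup>2 * (cmod z)\<^sup>2) *\<^sub>R h
     - (2 * 0\<^sup>2 * inner z h * (inverse (1 + 0\<^sup>2 * (cmod z)\<^sup>2))\<^sup>2) *\<^sub>R z"
    unfolding dtrunc_def by (intro tendsto_intros l) simp_all
  then show "(\<lambda>m. dtrunc (inverse (real (Suc m))) z h) \<longlonglongrightarrow> h" by simp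
qed

lemma smooth_trunc_compose:
  fixes f :: "real ^ 'd::finite \<Rightarrow> complex"
  assumes f: "smooth f"
  shows "Ck k (\<lambda>x. trunc a (f x))" "pderiv_at j (\<lambda>x. trunc a (f x)) x = dtrunc a (f x) (pderiv_at j f x)"
proof -
  have "smooth (\<lambda>x. Re (f x))" "smooth (\<lambda>x. Im (f x))" using f by (auto intro: Ck_Re Ck_Im)
  then have "smooth (\<lambda>x. 1 + a\<^sup>2 * (Re (f x) * Re (f x) + Im (f x) * Im (f x)))"
    by (intro allI Ck_add Ck_mult Ck_const) auto
  moreover have "(\<lambda>x. 1 + a\<^sup>2 * (cmod (f x))\<^sup>2) = (\<lambda>x. 1 + a\<^sup>2 * (Re (f x) * Re (f x) + Im (f x) * Im (f x)))"
    unfolding cmod_power2 by (simp add: power2_eq_square)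
  ultimately have s: "smooth (\<lambda>x. 1 + a\<^sup>2 * (cmod (f x))\<^sup>2)" by (simp only: simp_thms)
  have "1 + a\<^sup>2 * (cmod (f x))\<^sup>2 \<noteq> 0" for x using trunc_denom(1)[of a "f x"] by simp
  from Ck_inverse[OF s this] show "Ck k (\<lambda>x. trunc a (f x))"
    unfolding trunc_def using f by (intro Ck_scaleR) auto
  show "pderiv_at j (\<lambda>x. trunc a (f x)) x = dtrunc a (f x) (pderiv_at j f x)"
    by (rule pderiv_at_eqI[OF has_derivative_compose[OF smooth_has_derivative[OF f] has_derivative_trunc]])
qed

section \<open>Weak derivatives of integrable functions\<close>

text \<open>In contrast to \<open>weak_pderiv\<close>, nothing is said about integrability: the functions here are integrable or carry
  their own assumptions.\<close>

definition weak_deriv :: "'d::finite \<Rightarrow> (real ^ 'd \<Rightarrow> complex) \<Rightarrow> (real ^ 'd \<Rightarrow> complex) \<Rightarrow> bool" where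
  "weak_deriv j f g \<longleftrightarrow> (\<forall>\<phi> :: real ^ 'd \<Rightarrow> real. test_function \<phi> \<longrightarrow>
      (LINT x|lebesgue. \<phi> x *\<^sub>R g x) = - (LINT x|lebesgue. pderiv_at j \<phi> x *\<^sub>R f x))"

lemma test_function_bounded:
  fixes \<phi> :: "real ^ 'd::finite \<Rightarrow> 'b::real_normed_vector"
  assumes "test_function \<phi>"
  shows "\<exists>C\<ge>0. \<forall>x. norm (\<phi> x) \<le> C"
proof -
  obtain R where R: "R > 0" "\<And>x. norm x > R \<Longrightarrow> \<phi> x = 0"
    using test_function_bounded_support[OF assms] by blast
  show ?thesis by (rule bounded_compact_support[OF smooth_continuous[OF test_function_smooth[OF assms]] R(2)])
qed

lemma test_function_measurable:
  fixes \<phi> :: "real ^ 'd::finite \<Rightarrow> 'b::real_normed_vector"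
  shows "test_function \<phi> \<Longrightarrow> \<phi> \<in> borel_measurable lebesgue"
  by (intro continuous_measurable_lebesgue smooth_continuous test_function_smooth)

lemma test_function_scaleR_integrable:
  fixes \<phi> :: "real ^ 'd::finite \<Rightarrow> real" and f :: "real ^ 'd \<Rightarrow> 'b::{banach, second_countable_topology}"
  assumes "test_function \<phi>" "integrable lebesgue f"
  shows "integrable lebesgue (\<lambda>x. \<phi> x *\<^sub>R f x)"
proof -
  obtain C where "\<forall>x. norm (\<phi> x) \<le> C" using test_function_bounded[OF assms(1)] by blast
  then show ?thesis
    by (intro integrable_bounded_scaleR[OF assms(2), of _ C] test_function_measurable[OF assms(1)]) auto
qed

lemma test_function_integrable:
  fixes \<phi> :: "real ^ 'd::finite \<Rightarrow> 'b::{banach, second_countable_topology}"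
  assumes "test_function \<phi>"
  shows "integrable lebesgue \<phi>"
proof -
  obtain R where R: "R > 0" "\<And>x. norm x > R \<Longrightarrow> \<phi> x = 0"
    using test_function_bounded_support[OF assms] by blast
  show ?thesis by (rule integrable_compact_support[OF smooth_continuous[OF test_function_smooth[OF assms]] R(2)])
qed

lemma integral_pderiv_test_function:
  fixes \<phi> :: "real ^ 'd::finite \<Rightarrow> 'b::euclidean_space"
  assumes "test_function \<phi>"
  shows "(LINT x|lebesgue. pderiv_at j \<phi> x) = 0"
proof -
  obtain R where R: "R > 0" "\<And>x. norm x > R \<Longrightarrow> \<phi> x = 0"
    using test_function_bounded_support[OF assms] by blast
  have "Ck (Suc 0) \<phi>" using test_function_smooth[OF assms] by blast
  then show ?thesis by (rule integral_pderiv_eq_0[OF _ R(2)])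
qed

text \<open>The chain rule is classical for the mollified functions; they converge in \<open>L\<^sup>1\<close> together
  with their derivatives, and almost everywhere along a subsequence.\<close>

lemma weak_deriv_trunc:
  fixes f g :: "real ^ 'd::finite \<Rightarrow> complex"
  assumes f: "integrable lebesgue f" and g: "integrable lebesgue g" and w: "weak_deriv j f g"
  shows "weak_deriv j (\<lambda>x. trunc a (f x)) (\<lambda>x. dtrunc a (f x) (g x))"
  unfolding weak_deriv_def
proof (intro allI impI)
  fix \<phi> :: "real ^ 'd \<Rightarrow> real" assume \<phi>: "test_function \<phi>"
  define F where "F m = mollify (mollifier m) f" for m
  define G where "G m = mollify (mollifier m) g" for m
  have sF: "smooth (F m)" for m using smooth_mollify[OF test_function_mollifier f] by (simp add: F_def)
  have sG: "smooth (G m)" for m using smooth_mollify[OF test_function_mollifier g] by (simp add: G_def)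
  have dF: "pderiv_at j (F m) x = G m x" for m x
    unfolding F_def G_def
    by (rule pderiv_at_mollify_weak[OF test_function_mollifier f]) (use w in \<open>simp add: weak_deriv_def\<close>)
  have mf [measurable]: "f \<in> borel_measurable lebesgue" and mg [measurable]: "g \<in> borel_measurable lebesgue"
    using f g by auto
  have mF [measurable]: "F m \<in> borel_measurable lebesgue" for m
    by (rule continuous_measurable_lebesgue[OF smooth_continuous[OF sF]])
  have mG [measurable]: "G m \<in> borel_measurable lebesgue" for m
    by (rule continuous_measurable_lebesgue[OF smooth_continuous[OF sG]])
  have mt [measurable]: "\<phi> \<in> borel_measurable lebesgue" by (rule test_function_measurable[OF \<phi>])
  have intF: "integrable lebesgue (\<lambda>x. F m x - f x)" for m
    using mollify_L1_tendsto(1)[OF f, of m] unfolding F_def[symmetric] by (subst (asm) integrable_norm_iff) measurable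
  have "(\<lambda>m. LINT x|lebesgue. norm (F m x - f x)) \<longlonglongrightarrow> 0"
    using mollify_L1_tendsto(2)[OF f] unfolding F_def .
  from tendsto_L1_AE_subseq[OF intF this]
  obtain r where r: "strict_mono r" "AE x in lebesgue. (\<lambda>m. F (r m) x - f x) \<longlonglongrightarrow> 0" by blast
  have tf: "test_function (\<lambda>x. \<phi> x *\<^sub>R trunc a (F m x))" for m
    by (rule test_function_bilinear[OF bounded_bilinear_scaleR \<phi>]) (use smooth_trunc_compose(1)[OF sF] in blast)
  have classical: "(LINT x|lebesgue. \<phi> x *\<^sub>R dtrunc a (F m x) (G m x)) = - (LINT x|lebesgue. pderiv_at j \<phi> x *\<^sub>R trunc a (F m x))" for m
  proof -
    have eq: "pderiv_at j (\<lambda>x. \<phi> x *\<^sub>R trunc a (F m x)) x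
        = \<phi> x *\<^sub>R dtrunc a (F m x) (G m x) + pderiv_at j \<phi> x *\<^sub>R trunc a (F m x)" for x
      using pderiv_at_scaleR[OF smooth_differentiable[OF test_function_smooth[OF \<phi>]]
          smooth_differentiable[of "\<lambda>x. trunc a (F m x)"]]
        smooth_trunc_compose[OF sF] by (simp add: dF)
    have t2: "test_function (\<lambda>x. pderiv_at j \<phi> x *\<^sub>R trunc a (F m x))"
      by (rule test_function_bilinear[OF bounded_bilinear_scaleR test_function_pderiv[OF \<phi>]])
         (use smooth_trunc_compose(1)[OF sF] in blast)
    have i2: "integrable lebesgue (\<lambda>x. pderiv_at j \<phi> x *\<^sub>R trunc a (F m x))" by (rule test_function_integrable[OF t2])
    have "integrable lebesgue (\<lambda>x. pderiv_at j (\<lambda>x. \<phi> x *\<^sub>R trunc a (F m x)) x)"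
      by (rule test_function_integrable[OF test_function_pderiv[OF tf]])
    from Bochner_Integration.integrable_diff[OF this i2]
    have i1: "integrable lebesgue (\<lambda>x. \<phi> x *\<^sub>R dtrunc a (F m x) (G m x))" unfolding eq by simp
    have "0 = (LINT x|lebesgue. \<phi> x *\<^sub>R dtrunc a (F m x) (G m x) + pderiv_at j \<phi> x *\<^sub>R trunc a (F m x))"
      using integral_pderiv_test_function[OF tf[of m], where j=j] by (simp only: eq)
    also have "\<dots> = (LINT x|lebesgue. \<phi> x *\<^sub>R dtrunc a (F m x) (G m x)) + (LINT x|lebesgue. pderiv_at j \<phi> x *\<^sub>R trunc a (F m x))"
      by (rule Bochner_Integration.integral_add[OF i1 i2])
    finally show ?thesis by (simp add: eq_neg_iff_add_eq_0)
  qed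
  obtain C where C: "C \<ge> 0" "\<And>x. norm (\<phi> x) \<le> C" using test_function_bounded[OF \<phi>] by blast
  obtain C' where C': "C' \<ge> 0" "\<And>x. norm (pderiv_at j \<phi> x) \<le> C'"
    using test_function_bounded[OF test_function_pderiv[OF \<phi>]] by blast
  have mp [measurable]: "pderiv_at j \<phi> \<in> borel_measurable lebesgue"
    by (rule test_function_measurable[OF test_function_pderiv[OF \<phi>]])
  have l1F: "(\<lambda>m. LINT x|lebesgue. norm (F (r m) x - f x)) \<longlonglongrightarrow> 0"
    using LIMSEQ_subseq_LIMSEQ[OF mollify_L1_tendsto(2)[OF f] r(1)] by (simp add: F_def o_def)
  have l1G: "(\<lambda>m. LINT x|lebesgue. norm (G (r m) x - g x)) \<longlonglongrightarrow> 0"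
    using LIMSEQ_subseq_LIMSEQ[OF mollify_L1_tendsto(2)[OF g] r(1)] by (simp add: G_def o_def)
  have intG: "integrable lebesgue (\<lambda>x. G m x - g x)" for m
    using mollify_L1_tendsto(1)[OF g, of m] unfolding G_def[symmetric] by (subst (asm) integrable_norm_iff) measurable
  have tr_int: "integrable lebesgue (\<lambda>x. trunc a (f x))"
    by (rule Bochner_Integration.integrable_bound[OF f]) (auto intro!: AE_I2 trunc_norm_le)
  have right: "(\<lambda>m. LINT x|lebesgue. pderiv_at j \<phi> x *\<^sub>R trunc a (F (r m) x)) \<longlonglongrightarrow> (LINT x|lebesgue. pderiv_at j \<phi> x *\<^sub>R trunc a (f x))"
  proof (rule Lim_transform2[OF tendsto_const], rule Lim_null_comparison)
    show "(\<lambda>m. C' * 3 * (LINT x|lebesgue. norm (F (r m) x - f x))) \<longlonglongrightarrow> 0"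
      using tendsto_mult_right_zero[OF l1F] by simp
    show "\<forall>\<^sub>F m in sequentially. norm ((LINT x|lebesgue. pderiv_at j \<phi> x *\<^sub>R trunc a (f x)) - (LINT x|lebesgue. pderiv_at j \<phi> x *\<^sub>R trunc a (F (r m) x)))
        \<le> C' * 3 * (LINT x|lebesgue. norm (F (r m) x - f x))"
    proof (intro always_eventually allI)
      fix m
      have i1: "integrable lebesgue (\<lambda>x. pderiv_at j \<phi> x *\<^sub>R trunc a (f x))"
        by (rule test_function_scaleR_integrable[OF test_function_pderiv[OF \<phi>] tr_int])
      have "test_function (\<lambda>x. pderiv_at j \<phi> x *\<^sub>R trunc a (F (r m) x))"
        by (rule test_function_bilinear[OF bounded_bilinear_scaleR test_function_pderiv[OF \<phi>]])
           (use smooth_trunc_compose(1)[OF sF] in blast)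
      from test_function_integrable[OF this]
      have i2: "integrable lebesgue (\<lambda>x. pderiv_at j \<phi> x *\<^sub>R trunc a (F (r m) x))" .
      have "norm ((LINT x|lebesgue. pderiv_at j \<phi> x *\<^sub>R trunc a (f x)) - (LINT x|lebesgue. pderiv_at j \<phi> x *\<^sub>R trunc a (F (r m) x)))
          = norm (LINT x|lebesgue. pderiv_at j \<phi> x *\<^sub>R trunc a (f x) - pderiv_at j \<phi> x *\<^sub>R trunc a (F (r m) x))"
        by (simp only: Bochner_Integration.integral_diff[OF i1 i2])
      also have "\<dots> \<le> (LINT x|lebesgue. norm (pderiv_at j \<phi> x *\<^sub>R trunc a (f x) - pderiv_at j \<phi> x *\<^sub>R trunc a (F (r m) x)))"
        by (rule integral_norm_bound)
      also have "\<dots> \<le> (LINT x|lebesgue. C' * 3 * norm (F (r m) x - f x))"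
      proof (rule integral_mono)
        show "integrable lebesgue (\<lambda>x. norm (pderiv_at j \<phi> x *\<^sub>R trunc a (f x) - pderiv_at j \<phi> x *\<^sub>R trunc a (F (r m) x)))"
          by (rule integrable_norm[OF Bochner_Integration.integrable_diff[OF i1 i2]])
        show "integrable lebesgue (\<lambda>x. C' * 3 * norm (F (r m) x - f x))"
          by (intro integrable_mult_right integrable_norm intF)
        fix x
        have "norm (pderiv_at j \<phi> x *\<^sub>R trunc a (f x) - pderiv_at j \<phi> x *\<^sub>R trunc a (F (r m) x))
            = norm (pderiv_at j \<phi> x) * norm (trunc a (f x) - trunc a (F (r m) x))"
          by (simp only: scaleR_diff_right[symmetric] norm_scaleR real_norm_def)
        also have "\<dots> \<le> C' * (3 * norm (f x - F (r m) x))"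
          using C' trunc_lipschitz by (intro mult_mono) auto
        finally show "norm (pderiv_at j \<phi> x *\<^sub>R trunc a (f x) - pderiv_at j \<phi> x *\<^sub>R trunc a (F (r m) x)) \<le> C' * 3 * norm (F (r m) x - f x)"
          by (simp add: norm_minus_commute)
      qed
      finally show "norm ((LINT x|lebesgue. pderiv_at j \<phi> x *\<^sub>R trunc a (f x)) - (LINT x|lebesgue. pderiv_at j \<phi> x *\<^sub>R trunc a (F (r m) x)))
          \<le> C' * 3 * (LINT x|lebesgue. norm (F (r m) x - f x))" by simp
    qed
  qed
  have left: "(\<lambda>m. LINT x|lebesgue. \<phi> x *\<^sub>R dtrunc a (F (r m) x) (G (r m) x)) \<longlonglongrightarrow> (LINT x|lebesgue. \<phi> x *\<^sub>R dtrunc a (f x) (g x))"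
  proof -
    have bd_int: "integrable lebesgue (\<lambda>x. dtrunc a (F m x) (h x))" if "integrable lebesgue h" for h m
    proof (rule Bochner_Integration.integrable_bound)
      show "integrable lebesgue (\<lambda>x. 3 * h x)" using that by simp
      show "AE x in lebesgue. norm (dtrunc a (F m x) (h x)) \<le> norm (3 * h x)"
        using dtrunc_norm_le by (intro AE_I2) (simp add: norm_mult)
    qed (use that in measurable)
    have 1: "(\<lambda>m. LINT x|lebesgue. \<phi> x *\<^sub>R dtrunc a (F (r m) x) (g x)) \<longlonglongrightarrow> (LINT x|lebesgue. \<phi> x *\<^sub>R dtrunc a (f x) (g x))"
    proof (rule integral_dominated_convergence[where w="\<lambda>x. C * 3 * norm (g x)"])
      show "AE x in lebesgue. (\<lambda>m. \<phi> x *\<^sub>R dtrunc a (F (r m) x) (g x)) \<longlonglongrightarrow> \<phi> x *\<^sub>R dtrunc a (f x) (g x)"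
        using r(2)
      proof eventually_elim
        case (elim x)
        then have "(\<lambda>m. F (r m) x) \<longlonglongrightarrow> f x" by (simp add: LIM_zero_iff)
        then show ?case by (intro tendsto_intros tendsto_dtrunc)
      qed
      show "AE x in lebesgue. norm (\<phi> x *\<^sub>R dtrunc a (F (r m) x) (g x)) \<le> C * 3 * norm (g x)" for m
      proof (rule AE_I2)
        fix x
        have "norm (\<phi> x) * norm (dtrunc a (F (r m) x) (g x)) \<le> C * (3 * norm (g x))"
          using C dtrunc_norm_le by (intro mult_mono) auto
        then show "norm (\<phi> x *\<^sub>R dtrunc a (F (r m) x) (g x)) \<le> C * 3 * norm (g x)" by simp
      qed
      show "integrable lebesgue (\<lambda>x. C * 3 * norm (g x))" using g by simp
    qed measurable
    have 2: "(\<lambda>m. (LINT x|lebesgue. \<phi> x *\<^sub>R dtrunc a (F (r m) x) (G (r m) x - g x))) \<longlonglongrightarrow> 0"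
    proof (rule Lim_null_comparison)
      show "(\<lambda>m. C * 3 * (LINT x|lebesgue. norm (G (r m) x - g x))) \<longlonglongrightarrow> 0"
        using tendsto_mult_right_zero[OF l1G] by simp
      show "\<forall>\<^sub>F m in sequentially. norm (LINT x|lebesgue. \<phi> x *\<^sub>R dtrunc a (F (r m) x) (G (r m) x - g x))
          \<le> C * 3 * (LINT x|lebesgue. norm (G (r m) x - g x))"
      proof (intro always_eventually allI)
        fix m
        have "norm (LINT x|lebesgue. \<phi> x *\<^sub>R dtrunc a (F (r m) x) (G (r m) x - g x))
            \<le> (LINT x|lebesgue. norm (\<phi> x *\<^sub>R dtrunc a (F (r m) x) (G (r m) x - g x)))"
          by (rule integral_norm_bound)
        also have "\<dots> \<le> (LINT x|lebesgue. C * 3 * norm (G (r m) x - g x))"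
        proof (rule integral_mono)
          show "integrable lebesgue (\<lambda>x. norm (\<phi> x *\<^sub>R dtrunc a (F (r m) x) (G (r m) x - g x)))"
            by (intro integrable_norm test_function_scaleR_integrable[OF \<phi>] bd_int intG)
          show "integrable lebesgue (\<lambda>x. C * 3 * norm (G (r m) x - g x))"
            by (intro integrable_mult_right integrable_norm intG)
          fix x
          have "norm (\<phi> x) * norm (dtrunc a (F (r m) x) (G (r m) x - g x)) \<le> C * (3 * norm (G (r m) x - g x))"
            using C dtrunc_norm_le by (intro mult_mono) auto
          then show "norm (\<phi> x *\<^sub>R dtrunc a (F (r m) x) (G (r m) x - g x)) \<le> C * 3 * norm (G (r m) x - g x)" by simp
        qed
        finally show "norm (LINT x|lebesgue. \<phi> x *\<^sub>R dtrunc a (F (r m) x) (G (r m) x - g x))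
          \<le> C * 3 * (LINT x|lebesgue. norm (G (r m) x - g x))" by simp
      qed
    qed
    have "(LINT x|lebesgue. \<phi> x *\<^sub>R dtrunc a (F (r m) x) (G (r m) x))
        = (LINT x|lebesgue. \<phi> x *\<^sub>R dtrunc a (F (r m) x) (G (r m) x - g x)) + (LINT x|lebesgue. \<phi> x *\<^sub>R dtrunc a (F (r m) x) (g x))" for m
    proof -
      have "(LINT x|lebesgue. \<phi> x *\<^sub>R dtrunc a (F (r m) x) (G (r m) x))
        = (LINT x|lebesgue. \<phi> x *\<^sub>R dtrunc a (F (r m) x) (G (r m) x - g x) + \<phi> x *\<^sub>R dtrunc a (F (r m) x) (g x))"
        by (simp add: dtrunc_diff scaleR_diff_right)
      also have "\<dots> = (LINT x|lebesgue. \<phi> x *\<^sub>R dtrunc a (F (r m) x) (G (r m) x - g x)) + (LINT x|lebesgue. \<phi> x *\<^sub>R dtrunc a (F (r m) x) (g x))"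
        by (rule Bochner_Integration.integral_add[OF test_function_scaleR_integrable[OF \<phi> bd_int[OF intG]]
            test_function_scaleR_integrable[OF \<phi> bd_int[OF g]]])
      finally show ?thesis .
    qed
    then show ?thesis using tendsto_add[OF 2 1] by simp
  qed
  show "(LINT x|lebesgue. \<phi> x *\<^sub>R dtrunc a (f x) (g x)) = - (LINT x|lebesgue. pderiv_at j \<phi> x *\<^sub>R trunc a (f x))"
    using LIMSEQ_unique[OF left[unfolded classical] tendsto_minus[OF right]] .
qed

section \<open>The magnetic Sobolev space\<close>

text \<open>The gradient is carried along as a second function \<open>w\<close>, because it is determined by \<open>f\<close> only almost
  everywhere.\<close>

definition magH1 :: "(real ^ 'd::finite \<Rightarrow> real ^ 'd) \<Rightarrow> (real ^ 'd \<Rightarrow> complex) \<Rightarrow> ('d \<Rightarrow> real ^ 'd \<Rightarrow> complex) \<Rightarrow> bool" where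
  "magH1 A f w \<longleftrightarrow> L2 f \<and> (\<forall>j. L2 (w j)) \<and> (\<forall>j. weak_magnetic_pderiv A j f (w j))"

lemma Lp_loc_measurable: "Lp_loc p f \<Longrightarrow> f \<in> borel_measurable lebesgue"
  by (simp add: Lp_loc_def)

lemma test_function_scaleR_integrable_loc:
  fixes \<phi> :: "real ^ 'd::finite \<Rightarrow> real" and f :: "real ^ 'd \<Rightarrow> 'b::euclidean_space"
  assumes \<phi>: "test_function \<phi>" and f: "Lp_loc 1 f"
  shows "integrable lebesgue (\<lambda>x. \<phi> x *\<^sub>R f x)"
proof -
  obtain R where R: "R > 0" "\<And>x. norm x > R \<Longrightarrow> \<phi> x = 0"
    using test_function_bounded_support[OF \<phi>] by blast
  have "set_integrable lebesgue (cball 0 R) (\<lambda>x. norm (f x) ^ 1)"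
    using f compact_cball unfolding Lp_loc_def by blast
  then have n: "integrable lebesgue (\<lambda>x. indicator (cball 0 R) x *\<^sub>R norm (f x))"
    by (simp add: set_integrable_def)
  have m: "(\<lambda>x. indicator (cball 0 R) x *\<^sub>R f x) \<in> borel_measurable lebesgue"
    using Lp_loc_measurable[OF f] by (intro borel_measurable_scaleR borel_measurable_indicator) auto
  have "integrable lebesgue (\<lambda>x. indicator (cball 0 R) x *\<^sub>R f x)"
    by (rule Bochner_Integration.integrable_bound[OF n m]) auto
  from test_function_scaleR_integrable[OF \<phi> this]
  have "integrable lebesgue (\<lambda>x. \<phi> x *\<^sub>R (indicator (cball 0 R) x *\<^sub>R f x))" .
  moreover have "\<phi> x *\<^sub>R (indicator (cball 0 R) x *\<^sub>R f x) = \<phi> x *\<^sub>R f x" for x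
    using R(2)[of x] by (cases "norm x > R") auto
  ultimately show ?thesis by (simp only:)
qed

lemma component_measurable:
  fixes A :: "real ^ 'd::finite \<Rightarrow> real ^ 'd"
  assumes "A \<in> borel_measurable M"
  shows "(\<lambda>x. A x $ j) \<in> borel_measurable M"
  by (rule measurable_compose[OF assms borel_measurable_continuous_onI]) (intro continuous_intros)

text \<open>The support of \<open>b\<close> lies in a ball, on which \<open>A\<close> is square integrable.\<close>

lemma L2_potential_mult:
  fixes A :: "real ^ 'd::finite \<Rightarrow> real ^ 'd"
  assumes A: "Lp_loc 2 A" and b: "b \<in> borel_measurable lebesgue" "\<And>x. cmod (b x) \<le> C" "\<And>x. norm x > R \<Longrightarrow> b x = 0"
  shows "L2 (\<lambda>x. \<i> * complex_of_real (A x $ j) * b x)"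
proof -
  have mA: "A \<in> borel_measurable lebesgue" by (rule Lp_loc_measurable[OF A])
  have [measurable]: "(\<lambda>x. A x $ j) \<in> borel_measurable lebesgue" by (rule component_measurable[OF mA])
  note b(1)[measurable]
  have "set_integrable lebesgue (cball 0 R) (\<lambda>x. norm (A x) ^ 2)"
    using A compact_cball unfolding Lp_loc_def by blast
  then have n: "integrable lebesgue (\<lambda>x. indicator (cball 0 R) x *\<^sub>R (norm (A x))\<^sup>2)"
    by (simp add: set_integrable_def)
  show ?thesis
    unfolding L2_def
  proof
    show m: "(\<lambda>x. \<i> * complex_of_real (A x $ j) * b x) \<in> borel_measurable lebesgue" by measurable
    show "integrable lebesgue (\<lambda>x. (cmod (\<i> * complex_of_real (A x $ j) * b x))\<^sup>2)"
    proof (rule Bochner_Integration.integrable_bound)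
      show "integrable lebesgue (\<lambda>x. C\<^sup>2 * (indicator (cball 0 R) x *\<^sub>R (norm (A x))\<^sup>2))" using n by simp
      show "(\<lambda>x. (cmod (\<i> * complex_of_real (A x $ j) * b x))\<^sup>2) \<in> borel_measurable lebesgue" using m by measurable
      show "AE x in lebesgue. norm ((cmod (\<i> * complex_of_real (A x $ j) * b x))\<^sup>2)
          \<le> norm (C\<^sup>2 * (indicator (cball 0 R) x *\<^sub>R (norm (A x))\<^sup>2))"
      proof (rule AE_I2)
        fix x
        show "norm ((cmod (\<i> * complex_of_real (A x $ j) * b x))\<^sup>2)
          \<le> norm (C\<^sup>2 * (indicator (cball 0 R) x *\<^sub>R (norm (A x))\<^sup>2))"
        proof (cases "norm x \<le> R")
          case True
          have "cmod (\<i> * complex_of_real (A x $ j) * b x) \<le> norm (A x) * C"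
            unfolding norm_mult using b(2)[of x] component_le_norm_cart[of "A x" j] by (auto intro!: mult_mono)
          then have "(cmod (\<i> * complex_of_real (A x $ j) * b x))\<^sup>2 \<le> (norm (A x) * C)\<^sup>2" by (intro power_mono) auto
          then show ?thesis using True by (simp add: power_mult_distrib mult.commute)
        qed (use b(3) in simp)
      qed
    qed
  qed
qed

lemma L2_test_function:
  fixes \<phi> :: "real ^ 'd::finite \<Rightarrow> complex"
  assumes "test_function \<phi>" shows "L2 \<phi>"
proof -
  obtain C where C: "\<forall>x. norm (\<phi> x) \<le> C" using test_function_bounded[OF assms] by blast
  have i: "integrable lebesgue (\<lambda>x. norm (\<phi> x))" by (rule integrable_norm[OF test_function_integrable[OF assms]])
  show ?thesis
    unfolding L2_def
  proof
    show m: "\<phi> \<in> borel_measurable lebesgue" by (rule test_function_measurable[OF assms])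
    show "integrable lebesgue (\<lambda>x. (cmod (\<phi> x))\<^sup>2)"
    proof (rule Bochner_Integration.integrable_bound)
      show "integrable lebesgue (\<lambda>x. C * norm (\<phi> x))" using i by simp
      show "(\<lambda>x. (cmod (\<phi> x))\<^sup>2) \<in> borel_measurable lebesgue" using m by measurable
      show "AE x in lebesgue. norm ((cmod (\<phi> x))\<^sup>2) \<le> norm (C * norm (\<phi> x))"
      proof (rule AE_I2)
        fix x
        have "cmod (\<phi> x) * cmod (\<phi> x) \<le> C * cmod (\<phi> x)" using C by (intro mult_right_mono) auto
        then show "norm ((cmod (\<phi> x))\<^sup>2) \<le> norm (C * norm (\<phi> x))" by (simp add: power2_eq_square)
      qed
    qed
  qed
qed

lemma L2_magnetic_pderiv:
  fixes \<phi> :: "real ^ 'd::finite \<Rightarrow> complex"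
  assumes A: "Lp_loc 2 A" and \<phi>: "test_function \<phi>"
  shows "L2 (magnetic_pderiv A j \<phi>)"
proof -
  obtain C where C: "\<And>x. norm (\<phi> x) \<le> C" using test_function_bounded[OF \<phi>] by blast
  obtain R where R: "\<And>x. norm x > R \<Longrightarrow> \<phi> x = 0" using test_function_bounded_support[OF \<phi>] by blast
  have "L2 (\<lambda>x. pderiv_at j \<phi> x + \<i> * complex_of_real (A x $ j) * \<phi> x)"
    by (rule L2_add[OF L2_test_function[OF test_function_pderiv[OF \<phi>]]
        L2_potential_mult[OF A test_function_measurable[OF \<phi>] C R]])
  then show ?thesis by (simp add: magnetic_pderiv_def[abs_def])
qed

text \<open>The square of the distance in the graph norm; without the square root the triangle inequality holds with
  factors \<open>2\<close>.\<close>

definition H1dist :: "(real ^ 'd::finite \<Rightarrow> complex) \<Rightarrow> ('d \<Rightarrow> real ^ 'd \<Rightarrow> complex) \<Rightarrow>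
    (real ^ 'd \<Rightarrow> complex) \<Rightarrow> ('d \<Rightarrow> real ^ 'd \<Rightarrow> complex) \<Rightarrow> real" where
  "H1dist f w g v = sqint (\<lambda>x. f x - g x) + (\<Sum>j\<in>UNIV. sqint (\<lambda>x. w j x - v j x))"

lemma sqint_diff_triangle:
  assumes "L2 f" "L2 g" "L2 h"
  shows "sqint (\<lambda>x. f x - h x) \<le> 2 * sqint (\<lambda>x. f x - g x) + 2 * sqint (\<lambda>x. g x - h x)"
  using sqint_add_le[OF L2_diff[OF assms(1,2)] L2_diff[OF assms(2,3)]] by simp

lemma H1dist_triangle:
  assumes "L2 f" "L2 g" "L2 h" "\<And>j. L2 (w j)" "\<And>j. L2 (v j)" "\<And>j. L2 (u j)"
  shows "H1dist f w h u \<le> 2 * H1dist f w g v + 2 * H1dist g v h u"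
proof -
  have "H1dist f w h u \<le> (2 * sqint (\<lambda>x. f x - g x) + 2 * sqint (\<lambda>x. g x - h x))
      + (\<Sum>j\<in>UNIV. 2 * sqint (\<lambda>x. w j x - v j x) + 2 * sqint (\<lambda>x. v j x - u j x))"
    unfolding H1dist_def using assms by (intro add_mono sum_mono sqint_diff_triangle)
  also have "\<dots> = 2 * H1dist f w g v + 2 * H1dist g v h u"
    by (simp add: H1dist_def sum.distrib sum_distrib_left distrib_left)
  finally show ?thesis .
qed

lemma H1dist_tendsto:
  fixes f :: "nat \<Rightarrow> real ^ 'd::finite \<Rightarrow> complex"
  assumes "(\<lambda>m. sqint (\<lambda>x. f m x - g x)) \<longlonglongrightarrow> 0" "\<And>j. (\<lambda>m. sqint (\<lambda>x. w m j x - v j x)) \<longlonglongrightarrow> 0"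
  shows "(\<lambda>m. H1dist (f m) (w m) g v) \<longlonglongrightarrow> 0"
proof -
  have "(\<lambda>m. sqint (\<lambda>x. f m x - g x) + (\<Sum>j\<in>UNIV. sqint (\<lambda>x. w m j x - v j x))) \<longlonglongrightarrow> 0 + (\<Sum>j\<in>(UNIV :: 'd set). 0)"
    by (intro tendsto_add tendsto_sum assms)
  then show ?thesis by (simp add: H1dist_def)
qed

text \<open>For bounded support the ordinary weak derivative \<open>w\<^sub>j - i A\<^sub>j f\<close> is integrable, although it need not be square
  integrable; this is what the chain rule for the truncation requires.\<close>

definition compact_magH1 :: "(real ^ 'd::finite \<Rightarrow> real ^ 'd) \<Rightarrow> real \<Rightarrow> (real ^ 'd \<Rightarrow> complex) \<Rightarrow> ('d \<Rightarrow> real ^ 'd \<Rightarrow> complex) \<Rightarrow> bool" where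
  "compact_magH1 A R f w \<longleftrightarrow> L2 f \<and> (\<forall>j. L2 (w j)) \<and> integrable lebesgue f
     \<and> (\<forall>x. norm x > R \<longrightarrow> f x = 0)
     \<and> (\<forall>j. integrable lebesgue (\<lambda>x. w j x - \<i> * complex_of_real (A x $ j) * f x))
     \<and> (\<forall>j. weak_deriv j f (\<lambda>x. w j x - \<i> * complex_of_real (A x $ j) * f x))"

text \<open>The product rule for a weak derivative: \<open>\<phi> \<eta>\<close> is an admissible test function.\<close>

lemma cutoff_compact_magH1:
  fixes A :: "real ^ 'd::finite \<Rightarrow> real ^ 'd" and \<eta> :: "real ^ 'd \<Rightarrow> real"
  assumes u: "magH1 A f w" and \<eta>: "test_function \<eta>"
  shows "\<exists>R. compact_magH1 A R (\<lambda>x. \<eta> x *\<^sub>R f x) (\<lambda>j x. \<eta> x *\<^sub>R w j x + pderiv_at j \<eta> x *\<^sub>R f x)"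
proof -
  obtain R where R: "\<And>x. norm x > R \<Longrightarrow> \<eta> x = 0" using test_function_bounded_support[OF \<eta>] by blast
  have L2f: "L2 f" and L2w: "\<And>j. L2 (w j)" using u by (auto simp: magH1_def)
  have wk: "weak_magnetic_pderiv A j f (w j)" for j using u by (simp add: magH1_def)
  have locf: "Lp_loc 1 f" and locA: "Lp_loc 1 (\<lambda>x. complex_of_real (A x $ j) * f x)" and locw: "Lp_loc 1 (w j)" for j
    using wk[of j] by (auto simp: weak_magnetic_pderiv_def)
  have bdL2: "L2 (\<lambda>x. \<phi> x *\<^sub>R h x)" if t: "test_function \<phi>" and h: "L2 h" for \<phi> :: "real ^ 'd \<Rightarrow> real" and h
  proof -
    obtain C where C: "\<forall>x. norm (\<phi> x) \<le> C" using test_function_bounded[OF t] by blast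
    have "L2 (\<lambda>x. complex_of_real (\<phi> x) * h x)"
      by (rule L2_mult_bounded[OF h, of _ C]) (use C test_function_measurable[OF t] in auto)
    then show ?thesis by (simp add: scaleR_conv_of_real)
  qed
  have d\<eta>: "test_function (pderiv_at j \<eta>)" for j by (rule test_function_pderiv[OF \<eta>])
  have if1: "integrable lebesgue (\<lambda>x. \<phi> x *\<^sub>R f x)" if "test_function \<phi>" for \<phi> :: "real ^ 'd \<Rightarrow> real"
    by (rule test_function_scaleR_integrable_loc[OF that locf])
  have iw1: "integrable lebesgue (\<lambda>x. \<phi> x *\<^sub>R w j x)" if "test_function \<phi>" for \<phi> :: "real ^ 'd \<Rightarrow> real" and j
    by (rule test_function_scaleR_integrable_loc[OF that locw])
  have iA1: "integrable lebesgue (\<lambda>x. \<phi> x *\<^sub>R (\<i> * complex_of_real (A x $ j) * f x))"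
    if t: "test_function \<phi>" for \<phi> :: "real ^ 'd \<Rightarrow> real" and j
    using integrable_mult_right[OF test_function_scaleR_integrable_loc[OF t locA], of \<i>]
    by (simp only: mult_scaleR_right mult.assoc)
  define g where "g j x = (\<eta> x *\<^sub>R w j x + pderiv_at j \<eta> x *\<^sub>R f x) - \<i> * complex_of_real (A x $ j) * (\<eta> x *\<^sub>R f x)" for j x
  have g: "g j x = \<eta> x *\<^sub>R w j x + pderiv_at j \<eta> x *\<^sub>R f x - \<eta> x *\<^sub>R (\<i> * complex_of_real (A x $ j) * f x)" for j x
    by (simp add: g_def scaleR_conv_of_real mult_ac)
  have ig: "integrable lebesgue (g j)" for j
    unfolding g by (intro Bochner_Integration.integrable_diff Bochner_Integration.integrable_add iw1 if1 iA1 \<eta> d\<eta>)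
  have "weak_deriv j (\<lambda>x. \<eta> x *\<^sub>R f x) (g j)" for j
    unfolding weak_deriv_def
  proof (intro allI impI)
    fix \<phi> :: "real ^ 'd \<Rightarrow> real" assume \<phi>: "test_function \<phi>"
    define \<psi> where "\<psi> x = \<phi> x * \<eta> x" for x
    have \<psi>: "test_function \<psi>"
      unfolding \<psi>_def by (rule test_function_bilinear[OF bounded_bilinear_mult \<phi> test_function_smooth[OF \<eta>]])
    have d\<psi>: "pderiv_at j \<psi> x = \<phi> x * pderiv_at j \<eta> x + pderiv_at j \<phi> x * \<eta> x" for x
      unfolding \<psi>_def by (rule pderiv_at_mult) (intro smooth_differentiable test_function_smooth \<phi> \<eta>)+
    have t1: "test_function (\<lambda>x. \<phi> x * pderiv_at j \<eta> x)"
      by (rule test_function_bilinear[OF bounded_bilinear_mult \<phi> test_function_smooth[OF d\<eta>]])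
    have t2: "test_function (\<lambda>x. pderiv_at j \<phi> x * \<eta> x)"
      by (rule test_function_bilinear[OF bounded_bilinear_mult test_function_pderiv[OF \<phi>] test_function_smooth[OF \<eta>]])
    have weak: "(LINT x|lebesgue. \<psi> x *\<^sub>R w j x) = - (LINT x|lebesgue. pderiv_at j \<psi> x *\<^sub>R f x)
        + (LINT x|lebesgue. \<psi> x *\<^sub>R (\<i> * complex_of_real (A x $ j) * f x))"
      using wk[of j] \<psi> unfolding weak_magnetic_pderiv_def by blast
    have "(LINT x|lebesgue. pderiv_at j \<psi> x *\<^sub>R f x)
        = (LINT x|lebesgue. (\<phi> x * pderiv_at j \<eta> x) *\<^sub>R f x + (pderiv_at j \<phi> x * \<eta> x) *\<^sub>R f x)"
      by (simp only: d\<psi> scaleR_add_left)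
    also have "\<dots> = (LINT x|lebesgue. (\<phi> x * pderiv_at j \<eta> x) *\<^sub>R f x) + (LINT x|lebesgue. (pderiv_at j \<phi> x * \<eta> x) *\<^sub>R f x)"
      by (rule Bochner_Integration.integral_add[OF if1[OF t1] if1[OF t2]])
    finally have split: "(LINT x|lebesgue. pderiv_at j \<psi> x *\<^sub>R f x)
        = (LINT x|lebesgue. (\<phi> x * pderiv_at j \<eta> x) *\<^sub>R f x) + (LINT x|lebesgue. (pderiv_at j \<phi> x * \<eta> x) *\<^sub>R f x)" .
    have "(LINT x|lebesgue. \<phi> x *\<^sub>R g j x) = (LINT x|lebesgue. (\<psi> x *\<^sub>R w j x + (\<phi> x * pderiv_at j \<eta> x) *\<^sub>R f x)
        - \<psi> x *\<^sub>R (\<i> * complex_of_real (A x $ j) * f x))"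
      by (rule Bochner_Integration.integral_cong[OF refl])
         (simp only: g \<psi>_def scaleR_diff_right scaleR_add_right scaleR_scaleR)
    also have "\<dots> = ((LINT x|lebesgue. \<psi> x *\<^sub>R w j x) + (LINT x|lebesgue. (\<phi> x * pderiv_at j \<eta> x) *\<^sub>R f x))
        - (LINT x|lebesgue. \<psi> x *\<^sub>R (\<i> * complex_of_real (A x $ j) * f x))"
      unfolding Bochner_Integration.integral_diff[OF Bochner_Integration.integrable_add[OF iw1[OF \<psi>] if1[OF t1]] iA1[OF \<psi>]]
        Bochner_Integration.integral_add[OF iw1[OF \<psi>] if1[OF t1]] ..
    also have "\<dots> = - (LINT x|lebesgue. (pderiv_at j \<phi> x * \<eta> x) *\<^sub>R f x)" unfolding weak split by simp
    finally show "(LINT x|lebesgue. \<phi> x *\<^sub>R g j x) = - (LINT x|lebesgue. pderiv_at j \<phi> x *\<^sub>R (\<eta> x *\<^sub>R f x))"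
      by (simp only: scaleR_scaleR)
  qed
  then have "compact_magH1 A R (\<lambda>x. \<eta> x *\<^sub>R f x) (\<lambda>j x. \<eta> x *\<^sub>R w j x + pderiv_at j \<eta> x *\<^sub>R f x)"
    unfolding compact_magH1_def using bdL2[OF \<eta> L2f] L2_add[OF bdL2[OF \<eta> L2w] bdL2[OF d\<eta> L2f]] if1[OF \<eta>] R ig
    by (simp add: g_def[abs_def])
  then show ?thesis by blast
qed

text \<open>By \<open>dtrunc_rotation\<close> the chain rule for the ordinary derivative is the same as that for the magnetic one.\<close>

lemma trunc_compact_magH1:
  fixes A :: "real ^ 'd::finite \<Rightarrow> real ^ 'd"
  assumes u: "compact_magH1 A R f w" and mA: "A \<in> borel_measurable lebesgue"
  shows "compact_magH1 A R (\<lambda>x. trunc a (f x)) (\<lambda>j x. dtrunc a (f x) (w j x))"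
proof -
  have L2f: "L2 f" and L2w: "\<And>j. L2 (w j)" and fi: "integrable lebesgue f"
    and z: "\<And>x. norm x > R \<Longrightarrow> f x = 0"
    and gi: "\<And>j. integrable lebesgue (\<lambda>x. w j x - \<i> * complex_of_real (A x $ j) * f x)"
    and wd: "\<And>j. weak_deriv j f (\<lambda>x. w j x - \<i> * complex_of_real (A x $ j) * f x)"
    using u by (auto simp: compact_magH1_def)
  have [measurable]: "f \<in> borel_measurable lebesgue" "\<And>j. w j \<in> borel_measurable lebesgue"
    using L2f L2w L2_measurable by auto
  have mAj [measurable]: "(\<lambda>x. A x $ j) \<in> borel_measurable lebesgue" for j by (rule component_measurable[OF mA])
  have eq: "dtrunc a (f x) (w j x) - \<i> * complex_of_real (A x $ j) * trunc a (f x)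
      = dtrunc a (f x) (w j x - \<i> * complex_of_real (A x $ j) * f x)" for j x
    by (simp only: dtrunc_diff dtrunc_rotation)
  have 1: "L2 (\<lambda>x. trunc a (f x))"
    by (rule L2_bound[OF L2f, of _ 1]) (auto intro!: AE_I2 trunc_norm_le)
  have 2: "L2 (\<lambda>x. dtrunc a (f x) (w j x))" for j
    by (rule L2_bound[OF L2w[of j], of _ 3]) (auto intro!: AE_I2 dtrunc_norm_le)
  have 3: "integrable lebesgue (\<lambda>x. trunc a (f x))"
    by (rule Bochner_Integration.integrable_bound[OF fi]) (auto intro!: AE_I2 trunc_norm_le)
  have 4: "integrable lebesgue (\<lambda>x. dtrunc a (f x) (w j x - \<i> * complex_of_real (A x $ j) * f x))" for j
  proof (rule Bochner_Integration.integrable_bound)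
    show "integrable lebesgue (\<lambda>x. 3 * (w j x - \<i> * complex_of_real (A x $ j) * f x))"
      using gi[of j] by (rule integrable_mult_right)
    show "AE x in lebesgue. norm (dtrunc a (f x) (w j x - \<i> * complex_of_real (A x $ j) * f x))
        \<le> norm (3 * (w j x - \<i> * complex_of_real (A x $ j) * f x))"
      unfolding norm_mult norm_numeral by (rule AE_I2) (rule dtrunc_norm_le)
  qed measurable
  show ?thesis
    unfolding compact_magH1_def eq using 1 2 3 4 weak_deriv_trunc[OF fi gi wd] z by (simp add: trunc_def)
qed

lemma mollify_bounded:
  fixes f :: "real ^ 'd::finite \<Rightarrow> complex"
  assumes f: "integrable lebesgue f" "\<And>x. cmod (f x) \<le> M"
  shows "cmod (mollify (mollifier m) f x) \<le> M"
proof -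
  interpret mollifier_kernel "mollifier m :: real ^ 'd \<Rightarrow> real" "inverse (real (Suc m))" by (rule mollifier_kernel)
  let ?\<rho> = "mollifier m :: real ^ 'd \<Rightarrow> real"
  have t: "test_function (\<lambda>y. ?\<rho> (y - x))" by (rule test_function_translate(1)[OF test_function_mollifier])
  have "cmod (mollify ?\<rho> f x) \<le> (LINT y|lebesgue. norm (?\<rho> (y - x) *\<^sub>R f y))"
    unfolding mollify_def by (rule integral_norm_bound)
  also have "\<dots> \<le> (LINT y|lebesgue. M * ?\<rho> (y - x))"
  proof (rule integral_mono)
    show "integrable lebesgue (\<lambda>y. norm (?\<rho> (y - x) *\<^sub>R f y))"
      by (rule integrable_norm[OF test_function_scaleR_integrable[OF t f(1)]])
    show "integrable lebesgue (\<lambda>y. M * ?\<rho> (y - x))" using test_function_integrable[OF t] by simp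
    show "norm (?\<rho> (y - x) *\<^sub>R f y) \<le> M * ?\<rho> (y - x)" for y
      using mult_right_mono[OF f(2)[of y] nonneg[of "y - x"]] nonneg[of "y - x"] by (simp add: mult.commute)
  qed
  also have "\<dots> = M * (LINT y|lebesgue. ?\<rho> (y - x))" by simp
  also have "(LINT y|lebesgue. ?\<rho> (y - x)) = (LINT y|lborel. ?\<rho> (y - x))"
    by (rule integral_completion) measurable
  also have "\<dots> = 1" using integrable_translate(2)[OF kernel_integrable, of "- x"] normalized by simp
  finally show ?thesis by simp
qed

text \<open>For a bounded function of bounded support, mollification converges in the graph norm:
  the ordinary derivatives are square integrable and converge in \<open>L\<^sup>2\<close>, while \<open>A\<^sub>j\<close> times the
  mollified function converges by dominated convergence.  Boundedness is essential here, since \<open>A\<^sub>j\<close> is only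
  locally square integrable.\<close>

lemma mollify_compact_magH1:
  fixes A :: "real ^ 'd::finite \<Rightarrow> real ^ 'd"
  assumes A: "Lp_loc 2 A" and u: "compact_magH1 A R f w" and bd: "\<And>x. cmod (f x) \<le> M" and e: "e > 0"
  shows "\<exists>\<phi>. test_function \<phi> \<and> H1dist \<phi> (\<lambda>j. magnetic_pderiv A j \<phi>) f w < e"
proof -
  have L2f: "L2 f" and L2w: "\<And>j. L2 (w j)" and fi: "integrable lebesgue f"
    and z: "\<And>x. norm x > R \<Longrightarrow> f x = 0"
    and gi: "\<And>j. integrable lebesgue (\<lambda>x. w j x - \<i> * complex_of_real (A x $ j) * f x)"
    and wd: "\<And>j. weak_deriv j f (\<lambda>x. w j x - \<i> * complex_of_real (A x $ j) * f x)"
    using u by (auto simp: compact_magH1_def)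
  define g where "g j x = w j x - \<i> * complex_of_real (A x $ j) * f x" for j x
  have mf: "f \<in> borel_measurable lebesgue" using L2_measurable[OF L2f] .
  have L2Af: "L2 (\<lambda>x. \<i> * complex_of_real (A x $ j) * f x)" for j
    by (rule L2_potential_mult[OF A mf bd z])
  have L2g: "L2 (g j)" for j unfolding g_def by (rule L2_diff[OF L2w L2Af])
  have gi': "integrable lebesgue (g j)" for j using gi[of j] by (simp add: g_def[abs_def])
  define F where "F m = mollify (mollifier m) f" for m
  have tF: "test_function (F m)" for m
    unfolding F_def by (rule test_function_mollify[OF test_function_mollifier fi z])
  have dF: "pderiv_at j (F m) x = mollify (mollifier m) (g j) x" for j m x
    unfolding F_def
    by (rule pderiv_at_mollify_weak[OF test_function_mollifier fi])
       (use wd[of j] in \<open>simp add: weak_deriv_def g_def\<close>)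
  have M: "M \<ge> 0" using bd[of 0] norm_ge_zero order_trans by blast
  have Fb: "cmod (F m x) \<le> M" for m x unfolding F_def by (rule mollify_bounded[OF fi bd])
  have Fz: "F m x = 0" if "norm x > 1 + R" for m x
  proof -
    have "mollifier m y = 0" if "norm y > 1" for y :: "real ^ 'd"
    proof (rule mollifier_kernel.support[OF mollifier_kernel])
      show "norm y > inverse (real (Suc m))" using that inverse_le_1_iff[of "real (Suc m)"] by linarith
    qed
    then show ?thesis unfolding F_def using z that by (intro mollify_outside[of 1 _ R]) auto
  qed
  have mF: "F m \<in> borel_measurable lebesgue" for m by (rule test_function_measurable[OF tF])
  have intF: "integrable lebesgue (\<lambda>x. F m x - f x)" for m
    using fi test_function_integrable[OF tF[of m]] by simp
  have "(\<lambda>m. LINT x|lebesgue. norm (F m x - f x)) \<longlonglongrightarrow> 0"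
    using mollify_L1_tendsto(2)[OF fi] unfolding F_def .
  from tendsto_L1_AE_subseq[OF intF this]
  obtain r where r: "strict_mono r" "AE x in lebesgue. (\<lambda>m. F (r m) x - f x) \<longlonglongrightarrow> 0" by blast
  have lf: "(\<lambda>m. sqint (\<lambda>x. F (r m) x - f x)) \<longlonglongrightarrow> 0"
    using LIMSEQ_subseq_LIMSEQ[OF mollify_L2_tendsto(2)[OF fi L2f] r(1)] by (simp add: F_def o_def)
  have lg: "(\<lambda>m. sqint (\<lambda>x. mollify (mollifier (r m)) (g j) x - g j x)) \<longlonglongrightarrow> 0" for j
    using LIMSEQ_subseq_LIMSEQ[OF mollify_L2_tendsto(2)[OF gi' L2g] r(1)] by (simp add: o_def)
  have lA: "(\<lambda>m. sqint (\<lambda>x. \<i> * complex_of_real (A x $ j) * F (r m) x - \<i> * complex_of_real (A x $ j) * f x)) \<longlonglongrightarrow> 0" for j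
  proof (rule L2_dominated_convergence)
    show "L2 (\<lambda>x. \<i> * complex_of_real (A x $ j) * F (r m) x)" for m
      by (rule L2_potential_mult[OF A mF Fb Fz])
    show "L2 (\<lambda>x. \<i> * complex_of_real (A x $ j) * f x)" by (rule L2Af)
    show "L2 (\<lambda>x. \<i> * complex_of_real (A x $ j) * (indicator (cball 0 (1 + R)) x *\<^sub>R complex_of_real M))"
    proof (rule L2_potential_mult[OF A, of _ M "1 + R"])
      show "(\<lambda>x. indicator (cball 0 (1 + R)) x *\<^sub>R complex_of_real M) \<in> borel_measurable lebesgue"
        by (intro borel_measurable_scaleR borel_measurable_indicator borel_measurable_const) auto
    qed (use M in \<open>auto simp: indicator_def\<close>)
    show "AE x in lebesgue. (\<lambda>m. \<i> * complex_of_real (A x $ j) * F (r m) x) \<longlonglongrightarrow> \<i> * complex_of_real (A x $ j) * f x"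
      using r(2)
    proof eventually_elim
      case (elim x)
      then have "(\<lambda>m. F (r m) x) \<longlonglongrightarrow> f x" by (simp add: LIM_zero_iff)
      then show ?case by (intro tendsto_intros)
    qed
    show "AE x in lebesgue. cmod (\<i> * complex_of_real (A x $ j) * F (r m) x)
        \<le> cmod (\<i> * complex_of_real (A x $ j) * (indicator (cball 0 (1 + R)) x *\<^sub>R complex_of_real M))" for m
    proof (rule AE_I2)
      fix x
      have "cmod (F (r m) x) \<le> cmod (indicator (cball 0 (1 + R)) x *\<^sub>R complex_of_real M)"
        using Fb[of "r m" x] Fz[of x "r m"] M by (cases "norm x > 1 + R") (auto simp: indicator_def)
      then show "cmod (\<i> * complex_of_real (A x $ j) * F (r m) x)
        \<le> cmod (\<i> * complex_of_real (A x $ j) * (indicator (cball 0 (1 + R)) x *\<^sub>R complex_of_real M))"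
        unfolding norm_mult by (intro mult_left_mono) auto
    qed
  qed
  have lw: "(\<lambda>m. sqint (\<lambda>x. magnetic_pderiv A j (F (r m)) x - w j x)) \<longlonglongrightarrow> 0" for j
  proof (rule Lim_null_comparison)
    have "(\<lambda>m. 2 * sqint (\<lambda>x. mollify (mollifier (r m)) (g j) x - g j x)
        + 2 * sqint (\<lambda>x. \<i> * complex_of_real (A x $ j) * F (r m) x - \<i> * complex_of_real (A x $ j) * f x)) \<longlonglongrightarrow> 2 * 0 + 2 * 0"
      by (intro tendsto_intros lg lA)
    then show "(\<lambda>m. 2 * sqint (\<lambda>x. mollify (mollifier (r m)) (g j) x - g j x)
        + 2 * sqint (\<lambda>x. \<i> * complex_of_real (A x $ j) * F (r m) x - \<i> * complex_of_real (A x $ j) * f x)) \<longlonglongrightarrow> 0" by simp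
    show "\<forall>\<^sub>F m in sequentially. norm (sqint (\<lambda>x. magnetic_pderiv A j (F (r m)) x - w j x))
        \<le> 2 * sqint (\<lambda>x. mollify (mollifier (r m)) (g j) x - g j x)
        + 2 * sqint (\<lambda>x. \<i> * complex_of_real (A x $ j) * F (r m) x - \<i> * complex_of_real (A x $ j) * f x)"
    proof (intro always_eventually allI)
      fix m
      have "L2 (mollify (mollifier (r m)) (g j))"
      proof -
        have eq: "mollify (mollifier (r m)) (g j) = pderiv_at j (F (r m))" by (rule ext) (simp only: dF)
        show ?thesis unfolding eq by (rule L2_test_function[OF test_function_pderiv[OF tF]])
      qed
      then have a: "L2 (\<lambda>x. mollify (mollifier (r m)) (g j) x - g j x)" by (rule L2_diff[OF _ L2g])
      have b: "L2 (\<lambda>x. \<i> * complex_of_real (A x $ j) * F (r m) x - \<i> * complex_of_real (A x $ j) * f x)"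
        by (rule L2_diff[OF L2_potential_mult[OF A mF Fb Fz] L2Af])
      have "magnetic_pderiv A j (F (r m)) x - w j x = (mollify (mollifier (r m)) (g j) x - g j x)
          + (\<i> * complex_of_real (A x $ j) * F (r m) x - \<i> * complex_of_real (A x $ j) * f x)" for x
        by (simp add: magnetic_pderiv_def dF g_def)
      then show "norm (sqint (\<lambda>x. magnetic_pderiv A j (F (r m)) x - w j x))
        \<le> 2 * sqint (\<lambda>x. mollify (mollifier (r m)) (g j) x - g j x)
        + 2 * sqint (\<lambda>x. \<i> * complex_of_real (A x $ j) * F (r m) x - \<i> * complex_of_real (A x $ j) * f x)"
        using sqint_add_le[OF a b] by (simp only: real_norm_def abs_of_nonneg[OF sqint_nonneg])
    qed
  qed
  have "(\<lambda>m. H1dist (F (r m)) (\<lambda>j. magnetic_pderiv A j (F (r m))) f w) \<longlonglongrightarrow> 0"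
    by (rule H1dist_tendsto[OF lf lw])
  then have "\<forall>\<^sub>F m in sequentially. H1dist (F (r m)) (\<lambda>j. magnetic_pderiv A j (F (r m))) f w < e"
    by (rule order_tendstoD) (rule e)
  then obtain m where "H1dist (F (r m)) (\<lambda>j. magnetic_pderiv A j (F (r m))) f w < e"
    using eventually_happens[of _ sequentially] by auto
  with tF show ?thesis by blast
qed

lemma H1dist_eventually_less:
  assumes "(\<lambda>m. H1dist (f m) (w m) g v) \<longlonglongrightarrow> 0" "e > 0"
  shows "\<exists>m. H1dist (f m) (w m) g v < e"
proof -
  have "\<forall>\<^sub>F m in sequentially. H1dist (f m) (w m) g v < e"
    by (rule order_tendstoD(2)[OF assms])
  then show ?thesis using eventually_happens[of _ sequentially] by auto
qed

text \<open>The truncation step is needed because mollification of an unbounded function need not converge after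
  multiplication by \<open>A\<close>.\<close>

lemma test_functions_dense:
  fixes A :: "real ^ 'd::finite \<Rightarrow> real ^ 'd"
  assumes A: "Lp_loc 2 A" and u: "magH1 A f w" and e: "e > 0"
  shows "\<exists>\<phi>. test_function \<phi> \<and> H1dist \<phi> (\<lambda>j. magnetic_pderiv A j \<phi>) f w < e"
proof -
  have L2f: "L2 f" and L2w: "\<And>j. L2 (w j)" using u by (auto simp: magH1_def)
  define \<eta> :: "nat \<Rightarrow> real ^ 'd \<Rightarrow> real" where
    "\<eta> m x = inverse (bump (0 :: real ^ 'd)) * bump (0 + inverse (real (Suc m)) *\<^sub>R x)" for m x
  have b0: "bump (0 :: real ^ 'd) > 0" by (rule bump_0_pos)
  have sb: "Ck k (\<lambda>x :: real ^ 'd. bump (0 + inverse (real (Suc m)) *\<^sub>R x))" for k m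
    by (rule Ck_affine(1)[OF smooth_bump])
  have s\<eta>: "Ck k (\<eta> m)" for k m unfolding \<eta>_def by (intro Ck_mult Ck_const sb)
  have t\<eta>: "test_function (\<eta> m)" for m
  proof (rule test_functionI)
    show "smooth (\<eta> m)" using s\<eta> by blast
    show "\<eta> m x = 0" if "norm x > real (Suc m)" for x
    proof -
      have "norm (inverse (real (Suc m)) *\<^sub>R x) \<ge> 1"
        using that by (simp add: inverse_eq_divide pos_le_divide_eq del: of_nat_Suc)
      then show ?thesis by (simp add: \<eta>_def bump_eq_0)
    qed
  qed
  obtain K where K: "K \<ge> 0" "\<And>j x. \<bar>pderiv_at j (bump :: real ^ 'd \<Rightarrow> real) x\<bar> \<le> K"
  proof -
    have tb: "test_function (bump :: real ^ 'd \<Rightarrow> real)"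
      by (rule test_functionI[of _ 1]) (auto intro: smooth_bump bump_eq_0)
    have "\<forall>j. \<exists>C\<ge>0. \<forall>x. norm (pderiv_at j (bump :: real ^ 'd \<Rightarrow> real) x) \<le> C"
      using test_function_bounded[OF test_function_pderiv[OF tb]] by blast
    from choice[OF this] obtain C where C: "\<forall>j. C j \<ge> 0 \<and> (\<forall>x. norm (pderiv_at j (bump :: real ^ 'd \<Rightarrow> real) x) \<le> C j)" ..
    have s1: "\<bar>pderiv_at j (bump :: real ^ 'd \<Rightarrow> real) x\<bar> \<le> (\<Sum>j\<in>UNIV. C j)" for j x
    proof -
      have "\<bar>pderiv_at j (bump :: real ^ 'd \<Rightarrow> real) x\<bar> \<le> C j" using C by simp
      also have "\<dots> \<le> (\<Sum>j\<in>UNIV. C j)" by (rule member_le_sum) (use C in auto)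
      finally show ?thesis .
    qed
    have s0: "(\<Sum>j\<in>UNIV. C j) \<ge> 0" using C by (intro sum_nonneg) auto
    show thesis by (rule that[OF s0 s1])
  qed
  define K' where "K' = inverse (bump (0 :: real ^ 'd)) * K"
  have K': "K' \<ge> 0" using K(1) b0 by (simp add: K'_def)
  have d\<eta>: "\<bar>pderiv_at j (\<eta> m) x\<bar> \<le> inverse (real (Suc m)) * K'" for j m x
  proof -
    have "Ck (Suc 0) (bump :: real ^ 'd \<Rightarrow> real)" by (rule smooth_bump)
    from fun_cong[OF Ck_affine(2)[OF this, where a=0 and s="inverse (real (Suc m))"], where x=x]
    have b: "pderiv_at j (\<lambda>x. bump (0 + inverse (real (Suc m)) *\<^sub>R x)) x
        = inverse (real (Suc m)) *\<^sub>R pderiv_at j bump (0 + inverse (real (Suc m)) *\<^sub>R x)" .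
    have "pderiv_at j (\<eta> m) x = inverse (bump (0 :: real ^ 'd)) * (inverse (real (Suc m)) * pderiv_at j bump (0 + inverse (real (Suc m)) *\<^sub>R x))"
      unfolding \<eta>_def pderiv_at_linear[OF bounded_linear_mult_right smooth_differentiable[OF allI[OF sb]]] b by simp
    also have "\<bar>\<dots>\<bar> = inverse (real (Suc m)) * (inverse (bump (0 :: real ^ 'd)) * \<bar>pderiv_at j bump (0 + inverse (real (Suc m)) *\<^sub>R x)\<bar>)"
      using b0 by (simp add: abs_mult)
    also have "\<dots> \<le> inverse (real (Suc m)) * K'"
      unfolding K'_def using K(2) b0 by (intro mult_left_mono) auto
    finally show ?thesis .
  qed
  have \<eta>1: "\<bar>\<eta> m x\<bar> \<le> inverse (bump (0 :: real ^ 'd))" for m x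
    using bump_nonneg[of "0 + inverse (real (Suc m)) *\<^sub>R x"] bump_le_1[of "0 + inverse (real (Suc m)) *\<^sub>R x"] b0
    by (simp add: \<eta>_def abs_mult divide_inverse)
  have \<eta>lim: "(\<lambda>m. \<eta> m x) \<longlonglongrightarrow> 1" for x
  proof -
    have "continuous_on UNIV (bump :: real ^ 'd \<Rightarrow> real)" by (rule smooth_continuous) (intro allI smooth_bump)
    then have cont: "isCont (bump :: real ^ 'd \<Rightarrow> real) 0" by (simp add: continuous_on_eq_continuous_at)
    have "(\<lambda>m. 0 + inverse (real (Suc m)) *\<^sub>R x) \<longlonglongrightarrow> 0 + 0 *\<^sub>R x"
      by (intro tendsto_intros LIMSEQ_inverse_real_of_nat)
    then have l: "(\<lambda>m. 0 + inverse (real (Suc m)) *\<^sub>R x) \<longlonglongrightarrow> 0" by simp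
    have "(\<lambda>m. inverse (bump (0 :: real ^ 'd)) * bump (0 + inverse (real (Suc m)) *\<^sub>R x))
        \<longlonglongrightarrow> inverse (bump (0 :: real ^ 'd)) * bump (0 :: real ^ 'd)"
      by (rule tendsto_mult_left[OF isCont_tendsto_compose[OF cont l]])
    then show ?thesis using b0 by (simp add: \<eta>_def)
  qed
  define I where "I = inverse (bump (0 :: real ^ 'd))"
  have I: "I > 0" using b0 by (simp add: I_def)
  have L2\<eta>: "L2 (\<lambda>x. \<eta> m x *\<^sub>R h x)" if "L2 h" for h m
    by (rule L2_bound[OF that, of _ I])
       (use \<eta>1 in \<open>auto intro!: AE_I2 borel_measurable_scaleR test_function_measurable[OF t\<eta>] L2_measurable[OF that] mult_right_mono simp: I_def\<close>)
  have L2d\<eta>: "L2 (\<lambda>x. pderiv_at j (\<eta> m) x *\<^sub>R h x)" if "L2 h" for h m j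
    by (rule L2_bound[OF that, of _ "inverse (real (Suc m)) * K'"])
       (use d\<eta> in \<open>auto intro!: AE_I2 borel_measurable_scaleR test_function_measurable[OF test_function_pderiv[OF t\<eta>]] L2_measurable[OF that] mult_right_mono simp del: of_nat_Suc\<close>)
  have lim0: "(\<lambda>m. sqint (\<lambda>x. \<eta> m x *\<^sub>R h x - h x)) \<longlonglongrightarrow> 0" if h: "L2 h" for h
  proof (rule L2_dominated_convergence[OF L2\<eta>[OF h] h L2_cmult[OF h, of "complex_of_real I"]])
    show "AE x in lebesgue. (\<lambda>m. \<eta> m x *\<^sub>R h x) \<longlonglongrightarrow> h x"
    proof (rule AE_I2)
      fix x
      have "(\<lambda>m. \<eta> m x *\<^sub>R h x) \<longlonglongrightarrow> 1 *\<^sub>R h x" by (intro tendsto_intros \<eta>lim)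
      then show "(\<lambda>m. \<eta> m x *\<^sub>R h x) \<longlonglongrightarrow> h x" by simp
    qed
    show "AE x in lebesgue. cmod (\<eta> m x *\<^sub>R h x) \<le> cmod (complex_of_real I * h x)" for m
    proof (rule AE_I2)
      fix x
      have "\<bar>\<eta> m x\<bar> \<le> \<bar>I\<bar>" using \<eta>1[of m x] I unfolding I_def by simp
      then show "cmod (\<eta> m x *\<^sub>R h x) \<le> cmod (complex_of_real I * h x)"
        unfolding norm_mult norm_scaleR norm_of_real by (rule mult_right_mono) simp
    qed
  qed
  have lim1: "(\<lambda>m. sqint (\<lambda>x. pderiv_at j (\<eta> m) x *\<^sub>R f x)) \<longlonglongrightarrow> 0" for j
  proof (rule Lim_null_comparison)
    have "(\<lambda>m. (inverse (real (Suc m)) * K')\<^sup>2 * sqint f) \<longlonglongrightarrow> (0 * K')\<^sup>2 * sqint f"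
      by (intro tendsto_intros LIMSEQ_inverse_real_of_nat)
    then show "(\<lambda>m. (inverse (real (Suc m)) * K')\<^sup>2 * sqint f) \<longlonglongrightarrow> 0" by simp
    show "\<forall>\<^sub>F m in sequentially. norm (sqint (\<lambda>x. pderiv_at j (\<eta> m) x *\<^sub>R f x)) \<le> (inverse (real (Suc m)) * K')\<^sup>2 * sqint f"
    proof (intro always_eventually allI)
      fix m
      have "sqint (\<lambda>x. pderiv_at j (\<eta> m) x *\<^sub>R f x) \<le> (inverse (real (Suc m)) * K')\<^sup>2 * sqint f"
        by (rule sqint_mono[OF L2d\<eta>[OF L2f] L2f]) (simp add: mult_right_mono[OF d\<eta>] del: of_nat_Suc)
      then show "norm (sqint (\<lambda>x. pderiv_at j (\<eta> m) x *\<^sub>R f x)) \<le> (inverse (real (Suc m)) * K')\<^sup>2 * sqint f"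
        by (simp only: real_norm_def abs_of_nonneg[OF sqint_nonneg])
    qed
  qed
  define f1 where "f1 m x = \<eta> m x *\<^sub>R f x" for m x
  define w1 where "w1 m j x = \<eta> m x *\<^sub>R w j x + pderiv_at j (\<eta> m) x *\<^sub>R f x" for m j x
  have lw1: "(\<lambda>m. sqint (\<lambda>x. w1 m j x - w j x)) \<longlonglongrightarrow> 0" for j
  proof (rule Lim_null_comparison)
    have "(\<lambda>m. 2 * sqint (\<lambda>x. \<eta> m x *\<^sub>R w j x - w j x) + 2 * sqint (\<lambda>x. pderiv_at j (\<eta> m) x *\<^sub>R f x)) \<longlonglongrightarrow> 2 * 0 + 2 * 0"
      by (intro tendsto_intros lim0 lim1 L2w)
    then show "(\<lambda>m. 2 * sqint (\<lambda>x. \<eta> m x *\<^sub>R w j x - w j x) + 2 * sqint (\<lambda>x. pderiv_at j (\<eta> m) x *\<^sub>R f x)) \<longlonglongrightarrow> 0" by simp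
    show "\<forall>\<^sub>F m in sequentially. norm (sqint (\<lambda>x. w1 m j x - w j x))
        \<le> 2 * sqint (\<lambda>x. \<eta> m x *\<^sub>R w j x - w j x) + 2 * sqint (\<lambda>x. pderiv_at j (\<eta> m) x *\<^sub>R f x)"
    proof (intro always_eventually allI)
      fix m
      have "w1 m j x - w j x = (\<eta> m x *\<^sub>R w j x - w j x) + pderiv_at j (\<eta> m) x *\<^sub>R f x" for x
        by (simp add: w1_def)
      then show "norm (sqint (\<lambda>x. w1 m j x - w j x))
        \<le> 2 * sqint (\<lambda>x. \<eta> m x *\<^sub>R w j x - w j x) + 2 * sqint (\<lambda>x. pderiv_at j (\<eta> m) x *\<^sub>R f x)"
        using sqint_add_le[OF L2_diff[OF L2\<eta>[OF L2w] L2w] L2d\<eta>[OF L2f]]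
        by (simp only: real_norm_def abs_of_nonneg[OF sqint_nonneg])
    qed
  qed
  have "(\<lambda>m. H1dist (f1 m) (w1 m) f w) \<longlonglongrightarrow> 0"
    by (rule H1dist_tendsto[OF _ lw1]) (use lim0[OF L2f] in \<open>simp add: f1_def\<close>)
  from H1dist_eventually_less[OF this, of "e / 8"]
  obtain m1 where m1: "H1dist (f1 m1) (w1 m1) f w < e / 8" using e by auto
  obtain R where c1: "compact_magH1 A R (f1 m1) (w1 m1)"
    using cutoff_compact_magH1[OF u t\<eta>[of m1]] unfolding f1_def[abs_def] w1_def[abs_def] by blast
  have L2f1: "L2 (f1 m1)" and L2w1: "\<And>j. L2 (w1 m1 j)" using c1 by (auto simp: compact_magH1_def)
  define f2 where "f2 m x = trunc (inverse (real (Suc m))) (f1 m1 x)" for m x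
  define w2 where "w2 m j x = dtrunc (inverse (real (Suc m))) (f1 m1 x) (w1 m1 j x)" for m j x
  have c2: "compact_magH1 A R (f2 m) (w2 m)" for m
    unfolding f2_def[abs_def] w2_def[abs_def] by (rule trunc_compact_magH1[OF c1 Lp_loc_measurable[OF A]])
  have L2f2: "L2 (f2 m)" and L2w2: "\<And>j. L2 (w2 m j)" for m using c2 by (auto simp: compact_magH1_def)
  have "(\<lambda>m. H1dist (f2 m) (w2 m) (f1 m1) (w1 m1)) \<longlonglongrightarrow> 0"
  proof (rule H1dist_tendsto)
    show "(\<lambda>m. sqint (\<lambda>x. f2 m x - f1 m1 x)) \<longlonglongrightarrow> 0"
      by (rule L2_dominated_convergence[OF L2f2 L2f1 L2f1])
         (auto simp: f2_def trunc_norm_le trunc_tendsto simp del: of_nat_Suc)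
    show "(\<lambda>m. sqint (\<lambda>x. w2 m j x - w1 m1 j x)) \<longlonglongrightarrow> 0" for j
      by (rule L2_dominated_convergence[OF L2w2 L2w1 L2_cmult[OF L2w1[of j], of 3]])
         (auto simp: w2_def dtrunc_norm_le trunc_tendsto norm_mult simp del: of_nat_Suc)
  qed
  from H1dist_eventually_less[OF this, of "e / 16"]
  obtain m2 where m2: "H1dist (f2 m2) (w2 m2) (f1 m1) (w1 m1) < e / 16" using e by auto
  have bd: "cmod (f2 m2 x) \<le> inverse (inverse (real (Suc m2)))" for x
    unfolding f2_def by (rule trunc_bounded) simp
  obtain \<phi> where \<phi>: "test_function \<phi>" "H1dist \<phi> (\<lambda>j. magnetic_pderiv A j \<phi>) (f2 m2) (w2 m2) < e / 16"
    using mollify_compact_magH1[OF A c2[of m2] bd, of "e / 16"] e by auto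
  have L2\<phi>: "L2 \<phi>" "\<And>j. L2 (magnetic_pderiv A j \<phi>)"
    using L2_test_function[OF \<phi>(1)] L2_magnetic_pderiv[OF A \<phi>(1)] by auto
  have "H1dist \<phi> (\<lambda>j. magnetic_pderiv A j \<phi>) (f1 m1) (w1 m1)
      \<le> 2 * H1dist \<phi> (\<lambda>j. magnetic_pderiv A j \<phi>) (f2 m2) (w2 m2) + 2 * H1dist (f2 m2) (w2 m2) (f1 m1) (w1 m1)"
    by (rule H1dist_triangle[OF L2\<phi>(1) L2f2 L2f1 L2\<phi>(2) L2w2 L2w1])
  moreover have "H1dist \<phi> (\<lambda>j. magnetic_pderiv A j \<phi>) f w
      \<le> 2 * H1dist \<phi> (\<lambda>j. magnetic_pderiv A j \<phi>) (f1 m1) (w1 m1) + 2 * H1dist (f1 m1) (w1 m1) f w"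
    by (rule H1dist_triangle[OF L2\<phi>(1) L2f1 L2f L2\<phi>(2) L2w1 L2w])
  ultimately have "H1dist \<phi> (\<lambda>j. magnetic_pderiv A j \<phi>) f w < e" using m1 m2 \<phi>(2) e by linarith
  with \<phi>(1) show ?thesis by blast
qed

lemma test_functions_dense_sequence:
  fixes A :: "real ^ 'd::finite \<Rightarrow> real ^ 'd"
  assumes A: "Lp_loc 2 A" and u: "magH1 A f w"
  shows "\<exists>\<phi>. (\<forall>m. test_function (\<phi> m)) \<and> (\<lambda>m. sqint (\<lambda>x. \<phi> m x - f x)) \<longlonglongrightarrow> 0
    \<and> (\<forall>j. (\<lambda>m. sqint (\<lambda>x. magnetic_pderiv A j (\<phi> m) x - w j x)) \<longlonglongrightarrow> 0)"
proof -
  have "\<forall>m. \<exists>\<phi>. test_function \<phi> \<and> H1dist \<phi> (\<lambda>j. magnetic_pderiv A j \<phi>) f w < inverse (real (Suc m))"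
    using test_functions_dense[OF A u] by simp
  from choice[OF this] obtain \<phi> where
    \<phi>: "\<forall>m. test_function (\<phi> m) \<and> H1dist (\<phi> m) (\<lambda>j. magnetic_pderiv A j (\<phi> m)) f w < inverse (real (Suc m))" ..
  have 1: "sqint (\<lambda>x. \<phi> m x - f x) \<le> inverse (real (Suc m))" for m
  proof -
    have "0 \<le> (\<Sum>j\<in>UNIV. sqint (\<lambda>x. magnetic_pderiv A j (\<phi> m) x - w j x))"
      by (intro sum_nonneg sqint_nonneg)
    then show ?thesis using spec[OF \<phi>, of m] unfolding H1dist_def by linarith
  qed
  have 2: "sqint (\<lambda>x. magnetic_pderiv A j (\<phi> m) x - w j x) \<le> inverse (real (Suc m))" for m j
  proof -
    have "sqint (\<lambda>x. magnetic_pderiv A j (\<phi> m) x - w j x) \<le> (\<Sum>j\<in>UNIV. sqint (\<lambda>x. magnetic_pderiv A j (\<phi> m) x - w j x))"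
      by (rule member_le_sum) (auto simp: sqint_nonneg)
    then show ?thesis using spec[OF \<phi>, of m] sqint_nonneg[of "\<lambda>x. \<phi> m x - f x"] unfolding H1dist_def by linarith
  qed
  have "(\<lambda>m. sqint (\<lambda>x. \<phi> m x - f x)) \<longlonglongrightarrow> 0"
    by (rule Lim_null_comparison[OF _ LIMSEQ_inverse_real_of_nat])
       (simp only: real_norm_def abs_of_nonneg[OF sqint_nonneg] 1 eventually_True)
  moreover have "\<forall>j. (\<lambda>m. sqint (\<lambda>x. magnetic_pderiv A j (\<phi> m) x - w j x)) \<longlonglongrightarrow> 0"
    by (rule allI, rule Lim_null_comparison[OF _ LIMSEQ_inverse_real_of_nat])
       (simp only: real_norm_def abs_of_nonneg[OF sqint_nonneg] 2 eventually_True)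
  moreover have "\<forall>m. test_function (\<phi> m)" using \<phi> by simp
  ultimately show ?thesis by (intro exI[of _ \<phi>] conjI)
qed

section \<open>Integration by parts\<close>

lemma integral_by_parts_test:
  fixes f g :: "real ^ 'd::finite \<Rightarrow> complex"
  assumes f: "test_function f" and g: "smooth g"
  shows "(LINT x|lebesgue. f x * pderiv_at j g x) = - (LINT x|lebesgue. pderiv_at j f x * g x)"
proof -
  have t: "test_function (\<lambda>x. f x * g x)" by (rule test_function_bilinear[OF bounded_bilinear_mult f g])
  have i1: "integrable lebesgue (\<lambda>x. f x * pderiv_at j g x)"
    by (rule test_function_integrable[OF test_function_bilinear[OF bounded_bilinear_mult f smooth_pderiv[OF g]]])
  have i2: "integrable lebesgue (\<lambda>x. pderiv_at j f x * g x)"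
    by (rule test_function_integrable[OF test_function_bilinear[OF bounded_bilinear_mult test_function_pderiv[OF f] g]])
  have p: "pderiv_at j (\<lambda>x. f x * g x) x = f x * pderiv_at j g x + pderiv_at j f x * g x" for x
    by (rule pderiv_at_mult[OF smooth_differentiable[OF test_function_smooth[OF f]] smooth_differentiable[OF g]])
  have "0 = (LINT x|lebesgue. f x * pderiv_at j g x + pderiv_at j f x * g x)"
    using integral_pderiv_test_function[OF t, where j=j] by (simp only: p)
  also have "\<dots> = (LINT x|lebesgue. f x * pderiv_at j g x) + (LINT x|lebesgue. pderiv_at j f x * g x)"
    by (rule Bochner_Integration.integral_add[OF i1 i2])
  finally show ?thesis by (simp add: eq_neg_iff_add_eq_0)
qed

lemma smooth_diff_quotient:
  fixes g :: "real ^ 'd::finite \<Rightarrow> complex"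
  assumes s: "smooth g"
  shows "smooth (diff_quotient j m g)"
    "pderiv_at k (diff_quotient j m g) x = diff_quotient j m (pderiv_at k g) x"
proof -
  have eq: "diff_quotient j m g = (\<lambda>x. real (Suc m) *\<^sub>R (g (inverse (real (Suc m)) *\<^sub>R axis j 1 + 1 *\<^sub>R x) + (- 1) *\<^sub>R g x))"
    by (simp add: diff_quotient_def fun_eq_iff)
  have s1: "smooth (\<lambda>x. g (inverse (real (Suc m)) *\<^sub>R axis j 1 + 1 *\<^sub>R x))"
    using Ck_affine(1)[of _ g "inverse (real (Suc m)) *\<^sub>R axis j 1" 1] s by blast
  have s2: "smooth (\<lambda>x. (- 1) *\<^sub>R g x)"
    using Ck_linear[OF bounded_linear_scaleR_right, of _ g "- 1"] s by blast
  have s3: "smooth (\<lambda>x. g (inverse (real (Suc m)) *\<^sub>R axis j 1 + 1 *\<^sub>R x) + (- 1) *\<^sub>R g x)"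
    using Ck_add s1 s2 by blast
  show "smooth (diff_quotient j m g)"
    unfolding eq using Ck_linear[OF bounded_linear_scaleR_right] s3 by blast
  have "Ck (Suc 0) g" using s by blast
  note a = fun_cong[OF Ck_affine(2)[OF this, where a="inverse (real (Suc m)) *\<^sub>R axis j 1" and s=1 and j=k], of x]
  have "pderiv_at k (diff_quotient j m g) x = real (Suc m) *\<^sub>R
      (1 *\<^sub>R pderiv_at k g (inverse (real (Suc m)) *\<^sub>R axis j 1 + 1 *\<^sub>R x) + (- 1) *\<^sub>R pderiv_at k g x)"
    unfolding eq pderiv_at_linear[OF bounded_linear_scaleR_right smooth_differentiable[OF s3]]
      pderiv_at_add[OF smooth_differentiable[OF s1] smooth_differentiable[OF s2]]
      pderiv_at_linear[OF bounded_linear_scaleR_right smooth_differentiable[OF s]] a ..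
  then show "pderiv_at k (diff_quotient j m g) x = diff_quotient j m (pderiv_at k g) x"
    by (simp add: diff_quotient_def)
qed

lemma integral_mult_diff_quotient_tendsto:
  fixes f g :: "real ^ 'd::finite \<Rightarrow> complex"
  assumes f: "test_function f" and g: "test_function g"
  shows "(\<lambda>m. LINT x|lebesgue. f x * diff_quotient j m g x) \<longlonglongrightarrow> (LINT x|lebesgue. f x * pderiv_at j g x)"
proof -
  have d: "\<And>x. g differentiable (at x)" by (rule smooth_differentiable[OF test_function_smooth[OF g]])
  obtain C where C: "C \<ge> 0" "\<And>x. norm (pderiv_at j g x) \<le> C"
    using test_function_bounded[OF test_function_pderiv[OF g]] by blast
  have [measurable]: "f \<in> borel_measurable lebesgue" by (rule test_function_measurable[OF f])
  have [measurable]: "pderiv_at j g \<in> borel_measurable lebesgue" by (rule test_function_measurable[OF test_function_pderiv[OF g]])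
  have [measurable]: "diff_quotient j m g \<in> borel_measurable lebesgue" for m
    by (rule continuous_measurable_lebesgue[OF smooth_continuous[OF smooth_diff_quotient(1)[OF test_function_smooth[OF g]]]])
  show ?thesis
  proof (rule integral_dominated_convergence[where w="\<lambda>x. C * norm (f x)"])
    show "integrable lebesgue (\<lambda>x. C * norm (f x))" using test_function_integrable[OF f] by simp
    show "AE x in lebesgue. (\<lambda>m. f x * diff_quotient j m g x) \<longlonglongrightarrow> f x * pderiv_at j g x"
      by (intro AE_I2 tendsto_mult_left diff_quotient_tendsto d)
    show "AE x in lebesgue. norm (f x * diff_quotient j m g x) \<le> C * norm (f x)" for m
    proof (rule AE_I2)
      fix x
      have "norm (f x) * norm (diff_quotient j m g x) \<le> norm (f x) * C"
        by (rule mult_left_mono[OF diff_quotient_bound[OF d C(2)] norm_ge_zero])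
      then show "norm (f x * diff_quotient j m g x) \<le> C * norm (f x)" by (simp add: norm_mult mult.commute)
    qed
  qed measurable
qed

text \<open>Mixed derivatives commute, tested against test functions: difference quotients commute
  with derivatives, and one derivative can be moved to the other factor.\<close>

lemma integral_mixed_pderiv_commute:
  fixes f g :: "real ^ 'd::finite \<Rightarrow> complex"
  assumes f: "test_function f" and g: "test_function g"
  shows "(LINT x|lebesgue. f x * pderiv_at j (pderiv_at k g) x) = (LINT x|lebesgue. f x * pderiv_at k (pderiv_at j g) x)"
proof -
  have s: "smooth g" by (rule test_function_smooth[OF g])
  have sq: "smooth (diff_quotient j m g)" for m by (rule smooth_diff_quotient(1)[OF s])
  have dq: "pderiv_at k (diff_quotient j m g) x = diff_quotient j m (pderiv_at k g) x" for m x
    by (rule smooth_diff_quotient(2)[OF s])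
  have "(LINT x|lebesgue. f x * diff_quotient j m (pderiv_at k g) x)
      = - (LINT x|lebesgue. pderiv_at k f x * diff_quotient j m g x)" for m
    using integral_by_parts_test[OF f sq, where j=k] unfolding dq .
  moreover have "(\<lambda>m. LINT x|lebesgue. f x * diff_quotient j m (pderiv_at k g) x)
      \<longlonglongrightarrow> (LINT x|lebesgue. f x * pderiv_at j (pderiv_at k g) x)"
    by (rule integral_mult_diff_quotient_tendsto[OF f test_function_pderiv[OF g]])
  moreover have "(\<lambda>m. - (LINT x|lebesgue. pderiv_at k f x * diff_quotient j m g x))
      \<longlonglongrightarrow> - (LINT x|lebesgue. pderiv_at k f x * pderiv_at j g x)"
    by (rule tendsto_minus[OF integral_mult_diff_quotient_tendsto[OF test_function_pderiv[OF f] g]])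
  ultimately have "(LINT x|lebesgue. f x * pderiv_at j (pderiv_at k g) x) = - (LINT x|lebesgue. pderiv_at k f x * pderiv_at j g x)"
    using LIMSEQ_unique by simp
  then show ?thesis using integral_by_parts_test[OF f smooth_pderiv[OF s], where j=k] by simp
qed

lemma test_function_mult_potential_integrable:
  fixes \<phi> :: "real ^ 'd::finite \<Rightarrow> complex" and h :: "real ^ 'd \<Rightarrow> real"
  assumes \<phi>: "test_function \<phi>" and h: "Lp_loc 1 h"
  shows "integrable lebesgue (\<lambda>x. \<phi> x * complex_of_real (h x))"
    "(LINT x|lebesgue. \<phi> x * complex_of_real (h x))
      = complex_of_real (LINT x|lebesgue. Re (\<phi> x) * h x) + \<i> * complex_of_real (LINT x|lebesgue. Im (\<phi> x) * h x)"
proof -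
  have r: "integrable lebesgue (\<lambda>x. Re (\<phi> x) * h x)"
    using test_function_scaleR_integrable_loc[OF test_function_linear[OF bounded_linear_Re \<phi>] h] by simp
  have i: "integrable lebesgue (\<lambda>x. Im (\<phi> x) * h x)"
    using test_function_scaleR_integrable_loc[OF test_function_linear[OF bounded_linear_Im \<phi>] h] by simp
  have r': "integrable lebesgue (\<lambda>x. complex_of_real (Re (\<phi> x) * h x))" using r by (rule integrable_of_real)
  have i': "integrable lebesgue (\<lambda>x. \<i> * complex_of_real (Im (\<phi> x) * h x))" using integrable_of_real[OF i] by (intro integrable_mult_right)
  have eq: "\<phi> x * complex_of_real (h x) = complex_of_real (Re (\<phi> x) * h x) + \<i> * complex_of_real (Im (\<phi> x) * h x)" for x
    by (simp add: complex_eq_iff)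
  show "integrable lebesgue (\<lambda>x. \<phi> x * complex_of_real (h x))"
    unfolding eq by (rule Bochner_Integration.integrable_add[OF r' i'])
  show "(LINT x|lebesgue. \<phi> x * complex_of_real (h x))
      = complex_of_real (LINT x|lebesgue. Re (\<phi> x) * h x) + \<i> * complex_of_real (LINT x|lebesgue. Im (\<phi> x) * h x)"
    unfolding eq Bochner_Integration.integral_add[OF r' i'] by (simp only: integral_complex_of_real integral_mult_right_zero)
qed

lemma Lp_loc_component:
  fixes A :: "real ^ 'd::finite \<Rightarrow> real ^ 'e::finite"
  assumes "Lp_loc 1 A" shows "Lp_loc 1 (\<lambda>x. A x $ j)"
proof -
  have m: "(\<lambda>x. A x $ j) \<in> borel_measurable lebesgue"
    by (rule measurable_compose[OF Lp_loc_measurable[OF assms] borel_measurable_continuous_onI]) (intro continuous_intros)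
  have "set_integrable lebesgue K (\<lambda>x. norm (A x $ j) ^ 1)" if K: "compact K" for K :: "(real ^ 'd) set"
  proof -
    have "set_integrable lebesgue K (\<lambda>x. norm (A x) ^ 1)" using assms K unfolding Lp_loc_def by blast
    then show ?thesis
    proof (rule set_integrable_bound)
      have "K \<in> sets lebesgue" by (rule fmeasurableD[OF lmeasurable_compact[OF K]])
      then show "set_borel_measurable lebesgue K (\<lambda>x. norm (A x $ j) ^ 1)"
        unfolding set_borel_measurable_def using m by (intro borel_measurable_scaleR borel_measurable_indicator) auto
      show "AE x in lebesgue. x \<in> K \<longrightarrow> norm (norm (A x $ j) ^ 1) \<le> norm (norm (A x) ^ 1)"
        by (intro AE_I2) (simp add: component_le_norm_cart)
    qed
  qed
  with m show ?thesis unfolding Lp_loc_def by blast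
qed

lemma Lp_loc_matrix_entry:
  fixes B :: "real ^ 'd::finite \<Rightarrow> real ^ 'd ^ 'd"
  assumes "Lp_loc 1 B" shows "Lp_loc 1 (\<lambda>x. B x $ j $ k)"
proof -
  have m: "(\<lambda>x. B x $ j $ k) \<in> borel_measurable lebesgue"
    by (rule measurable_compose[OF Lp_loc_measurable[OF assms] borel_measurable_continuous_onI]) (intro continuous_intros)
  have "set_integrable lebesgue K (\<lambda>x. norm (B x $ j $ k) ^ 1)" if K: "compact K" for K :: "(real ^ 'd) set"
  proof -
    have "set_integrable lebesgue K (\<lambda>x. norm (B x) ^ 1)" using assms K unfolding Lp_loc_def by blast
    then show ?thesis
    proof (rule set_integrable_bound)
      have "K \<in> sets lebesgue" by (rule fmeasurableD[OF lmeasurable_compact[OF K]])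
      then show "set_borel_measurable lebesgue K (\<lambda>x. norm (B x $ j $ k) ^ 1)"
        unfolding set_borel_measurable_def using m by (intro borel_measurable_scaleR borel_measurable_indicator) auto
      have "norm (B x $ j $ k) \<le> norm (B x)" for x
        by (rule order_trans[OF Finite_Cartesian_Product.norm_nth_le Finite_Cartesian_Product.norm_nth_le])
      then show "AE x in lebesgue. x \<in> K \<longrightarrow> norm (norm (B x $ j $ k) ^ 1) \<le> norm (norm (B x) ^ 1)"
        by (intro AE_I2) simp
    qed
  qed
  with m show ?thesis unfolding Lp_loc_def by blast
qed

text \<open>The real and imaginary parts of a complex test function are test functions.\<close>

lemma magnetic_field_complex:
  fixes A :: "real ^ 'd::finite \<Rightarrow> real ^ 'd" and \<theta> :: "real ^ 'd \<Rightarrow> complex"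
  assumes B: "magnetic_field A B" and \<theta>: "test_function \<theta>"
  shows "(LINT x|lebesgue. \<theta> x * complex_of_real (B x $ j $ k))
    = - ((LINT x|lebesgue. pderiv_at j \<theta> x * complex_of_real (A x $ k)) - (LINT x|lebesgue. pderiv_at k \<theta> x * complex_of_real (A x $ j)))"
proof -
  have "Lp_loc 1 A" using B unfolding magnetic_field_def by blast
  then have lA: "Lp_loc 1 (\<lambda>x. A x $ j)" for j by (rule Lp_loc_component)
  have "Lp_loc 1 B" using B unfolding magnetic_field_def by blast
  then have lB: "Lp_loc 1 (\<lambda>x. B x $ j $ k)" by (rule Lp_loc_matrix_entry)
  have d: "\<theta> differentiable (at x)" for x by (rule smooth_differentiable[OF test_function_smooth[OF \<theta>]])
  have real: "(LINT x|lebesgue. \<phi> x * B x $ j $ k)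
      = - ((LINT x|lebesgue. pderiv_at j \<phi> x * A x $ k) - (LINT x|lebesgue. pderiv_at k \<phi> x * A x $ j))"
    if \<phi>: "test_function \<phi>" for \<phi> :: "real ^ 'd \<Rightarrow> real"
  proof -
    have i: "integrable lebesgue (\<lambda>x. pderiv_at a \<phi> x * A x $ b)" for a b
      using test_function_scaleR_integrable_loc[OF test_function_pderiv[OF \<phi>] lA] by simp
    have "(LINT x|lebesgue. \<phi> x * B x $ j $ k) = - (LINT x|lebesgue. pderiv_at j \<phi> x * A x $ k - pderiv_at k \<phi> x * A x $ j)"
      using B \<phi> unfolding magnetic_field_def by blast
    then show ?thesis by (simp only: Bochner_Integration.integral_diff[OF i i])
  qed
  have Re: "pderiv_at a (\<lambda>x. Re (\<theta> x)) x = Re (pderiv_at a \<theta> x)" and Im: "pderiv_at a (\<lambda>x. Im (\<theta> x)) x = Im (pderiv_at a \<theta> x)" for a x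
    by (rule pderiv_at_Re[OF d] pderiv_at_Im[OF d])+
  have 1: "test_function (\<lambda>x. Re (\<theta> x))" "test_function (\<lambda>x. Im (\<theta> x))"
    by (rule test_function_linear[OF bounded_linear_Re \<theta>] test_function_linear[OF bounded_linear_Im \<theta>])+
  show ?thesis
    unfolding test_function_mult_potential_integrable(2)[OF \<theta> lB]
      test_function_mult_potential_integrable(2)[OF test_function_pderiv[OF \<theta>] lA]
      real[OF 1(1)] real[OF 1(2)] Re Im
    by (simp add: algebra_simps)
qed

section \<open>The quadratic identities for test functions\<close>

text \<open>The potential drops out: \<open>i A\<^sub>j\<close> is skew, so \<open>cnj (D\<^sub>j f) g + cnj f (D\<^sub>j g) = \<partial>\<^sub>j (cnj f g)\<close>.\<close>

lemma magnetic_pderiv_by_parts_test: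
  fixes A :: "real ^ 'd::finite \<Rightarrow> real ^ 'd" and f g :: "real ^ 'd \<Rightarrow> complex" and \<psi> :: "real ^ 'd \<Rightarrow> real"
  assumes f: "test_function f" and g: "test_function g" and \<psi>: "smooth \<psi>"
  shows "(LINT x|lebesgue. complex_of_real (\<psi> x) * (cnj (magnetic_pderiv A j f x) * g x + cnj (f x) * magnetic_pderiv A j g x))
    = - (LINT x|lebesgue. complex_of_real (pderiv_at j \<psi> x) * (cnj (f x) * g x))"
proof -
  define h where "h x = cnj (f x) * g x" for x
  have tcf: "test_function (\<lambda>x. cnj (f x))" by (rule test_function_linear[OF bounded_linear_cnj f])
  have th: "test_function h" unfolding h_def by (rule test_function_bilinear[OF bounded_bilinear_mult tcf test_function_smooth[OF g]])
  have df: "\<And>x. f differentiable (at x)" and dg: "\<And>x. g differentiable (at x)" and dcf: "\<And>x. (\<lambda>x. cnj (f x)) differentiable (at x)"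
    using smooth_differentiable[OF test_function_smooth] f g tcf by blast+
  have ph: "pderiv_at j h x = cnj (f x) * pderiv_at j g x + cnj (pderiv_at j f x) * g x" for x
    unfolding h_def pderiv_at_mult[OF dcf dg] pderiv_at_cnj[OF df] ..
  have s\<psi>: "smooth (\<lambda>x. complex_of_real (\<psi> x))" using Ck_of_real \<psi> by blast
  have d\<psi>: "pderiv_at j (\<lambda>x. complex_of_real (\<psi> x)) x = complex_of_real (pderiv_at j \<psi> x)" for x
    by (rule pderiv_at_linear[OF bounded_linear_of_real smooth_differentiable[OF \<psi>]])
  have E: "(LINT x|lebesgue. h x * complex_of_real (pderiv_at j \<psi> x)) = - (LINT x|lebesgue. pderiv_at j h x * complex_of_real (\<psi> x))"
    using integral_by_parts_test[OF th s\<psi>, where j=j] unfolding d\<psi> .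
  have point: "complex_of_real (\<psi> x) * (cnj (magnetic_pderiv A j f x) * g x + cnj (f x) * magnetic_pderiv A j g x)
      = pderiv_at j h x * complex_of_real (\<psi> x)" for x
    by (simp add: magnetic_pderiv_def ph algebra_simps)
  have "(LINT x|lebesgue. pderiv_at j h x * complex_of_real (\<psi> x)) = - (LINT x|lebesgue. h x * complex_of_real (pderiv_at j \<psi> x))"
    by (simp only: E minus_minus)
  also have "\<dots> = - (LINT x|lebesgue. complex_of_real (pderiv_at j \<psi> x) * (cnj (f x) * g x))"
    by (simp only: h_def mult.commute)
  finally show ?thesis by (simp only: point)
qed

text \<open>In the antisymmetrised product of first derivatives the second derivatives and the terms
  quadratic in \<open>A\<close> cancel, and the terms linear in \<open>A\<close> combine to the magnetic field.  The
  identity involves first derivatives of \<open>f\<close> and \<open>g\<close> only and hence survives in the form domain.\<close>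

lemma magnetic_commutator_test:
  fixes A :: "real ^ 'd::finite \<Rightarrow> real ^ 'd" and f g :: "real ^ 'd \<Rightarrow> complex" and \<psi> :: "real ^ 'd \<Rightarrow> real"
  assumes B: "magnetic_field A B" and f: "test_function f" and g: "test_function g" and \<psi>: "smooth \<psi>"
  shows "(LINT x|lebesgue. complex_of_real (\<psi> x) *
      (cnj (magnetic_pderiv A j f x) * magnetic_pderiv A k g x - cnj (magnetic_pderiv A k f x) * magnetic_pderiv A j g x))
    = - \<i> * (LINT x|lebesgue. complex_of_real (\<psi> x) * (cnj (f x) * g x) * complex_of_real (B x $ j $ k))
      - (LINT x|lebesgue. complex_of_real (pderiv_at j \<psi> x) * cnj (f x) * magnetic_pderiv A k g x)
      + (LINT x|lebesgue. complex_of_real (pderiv_at k \<psi> x) * cnj (f x) * magnetic_pderiv A j g x)"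
proof -
  have "Lp_loc 1 A" using B unfolding magnetic_field_def by blast
  then have lA: "Lp_loc 1 (\<lambda>x. A x $ j)" for j by (rule Lp_loc_component)
  define F where "F x = complex_of_real (\<psi> x) * cnj (f x)" for x
  define \<theta> where "\<theta> x = F x * g x" for x
  have sf: "smooth f" and sg: "smooth g" using f g test_function_smooth by blast+
  have tcf: "test_function (\<lambda>x. cnj (f x))" by (rule test_function_linear[OF bounded_linear_cnj f])
  have s\<psi>: "smooth (\<lambda>x. complex_of_real (\<psi> x))" using Ck_of_real \<psi> by blast
  have tF: "test_function F"
    using test_function_bilinear[OF bounded_bilinear_mult tcf s\<psi>] unfolding F_def[abs_def] by (simp only: mult.commute)
  have t\<theta>: "test_function \<theta>" unfolding \<theta>_def by (rule test_function_bilinear[OF bounded_bilinear_mult tF sg])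
  have pF: "pderiv_at a F x = complex_of_real (\<psi> x) * cnj (pderiv_at a f x) + complex_of_real (pderiv_at a \<psi> x) * cnj (f x)" for a x
    unfolding F_def pderiv_at_mult[OF smooth_differentiable[OF s\<psi>] smooth_differentiable[OF test_function_smooth[OF tcf]]]
      pderiv_at_cnj[OF smooth_differentiable[OF sf]] pderiv_at_linear[OF bounded_linear_of_real smooth_differentiable[OF \<psi>]] ..
  have p\<theta>: "pderiv_at a \<theta> x = F x * pderiv_at a g x + pderiv_at a F x * g x" for a x
    unfolding \<theta>_def by (rule pderiv_at_mult[OF smooth_differentiable[OF test_function_smooth[OF tF]] smooth_differentiable[OF sg]])
  have iFg: "integrable lebesgue (\<lambda>x. pderiv_at a F x * pderiv_at b g x)" for a b
    by (rule test_function_integrable[OF test_function_bilinear[OF bounded_bilinear_mult test_function_pderiv[OF tF] smooth_pderiv[OF sg]]])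
  have i\<theta>A: "integrable lebesgue (\<lambda>x. pderiv_at a \<theta> x * complex_of_real (A x $ b))" for a b
    by (rule test_function_mult_potential_integrable(1)[OF test_function_pderiv[OF t\<theta>] lA])
  have t1: "test_function (\<lambda>x. complex_of_real (pderiv_at a \<psi> x) * cnj (f x) * pderiv_at b g x)"
    and t2: "test_function (\<lambda>x. complex_of_real (pderiv_at a \<psi> x) * cnj (f x) * g x)" for a b
  proof -
    have "smooth (\<lambda>x. complex_of_real (pderiv_at a \<psi> x))" using Ck_of_real smooth_pderiv[OF \<psi>] by blast
    from test_function_bilinear[OF bounded_bilinear_mult tcf this]
    have t: "test_function (\<lambda>x. complex_of_real (pderiv_at a \<psi> x) * cnj (f x))" by (simp only: mult.commute)
    show "test_function (\<lambda>x. complex_of_real (pderiv_at a \<psi> x) * cnj (f x) * pderiv_at b g x)"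
      by (rule test_function_bilinear[OF bounded_bilinear_mult t smooth_pderiv[OF sg]])
    show "test_function (\<lambda>x. complex_of_real (pderiv_at a \<psi> x) * cnj (f x) * g x)"
      by (rule test_function_bilinear[OF bounded_bilinear_mult t sg])
  qed
  have iD: "integrable lebesgue (\<lambda>x. complex_of_real (pderiv_at a \<psi> x) * cnj (f x) * magnetic_pderiv A b g x)" for a b
  proof -
    have "integrable lebesgue (\<lambda>x. \<i> * (complex_of_real (pderiv_at a \<psi> x) * cnj (f x) * g x * complex_of_real (A x $ b)))"
      by (rule integrable_mult_right[OF test_function_mult_potential_integrable(1)[OF t2 lA]])
    from Bochner_Integration.integrable_add[OF test_function_integrable[OF t1] this]
    show ?thesis by (simp only: magnetic_pderiv_def distrib_left mult_ac)
  qed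
  \<comment> \<open>Symmetry of second derivatives, in integrated form.\<close>
  have zero: "(LINT x|lebesgue. pderiv_at j F x * pderiv_at k g x) = (LINT x|lebesgue. pderiv_at k F x * pderiv_at j g x)"
  proof -
    have a: "(LINT x|lebesgue. F x * pderiv_at a (pderiv_at b g) x) = - (LINT x|lebesgue. pderiv_at a F x * pderiv_at b g x)" for a b
      by (rule integral_by_parts_test[OF tF smooth_pderiv[OF sg]])
    show ?thesis using integral_mixed_pderiv_commute[OF tF g, where j=j and k=k] a[of j k] a[of k j] by simp
  qed
  have point: "complex_of_real (\<psi> x) *
      (cnj (magnetic_pderiv A j f x) * magnetic_pderiv A k g x - cnj (magnetic_pderiv A k f x) * magnetic_pderiv A j g x)
    = ((pderiv_at j F x * pderiv_at k g x - pderiv_at k F x * pderiv_at j g x)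
      + \<i> * (pderiv_at j \<theta> x * complex_of_real (A x $ k) - pderiv_at k \<theta> x * complex_of_real (A x $ j)))
      - complex_of_real (pderiv_at j \<psi> x) * cnj (f x) * magnetic_pderiv A k g x
      + complex_of_real (pderiv_at k \<psi> x) * cnj (f x) * magnetic_pderiv A j g x" for x
    by (simp add: magnetic_pderiv_def p\<theta> pF F_def algebra_simps)
  note i1 = Bochner_Integration.integrable_diff[OF iFg[of j k] iFg[of k j]]
  note i2 = Bochner_Integration.integrable_diff[OF i\<theta>A[of j k] i\<theta>A[of k j]]
  note i2' = integrable_mult_right[OF i2, of \<i>]
  note i3 = Bochner_Integration.integrable_add[OF i1 i2']
  note i4 = Bochner_Integration.integrable_diff[OF i3 iD[of j k]]
  have eq1: "(LINT x|lebesgue. complex_of_real (\<psi> x) *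
      (cnj (magnetic_pderiv A j f x) * magnetic_pderiv A k g x - cnj (magnetic_pderiv A k f x) * magnetic_pderiv A j g x))
    = (((LINT x|lebesgue. pderiv_at j F x * pderiv_at k g x) - (LINT x|lebesgue. pderiv_at k F x * pderiv_at j g x))
      + \<i> * ((LINT x|lebesgue. pderiv_at j \<theta> x * complex_of_real (A x $ k)) - (LINT x|lebesgue. pderiv_at k \<theta> x * complex_of_real (A x $ j))))
      - (LINT x|lebesgue. complex_of_real (pderiv_at j \<psi> x) * cnj (f x) * magnetic_pderiv A k g x)
      + (LINT x|lebesgue. complex_of_real (pderiv_at k \<psi> x) * cnj (f x) * magnetic_pderiv A j g x)"
    unfolding point Bochner_Integration.integral_add[OF i4 iD[of k j]] Bochner_Integration.integral_diff[OF i3 iD[of j k]]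
      Bochner_Integration.integral_add[OF i1 i2'] Bochner_Integration.integral_diff[OF iFg[of j k] iFg[of k j]]
      integral_mult_right_zero Bochner_Integration.integral_diff[OF i\<theta>A[of j k] i\<theta>A[of k j]] ..
  have eq2: "(LINT x|lebesgue. complex_of_real (\<psi> x) * (cnj (f x) * g x) * complex_of_real (B x $ j $ k))
      = - ((LINT x|lebesgue. pderiv_at j \<theta> x * complex_of_real (A x $ k)) - (LINT x|lebesgue. pderiv_at k \<theta> x * complex_of_real (A x $ j)))"
    using magnetic_field_complex[OF B t\<theta>, where j=j and k=k] by (simp only: \<theta>_def F_def mult.assoc)
  show ?thesis unfolding eq1 eq2 zero by (simp add: right_diff_distrib)
qed

section \<open>Form-bounded weights\<close>

text \<open>Multiplication by \<open>p\<close> is bounded from the form domain to \<open>L\<^sup>2\<close>; the two constants are kept separate because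
  Hardy's inequality and the hypothesis on the field hold with \<open>a = 0\<close>, and their second constants matter.\<close>

definition form_bounded :: "(real ^ 'd::finite \<Rightarrow> real ^ 'd) \<Rightarrow> (real ^ 'd \<Rightarrow> real) \<Rightarrow> real \<Rightarrow> real \<Rightarrow> bool" where
  "form_bounded A p a b \<longleftrightarrow> p \<in> borel_measurable lebesgue \<and> a \<ge> 0 \<and> b \<ge> 0 \<and>
     (\<forall>\<phi>. test_function \<phi> \<longrightarrow> L2 (\<lambda>x. complex_of_real (p x) * \<phi> x) \<and>
        sqint (\<lambda>x. complex_of_real (p x) * \<phi> x) \<le> a * sqint \<phi> + b * (\<Sum>j\<in>UNIV. sqint (magnetic_pderiv A j \<phi>)))"

lemma form_bounded_1: "form_bounded A (\<lambda>x. 1) 1 0"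
  by (simp add: form_bounded_def L2_test_function)

lemma form_bounded_mono:
  assumes p: "form_bounded A p a b" and q: "q \<in> borel_measurable lebesgue" "\<And>x. \<bar>q x\<bar> \<le> \<bar>p x\<bar>"
  shows "form_bounded A q a b"
  unfolding form_bounded_def
proof (intro conjI allI impI)
  fix \<phi> :: "real ^ 'a \<Rightarrow> complex" assume \<phi>: "test_function \<phi>"
  have pL: "L2 (\<lambda>x. complex_of_real (p x) * \<phi> x)"
    and ps: "sqint (\<lambda>x. complex_of_real (p x) * \<phi> x) \<le> a * sqint \<phi> + b * (\<Sum>j\<in>UNIV. sqint (magnetic_pderiv A j \<phi>))"
    using p \<phi> by (auto simp: form_bounded_def)
  have m: "(\<lambda>x. complex_of_real (q x) * \<phi> x) \<in> borel_measurable lebesgue"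
    using q(1) test_function_measurable[OF \<phi>] by measurable
  have le: "cmod (complex_of_real (q x) * \<phi> x) \<le> 1 * cmod (complex_of_real (p x) * \<phi> x)" for x
    using q(2)[of x] by (simp add: norm_mult mult_right_mono)
  show qL: "L2 (\<lambda>x. complex_of_real (q x) * \<phi> x)"
    by (rule L2_bound[OF pL m, of 1]) (use le in auto)
  show "sqint (\<lambda>x. complex_of_real (q x) * \<phi> x) \<le> a * sqint \<phi> + b * (\<Sum>j\<in>UNIV. sqint (magnetic_pderiv A j \<phi>))"
    using sqint_mono[OF qL pL le] ps by simp
qed (use p q in \<open>auto simp: form_bounded_def\<close>)

lemma test_function_diff:
  fixes f g :: "real ^ 'd::finite \<Rightarrow> complex"
  assumes f: "test_function f" and g: "test_function g"
  shows "test_function (\<lambda>x. f x - g x)"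
    "magnetic_pderiv A j (\<lambda>x. f x - g x) x = magnetic_pderiv A j f x - magnetic_pderiv A j g x"
proof -
  have g': "test_function (\<lambda>x. - g x)" by (rule test_function_linear[OF bounded_linear_minus[OF bounded_linear_ident] g])
  obtain R where R: "\<And>x. norm x > R \<Longrightarrow> f x = 0" using test_function_bounded_support[OF f] by blast
  obtain S where S: "\<And>x. norm x > S \<Longrightarrow> g x = 0" using test_function_bounded_support[OF g] by blast
  have s: "smooth (\<lambda>x. f x + - g x)" using Ck_add test_function_smooth[OF f] test_function_smooth[OF g'] by blast
  show "test_function (\<lambda>x. f x - g x)"
    by (rule test_functionI[of _ "max R S"]) (use s R S in auto)
  have "pderiv_at j (\<lambda>x. f x + - g x) x = pderiv_at j f x + - pderiv_at j g x"
    unfolding pderiv_at_add[OF smooth_differentiable[OF test_function_smooth[OF f]] smooth_differentiable[OF test_function_smooth[OF g']]]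
      pderiv_at_linear[OF bounded_linear_minus[OF bounded_linear_ident] smooth_differentiable[OF test_function_smooth[OF g]]] ..
  then show "magnetic_pderiv A j (\<lambda>x. f x - g x) x = magnetic_pderiv A j f x - magnetic_pderiv A j g x"
    by (simp add: magnetic_pderiv_def algebra_simps)
qed

lemma sqint_subseq_AE:
  fixes f :: "nat \<Rightarrow> real ^ 'd::finite \<Rightarrow> complex"
  assumes "\<And>m. L2 (f m)" "L2 g" "(\<lambda>m. sqint (\<lambda>x. f m x - g x)) \<longlonglongrightarrow> 0"
  shows "\<exists>r. strict_mono r \<and> (AE x in lebesgue. (\<lambda>m. f (r m) x) \<longlonglongrightarrow> g x)"
proof -
  have i: "integrable lebesgue (\<lambda>x. (cmod (f m x - g x))\<^sup>2)" for m by (rule L2_integrable[OF L2_diff[OF assms(1,2)]])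
  have "(\<lambda>m. LINT x|lebesgue. norm ((cmod (f m x - g x))\<^sup>2)) \<longlonglongrightarrow> 0" using assms(3) by (simp add: sqint_def)
  from tendsto_L1_AE_subseq[OF i this]
  obtain r where r: "strict_mono r" "AE x in lebesgue. (\<lambda>m. (cmod (f (r m) x - g x))\<^sup>2) \<longlonglongrightarrow> 0" by blast
  have "AE x in lebesgue. (\<lambda>m. f (r m) x) \<longlonglongrightarrow> g x"
    using r(2)
  proof eventually_elim
    case (elim x)
    from tendsto_real_sqrt[OF elim] have "(\<lambda>m. cmod (f (r m) x - g x)) \<longlonglongrightarrow> 0" by simp
    then show ?case by (simp add: tendsto_norm_zero_iff LIM_zero_iff)
  qed
  with r(1) show ?thesis by blast
qed

text \<open>A form-bounded weight acts continuously on the form domain: the bound passes to limits of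
  test functions by Fatou's lemma.\<close>

lemma form_bounded_extend:
  fixes A :: "real ^ 'd::finite \<Rightarrow> real ^ 'd"
  assumes A: "Lp_loc 2 A" and p: "form_bounded A p a b" and u: "magH1 A f w"
    and \<phi>: "\<And>m. test_function (\<phi> m)" and lf: "(\<lambda>m. sqint (\<lambda>x. \<phi> m x - f x)) \<longlonglongrightarrow> 0"
    and lw: "\<And>j. (\<lambda>m. sqint (\<lambda>x. magnetic_pderiv A j (\<phi> m) x - w j x)) \<longlonglongrightarrow> 0"
  shows "L2 (\<lambda>x. complex_of_real (p x) * f x)"
    "(\<lambda>m. sqint (\<lambda>x. complex_of_real (p x) * \<phi> m x - complex_of_real (p x) * f x)) \<longlonglongrightarrow> 0"
    "sqint (\<lambda>x. complex_of_real (p x) * f x) \<le> a * sqint f + b * (\<Sum>j\<in>UNIV. sqint (w j))"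
proof -
  have L2f: "L2 f" and L2w: "\<And>j. L2 (w j)" using u by (auto simp: magH1_def)
  have ab: "a \<ge> 0" "b \<ge> 0" and pm: "p \<in> borel_measurable lebesgue" using p by (auto simp: form_bounded_def)
  have pL: "L2 (\<lambda>x. complex_of_real (p x) * \<theta> x)"
    and ps: "sqint (\<lambda>x. complex_of_real (p x) * \<theta> x) \<le> a * sqint \<theta> + b * (\<Sum>j\<in>UNIV. sqint (magnetic_pderiv A j \<theta>))"
    if "test_function \<theta>" for \<theta> using p that by (auto simp: form_bounded_def)
  have L2\<phi>: "L2 (\<phi> m)" and L2D: "L2 (magnetic_pderiv A j (\<phi> m))" for m j
    using L2_test_function[OF \<phi>] L2_magnetic_pderiv[OF A \<phi>] by auto
  define N where "N m = a * sqint (\<lambda>x. \<phi> m x - f x) + b * (\<Sum>j\<in>UNIV. sqint (\<lambda>x. magnetic_pderiv A j (\<phi> m) x - w j x))" for m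
  have N0: "N m \<ge> 0" for m unfolding N_def using ab by (intro add_nonneg_nonneg mult_nonneg_nonneg sum_nonneg sqint_nonneg)
  have "N \<longlonglongrightarrow> a * 0 + b * (\<Sum>j\<in>(UNIV :: 'd set). 0)"
    unfolding N_def by (intro tendsto_intros lf lw)
  then have N: "N \<longlonglongrightarrow> 0" by simp
  \<comment> \<open>The images of the test functions form a Cauchy sequence; letting l tend to infinity along an almost everywhere
    convergent subsequence, Fatou's lemma bounds the distance to the limit.\<close>
  have cauchy: "sqint (\<lambda>x. complex_of_real (p x) * (\<phi> m x - \<phi> l x)) \<le> 2 * N m + 2 * N l" for m l
  proof -
    have t: "test_function (\<lambda>x. \<phi> m x - \<phi> l x)" by (rule test_function_diff(1)[OF \<phi> \<phi>])
    have d: "sqint (\<lambda>x. h x - k x) \<le> 2 * sqint (\<lambda>x. h x - g x) + 2 * sqint (\<lambda>x. k x - g x)"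
      if "L2 h" "L2 k" "L2 g" for h k g :: "real ^ 'd \<Rightarrow> complex"
    proof -
      have e: "sqint (\<lambda>x. g x - k x) = sqint (\<lambda>x. k x - g x)" by (simp add: sqint_def norm_minus_commute)
      show ?thesis using sqint_diff_triangle[OF that(1) that(3) that(2)] unfolding e .
    qed
    have "sqint (\<lambda>x. complex_of_real (p x) * (\<phi> m x - \<phi> l x)) \<le> a * sqint (\<lambda>x. \<phi> m x - \<phi> l x)
        + b * (\<Sum>j\<in>UNIV. sqint (\<lambda>x. magnetic_pderiv A j (\<phi> m) x - magnetic_pderiv A j (\<phi> l) x))"
      using ps[OF t] unfolding test_function_diff(2)[OF \<phi> \<phi>, abs_def] .
    also have "\<dots> \<le> a * (2 * sqint (\<lambda>x. \<phi> m x - f x) + 2 * sqint (\<lambda>x. \<phi> l x - f x))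
        + b * (\<Sum>j\<in>UNIV. 2 * sqint (\<lambda>x. magnetic_pderiv A j (\<phi> m) x - w j x) + 2 * sqint (\<lambda>x. magnetic_pderiv A j (\<phi> l) x - w j x))"
      using ab by (intro add_mono mult_left_mono sum_mono d L2\<phi> L2D L2f L2w)
    also have "\<dots> = 2 * N m + 2 * N l"
      by (simp add: N_def sum.distrib sum_distrib_left[symmetric] algebra_simps)
    finally show ?thesis .
  qed
  obtain r where r: "strict_mono r" "AE x in lebesgue. (\<lambda>l. \<phi> (r l) x) \<longlonglongrightarrow> f x"
    using sqint_subseq_AE[OF L2\<phi> L2f lf] by blast
  have fatou: "(\<integral>\<^sup>+ x. ennreal ((cmod (complex_of_real (p x) * \<phi> m x - complex_of_real (p x) * f x))\<^sup>2) \<partial>lebesgue) \<le> ennreal (2 * N m)" for m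
  proof -
    define F where "F l x = ennreal ((cmod (complex_of_real (p x) * (\<phi> m x - \<phi> (r l) x)))\<^sup>2)" for l x
    have Fm: "F l \<in> borel_measurable lebesgue" for l
    proof -
      have "(\<lambda>x. (cmod (complex_of_real (p x) * (\<phi> m x - \<phi> (r l) x)))\<^sup>2) \<in> borel_measurable lebesgue"
        by (rule borel_measurable_integrable[OF L2_integrable[OF pL[OF test_function_diff(1)[OF \<phi> \<phi>]]]])
      then show ?thesis unfolding F_def[abs_def] by measurable
    qed
    have Fi: "(\<integral>\<^sup>+ x. F l x \<partial>lebesgue) \<le> ennreal (2 * N m + 2 * N (r l))" for l
    proof -
      have "(\<integral>\<^sup>+ x. F l x \<partial>lebesgue) = ennreal (sqint (\<lambda>x. complex_of_real (p x) * (\<phi> m x - \<phi> (r l) x)))"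
        unfolding F_def sqint_def
        by (rule nn_integral_eq_integral[OF L2_integrable[OF pL[OF test_function_diff(1)[OF \<phi> \<phi>]]]]) simp
      also have "\<dots> \<le> ennreal (2 * N m + 2 * N (r l))" by (rule ennreal_leI[OF cauchy])
      finally show ?thesis .
    qed
    have "(\<integral>\<^sup>+ x. ennreal ((cmod (complex_of_real (p x) * \<phi> m x - complex_of_real (p x) * f x))\<^sup>2) \<partial>lebesgue)
        = (\<integral>\<^sup>+ x. liminf (\<lambda>l. F l x) \<partial>lebesgue)"
    proof (rule nn_integral_cong_AE)
      show "AE x in lebesgue. ennreal ((cmod (complex_of_real (p x) * \<phi> m x - complex_of_real (p x) * f x))\<^sup>2) = liminf (\<lambda>l. F l x)"
        using r(2)
      proof eventually_elim
        case (elim x)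
        have "(\<lambda>l. F l x) \<longlonglongrightarrow> ennreal ((cmod (complex_of_real (p x) * (\<phi> m x - f x)))\<^sup>2)"
          unfolding F_def by (intro tendsto_ennrealI tendsto_intros elim)
        from lim_imp_Liminf[OF _ this] show ?case by (simp add: right_diff_distrib)
      qed
    qed
    also have "\<dots> \<le> liminf (\<lambda>l. \<integral>\<^sup>+ x. F l x \<partial>lebesgue)" by (rule nn_integral_liminf[OF Fm])
    also have "\<dots> \<le> liminf (\<lambda>l. ennreal (2 * N m + 2 * N (r l)))"
      by (intro Liminf_mono always_eventually allI Fi)
    also have "\<dots> = ennreal (2 * N m)"
    proof (rule lim_imp_Liminf)
      have "(\<lambda>l. ennreal (2 * N m + 2 * N (r l))) \<longlonglongrightarrow> ennreal (2 * N m + 2 * 0)"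
        using LIMSEQ_subseq_LIMSEQ[OF N r(1)] by (intro tendsto_ennrealI tendsto_intros) (simp add: o_def)
      then show "(\<lambda>l. ennreal (2 * N m + 2 * N (r l))) \<longlonglongrightarrow> ennreal (2 * N m)" by simp
    qed simp
    finally show ?thesis .
  qed
  have pfm: "(\<lambda>x. complex_of_real (p x) * f x) \<in> borel_measurable lebesgue"
    using pm L2_measurable[OF L2f] by measurable
  have dm: "(\<lambda>x. complex_of_real (p x) * \<phi> m x - complex_of_real (p x) * f x) \<in> borel_measurable lebesgue" for m
    using pfm L2_measurable[OF pL[OF \<phi>[of m]]] by measurable
  have dm2: "(\<lambda>x. (cmod (complex_of_real (p x) * \<phi> m x - complex_of_real (p x) * f x))\<^sup>2) \<in> borel_measurable lebesgue" for m
    using dm[of m] by measurable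
  have N2: "0 \<le> 2 * N m" for m using N0[of m] by simp
  have dL: "L2 (\<lambda>x. complex_of_real (p x) * \<phi> m x - complex_of_real (p x) * f x)" for m
    unfolding L2_def using dm integral_le_nn_bound(1)[OF dm2 zero_le_power2 fatou N2] by blast
  have ds: "sqint (\<lambda>x. complex_of_real (p x) * \<phi> m x - complex_of_real (p x) * f x) \<le> 2 * N m" for m
    unfolding sqint_def by (rule integral_le_nn_bound(2)[OF dm2 zero_le_power2 fatou N2])
  show L: "L2 (\<lambda>x. complex_of_real (p x) * f x)"
    using L2_diff[OF pL[OF \<phi>[of 0]] dL[of 0]] by simp
  show lim: "(\<lambda>m. sqint (\<lambda>x. complex_of_real (p x) * \<phi> m x - complex_of_real (p x) * f x)) \<longlonglongrightarrow> 0"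
  proof (rule Lim_null_comparison)
    show "(\<lambda>m. 2 * N m) \<longlonglongrightarrow> 0" using tendsto_mult_right_zero[OF N] by simp
    show "\<forall>\<^sub>F m in sequentially. norm (sqint (\<lambda>x. complex_of_real (p x) * \<phi> m x - complex_of_real (p x) * f x)) \<le> 2 * N m"
      by (simp only: real_norm_def abs_of_nonneg[OF sqint_nonneg] ds eventually_True)
  qed
  have l1: "(\<lambda>m. sqint (\<lambda>x. complex_of_real (p x) * \<phi> m x)) \<longlonglongrightarrow> sqint (\<lambda>x. complex_of_real (p x) * f x)"
    by (rule sqint_tendsto[OF pL[OF \<phi>] L lim])
  have l2: "(\<lambda>m. a * sqint (\<phi> m) + b * (\<Sum>j\<in>UNIV. sqint (magnetic_pderiv A j (\<phi> m)))) \<longlonglongrightarrow> a * sqint f + b * (\<Sum>j\<in>UNIV. sqint (w j))"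
    by (intro tendsto_add tendsto_mult_left tendsto_sum sqint_tendsto[OF L2\<phi> L2f lf] sqint_tendsto[OF L2D L2w lw])
  show "sqint (\<lambda>x. complex_of_real (p x) * f x) \<le> a * sqint f + b * (\<Sum>j\<in>UNIV. sqint (w j))"
    by (rule LIMSEQ_le[OF l1 l2]) (use ps[OF \<phi>] in blast)
qed

lemma form_bounded_L2:
  fixes A :: "real ^ 'd::finite \<Rightarrow> real ^ 'd"
  assumes A: "Lp_loc 2 A" and p: "form_bounded A p a b" and u: "magH1 A f w"
  shows "L2 (\<lambda>x. complex_of_real (p x) * f x)"
    "sqint (\<lambda>x. complex_of_real (p x) * f x) \<le> a * sqint f + b * (\<Sum>j\<in>UNIV. sqint (w j))"
proof -
  obtain \<phi> where \<phi>: "\<forall>m. test_function (\<phi> m)" "(\<lambda>m. sqint (\<lambda>x. \<phi> m x - f x)) \<longlonglongrightarrow> 0"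
    "\<forall>j. (\<lambda>m. sqint (\<lambda>x. magnetic_pderiv A j (\<phi> m) x - w j x)) \<longlonglongrightarrow> 0"
    using test_functions_dense_sequence[OF A u] by blast
  note e = form_bounded_extend[OF A p u spec[OF \<phi>(1)] \<phi>(2) spec[OF \<phi>(3)]]
  show "L2 (\<lambda>x. complex_of_real (p x) * f x)" by (rule e(1))
  show "sqint (\<lambda>x. complex_of_real (p x) * f x) \<le> a * sqint f + b * (\<Sum>j\<in>UNIV. sqint (w j))" by (rule e(3))
qed

section \<open>The quadratic identities on the form domain\<close>

lemma bounded_weight_L2_tendsto:
  fixes f :: "nat \<Rightarrow> real ^ 'd::finite \<Rightarrow> complex" and \<psi> :: "real ^ 'd \<Rightarrow> real"
  assumes f: "\<And>m. L2 (f m)" "L2 f0" "(\<lambda>m. sqint (\<lambda>x. f m x - f0 x)) \<longlonglongrightarrow> 0"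
    and \<psi>: "\<psi> \<in> borel_measurable lebesgue" "\<And>x. \<bar>\<psi> x\<bar> \<le> C"
  shows "L2 (\<lambda>x. complex_of_real (\<psi> x) * f m x)" "L2 (\<lambda>x. complex_of_real (\<psi> x) * f0 x)"
    "(\<lambda>m. sqint (\<lambda>x. complex_of_real (\<psi> x) * f m x - complex_of_real (\<psi> x) * f0 x)) \<longlonglongrightarrow> 0"
proof -
  have L: "L2 (\<lambda>x. complex_of_real (\<psi> x) * h x)" if "L2 h" for h
    by (rule L2_mult_bounded[OF that, of _ C]) (use \<psi> in auto)
  show "L2 (\<lambda>x. complex_of_real (\<psi> x) * f m x)" "L2 (\<lambda>x. complex_of_real (\<psi> x) * f0 x)"
    by (rule L[OF f(1)], rule L[OF f(2)])
  show "(\<lambda>m. sqint (\<lambda>x. complex_of_real (\<psi> x) * f m x - complex_of_real (\<psi> x) * f0 x)) \<longlonglongrightarrow> 0"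
  proof (rule Lim_null_comparison)
    show "(\<lambda>m. C\<^sup>2 * sqint (\<lambda>x. f m x - f0 x)) \<longlonglongrightarrow> 0" using tendsto_mult_right_zero[OF f(3)] by simp
    show "\<forall>\<^sub>F m in sequentially. norm (sqint (\<lambda>x. complex_of_real (\<psi> x) * f m x - complex_of_real (\<psi> x) * f0 x)) \<le> C\<^sup>2 * sqint (\<lambda>x. f m x - f0 x)"
    proof (rule always_eventually, rule allI)
      fix m
      have "sqint (\<lambda>x. complex_of_real (\<psi> x) * (f m x - f0 x)) \<le> C\<^sup>2 * sqint (\<lambda>x. f m x - f0 x)"
        by (rule sqint_mono[OF L[OF L2_diff[OF f(1,2)]] L2_diff[OF f(1,2)]]) (use \<psi>(2) in \<open>simp add: norm_mult mult_right_mono\<close>)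
      then show "norm (sqint (\<lambda>x. complex_of_real (\<psi> x) * f m x - complex_of_real (\<psi> x) * f0 x)) \<le> C\<^sup>2 * sqint (\<lambda>x. f m x - f0 x)"
        by (simp only: real_norm_def abs_of_nonneg[OF sqint_nonneg] right_diff_distrib)
    qed
  qed
qed

lemma sqint_cnj_diff: "sqint (\<lambda>x. cnj (f x) - cnj (g x)) = sqint (\<lambda>x. f x - g x)"
  unfolding complex_cnj_diff[symmetric] by (rule sqint_cnj)

lemma weighted_product_tendsto:
  fixes f :: "nat \<Rightarrow> real ^ 'd::finite \<Rightarrow> complex" and \<psi> :: "real ^ 'd \<Rightarrow> real"
  assumes f: "\<And>m. L2 (f m)" "L2 f0" "(\<lambda>m. sqint (\<lambda>x. f m x - f0 x)) \<longlonglongrightarrow> 0"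
    and g: "\<And>m. L2 (g m)" "L2 g0" "(\<lambda>m. sqint (\<lambda>x. g m x - g0 x)) \<longlonglongrightarrow> 0"
    and \<psi>: "\<psi> \<in> borel_measurable lebesgue" "\<And>x. \<bar>\<psi> x\<bar> \<le> C"
  shows "(\<lambda>m. LINT x|lebesgue. complex_of_real (\<psi> x) * cnj (f m x) * g m x)
    \<longlonglongrightarrow> (LINT x|lebesgue. complex_of_real (\<psi> x) * cnj (f0 x) * g0 x)"
    "integrable lebesgue (\<lambda>x. complex_of_real (\<psi> x) * cnj (f m x) * g m x)"
    "integrable lebesgue (\<lambda>x. complex_of_real (\<psi> x) * cnj (f0 x) * g0 x)"
proof -
  have lc: "(\<lambda>m. sqint (\<lambda>x. cnj (f m x) - cnj (f0 x))) \<longlonglongrightarrow> 0" using f(3) unfolding sqint_cnj_diff .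
  note b = bounded_weight_L2_tendsto[OF L2_cnj[OF f(1)] L2_cnj[OF f(2)] lc \<psi>]
  show "(\<lambda>m. LINT x|lebesgue. complex_of_real (\<psi> x) * cnj (f m x) * g m x)
    \<longlonglongrightarrow> (LINT x|lebesgue. complex_of_real (\<psi> x) * cnj (f0 x) * g0 x)"
    by (rule L2_tendsto_mult[OF b g])
  show "integrable lebesgue (\<lambda>x. complex_of_real (\<psi> x) * cnj (f m x) * g m x)"
    by (rule L2_mult_integrable[OF b(1) g(1)])
  show "integrable lebesgue (\<lambda>x. complex_of_real (\<psi> x) * cnj (f0 x) * g0 x)"
    by (rule L2_mult_integrable[OF b(2) g(2)])
qed

lemma magnetic_pderiv_by_parts:
  fixes A :: "real ^ 'd::finite \<Rightarrow> real ^ 'd" and \<psi> :: "real ^ 'd \<Rightarrow> real"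
  assumes A: "Lp_loc 2 A" and u: "magH1 A f w" and v: "magH1 A g y"
    and \<psi>: "smooth \<psi>" "\<And>x. \<bar>\<psi> x\<bar> \<le> C" "\<And>x. \<bar>pderiv_at j \<psi> x\<bar> \<le> C"
  shows "(LINT x|lebesgue. complex_of_real (\<psi> x) * cnj (w j x) * g x) + (LINT x|lebesgue. complex_of_real (\<psi> x) * cnj (f x) * y j x)
    = - (LINT x|lebesgue. complex_of_real (pderiv_at j \<psi> x) * cnj (f x) * g x)"
proof -
  obtain \<phi> where \<phi>: "\<forall>m. test_function (\<phi> m)" and lf: "(\<lambda>m. sqint (\<lambda>x. \<phi> m x - f x)) \<longlonglongrightarrow> 0"
    and lw: "\<forall>j. (\<lambda>m. sqint (\<lambda>x. magnetic_pderiv A j (\<phi> m) x - w j x)) \<longlonglongrightarrow> 0"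
    using test_functions_dense_sequence[OF A u] by blast
  obtain \<theta> where \<theta>: "\<forall>m. test_function (\<theta> m)" and lg: "(\<lambda>m. sqint (\<lambda>x. \<theta> m x - g x)) \<longlonglongrightarrow> 0"
    and ly: "\<forall>j. (\<lambda>m. sqint (\<lambda>x. magnetic_pderiv A j (\<theta> m) x - y j x)) \<longlonglongrightarrow> 0"
    using test_functions_dense_sequence[OF A v] by blast
  have L: "L2 f" "L2 (w j)" "L2 g" "L2 (y j)" using u v by (auto simp: magH1_def)
  note m1 = continuous_measurable_lebesgue[OF smooth_continuous[OF \<psi>(1)]]
  note m2 = continuous_measurable_lebesgue[OF smooth_continuous[OF smooth_pderiv[OF \<psi>(1)]]]
  note tf = L2_test_function[OF spec[OF \<phi>]] and tg = L2_test_function[OF spec[OF \<theta>]]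
  note df = L2_magnetic_pderiv[OF A spec[OF \<phi>]] and dg = L2_magnetic_pderiv[OF A spec[OF \<theta>]]
  note a = weighted_product_tendsto[OF df L(2) spec[OF lw] tg L(3) lg m1 \<psi>(2)]
  note b = weighted_product_tendsto[OF tf L(1) lf dg L(4) spec[OF ly] m1 \<psi>(2)]
  note c = weighted_product_tendsto[OF tf L(1) lf tg L(3) lg m2 \<psi>(3)]
  have "(LINT x|lebesgue. complex_of_real (\<psi> x) * cnj (magnetic_pderiv A j (\<phi> m) x) * \<theta> m x)
      + (LINT x|lebesgue. complex_of_real (\<psi> x) * cnj (\<phi> m x) * magnetic_pderiv A j (\<theta> m) x)
      = - (LINT x|lebesgue. complex_of_real (pderiv_at j \<psi> x) * cnj (\<phi> m x) * \<theta> m x)" for m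
    using magnetic_pderiv_by_parts_test[OF spec[OF \<phi>, of m] spec[OF \<theta>, of m] \<psi>(1), where j=j and A=A]
    unfolding distrib_left mult.assoc[symmetric] Bochner_Integration.integral_add[OF a(2) b(2)] .
  with tendsto_add[OF a(1) b(1)]
  have "(\<lambda>m. - (LINT x|lebesgue. complex_of_real (pderiv_at j \<psi> x) * cnj (\<phi> m x) * \<theta> m x))
    \<longlonglongrightarrow> (LINT x|lebesgue. complex_of_real (\<psi> x) * cnj (w j x) * g x) + (LINT x|lebesgue. complex_of_real (\<psi> x) * cnj (f x) * y j x)"
    by simp
  from LIMSEQ_unique[OF this tendsto_minus[OF c(1)]] show ?thesis .
qed

text \<open>The field is only controlled through the form: the weight \<open>\<psi> B\<^sub>j\<^sub>k\<close> is split into two factors, one for each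
  of \<open>f\<close> and \<open>g\<close>.  Two splittings are used: \<open>B\<^sub>j\<^sub>k = (r B\<^sub>j\<^sub>k) (1 / r)\<close> when \<open>\<psi> = 1\<close>, and \<open>\<psi> B\<^sub>j\<^sub>k = (\<psi> B\<^sub>j\<^sub>k) 1\<close>
  when \<open>\<bar>\<psi>\<bar> \<le> r\<close>.\<close>

lemma magnetic_commutator:
  fixes A :: "real ^ 'd::finite \<Rightarrow> real ^ 'd" and \<psi> :: "real ^ 'd \<Rightarrow> real"
  assumes A: "Lp_loc 2 A" and B: "magnetic_field A B" and u: "magH1 A f w" and v: "magH1 A g y"
    and \<psi>: "smooth \<psi>" "\<And>x. \<bar>\<psi> x\<bar> \<le> C" "\<And>x. \<bar>pderiv_at j \<psi> x\<bar> \<le> C" "\<And>x. \<bar>pderiv_at k \<psi> x\<bar> \<le> C"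
    and p: "form_bounded A p a b" and q: "form_bounded A q a' b'"
    and pq: "AE x in lebesgue. \<psi> x * B x $ j $ k = p x * q x"
  shows "(LINT x|lebesgue. complex_of_real (\<psi> x) * cnj (w j x) * y k x) - (LINT x|lebesgue. complex_of_real (\<psi> x) * cnj (w k x) * y j x)
    = - \<i> * (LINT x|lebesgue. complex_of_real (\<psi> x * B x $ j $ k) * (cnj (f x) * g x))
      - (LINT x|lebesgue. complex_of_real (pderiv_at j \<psi> x) * cnj (f x) * y k x)
      + (LINT x|lebesgue. complex_of_real (pderiv_at k \<psi> x) * cnj (f x) * y j x)"
    "integrable lebesgue (\<lambda>x. complex_of_real (\<psi> x * B x $ j $ k) * (cnj (f x) * g x))"
proof -
  obtain \<phi> where \<phi>: "\<forall>m. test_function (\<phi> m)" and lf: "(\<lambda>m. sqint (\<lambda>x. \<phi> m x - f x)) \<longlonglongrightarrow> 0"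
    and lw: "\<forall>j. (\<lambda>m. sqint (\<lambda>x. magnetic_pderiv A j (\<phi> m) x - w j x)) \<longlonglongrightarrow> 0"
    using test_functions_dense_sequence[OF A u] by blast
  obtain \<theta> where \<theta>: "\<forall>m. test_function (\<theta> m)" and lg: "(\<lambda>m. sqint (\<lambda>x. \<theta> m x - g x)) \<longlonglongrightarrow> 0"
    and ly: "\<forall>j. (\<lambda>m. sqint (\<lambda>x. magnetic_pderiv A j (\<theta> m) x - y j x)) \<longlonglongrightarrow> 0"
    using test_functions_dense_sequence[OF A v] by blast
  have L: "L2 f" "\<And>j. L2 (w j)" "L2 g" "\<And>j. L2 (y j)" using u v by (auto simp: magH1_def)
  note m1 = continuous_measurable_lebesgue[OF smooth_continuous[OF \<psi>(1)]]
  note m2 = continuous_measurable_lebesgue[OF smooth_continuous[OF smooth_pderiv[OF \<psi>(1)]]]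
  note tf = L2_test_function[OF spec[OF \<phi>]] and tg = L2_test_function[OF spec[OF \<theta>]]
  note df = L2_magnetic_pderiv[OF A spec[OF \<phi>]] and dg = L2_magnetic_pderiv[OF A spec[OF \<theta>]]
  note jk = weighted_product_tendsto[OF df L(2) spec[OF lw] dg L(4) spec[OF ly] m1 \<psi>(2)]
  note c = weighted_product_tendsto[OF tf L(1) lf dg L(4) spec[OF ly] m2 \<psi>(3)]
  note d = weighted_product_tendsto[OF tf L(1) lf dg L(4) spec[OF ly] m2 \<psi>(4)]
  note pe = form_bounded_extend[OF A p u spec[OF \<phi>] lf spec[OF lw]]
  note qe = form_bounded_extend[OF A q v spec[OF \<theta>] lg spec[OF ly]]
  have pL: "L2 (\<lambda>x. complex_of_real (p x) * h x)" and qL: "L2 (\<lambda>x. complex_of_real (q x) * h x)" if "test_function h" for h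
    using p q that by (auto simp: form_bounded_def)
  have lc: "(\<lambda>m. sqint (\<lambda>x. cnj (complex_of_real (p x) * \<phi> m x) - cnj (complex_of_real (p x) * f x))) \<longlonglongrightarrow> 0"
    using pe(2) unfolding sqint_cnj_diff .
  have Bm: "(\<lambda>x. complex_of_real (\<psi> x * B x $ j $ k)) \<in> borel_measurable lebesgue"
  proof -
    have "Lp_loc 1 B" using B unfolding magnetic_field_def by blast
    from Lp_loc_measurable[OF Lp_loc_matrix_entry[OF this]]
    show ?thesis using m1 by measurable
  qed
  have rw: "AE x in lebesgue. cnj (complex_of_real (p x) * h x) * (complex_of_real (q x) * k' x)
      = complex_of_real (\<psi> x * B x $ j $ k) * (cnj (h x) * k' x)" for h k'
    using pq
  proof eventually_elim
    case (elim x)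
    show ?case unfolding elim by (simp add: mult_ac)
  qed
  have conv: "(LINT x|lebesgue. cnj (complex_of_real (p x) * h x) * (complex_of_real (q x) * k' x))
      = (LINT x|lebesgue. complex_of_real (\<psi> x * B x $ j $ k) * (cnj (h x) * k' x))"
    and convi: "integrable lebesgue (\<lambda>x. complex_of_real (\<psi> x * B x $ j $ k) * (cnj (h x) * k' x))"
    if hk: "L2 (\<lambda>x. complex_of_real (p x) * h x)" "L2 (\<lambda>x. complex_of_real (q x) * k' x)" "L2 h" "L2 k'" for h k'
  proof -
    have m: "(\<lambda>x. complex_of_real (\<psi> x * B x $ j $ k) * (cnj (h x) * k' x)) \<in> borel_measurable lebesgue"
      by (intro borel_measurable_times Bm L2_measurable L2_cnj hk)
    have i: "integrable lebesgue (\<lambda>x. cnj (complex_of_real (p x) * h x) * (complex_of_real (q x) * k' x))"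
      by (rule L2_mult_integrable[OF L2_cnj[OF hk(1)] hk(2)])
    show "(LINT x|lebesgue. cnj (complex_of_real (p x) * h x) * (complex_of_real (q x) * k' x))
      = (LINT x|lebesgue. complex_of_real (\<psi> x * B x $ j $ k) * (cnj (h x) * k' x))"
      by (rule integral_cong_AE[OF borel_measurable_integrable[OF i] m rw])
    show "integrable lebesgue (\<lambda>x. complex_of_real (\<psi> x * B x $ j $ k) * (cnj (h x) * k' x))"
      using i integrable_cong_AE[OF borel_measurable_integrable[OF i] m rw] by blast
  qed
  show "integrable lebesgue (\<lambda>x. complex_of_real (\<psi> x * B x $ j $ k) * (cnj (f x) * g x))"
    by (rule convi[OF pe(1) qe(1) L(1) L(3)])
  have e: "(\<lambda>m. LINT x|lebesgue. complex_of_real (\<psi> x * B x $ j $ k) * (cnj (\<phi> m x) * \<theta> m x))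
      \<longlonglongrightarrow> (LINT x|lebesgue. complex_of_real (\<psi> x * B x $ j $ k) * (cnj (f x) * g x))"
    using L2_tendsto_mult[OF L2_cnj[OF pL[OF spec[OF \<phi>]]] L2_cnj[OF pe(1)] lc qL[OF spec[OF \<theta>]] qe(1) qe(2)]
    unfolding conv[OF pL[OF spec[OF \<phi>]] qL[OF spec[OF \<theta>]] tf tg] conv[OF pe(1) qe(1) L(1) L(3)] .
  have id: "(LINT x|lebesgue. complex_of_real (\<psi> x) * cnj (magnetic_pderiv A j (\<phi> m) x) * magnetic_pderiv A k (\<theta> m) x)
      - (LINT x|lebesgue. complex_of_real (\<psi> x) * cnj (magnetic_pderiv A k (\<phi> m) x) * magnetic_pderiv A j (\<theta> m) x)
    = - \<i> * (LINT x|lebesgue. complex_of_real (\<psi> x * B x $ j $ k) * (cnj (\<phi> m x) * \<theta> m x))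
      - (LINT x|lebesgue. complex_of_real (pderiv_at j \<psi> x) * cnj (\<phi> m x) * magnetic_pderiv A k (\<theta> m) x)
      + (LINT x|lebesgue. complex_of_real (pderiv_at k \<psi> x) * cnj (\<phi> m x) * magnetic_pderiv A j (\<theta> m) x)" for m
  proof -
    have "(LINT x|lebesgue. complex_of_real (\<psi> x) * (cnj (\<phi> m x) * \<theta> m x) * complex_of_real (B x $ j $ k))
        = (LINT x|lebesgue. complex_of_real (\<psi> x * B x $ j $ k) * (cnj (\<phi> m x) * \<theta> m x))"
      by (simp only: of_real_mult mult_ac)
    then show ?thesis
      using magnetic_commutator_test[OF B spec[OF \<phi>, of m] spec[OF \<theta>, of m] \<psi>(1), where j=j and k=k]
      unfolding right_diff_distrib mult.assoc[symmetric] Bochner_Integration.integral_diff[OF jk(2) jk(2)] by (simp only:)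
  qed
  have l1: "(\<lambda>m. (LINT x|lebesgue. complex_of_real (\<psi> x) * cnj (magnetic_pderiv A j (\<phi> m) x) * magnetic_pderiv A k (\<theta> m) x)
      - (LINT x|lebesgue. complex_of_real (\<psi> x) * cnj (magnetic_pderiv A k (\<phi> m) x) * magnetic_pderiv A j (\<theta> m) x))
      \<longlonglongrightarrow> (LINT x|lebesgue. complex_of_real (\<psi> x) * cnj (w j x) * y k x) - (LINT x|lebesgue. complex_of_real (\<psi> x) * cnj (w k x) * y j x)"
    by (rule tendsto_diff[OF jk(1) jk(1)])
  have l2: "(\<lambda>m. - \<i> * (LINT x|lebesgue. complex_of_real (\<psi> x * B x $ j $ k) * (cnj (\<phi> m x) * \<theta> m x))
      - (LINT x|lebesgue. complex_of_real (pderiv_at j \<psi> x) * cnj (\<phi> m x) * magnetic_pderiv A k (\<theta> m) x)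
      + (LINT x|lebesgue. complex_of_real (pderiv_at k \<psi> x) * cnj (\<phi> m x) * magnetic_pderiv A j (\<theta> m) x))
    \<longlonglongrightarrow> - \<i> * (LINT x|lebesgue. complex_of_real (\<psi> x * B x $ j $ k) * (cnj (f x) * g x))
      - (LINT x|lebesgue. complex_of_real (pderiv_at j \<psi> x) * cnj (f x) * y k x)
      + (LINT x|lebesgue. complex_of_real (pderiv_at k \<psi> x) * cnj (f x) * y j x)"
    by (intro tendsto_add tendsto_diff tendsto_mult_left e c(1) d(1))
  show "(LINT x|lebesgue. complex_of_real (\<psi> x) * cnj (w j x) * y k x) - (LINT x|lebesgue. complex_of_real (\<psi> x) * cnj (w k x) * y j x)
    = - \<i> * (LINT x|lebesgue. complex_of_real (\<psi> x * B x $ j $ k) * (cnj (f x) * g x))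
      - (LINT x|lebesgue. complex_of_real (pderiv_at j \<psi> x) * cnj (f x) * y k x)
      + (LINT x|lebesgue. complex_of_real (pderiv_at k \<psi> x) * cnj (f x) * y j x)"
    by (rule LIMSEQ_unique[OF l1[unfolded id] l2])
qed

section \<open>Radial vector fields and Hardy's inequality\<close>

text \<open>The weight \<open>1 / (a + b r\<^sup>2)\<close> serves twice: with \<open>a = \<epsilon>\<close>, \<open>b = 1\<close> it regularises \<open>1 / r\<^sup>2\<close> in Hardy's inequality,
  with \<open>a = 1\<close>, \<open>b = \<epsilon>\<close> it bounds the field \<open>x\<close> in the virial identity.\<close>

definition radial_weight :: "real \<Rightarrow> real \<Rightarrow> real ^ 'd::finite \<Rightarrow> real" where
  "radial_weight a b x = inverse (a + b * (norm x)\<^sup>2)"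

definition radial_field :: "real \<Rightarrow> real \<Rightarrow> 'd::finite \<Rightarrow> real ^ 'd \<Rightarrow> real" where
  "radial_field a b j x = x $ j * radial_weight a b x"

lemma radial_denom_pos: "a > 0 \<Longrightarrow> b \<ge> 0 \<Longrightarrow> a + b * (norm x)\<^sup>2 > 0"
  by (intro add_pos_nonneg mult_nonneg_nonneg) auto

lemma radial_weight_bounds:
  assumes "a > 0" "b \<ge> 0"
  shows "0 < radial_weight a b x" "radial_weight a b x \<le> inverse a" "b * (norm x)\<^sup>2 * radial_weight a b x \<le> 1"
proof -
  have p: "a + b * (norm x)\<^sup>2 > 0" by (rule radial_denom_pos[OF assms])
  have q: "b * (norm x)\<^sup>2 \<ge> 0" using assms by simp
  show "0 < radial_weight a b x" using p by (simp add: radial_weight_def)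
  show "radial_weight a b x \<le> inverse a"
    unfolding radial_weight_def using assms q by (intro le_imp_inverse_le) auto
  have "b * (norm x)\<^sup>2 / (a + b * (norm x)\<^sup>2) \<le> 1"
    using p assms by (subst pos_divide_le_eq) auto
  then show "b * (norm x)\<^sup>2 * radial_weight a b x \<le> 1" by (simp add: radial_weight_def divide_inverse)
qed

lemma smooth_radial_denom: "Ck k (\<lambda>x :: real ^ 'd::finite. a + b * (norm x)\<^sup>2)"
  by (intro Ck_add Ck_mult Ck_const smooth_norm_sq)

lemma smooth_radial_weight:
  assumes "a > 0" "b \<ge> 0" shows "Ck k (radial_weight a b :: real ^ 'd::finite \<Rightarrow> real)"
  unfolding radial_weight_def[abs_def]
proof (rule Ck_inverse)
  show "\<forall>k. Ck k (\<lambda>x :: real ^ 'd. a + b * (norm x)\<^sup>2)" by (intro allI smooth_radial_denom)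
  show "a + b * (norm x)\<^sup>2 \<noteq> 0" for x :: "real ^ 'd" using radial_denom_pos[OF assms, of x] by simp
qed

lemma smooth_radial_field:
  assumes "a > 0" "b \<ge> 0" shows "Ck k (radial_field a b j)"
  unfolding radial_field_def[abs_def] by (intro Ck_mult Ck_nth smooth_radial_weight assms)

lemma pderiv_radial_field:
  fixes x :: "real ^ 'd::finite"
  assumes "a > 0" "b \<ge> 0"
  shows "pderiv_at i (radial_field a b j) x
    = (if i = j then radial_weight a b x else 0) - 2 * b * (x $ i * x $ j) * (radial_weight a b x)\<^sup>2"
proof -
  have dq: "(\<lambda>x :: real ^ 'd. a + b * (norm x)\<^sup>2) differentiable (at x)"
    by (rule smooth_differentiable) (intro allI smooth_radial_denom)
  have dn: "(\<lambda>x :: real ^ 'd. (norm x)\<^sup>2) differentiable (at x)"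
    by (rule smooth_differentiable) (intro allI smooth_norm_sq)
  have dbn: "(\<lambda>x :: real ^ 'd. b * (norm x)\<^sup>2) differentiable (at x)"
    by (rule smooth_differentiable) (intro allI Ck_mult Ck_const smooth_norm_sq)
  have dx: "(\<lambda>x :: real ^ 'd. x $ j) differentiable (at x)"
    by (rule smooth_differentiable) (intro allI Ck_nth)
  have dw: "(radial_weight a b :: real ^ 'd \<Rightarrow> real) differentiable (at x)"
    by (rule smooth_differentiable) (intro allI smooth_radial_weight assms)
  have px: "pderiv_at i (\<lambda>x :: real ^ 'd. x $ j) x = (if i = j then 1 else 0)"
    by (subst pderiv_at_eqI[OF bounded_linear_imp_has_derivative[OF bounded_linear_vec_nth]]) (simp add: axis_def)
  have pq: "pderiv_at i (\<lambda>x :: real ^ 'd. a + b * (norm x)\<^sup>2) x = b * (2 * x $ i)"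
    unfolding pderiv_at_add[OF differentiable_const dbn] pderiv_at_linear[OF bounded_linear_mult_right dn] pderiv_at_norm_sq
    by simp
  have nz: "a + b * (norm x)\<^sup>2 \<noteq> 0" using radial_denom_pos[OF assms, of x] by simp
  have pw: "pderiv_at i (radial_weight a b) x = - (b * (2 * x $ i)) * (radial_weight a b x)\<^sup>2"
    using pderiv_at_inverse[OF dq nz, of i] unfolding pq by (simp add: radial_weight_def[abs_def])
  show ?thesis
    unfolding radial_field_def[abs_def] pderiv_at_mult[OF dx dw] px pw by (simp add: algebra_simps)
qed

lemma abs_mult_coords_le: "\<bar>x $ i * x $ j\<bar> \<le> (norm x)\<^sup>2" for x :: "real ^ 'd::finite"
  unfolding abs_mult power2_eq_square by (intro mult_mono component_le_norm_cart) auto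

lemma radial_field_bounds:
  fixes x :: "real ^ 'd::finite"
  assumes "a > 0" "b > 0"
  shows "\<bar>radial_field a b j x\<bar> \<le> inverse a + inverse b" "\<bar>pderiv_at i (radial_field a b j) x\<bar> \<le> 3 * inverse a"
proof -
  have b0: "b \<ge> 0" using assms by simp
  note w = radial_weight_bounds[OF assms(1) b0, of x]
  have "\<bar>x $ j\<bar> \<le> 1 + (norm x)\<^sup>2"
  proof -
    have "0 \<le> (norm x - 1)\<^sup>2" by simp
    then have "2 * norm x \<le> 1 + (norm x)\<^sup>2" by (simp add: power2_eq_square algebra_simps)
    moreover have "norm x \<ge> 0" by simp
    ultimately show ?thesis using component_le_norm_cart[of x j] by linarith
  qed
  then have "\<bar>radial_field a b j x\<bar> \<le> (1 + (norm x)\<^sup>2) * radial_weight a b x"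
    unfolding radial_field_def abs_mult using w by (intro mult_mono) auto
  also have "\<dots> = radial_weight a b x + (b * (norm x)\<^sup>2 * radial_weight a b x) * inverse b"
    using assms by (simp add: algebra_simps)
  also have "\<dots> \<le> inverse a + 1 * inverse b"
    using w assms by (intro add_mono mult_right_mono) auto
  finally show "\<bar>radial_field a b j x\<bar> \<le> inverse a + inverse b" by simp
  have "\<bar>2 * b * (x $ i * x $ j) * (radial_weight a b x)\<^sup>2\<bar> = 2 * (b * \<bar>x $ i * x $ j\<bar> * (radial_weight a b x)\<^sup>2)"
    using assms by (simp add: abs_mult)
  also have "\<dots> \<le> 2 * (b * (norm x)\<^sup>2 * (radial_weight a b x)\<^sup>2)"
    using abs_mult_coords_le[of x i j] assms by (intro mult_left_mono mult_right_mono) auto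
  also have "\<dots> = 2 * ((b * (norm x)\<^sup>2 * radial_weight a b x) * radial_weight a b x)" by (simp add: power2_eq_square)
  also have "\<dots> \<le> 2 * (1 * inverse a)"
    using w by (intro mult_left_mono mult_mono) auto
  finally have 1: "\<bar>2 * b * (x $ i * x $ j) * (radial_weight a b x)\<^sup>2\<bar> \<le> 2 * inverse a" by simp
  have 2: "\<bar>if i = j then radial_weight a b x else 0\<bar> \<le> inverse a" using w assms by auto
  show "\<bar>pderiv_at i (radial_field a b j) x\<bar> \<le> 3 * inverse a"
    unfolding pderiv_radial_field[OF assms(1) b0] using 1 2 by linarith
qed

lemma sum_radial_field_sq:
  fixes x :: "real ^ 'd::finite"
  shows "(\<Sum>j\<in>UNIV. (radial_field a b j x)\<^sup>2) = (norm x)\<^sup>2 * (radial_weight a b x)\<^sup>2"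
  unfolding norm_sq_eq_sum sum_distrib_right
  by (rule sum.cong) (simp_all add: radial_field_def power2_eq_square mult_ac)

lemma divergence_radial_field:
  fixes x :: "real ^ 'd::finite"
  assumes "a > 0" "b \<ge> 0"
  shows "(\<Sum>j\<in>UNIV. pderiv_at j (radial_field a b j) x)
    = real CARD('d) * radial_weight a b x - 2 * b * (norm x)\<^sup>2 * (radial_weight a b x)\<^sup>2"
  unfolding pderiv_radial_field[OF assms]
  by (simp add: sum_subtractf norm_sq_eq_sum sum_distrib_left sum_distrib_right mult_ac)

lemma integral_weight_cnj:
  "(LINT x|lebesgue. complex_of_real (b x) * (cnj (f x) * f x)) = complex_of_real (LINT x|lebesgue. b x * (cmod (f x))\<^sup>2)"
proof -
  have "complex_of_real (b x) * (cnj (f x) * f x) = complex_of_real (b x * (cmod (f x))\<^sup>2)" for x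
    unfolding of_real_mult complex_norm_square by (simp only: mult.commute)
  then show ?thesis by (simp only: integral_complex_of_real)
qed

lemma test_function_sq_integrable:
  fixes \<phi> :: "real ^ 'd::finite \<Rightarrow> complex"
  assumes "test_function \<phi>" "continuous_on UNIV b"
  shows "integrable lebesgue (\<lambda>x. b x * (cmod (\<phi> x))\<^sup>2)"
proof -
  obtain R where R: "\<And>x. norm x > R \<Longrightarrow> \<phi> x = 0" using test_function_bounded_support[OF assms(1)] by blast
  show ?thesis
    by (rule integrable_compact_support[of _ R])
       (use R assms(2) smooth_continuous[OF test_function_smooth[OF assms(1)]] in \<open>auto intro!: continuous_intros\<close>)
qed

text \<open>Expanding \<open>\<integral> \<bar>D \<phi> + s F \<phi>\<bar>\<^sup>2 \<ge> 0\<close> for \<open>F = x / (\<epsilon> + \<bar>x\<bar>\<^sup>2)\<close>, whose divergence is at least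
  \<open>(d - 2) / (\<epsilon> + \<bar>x\<bar>\<^sup>2)\<close>; the best choice is \<open>s = (d - 2) / 2\<close>.\<close>

lemma hardy_regularised:
  fixes A :: "real ^ 'd::finite \<Rightarrow> real ^ 'd"
  assumes A: "Lp_loc 2 A" and \<phi>: "test_function \<phi>" and e: "\<epsilon> > 0" and d: "CARD('d) \<ge> 3"
  shows "(LINT x|lebesgue. radial_weight \<epsilon> 1 x * (cmod (\<phi> x))\<^sup>2)
    \<le> (2 / (real CARD('d) - 2))\<^sup>2 * (\<Sum>j\<in>UNIV. sqint (magnetic_pderiv A j \<phi>))"
proof -
  define s where "s = (real CARD('d) - 2) / 2"
  have s: "s > 0" using d by (simp add: s_def)
  define F where "F = (radial_field \<epsilon> 1 :: 'd \<Rightarrow> real ^ 'd \<Rightarrow> real)"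
  define G where "G = (radial_weight \<epsilon> 1 :: real ^ 'd \<Rightarrow> real)"
  have sF: "smooth (F j)" for j unfolding F_def using smooth_radial_field[OF e zero_le_one] by blast
  have cF: "continuous_on UNIV (F j)" for j by (rule smooth_continuous[OF sF])
  have cdF: "continuous_on UNIV (pderiv_at j (F j))" for j by (rule smooth_continuous[OF smooth_pderiv[OF sF]])
  have cG: "continuous_on UNIV G" unfolding G_def by (rule smooth_continuous) (intro allI smooth_radial_weight e, simp)
  define X where "X j = (LINT x|lebesgue. pderiv_at j (F j) x * (cmod (\<phi> x))\<^sup>2)" for j
  define Y where "Y j = (LINT x|lebesgue. (F j x)\<^sup>2 * (cmod (\<phi> x))\<^sup>2)" for j
  have main: "0 \<le> sqint (magnetic_pderiv A j \<phi>) - s * X j + s\<^sup>2 * Y j" for j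
  proof -
    let ?D = "magnetic_pderiv A j \<phi>"
    have LD: "L2 ?D" by (rule L2_magnetic_pderiv[OF A \<phi>])
    have tF: "test_function (\<lambda>x. complex_of_real (F j x) * \<phi> x)"
    proof -
      have "smooth (\<lambda>x. complex_of_real (F j x))" using Ck_of_real sF by blast
      from test_function_bilinear[OF bounded_bilinear_mult \<phi> this] show ?thesis by (simp only: mult.commute)
    qed
    have LF: "L2 (\<lambda>x. complex_of_real (F j x) * \<phi> x)" by (rule L2_test_function[OF tF])
    have i1: "integrable lebesgue (\<lambda>x. cnj (?D x) * ?D x)" by (rule L2_cnj_mult_integrable[OF LD LD])
    have i2: "integrable lebesgue (\<lambda>x. complex_of_real (F j x) * (cnj (?D x) * \<phi> x + cnj (\<phi> x) * ?D x))"
    proof -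
      have "integrable lebesgue (\<lambda>x. cnj (?D x) * (complex_of_real (F j x) * \<phi> x) + cnj (complex_of_real (F j x) * \<phi> x) * ?D x)"
        by (rule Bochner_Integration.integrable_add[OF L2_cnj_mult_integrable[OF LD LF] L2_cnj_mult_integrable[OF LF LD]])
      then show ?thesis by (simp add: algebra_simps)
    qed
    have i3: "integrable lebesgue (\<lambda>x. complex_of_real ((F j x)\<^sup>2) * (cnj (\<phi> x) * \<phi> x))"
    proof -
      have "integrable lebesgue (\<lambda>x. cnj (complex_of_real (F j x) * \<phi> x) * (complex_of_real (F j x) * \<phi> x))"
        by (rule L2_cnj_mult_integrable[OF LF LF])
      then show ?thesis by (simp add: power2_eq_square mult_ac)
    qed
    have "complex_of_real (sqint (\<lambda>x. ?D x + complex_of_real s * (complex_of_real (F j x) * \<phi> x)))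
        = (LINT x|lebesgue. cnj (?D x) * ?D x + (complex_of_real s * (complex_of_real (F j x) * (cnj (?D x) * \<phi> x + cnj (\<phi> x) * ?D x))
          + complex_of_real (s\<^sup>2) * (complex_of_real ((F j x)\<^sup>2) * (cnj (\<phi> x) * \<phi> x))))"
      unfolding sqint_eq_integral_cnj
      by (rule Bochner_Integration.integral_cong[OF refl]) (simp add: power2_eq_square algebra_simps)
    also have "\<dots> = (LINT x|lebesgue. cnj (?D x) * ?D x)
        + (complex_of_real s * (LINT x|lebesgue. complex_of_real (F j x) * (cnj (?D x) * \<phi> x + cnj (\<phi> x) * ?D x))
        + complex_of_real (s\<^sup>2) * (LINT x|lebesgue. complex_of_real ((F j x)\<^sup>2) * (cnj (\<phi> x) * \<phi> x)))"
      unfolding Bochner_Integration.integral_add[OF i1 Bochner_Integration.integrable_add[OF integrable_mult_right[OF i2] integrable_mult_right[OF i3]]]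
        Bochner_Integration.integral_add[OF integrable_mult_right[OF i2] integrable_mult_right[OF i3]] integral_mult_right_zero ..
    also have "\<dots> = complex_of_real (sqint ?D - s * X j + s\<^sup>2 * Y j)"
      unfolding sqint_eq_integral_cnj[symmetric] magnetic_pderiv_by_parts_test[OF \<phi> \<phi> sF] integral_weight_cnj X_def Y_def
      by simp
    finally have "sqint (\<lambda>x. ?D x + complex_of_real s * (complex_of_real (F j x) * \<phi> x)) = sqint ?D - s * X j + s\<^sup>2 * Y j"
      by (simp only: of_real_eq_iff)
    then show ?thesis using sqint_nonneg by metis
  qed
  have iX: "integrable lebesgue (\<lambda>x. pderiv_at j (F j) x * (cmod (\<phi> x))\<^sup>2)" for j
    by (rule test_function_sq_integrable[OF \<phi> cdF])
  have iY: "integrable lebesgue (\<lambda>x. (F j x)\<^sup>2 * (cmod (\<phi> x))\<^sup>2)" for j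
    by (rule test_function_sq_integrable[OF \<phi>]) (intro continuous_intros cF)
  have iG: "integrable lebesgue (\<lambda>x. G x * (cmod (\<phi> x))\<^sup>2)"
    by (rule test_function_sq_integrable[OF \<phi> cG])
  have "s\<^sup>2 * (LINT x|lebesgue. G x * (cmod (\<phi> x))\<^sup>2) = (LINT x|lebesgue. s\<^sup>2 * (G x * (cmod (\<phi> x))\<^sup>2))" by simp
  also have "\<dots> \<le> (LINT x|lebesgue. s * (\<Sum>j\<in>UNIV. pderiv_at j (F j) x * (cmod (\<phi> x))\<^sup>2) - s\<^sup>2 * (\<Sum>j\<in>UNIV. (F j x)\<^sup>2 * (cmod (\<phi> x))\<^sup>2))"
  proof (rule integral_mono)
    show "integrable lebesgue (\<lambda>x. s\<^sup>2 * (G x * (cmod (\<phi> x))\<^sup>2))" using iG by simp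
    show "integrable lebesgue (\<lambda>x. s * (\<Sum>j\<in>UNIV. pderiv_at j (F j) x * (cmod (\<phi> x))\<^sup>2) - s\<^sup>2 * (\<Sum>j\<in>UNIV. (F j x)\<^sup>2 * (cmod (\<phi> x))\<^sup>2))"
      by (intro Bochner_Integration.integrable_diff integrable_mult_right Bochner_Integration.integrable_sum iX iY)
    fix x :: "real ^ 'd"
    note w = radial_weight_bounds[OF e zero_le_one, of x, folded G_def]
    have rG: "(norm x)\<^sup>2 * (G x)\<^sup>2 \<le> G x"
    proof -
      have "(1 * (norm x)\<^sup>2 * G x) * G x \<le> 1 * G x" using w by (intro mult_right_mono) auto
      then show ?thesis by (simp add: power2_eq_square mult_ac)
    qed
    have div: "(\<Sum>j\<in>UNIV. pderiv_at j (F j) x) = real CARD('d) * G x - 2 * ((norm x)\<^sup>2 * (G x)\<^sup>2)"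
      unfolding F_def G_def divergence_radial_field[OF e zero_le_one] by simp
    have sq: "(\<Sum>j\<in>UNIV. (F j x)\<^sup>2) = (norm x)\<^sup>2 * (G x)\<^sup>2"
      unfolding F_def G_def by (rule sum_radial_field_sq)
    have "s * (2 * (G x)) \<ge> s * (2 * ((norm x)\<^sup>2 * (G x)\<^sup>2))" "s\<^sup>2 * G x \<ge> s\<^sup>2 * ((norm x)\<^sup>2 * (G x)\<^sup>2)"
      using rG s by (intro mult_left_mono; simp)+
    then have "s * (real CARD('d) * G x - 2 * ((norm x)\<^sup>2 * (G x)\<^sup>2)) - s\<^sup>2 * ((norm x)\<^sup>2 * (G x)\<^sup>2)
        \<ge> s * (real CARD('d) * G x) - s * (2 * G x) - s\<^sup>2 * G x"
      unfolding right_diff_distrib by linarith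
    moreover have "s * (real CARD('d) * G x) - s * (2 * G x) - s\<^sup>2 * G x = s\<^sup>2 * G x"
      by (simp add: s_def power2_eq_square field_simps)
    ultimately have "s\<^sup>2 * G x \<le> s * (\<Sum>j\<in>UNIV. pderiv_at j (F j) x) - s\<^sup>2 * (\<Sum>j\<in>UNIV. (F j x)\<^sup>2)"
      unfolding div sq by simp
    from mult_right_mono[OF this zero_le_power2[of "cmod (\<phi> x)"]]
    show "s\<^sup>2 * (G x * (cmod (\<phi> x))\<^sup>2) \<le> s * (\<Sum>j\<in>UNIV. pderiv_at j (F j) x * (cmod (\<phi> x))\<^sup>2) - s\<^sup>2 * (\<Sum>j\<in>UNIV. (F j x)\<^sup>2 * (cmod (\<phi> x))\<^sup>2)"
      by (simp only: sum_distrib_right[symmetric] left_diff_distrib mult.assoc)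
  qed
  also have "\<dots> = s * (\<Sum>j\<in>UNIV. X j) - s\<^sup>2 * (\<Sum>j\<in>UNIV. Y j)"
    unfolding X_def Y_def
    by (simp only: Bochner_Integration.integral_diff integrable_mult_right Bochner_Integration.integrable_sum iX iY
        integral_mult_right_zero Bochner_Integration.integral_sum)
  also have "\<dots> \<le> (\<Sum>j\<in>UNIV. sqint (magnetic_pderiv A j \<phi>))"
  proof -
    have "0 \<le> (\<Sum>j\<in>UNIV. sqint (magnetic_pderiv A j \<phi>) - s * X j + s\<^sup>2 * Y j)" by (intro sum_nonneg main)
    then show ?thesis by (simp add: sum.distrib sum_subtractf sum_distrib_left)
  qed
  finally have "s\<^sup>2 * (LINT x|lebesgue. G x * (cmod (\<phi> x))\<^sup>2) \<le> (\<Sum>j\<in>UNIV. sqint (magnetic_pderiv A j \<phi>))" .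
  then have "(LINT x|lebesgue. G x * (cmod (\<phi> x))\<^sup>2) \<le> (\<Sum>j\<in>UNIV. sqint (magnetic_pderiv A j \<phi>)) / s\<^sup>2"
    using s by (simp add: pos_le_divide_eq mult.commute)
  also have "\<dots> = (2 / (real CARD('d) - 2))\<^sup>2 * (\<Sum>j\<in>UNIV. sqint (magnetic_pderiv A j \<phi>))"
    by (simp add: s_def power_divide)
  finally show ?thesis by (simp only: G_def)
qed

text \<open>Hardy's inequality: the constants of the regularised inequality do not depend on \<open>\<epsilon>\<close>, and Fatou's lemma lets
  \<open>\<epsilon>\<close> tend to zero.\<close>

lemma form_bounded_hardy:
  fixes A :: "real ^ 'd::finite \<Rightarrow> real ^ 'd"
  assumes A: "Lp_loc 2 A" and d: "CARD('d) \<ge> 3"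
  shows "form_bounded A (\<lambda>x. inverse (norm x)) 0 ((2 / (real CARD('d) - 2))\<^sup>2)"
  unfolding form_bounded_def
proof (intro conjI allI impI)
  show m: "(\<lambda>x :: real ^ 'd. inverse (norm x)) \<in> borel_measurable lebesgue"
    by (intro borel_measurable_lebesgueI) measurable
  fix \<phi> :: "real ^ 'd \<Rightarrow> complex" assume \<phi>: "test_function \<phi>"
  let ?C = "(2 / (real CARD('d) - 2))\<^sup>2 * (\<Sum>j\<in>UNIV. sqint (magnetic_pderiv A j \<phi>))"
  have C: "?C \<ge> 0" by (intro mult_nonneg_nonneg sum_nonneg sqint_nonneg) auto
  define F where "F m x = ennreal (radial_weight (inverse (real (Suc m))) 1 x * (cmod (\<phi> x))\<^sup>2)" for m and x :: "real ^ 'd"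
  have pm: "(\<lambda>x. complex_of_real (inverse (norm x)) * \<phi> x) \<in> borel_measurable lebesgue"
    using m test_function_measurable[OF \<phi>] by measurable
  have pm2: "(\<lambda>x. (cmod (complex_of_real (inverse (norm x)) * \<phi> x))\<^sup>2) \<in> borel_measurable lebesgue"
    using pm by measurable
  have iF: "integrable lebesgue (\<lambda>x. radial_weight (inverse (real (Suc m))) 1 x * (cmod (\<phi> x))\<^sup>2)" for m
    by (rule test_function_sq_integrable[OF \<phi> smooth_continuous]) (intro allI smooth_radial_weight; simp)
  have Fm: "F m \<in> borel_measurable lebesgue" for m
    using borel_measurable_integrable[OF iF] unfolding F_def[abs_def] by measurable
  have bound: "(\<integral>\<^sup>+ x. F m x \<partial>lebesgue) \<le> ennreal ?C" for m
  proof -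
    have "(\<integral>\<^sup>+ x. F m x \<partial>lebesgue) = ennreal (LINT x|lebesgue. radial_weight (inverse (real (Suc m))) 1 x * (cmod (\<phi> x))\<^sup>2)"
      unfolding F_def
    proof (rule nn_integral_eq_integral[OF iF], rule AE_I2)
      fix x :: "real ^ 'd"
      have "inverse (real (Suc m)) > 0" by simp
      from radial_weight_bounds(1)[OF this zero_le_one, of x]
      show "0 \<le> radial_weight (inverse (real (Suc m))) 1 x * (cmod (\<phi> x))\<^sup>2" by (intro mult_nonneg_nonneg) auto
    qed
    also have "\<dots> \<le> ennreal ?C" by (rule ennreal_leI[OF hardy_regularised[OF A \<phi> _ d]]) simp
    finally show ?thesis .
  qed
  have "(\<integral>\<^sup>+ x. ennreal ((cmod (complex_of_real (inverse (norm x)) * \<phi> x))\<^sup>2) \<partial>lebesgue) \<le> (\<integral>\<^sup>+ x. liminf (\<lambda>m. F m x) \<partial>lebesgue)"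
  proof (rule nn_integral_mono)
    fix x :: "real ^ 'd"
    show "ennreal ((cmod (complex_of_real (inverse (norm x)) * \<phi> x))\<^sup>2) \<le> liminf (\<lambda>m. F m x)"
    proof (cases "x = 0")
      case False
      have "(\<lambda>m. radial_weight (inverse (real (Suc m))) 1 x * (cmod (\<phi> x))\<^sup>2) \<longlonglongrightarrow> inverse (0 + 1 * (norm x)\<^sup>2) * (cmod (\<phi> x))\<^sup>2"
        unfolding radial_weight_def using False by (intro tendsto_intros LIMSEQ_inverse_real_of_nat) auto
      then have "(\<lambda>m. F m x) \<longlonglongrightarrow> ennreal (inverse (0 + 1 * (norm x)\<^sup>2) * (cmod (\<phi> x))\<^sup>2)"
        unfolding F_def by (rule tendsto_ennrealI)
      from lim_imp_Liminf[OF _ this]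
      have "liminf (\<lambda>m. F m x) = ennreal (inverse (0 + 1 * (norm x)\<^sup>2) * (cmod (\<phi> x))\<^sup>2)" by simp
      also have "inverse (0 + 1 * (norm x)\<^sup>2) * (cmod (\<phi> x))\<^sup>2 = (cmod (complex_of_real (inverse (norm x)) * \<phi> x))\<^sup>2"
        by (simp add: norm_mult norm_inverse power_mult_distrib power_inverse)
      finally show ?thesis by simp
    qed simp
  qed
  also have "\<dots> \<le> liminf (\<lambda>m. \<integral>\<^sup>+ x. F m x \<partial>lebesgue)" by (rule nn_integral_liminf[OF Fm])
  also have "\<dots> \<le> liminf (\<lambda>m :: nat. ennreal ?C)"
    by (intro Liminf_mono always_eventually allI bound)
  also have "\<dots> = ennreal ?C" by (simp add: Liminf_const)
  finally have fin: "(\<integral>\<^sup>+ x. ennreal ((cmod (complex_of_real (inverse (norm x)) * \<phi> x))\<^sup>2) \<partial>lebesgue) \<le> ennreal ?C" .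
  note r = integral_le_nn_bound[OF pm2 zero_le_power2 fin C]
  show "L2 (\<lambda>x. complex_of_real (inverse (norm x)) * \<phi> x)" unfolding L2_def using pm r(1) by blast
  show "sqint (\<lambda>x. complex_of_real (inverse (norm x)) * \<phi> x)
      \<le> 0 * sqint \<phi> + (2 / (real CARD('d) - 2))\<^sup>2 * (\<Sum>j\<in>UNIV. sqint (magnetic_pderiv A j \<phi>))"
    unfolding sqint_def[of "\<lambda>x. complex_of_real (inverse (norm x)) * \<phi> x"] using r(2) by simp
qed auto

section \<open>The operator norm of the magnetic field\<close>

abbreviation opnorm :: "real ^ 'd::finite ^ 'd \<Rightarrow> real" where
  "opnorm M \<equiv> onorm ((*v) M)"

lemma opnorm_nonneg: "0 \<le> opnorm M"
  by (rule onorm_pos_le[OF matrix_vector_mul_bounded_linear])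

lemma norm_matrix_vector_le: "norm (M *v x) \<le> opnorm M * norm x"
  by (rule onorm[OF matrix_vector_mul_bounded_linear])

text \<open>The matrix applied to its own \<open>j\<close>-th row has the square of the norm of that row as \<open>j\<close>-th component.\<close>

lemma norm_row_le_opnorm: "norm (M $ j) \<le> opnorm M" for M :: "real ^ 'd::finite ^ 'd"
proof (cases "M $ j = 0")
  case False
  have "(norm (M $ j))\<^sup>2 = (M *v (M $ j)) $ j"
    by (simp add: norm_sq_eq_sum matrix_vector_mult_def)
  also have "\<dots> \<le> norm (M *v (M $ j))"
    using component_le_norm_cart[of "M *v (M $ j)" j] by linarith
  also have "\<dots> \<le> opnorm M * norm (M $ j)" by (rule norm_matrix_vector_le)
  finally have "norm (M $ j) * norm (M $ j) \<le> opnorm M * norm (M $ j)" by (simp add: power2_eq_square)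
  then show ?thesis using False by (simp add: mult_le_cancel_right)
qed (simp add: opnorm_nonneg)

lemma abs_entry_le_opnorm: "\<bar>M $ j $ k\<bar> \<le> opnorm M" for M :: "real ^ 'd::finite ^ 'd"
  using component_le_norm_cart[of "M $ j" k] norm_row_le_opnorm[of M j] by linarith

lemma continuous_opnorm: "continuous_on UNIV (opnorm :: real ^ 'd::finite ^ 'd \<Rightarrow> real)"
proof -
  have le: "opnorm M \<le> opnorm N + real CARD('d) * real CARD('d) * norm (M - N)" for M N :: "real ^ 'd ^ 'd"
  proof -
    have "opnorm M = onorm (\<lambda>x. N *v x + (M - N) *v x)"
      by (simp add: matrix_vector_mult_diff_rdistrib)
    also have "\<dots> \<le> opnorm N + opnorm (M - N)"
      by (rule onorm_triangle) (rule matrix_vector_mul_bounded_linear)+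
    also have "opnorm (M - N) \<le> real CARD('d) * real CARD('d) * norm (M - N)"
      by (rule onorm_le_matrix_component)
         (simp only: real_norm_def[symmetric], rule order_trans[OF Finite_Cartesian_Product.norm_nth_le Finite_Cartesian_Product.norm_nth_le])
    finally show ?thesis by simp
  qed
  define L where "L = real CARD('d) * real CARD('d)"
  have "\<bar>opnorm M - opnorm N\<bar> \<le> L * norm (M - N)" for M N :: "real ^ 'd ^ 'd"
    using le[of M N] le[of N M] unfolding L_def norm_minus_commute[of N M] by linarith
  then have "L-lipschitz_on UNIV (opnorm :: real ^ 'd ^ 'd \<Rightarrow> real)"
    by (intro lipschitz_onI) (auto simp: dist_norm L_def)
  then show ?thesis by (rule lipschitz_on_continuous_on)
qed

lemma opnorm_measurable:
  fixes B :: "real ^ 'd::finite \<Rightarrow> real ^ 'd ^ 'd"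
  assumes "B \<in> borel_measurable lebesgue"
  shows "(\<lambda>x. opnorm (B x)) \<in> borel_measurable lebesgue"
  by (rule measurable_compose[OF assms borel_measurable_continuous_onI[OF continuous_opnorm]])

lemma magnetic_pderiv_zero: "magnetic_pderiv A j (\<lambda>x. 0) x = 0"
  by (simp add: magnetic_pderiv_def)

text \<open>The bound for spinors contains the bound for scalar functions: put \<open>\<phi>\<close> in the first component.\<close>

lemma form_bounded_field:
  fixes A :: "real ^ 'd::finite \<Rightarrow> real ^ 'd" and B :: "real ^ 'd \<Rightarrow> real ^ 'd ^ 'd"
  assumes A: "Lp_loc 2 A" and mB: "B \<in> borel_measurable lebesgue" and n: "n \<ge> 1"
    and bound: "\<And>u :: real ^ 'd \<Rightarrow> complex Matrix.vec.
       (\<forall>x. u x \<in> carrier_vec n) \<Longrightarrow> (\<forall>k<n. test_function (\<lambda>x. u x $v k)) \<Longrightarrow>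
       (\<integral>\<^sup>+ x. ennreal ((norm x)\<^sup>2 * (opnorm (B x))\<^sup>2 * (\<Sum>k<n. (cmod (u x $v k))\<^sup>2)) \<partial>lebesgue)
         \<le> ennreal (c\<^sup>2) *
           (\<integral>\<^sup>+ x. ennreal (\<Sum>k<n. \<Sum>j\<in>UNIV. (cmod (magnetic_pderiv A j (\<lambda>y. u y $v k) x))\<^sup>2) \<partial>lebesgue)"
  shows "form_bounded A (\<lambda>x. norm x * opnorm (B x)) 0 (c\<^sup>2)"
  unfolding form_bounded_def
proof (intro conjI allI impI)
  have mn: "(\<lambda>x :: real ^ 'd. norm x) \<in> borel_measurable lebesgue" by (intro borel_measurable_lebesgueI) measurable
  show m: "(\<lambda>x. norm x * opnorm (B x)) \<in> borel_measurable lebesgue"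
    by (intro borel_measurable_times mn opnorm_measurable mB)
  fix \<phi> :: "real ^ 'd \<Rightarrow> complex" assume \<phi>: "test_function \<phi>"
  define u where "u x = Matrix.vec n (\<lambda>k. if k = 0 then \<phi> x else 0)" for x
  have uk: "u x $v k = (if k = 0 then \<phi> x else 0)" if "k < n" for x k using that by (simp add: u_def)
  have car: "\<forall>x. u x \<in> carrier_vec n" by (simp add: u_def)
  have t0: "test_function (\<lambda>x :: real ^ 'd. 0 :: complex)"
    by (rule test_functionI[of _ 0]) auto
  have tu: "\<forall>k<n. test_function (\<lambda>x. u x $v k)"
  proof (intro allI impI)
    fix k assume k: "k < n"
    show "test_function (\<lambda>x. u x $v k)" unfolding uk[OF k] using \<phi> t0 by (cases "k = 0") simp_all
  qed
  have s1: "(\<Sum>k<n. (cmod (u x $v k))\<^sup>2) = (cmod (\<phi> x))\<^sup>2" for x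
  proof -
    have "(\<Sum>k<n. (cmod (u x $v k))\<^sup>2) = (\<Sum>k<n. if k = 0 then (cmod (\<phi> x))\<^sup>2 else 0)"
      by (rule sum.cong) (auto simp: uk)
    then show ?thesis using n by simp
  qed
  have s2: "(\<Sum>k<n. \<Sum>j\<in>UNIV. (cmod (magnetic_pderiv A j (\<lambda>y. u y $v k) x))\<^sup>2) = (\<Sum>j\<in>UNIV. (cmod (magnetic_pderiv A j \<phi> x))\<^sup>2)" for x
  proof -
    have "(\<Sum>k<n. \<Sum>j\<in>UNIV. (cmod (magnetic_pderiv A j (\<lambda>y. u y $v k) x))\<^sup>2)
        = (\<Sum>k<n. if k = 0 then (\<Sum>j\<in>UNIV. (cmod (magnetic_pderiv A j \<phi> x))\<^sup>2) else 0)"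
      by (rule sum.cong) (auto simp: uk magnetic_pderiv_zero)
    then show ?thesis using n by simp
  qed
  let ?S = "\<Sum>j\<in>UNIV. sqint (magnetic_pderiv A j \<phi>)"
  have LD: "L2 (magnetic_pderiv A j \<phi>)" for j by (rule L2_magnetic_pderiv[OF A \<phi>])
  have rhs: "(\<integral>\<^sup>+ x. ennreal (\<Sum>j\<in>UNIV. (cmod (magnetic_pderiv A j \<phi> x))\<^sup>2) \<partial>lebesgue) = ennreal ?S"
  proof -
    have "(\<integral>\<^sup>+ x. ennreal (\<Sum>j\<in>UNIV. (cmod (magnetic_pderiv A j \<phi> x))\<^sup>2) \<partial>lebesgue)
        = ennreal (LINT x|lebesgue. (\<Sum>j\<in>UNIV. (cmod (magnetic_pderiv A j \<phi> x))\<^sup>2))"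
      by (rule nn_integral_eq_integral) (auto intro!: Bochner_Integration.integrable_sum L2_integrable[OF LD] sum_nonneg)
    also have "(LINT x|lebesgue. (\<Sum>j\<in>UNIV. (cmod (magnetic_pderiv A j \<phi> x))\<^sup>2)) = ?S"
      unfolding sqint_def by (rule Bochner_Integration.integral_sum) (rule L2_integrable[OF LD])
    finally show ?thesis .
  qed
  have "(\<integral>\<^sup>+ x. ennreal ((cmod (complex_of_real (norm x * opnorm (B x)) * \<phi> x))\<^sup>2) \<partial>lebesgue) \<le> ennreal (c\<^sup>2) * ennreal ?S"
    using bound[OF car tu] unfolding s1 s2 rhs
    by (simp add: norm_mult power_mult_distrib)
  also have "\<dots> = ennreal (c\<^sup>2 * ?S)" by (rule ennreal_mult'[symmetric]) simp
  finally have fin: "(\<integral>\<^sup>+ x. ennreal ((cmod (complex_of_real (norm x * opnorm (B x)) * \<phi> x))\<^sup>2) \<partial>lebesgue) \<le> ennreal (c\<^sup>2 * ?S)" .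
  have pm: "(\<lambda>x. complex_of_real (norm x * opnorm (B x)) * \<phi> x) \<in> borel_measurable lebesgue"
    using m test_function_measurable[OF \<phi>] by measurable
  have pm2: "(\<lambda>x. (cmod (complex_of_real (norm x * opnorm (B x)) * \<phi> x))\<^sup>2) \<in> borel_measurable lebesgue"
    using pm by measurable
  have C: "c\<^sup>2 * ?S \<ge> 0" by (intro mult_nonneg_nonneg sum_nonneg sqint_nonneg) auto
  note r = integral_le_nn_bound[OF pm2 zero_le_power2 fin C]
  show "L2 (\<lambda>x. complex_of_real (norm x * opnorm (B x)) * \<phi> x)" unfolding L2_def using pm r(1) by blast
  show "sqint (\<lambda>x. complex_of_real (norm x * opnorm (B x)) * \<phi> x) \<le> 0 * sqint \<phi> + c\<^sup>2 * ?S"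
    unfolding sqint_def[of "\<lambda>x. complex_of_real (norm x * opnorm (B x)) * \<phi> x"] using r(2) by simp
qed auto

section \<open>Weighted scalar products\<close>

text \<open>Weighted scalar products \<open>\<integral> b cnj f g\<close> with real bounded \<open>b\<close>; the weights are components of vector fields and
  their derivatives.\<close>

definition bounded_weight :: "(real ^ 'd::finite \<Rightarrow> real) \<Rightarrow> bool" where
  "bounded_weight b \<longleftrightarrow> b \<in> borel_measurable lebesgue \<and> (\<exists>C. \<forall>x. \<bar>b x\<bar> \<le> C)"

definition ip :: "(real ^ 'd::finite \<Rightarrow> real) \<Rightarrow> (real ^ 'd \<Rightarrow> complex) \<Rightarrow> (real ^ 'd \<Rightarrow> complex) \<Rightarrow> complex" where
  "ip b f g = (LINT x|lebesgue. complex_of_real (b x) * cnj (f x) * g x)"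

lemma bounded_weight_const: "bounded_weight (\<lambda>x. c)"
  by (auto simp: bounded_weight_def)

lemma bounded_weightI: "continuous_on UNIV b \<Longrightarrow> (\<And>x. \<bar>b x\<bar> \<le> C) \<Longrightarrow> bounded_weight b"
  unfolding bounded_weight_def by (auto intro: continuous_measurable_lebesgue)

lemma ip_integrable:
  assumes "bounded_weight b" "L2 f" "L2 g"
  shows "integrable lebesgue (\<lambda>x. complex_of_real (b x) * cnj (f x) * g x)"
proof -
  obtain C where C: "\<forall>x. \<bar>b x\<bar> \<le> C" and m: "b \<in> borel_measurable lebesgue" using assms(1) by (auto simp: bounded_weight_def)
  have "L2 (\<lambda>x. complex_of_real (b x) * cnj (f x))"
    by (rule L2_mult_bounded[OF L2_cnj[OF assms(2)], of _ C]) (use C m in auto)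
  from L2_mult_integrable[OF this assms(3)] show ?thesis .
qed

lemma ip_cnj: "cnj (ip b f g) = ip b g f"
proof -
  have "cnj (ip b f g) = (LINT x|lebesgue. cnj (complex_of_real (b x) * cnj (f x) * g x))"
    unfolding ip_def by (rule Bochner_Integration.integral_cnj[symmetric])
  then show ?thesis by (simp add: ip_def mult_ac)
qed

lemma ip_cong_AE_right:
  assumes "AE x in lebesgue. g x = h x" "bounded_weight b" "L2 f" "L2 g" "L2 h"
  shows "ip b f g = ip b f h"
  unfolding ip_def
proof (rule integral_cong_AE)
  show "AE x in lebesgue. complex_of_real (b x) * cnj (f x) * g x = complex_of_real (b x) * cnj (f x) * h x"
    using assms(1) by eventually_elim simp
qed (intro borel_measurable_integrable ip_integrable assms)+

lemma ip_scale_right: "ip b f (\<lambda>x. c * g x) = c * ip b f g"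
proof -
  have "ip b f (\<lambda>x. c * g x) = (LINT x|lebesgue. c * (complex_of_real (b x) * cnj (f x) * g x))"
    unfolding ip_def by (rule Bochner_Integration.integral_cong[OF refl]) (simp add: mult_ac)
  then show ?thesis by (simp add: ip_def)
qed

lemma ip_self: "ip (\<lambda>x. 1) f f = complex_of_real (sqint f)"
  by (simp add: ip_def sqint_eq_integral_cnj)

lemma ip_zero_weight [simp]: "ip (\<lambda>x. 0) f g = 0"
  by (simp add: ip_def)

section \<open>Clifford algebra\<close>

text \<open>What is used about the Dirac matrices: \<open>a j k l\<close> is the entry \<open>(k, l)\<close> of the matrix belonging to the coordinate
  \<open>j\<close>, and \<open>s\<close> is the diagonal of \<open>\<beta>\<close>.  That \<open>\<beta>\<close> anticommutes with each of these matrices is \<open>offdiagonal\<close>.\<close>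

locale dirac_coefficients =
  fixes n :: nat and a :: "'d::finite \<Rightarrow> nat \<Rightarrow> nat \<Rightarrow> complex" and s :: "nat \<Rightarrow> real"
  assumes hermitian: "k < n \<Longrightarrow> l < n \<Longrightarrow> cnj (a j k l) = a j l k"
    and clifford: "k < n \<Longrightarrow> m < n \<Longrightarrow>
      (\<Sum>l<n. a i k l * a j l m + a j k l * a i l m) = (if i = j \<and> k = m then 2 else 0)"
    and sign: "s k = 1 \<or> s k = - 1"
    and offdiagonal: "k < n \<Longrightarrow> l < n \<Longrightarrow> a j k l \<noteq> 0 \<Longrightarrow> s l = - s k"
begin

definition prod2 :: "'d \<Rightarrow> 'd \<Rightarrow> nat \<Rightarrow> nat \<Rightarrow> complex" where
  "prod2 i j l m = (\<Sum>k<n. a i l k * a j k m)"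

lemma prod2_anticommute: "l < n \<Longrightarrow> m < n \<Longrightarrow> prod2 i j l m + prod2 j i l m = (if i = j \<and> l = m then 2 else 0)"
  using clifford[of l m i j] by (simp add: prod2_def sum.distrib)

lemma sum_rotate: "(\<Sum>k\<in>K. \<Sum>l\<in>L. \<Sum>m\<in>M. T k l m) = (\<Sum>l\<in>L. \<Sum>m\<in>M. \<Sum>k\<in>K. (T k l m :: 'b::comm_monoid_add))"
proof -
  have "(\<Sum>k\<in>K. \<Sum>l\<in>L. \<Sum>m\<in>M. T k l m) = (\<Sum>l\<in>L. \<Sum>k\<in>K. \<Sum>m\<in>M. T k l m)" by (rule sum.swap)
  also have "\<dots> = (\<Sum>l\<in>L. \<Sum>m\<in>M. \<Sum>k\<in>K. T k l m)" by (intro sum.cong[OF refl] sum.swap)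
  finally show ?thesis .
qed

lemma sum_cnj_mult_one:
  "(\<Sum>k<n. cnj (\<Sum>l<n. a i k l * x l) * (\<Sum>j\<in>UNIV. \<Sum>m<n. a j k m * y j m))
    = (\<Sum>j\<in>UNIV. \<Sum>l<n. \<Sum>m<n. prod2 i j l m * (cnj (x l) * y j m))"
proof -
  have "(\<Sum>k<n. cnj (\<Sum>l<n. a i k l * x l) * (\<Sum>j\<in>UNIV. \<Sum>m<n. a j k m * y j m))
      = (\<Sum>k<n. (\<Sum>l<n. a i l k * cnj (x l)) * (\<Sum>j\<in>UNIV. \<Sum>m<n. a j k m * y j m))"
    by (rule sum.cong) (auto simp: hermitian)
  also have "\<dots> = (\<Sum>k<n. \<Sum>j\<in>UNIV. \<Sum>l<n. \<Sum>m<n. (a i l k * cnj (x l)) * (a j k m * y j m))"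
    by (rule sum.cong[OF refl]) (simp only: sum_distrib_left[of _ _ UNIV] sum_product)
  also have "\<dots> = (\<Sum>j\<in>UNIV. \<Sum>k<n. \<Sum>l<n. \<Sum>m<n. (a i l k * cnj (x l)) * (a j k m * y j m))"
    by (rule sum.swap)
  also have "\<dots> = (\<Sum>j\<in>UNIV. \<Sum>l<n. \<Sum>m<n. \<Sum>k<n. (a i l k * cnj (x l)) * (a j k m * y j m))"
    by (intro sum.cong[OF refl] sum_rotate)
  also have "\<dots> = (\<Sum>j\<in>UNIV. \<Sum>l<n. \<Sum>m<n. prod2 i j l m * (cnj (x l) * y j m))"
    unfolding prod2_def sum_distrib_right by (intro sum.cong[OF refl]) (simp add: mult_ac)
  finally show ?thesis .
qed

lemma sum_cnj_mult:
  "(\<Sum>k<n. cnj (\<Sum>i\<in>UNIV. \<Sum>l<n. a i k l * x i l) * (\<Sum>j\<in>UNIV. \<Sum>m<n. a j k m * y j m))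
    = (\<Sum>i\<in>UNIV. \<Sum>j\<in>UNIV. \<Sum>l<n. \<Sum>m<n. prod2 i j l m * (cnj (x i l) * y j m))"
proof -
  have "(\<Sum>k<n. cnj (\<Sum>i\<in>UNIV. \<Sum>l<n. a i k l * x i l) * (\<Sum>j\<in>UNIV. \<Sum>m<n. a j k m * y j m))
    = (\<Sum>k<n. \<Sum>i\<in>UNIV. cnj (\<Sum>l<n. a i k l * x i l) * (\<Sum>j\<in>UNIV. \<Sum>m<n. a j k m * y j m))"
    by (simp only: cnj_sum[of _ UNIV] sum_distrib_right[of _ UNIV])
  also have "\<dots> = (\<Sum>i\<in>UNIV. \<Sum>k<n. cnj (\<Sum>l<n. a i k l * x i l) * (\<Sum>j\<in>UNIV. \<Sum>m<n. a j k m * y j m))"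
    by (rule sum.swap)
  also have "\<dots> = (\<Sum>i\<in>UNIV. \<Sum>j\<in>UNIV. \<Sum>l<n. \<Sum>m<n. prod2 i j l m * (cnj (x i l) * y j m))"
    by (simp only: sum_cnj_mult_one)
  finally show ?thesis .
qed

text \<open>The anticommutation relations leave, besides the diagonal, only the part of \<open>W\<close>
  that is antisymmetric in the two vector indices.\<close>

lemma sum_prod2_antisymmetrise:
  "(\<Sum>i\<in>UNIV. \<Sum>j\<in>UNIV. \<Sum>l<n. \<Sum>m<n. prod2 i j l m * W i j l m)
    = (\<Sum>i\<in>UNIV. \<Sum>j\<in>UNIV. \<Sum>l<n. \<Sum>m<n. prod2 i j l m * (W i j l m - W j i l m)) / 2
      + (\<Sum>i\<in>UNIV. \<Sum>l<n. W i i l l)"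
proof -
  let ?S = "\<Sum>i\<in>UNIV. \<Sum>j\<in>UNIV. \<Sum>l<n. \<Sum>m<n. prod2 i j l m * W i j l m"
  let ?T = "\<Sum>i\<in>UNIV. \<Sum>j\<in>UNIV. \<Sum>l<n. \<Sum>m<n. prod2 i j l m * W j i l m"
  have swap: "(\<Sum>i\<in>UNIV. \<Sum>j\<in>UNIV. \<Sum>l<n. \<Sum>m<n. prod2 j i l m * W j i l m) = ?S"
    by (rule sum.swap)
  have "?T + ?S = (\<Sum>i\<in>UNIV. \<Sum>j\<in>UNIV. \<Sum>l<n. \<Sum>m<n. (prod2 i j l m + prod2 j i l m) * W j i l m)"
    unfolding swap[symmetric] by (simp only: sum.distrib[symmetric] distrib_right)
  also have "\<dots> = (\<Sum>i\<in>UNIV. \<Sum>j\<in>UNIV. \<Sum>l<n. \<Sum>m<n. if i = j then (if l = m then 2 * W i i l l else 0) else 0)"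
    by (intro sum.cong[OF refl]) (auto simp: prod2_anticommute)
  also have "\<dots> = (\<Sum>i\<in>UNIV. \<Sum>j\<in>UNIV. if i = j then (\<Sum>l<n. \<Sum>m<n. if l = m then 2 * W i i l l else 0) else 0)"
    by (intro sum.cong[OF refl]) auto
  also have "\<dots> = (\<Sum>i\<in>UNIV. \<Sum>l<n. 2 * W i i l l)" by simp
  also have "\<dots> = 2 * (\<Sum>i\<in>UNIV. \<Sum>l<n. W i i l l)" by (simp only: sum_distrib_left)
  finally have TS: "?T = 2 * (\<Sum>i\<in>UNIV. \<Sum>l<n. W i i l l) - ?S" by (simp only: eq_diff_eq)
  have "(\<Sum>i\<in>UNIV. \<Sum>j\<in>UNIV. \<Sum>l<n. \<Sum>m<n. prod2 i j l m * (W i j l m - W j i l m)) = ?S - ?T"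
    by (simp only: right_diff_distrib sum_subtractf)
  then show ?thesis unfolding TS by (simp add: field_simps)
qed

definition cliff :: "('d \<Rightarrow> real) \<Rightarrow> (nat \<Rightarrow> complex) \<Rightarrow> nat \<Rightarrow> complex" where
  "cliff b v k = (\<Sum>j\<in>UNIV. \<Sum>l<n. a j k l * (complex_of_real (b j) * v l))"

text \<open>The Clifford relations say \<open>(\<Sum>\<^sub>j b\<^sub>j \<alpha>\<^sub>j)\<^sup>2 = \<bar>b\<bar>\<^sup>2\<close>.\<close>

lemma cliff_isometry: "(\<Sum>k<n. (cmod (cliff b v k))\<^sup>2) = (\<Sum>j\<in>UNIV. (b j)\<^sup>2) * (\<Sum>k<n. (cmod (v k))\<^sup>2)"
proof -
  have c2: "complex_of_real ((cmod z)\<^sup>2) = cnj z * z" for z by (simp only: complex_norm_square mult.commute)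
  have "complex_of_real (\<Sum>k<n. (cmod (cliff b v k))\<^sup>2) = (\<Sum>k<n. cnj (cliff b v k) * cliff b v k)"
    by (simp only: of_real_sum c2)
  also have "\<dots> = (\<Sum>i\<in>UNIV. \<Sum>j\<in>UNIV. \<Sum>l<n. \<Sum>m<n.
      prod2 i j l m * (cnj (complex_of_real (b i) * v l) * (complex_of_real (b j) * v m)))"
    unfolding cliff_def by (rule sum_cnj_mult)
  also have "\<dots> = (\<Sum>i\<in>UNIV. \<Sum>l<n. cnj (complex_of_real (b i) * v l) * (complex_of_real (b i) * v l))"
  proof -
    have "cnj (complex_of_real (b i) * v l) * (complex_of_real (b j) * v m)
        - cnj (complex_of_real (b j) * v l) * (complex_of_real (b i) * v m) = 0" for i j l m by simp
    then show ?thesis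
      using sum_prod2_antisymmetrise[of "\<lambda>i j l m. cnj (complex_of_real (b i) * v l) * (complex_of_real (b j) * v m)"]
      by (simp only: mult_zero_right sum.neutral_const) simp
  qed
  also have "\<dots> = complex_of_real (\<Sum>i\<in>UNIV. \<Sum>l<n. (b i)\<^sup>2 * (cmod (v l))\<^sup>2)"
    unfolding of_real_sum c2[symmetric] by (simp only: norm_mult norm_of_real power_mult_distrib power2_abs)
  also have "\<dots> = complex_of_real ((\<Sum>j\<in>UNIV. (b j)\<^sup>2) * (\<Sum>k<n. (cmod (v k))\<^sup>2))"
    by (simp only: sum_product)
  finally show ?thesis by (simp only: of_real_eq_iff)
qed

lemma cmod_sum_cnj_le: "cmod (\<Sum>k<n. cnj (p k) * q k) \<le> sqrt (\<Sum>k<n. (cmod (p k))\<^sup>2) * sqrt (\<Sum>k<n. (cmod (q k))\<^sup>2)"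
proof -
  have "cmod (\<Sum>k<n. cnj (p k) * q k) \<le> (\<Sum>k<n. \<bar>cmod (p k)\<bar> * \<bar>cmod (q k)\<bar>)"
    by (rule order_trans[OF norm_sum]) (simp add: norm_mult)
  also have "\<dots> \<le> L2_set (\<lambda>k. cmod (p k)) {..<n} * L2_set (\<lambda>k. cmod (q k)) {..<n}" by (rule L2_set_mult_ineq)
  finally show ?thesis by (simp only: L2_set_def)
qed

text \<open>Splitting a spinor by the sign of \<open>\<beta>\<close>: the matrices \<open>\<alpha>\<close> exchange the two parts.\<close>

definition part :: "real \<Rightarrow> (nat \<Rightarrow> 'b::zero) \<Rightarrow> nat \<Rightarrow> 'b" where
  "part t v k = (if s k = t then v k else 0)"

text \<open>Only the products of one part of \<open>v\<close> with the other survive, which gives \<open>2 \<bar>b\<bar> \<bar>v\<^sub>+\<bar> \<bar>v\<^sub>-\<bar>\<close>; the parameter \<open>\<tau>\<close>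
  separates the two factors so that the bound can be integrated.\<close>

lemma cliff_offdiagonal_bound:
  assumes t: "\<tau> > 0" and b: "(\<Sum>j\<in>UNIV. (b j)\<^sup>2) \<le> M\<^sup>2" and M: "M \<ge> 0"
  shows "cmod (\<Sum>k<n. cnj (v k) * cliff b v k)
    \<le> \<tau> * (M\<^sup>2 * (\<Sum>k<n. (cmod (part 1 v k))\<^sup>2)) + (\<Sum>k<n. (cmod (part (- 1) v k))\<^sup>2) / \<tau>"
proof -
  define P where "P = sqrt (\<Sum>k<n. (cmod (part 1 v k))\<^sup>2)"
  define Q where "Q = sqrt (\<Sum>k<n. (cmod (part (- 1) v k))\<^sup>2)"
  have P: "P \<ge> 0" "P\<^sup>2 = (\<Sum>k<n. (cmod (part 1 v k))\<^sup>2)" and Q: "Q \<ge> 0" "Q\<^sup>2 = (\<Sum>k<n. (cmod (part (- 1) v k))\<^sup>2)"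
    by (auto simp: P_def Q_def sum_nonneg)
  have sc: "sqrt (\<Sum>k<n. (cmod (cliff b x k))\<^sup>2) \<le> M * sqrt (\<Sum>k<n. (cmod (x k))\<^sup>2)" for x
  proof -
    have "sqrt (\<Sum>k<n. (cmod (cliff b x k))\<^sup>2) = sqrt (\<Sum>j\<in>UNIV. (b j)\<^sup>2) * sqrt (\<Sum>k<n. (cmod (x k))\<^sup>2)"
      unfolding cliff_isometry by (rule real_sqrt_mult)
    also have "\<dots> \<le> M * sqrt (\<Sum>k<n. (cmod (x k))\<^sup>2)"
      using b M by (intro mult_right_mono real_le_lsqrt) (auto intro: sum_nonneg)
    finally show ?thesis .
  qed
  have cl: "part t v k = 0 \<or> cliff b v k = cliff b (part (- t) v) k" if k: "k < n" for k t
  proof (cases "s k = t")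
    case True
    have eq: "a j k l * (complex_of_real (b j) * v l) = a j k l * (complex_of_real (b j) * part (- t) v l)" if "l < n" for j l
      using offdiagonal[OF k that, of j] True by (cases "a j k l = 0") (auto simp: part_def)
    have "cliff b v k = cliff b (part (- t) v) k"
      unfolding cliff_def by (intro sum.cong[OF refl] eq) simp
    then show ?thesis ..
  qed (simp add: part_def)
  have split: "cnj (v k) * cliff b v k = cnj (part (- 1) v k) * cliff b (part 1 v) k + cnj (part 1 v k) * cliff b (part (- 1) v) k"
    if k: "k < n" for k
  proof -
    consider "s k = 1" | "s k = - 1" using sign by blast
    then show ?thesis
    proof cases
      case 1
      then show ?thesis using cl[OF k, of 1] by (auto simp: part_def)
    next
      case 2
      then show ?thesis using cl[OF k, of "- 1"] by (auto simp: part_def)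
    qed
  qed
  have "(\<Sum>k<n. cnj (v k) * cliff b v k) = (\<Sum>k<n. cnj (part (- 1) v k) * cliff b (part 1 v) k)
      + (\<Sum>k<n. cnj (part 1 v k) * cliff b (part (- 1) v) k)"
    unfolding sum.distrib[symmetric] by (rule sum.cong) (auto simp: split)
  also have "cmod \<dots> \<le> Q * (M * P) + P * (M * Q)"
    by (rule order_trans[OF norm_triangle_ineq], rule add_mono; rule order_trans[OF cmod_sum_cnj_le])
       (auto simp: P_def Q_def intro!: mult_left_mono sc sum_nonneg)
  also have "\<dots> = 2 * ((M * P) * Q)" by simp
  also have "\<dots> \<le> \<tau> * (M * P)\<^sup>2 + Q\<^sup>2 / \<tau>"
  proof -
    have "0 \<le> (\<tau> * (M * P) - Q)\<^sup>2 / \<tau>" using t by simp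
    also have "\<dots> = \<tau> * (M * P)\<^sup>2 + Q\<^sup>2 / \<tau> - 2 * ((M * P) * Q)"
      using t by (simp add: power2_eq_square field_simps)
    finally show ?thesis by simp
  qed
  finally show ?thesis unfolding power_mult_distrib P(2) Q(2) .
qed

text \<open>For fixed \<open>i\<close> the sum is the scalar product of \<open>\<alpha>\<^sub>i v\<close> with \<open>(\<Sum>\<^sub>j M\<^sub>i\<^sub>j \<alpha>\<^sub>j) v\<close>, and the rows of \<open>M\<close> are bounded
  by its operator norm.  This is where the factor \<open>d\<close> in the coercivity estimate arises.\<close>

lemma cliff_commutator_bound:
  fixes M :: "real ^ 'd ^ 'd"
  shows "cmod (\<Sum>i\<in>UNIV. \<Sum>j\<in>UNIV. \<Sum>l<n. \<Sum>m<n. prod2 i j l m * (complex_of_real (M $ i $ j) * (cnj (v l) * v m)))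
    \<le> real CARD('d) * (opnorm M * (\<Sum>k<n. (cmod (v k))\<^sup>2))"
proof -
  let ?V = "\<Sum>k<n. (cmod (v k))\<^sup>2"
  have one: "cmod (\<Sum>j\<in>UNIV. \<Sum>l<n. \<Sum>m<n. prod2 i j l m * (complex_of_real (M $ i $ j) * (cnj (v l) * v m))) \<le> opnorm M * ?V" for i
  proof -
    define p where "p k = (\<Sum>l<n. a i k l * v l)" for k
    have p: "p k = cliff (\<lambda>j. if j = i then 1 else 0) v k" for k
    proof -
      have "cliff (\<lambda>j. if j = i then 1 else 0) v k = (\<Sum>j\<in>UNIV. if j = i then (\<Sum>l<n. a i k l * v l) else 0)"
        unfolding cliff_def by (rule sum.cong) auto
      then show ?thesis by (simp add: p_def)
    qed
    have "(\<Sum>j\<in>UNIV. \<Sum>l<n. \<Sum>m<n. prod2 i j l m * (complex_of_real (M $ i $ j) * (cnj (v l) * v m)))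
        = (\<Sum>k<n. cnj (p k) * cliff (\<lambda>j. M $ i $ j) v k)"
      unfolding p_def cliff_def sum_cnj_mult_one by (simp only: mult_ac)
    also have "cmod \<dots> \<le> sqrt (\<Sum>k<n. (cmod (p k))\<^sup>2) * sqrt (\<Sum>k<n. (cmod (cliff (\<lambda>j. M $ i $ j) v k))\<^sup>2)"
      by (rule cmod_sum_cnj_le)
    also have "(\<Sum>k<n. (cmod (p k))\<^sup>2) = ?V"
    proof -
      have "(\<Sum>j\<in>UNIV. (if j = i then 1 else 0)\<^sup>2) = (\<Sum>j\<in>UNIV. if j = i then 1 else (0 :: real))"
        by (rule sum.cong) auto
      then show ?thesis unfolding p cliff_isometry by simp
    qed
    also have "(\<Sum>k<n. (cmod (cliff (\<lambda>j. M $ i $ j) v k))\<^sup>2) = (norm (M $ i))\<^sup>2 * ?V"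
      unfolding cliff_isometry norm_sq_eq_sum by (simp only: power2_eq_square)
    also have "sqrt ?V * sqrt ((norm (M $ i))\<^sup>2 * ?V) = norm (M $ i) * ?V"
      using sum_nonneg[of "{..<n}" "\<lambda>k. (cmod (v k))\<^sup>2"] by (simp add: real_sqrt_mult)
    also have "\<dots> \<le> opnorm M * ?V" by (intro mult_right_mono norm_row_le_opnorm sum_nonneg) auto
    finally show ?thesis .
  qed
  have "cmod (\<Sum>i\<in>UNIV. \<Sum>j\<in>UNIV. \<Sum>l<n. \<Sum>m<n. prod2 i j l m * (complex_of_real (M $ i $ j) * (cnj (v l) * v m)))
      \<le> (\<Sum>i\<in>(UNIV :: 'd set). opnorm M * ?V)"
    by (rule order_trans[OF norm_sum]) (intro sum_mono one)
  then show ?thesis by simp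
qed

end

section \<open>The Dirac operator with a magnetic field\<close>

lemma AE_neq_0: "AE x in lebesgue. x \<noteq> (0 :: real ^ 'd::finite)"
  by (rule AE_I'[of "{0}"]) auto

lemma real_one_pos: "0 < (1 :: real)"
  by simp

lemma sum_nonneg_le_0:
  assumes "finite I" "\<And>i. i \<in> I \<Longrightarrow> (0::real) \<le> f i" "sum f I \<le> 0" "i \<in> I"
  shows "f i = 0"
  using sum_nonneg_eq_0_iff[OF assms(1,2)] sum_nonneg[of I f] assms by force

lemma ip_weight_tendsto:
  assumes f: "L2 f" "L2 g" and m: "\<And>i. b i \<in> borel_measurable lebesgue"
    and C: "\<And>i x. \<bar>b i x\<bar> \<le> C" and l: "\<And>x. (\<lambda>i. b i x) \<longlonglongrightarrow> b0 x"
  shows "(\<lambda>i. ip (b i) f g) \<longlonglongrightarrow> ip b0 f g"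
  unfolding ip_def
proof (rule integral_dominated_convergence[where w = "\<lambda>x. C * (cmod (f x) * cmod (g x))"])
  have b: "bounded_weight (b i)" for i unfolding bounded_weight_def using m C by blast
  have b0: "bounded_weight b0"
    unfolding bounded_weight_def
  proof
    show "b0 \<in> borel_measurable lebesgue" by (rule borel_measurable_LIMSEQ_real[OF l m])
    have "\<bar>b0 x\<bar> \<le> C" for x
      by (rule LIMSEQ_le_const2[OF tendsto_rabs[OF l]]) (use C in blast)
    then show "\<exists>C. \<forall>x. \<bar>b0 x\<bar> \<le> C" by blast
  qed
  show "(\<lambda>x. complex_of_real (b0 x) * cnj (f x) * g x) \<in> borel_measurable lebesgue"
    by (rule borel_measurable_integrable[OF ip_integrable[OF b0 f]])
  show "(\<lambda>x. complex_of_real (b i x) * cnj (f x) * g x) \<in> borel_measurable lebesgue" for i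
    by (rule borel_measurable_integrable[OF ip_integrable[OF b f]])
  show "integrable lebesgue (\<lambda>x. C * (cmod (f x) * cmod (g x)))"
    using integrable_norm[OF L2_mult_integrable[OF f]] by (simp add: norm_mult)
  show "AE x in lebesgue. (\<lambda>i. complex_of_real (b i x) * cnj (f x) * g x) \<longlonglongrightarrow> complex_of_real (b0 x) * cnj (f x) * g x"
    by (intro AE_I2 tendsto_intros l)
  show "AE x in lebesgue. cmod (complex_of_real (b i x) * cnj (f x) * g x) \<le> C * (cmod (f x) * cmod (g x))" for i
    unfolding norm_mult norm_of_real complex_mod_cnj mult.assoc by (intro AE_I2 mult_right_mono C) auto
qed

text \<open>The number \<open>h\<close> is the constant of Hardy's inequality, \<open>2 / (d - 2)\<close> in the application.\<close>

locale magnetic_dirac = dirac_coefficients n a s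
  for n :: nat and a :: "'d::finite \<Rightarrow> nat \<Rightarrow> nat \<Rightarrow> complex" and s :: "nat \<Rightarrow> real" +
  fixes A :: "real ^ 'd \<Rightarrow> real ^ 'd" and B :: "real ^ 'd \<Rightarrow> real ^ 'd ^ 'd" and c h :: real
  assumes A: "Lp_loc 2 A" and B: "magnetic_field A B"
    and field: "form_bounded A (\<lambda>x. norm x * opnorm (B x)) 0 (c\<^sup>2)"
    and hardy: "form_bounded A (\<lambda>x. inverse (norm x)) 0 (h\<^sup>2)"
    and c: "c \<ge> 0" and h: "h \<ge> 0"
begin

lemma B_measurable: "B \<in> borel_measurable lebesgue"
  using B by (auto simp: magnetic_field_def Lp_loc_def)

lemma B_entry_measurable: "(\<lambda>x. B x $ i $ j) \<in> borel_measurable lebesgue"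
  by (rule measurable_compose[OF B_measurable borel_measurable_continuous_onI]) (intro continuous_intros)

text \<open>The operator \<open>\<Sum>\<^sub>j \<alpha>\<^sub>j (\<partial>\<^sub>j + i A\<^sub>j)\<close> in terms of a given magnetic gradient \<open>w\<close>.\<close>

definition alpha_grad :: "(nat \<Rightarrow> 'd \<Rightarrow> real ^ 'd \<Rightarrow> complex) \<Rightarrow> nat \<Rightarrow> real ^ 'd \<Rightarrow> complex" where
  "alpha_grad w k x = (\<Sum>j\<in>UNIV. \<Sum>l<n. a j k l * w l j x)"

lemma alpha_grad_L2: assumes "\<And>l j. l < n \<Longrightarrow> L2 (w l j)" shows "L2 (alpha_grad w k)"
  unfolding alpha_grad_def[abs_def] by (intro L2_sum L2_cmult assms) auto

lemma ip_alpha_grad_right: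
  assumes b: "bounded_weight b" and f: "L2 f" and w: "\<And>l j. l < n \<Longrightarrow> L2 (w l j)"
  shows "ip b f (alpha_grad w k) = (\<Sum>j\<in>UNIV. \<Sum>l<n. a j k l * ip b f (w l j))"
proof -
  have "has_bochner_integral lebesgue (\<lambda>x. \<Sum>j\<in>UNIV. \<Sum>l<n. a j k l * (complex_of_real (b x) * cnj (f x) * w l j x))
      (\<Sum>j\<in>UNIV. \<Sum>l<n. a j k l * ip b f (w l j))"
    unfolding ip_def
    by (intro has_bochner_integral_sum has_bochner_integral_mult_right has_bochner_integral_integrable ip_integrable b f w) auto
  moreover have "(\<lambda>x. \<Sum>j\<in>UNIV. \<Sum>l<n. a j k l * (complex_of_real (b x) * cnj (f x) * w l j x))
      = (\<lambda>x. complex_of_real (b x) * cnj (f x) * alpha_grad w k x)"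
    by (simp add: alpha_grad_def sum_distrib_left mult_ac)
  ultimately show ?thesis unfolding ip_def[of b f "alpha_grad w k"] by (simp only: has_bochner_integral_integral_eq)
qed

lemma ip_alpha_grad_left:
  assumes b: "bounded_weight b" and f: "L2 f" and w: "\<And>l j. l < n \<Longrightarrow> L2 (w l j)" and k: "k < n"
  shows "ip b (alpha_grad w k) f = (\<Sum>j\<in>UNIV. \<Sum>l<n. a j l k * ip b (w l j) f)"
proof -
  have "ip b (alpha_grad w k) f = cnj (ip b f (alpha_grad w k))" by (rule ip_cnj[symmetric])
  also have "\<dots> = cnj (\<Sum>j\<in>UNIV. \<Sum>l<n. a j k l * ip b f (w l j))" by (simp only: ip_alpha_grad_right[OF b f w])
  also have "\<dots> = (\<Sum>j\<in>UNIV. \<Sum>l<n. a j l k * ip b (w l j) f)"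
    unfolding cnj_sum complex_cnj_mult ip_cnj
    by (intro sum.cong[OF refl]) (use k in \<open>simp add: hermitian\<close>)
  finally show ?thesis .
qed

lemma integral_sum_prod2:
  assumes "\<And>i j l m. l < n \<Longrightarrow> m < n \<Longrightarrow> integrable lebesgue (F i j l m)"
  shows "(LINT x|lebesgue. (\<Sum>i\<in>UNIV. \<Sum>j\<in>UNIV. \<Sum>l<n. \<Sum>m<n. prod2 i j l m * F i j l m x))
      = (\<Sum>i\<in>UNIV. \<Sum>j\<in>UNIV. \<Sum>l<n. \<Sum>m<n. prod2 i j l m * (LINT x|lebesgue. F i j l m x))"
    "integrable lebesgue (\<lambda>x. \<Sum>i\<in>UNIV. \<Sum>j\<in>UNIV. \<Sum>l<n. \<Sum>m<n. prod2 i j l m * F i j l m x)"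
proof -
  have H: "has_bochner_integral lebesgue (\<lambda>x. \<Sum>i\<in>UNIV. \<Sum>j\<in>UNIV. \<Sum>l<n. \<Sum>m<n. prod2 i j l m * F i j l m x)
      (\<Sum>i\<in>UNIV. \<Sum>j\<in>UNIV. \<Sum>l<n. \<Sum>m<n. prod2 i j l m * (LINT x|lebesgue. F i j l m x))"
    by (intro has_bochner_integral_sum has_bochner_integral_mult_right has_bochner_integral_integrable assms) auto
  show "(LINT x|lebesgue. (\<Sum>i\<in>UNIV. \<Sum>j\<in>UNIV. \<Sum>l<n. \<Sum>m<n. prod2 i j l m * F i j l m x))
      = (\<Sum>i\<in>UNIV. \<Sum>j\<in>UNIV. \<Sum>l<n. \<Sum>m<n. prod2 i j l m * (LINT x|lebesgue. F i j l m x))"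
    by (rule has_bochner_integral_integral_eq[OF H])
  show "integrable lebesgue (\<lambda>x. \<Sum>i\<in>UNIV. \<Sum>j\<in>UNIV. \<Sum>l<n. \<Sum>m<n. prod2 i j l m * F i j l m x)"
    using H by (rule integrable.intros)
qed

text \<open>The Cauchy-Schwarz inequality for \<open>r \<bar>B\<bar> f\<close> and \<open>f / r\<close>.\<close>

lemma field_integral_le:
  assumes u: "magH1 A f w"
  shows "integrable lebesgue (\<lambda>x. opnorm (B x) * (cmod (f x))\<^sup>2)"
    "(LINT x|lebesgue. opnorm (B x) * (cmod (f x))\<^sup>2) \<le> c * h * (\<Sum>j\<in>UNIV. sqint (w j))"
proof -
  let ?p = "\<lambda>x. complex_of_real (norm x * opnorm (B x)) * f x"
  let ?q = "\<lambda>x. complex_of_real (inverse (norm x)) * f x"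
  let ?S = "\<Sum>j\<in>UNIV. sqint (w j)"
  have S: "?S \<ge> 0" by (intro sum_nonneg sqint_nonneg)
  note p = form_bounded_L2[OF A field u] and q = form_bounded_L2[OF A hardy u]
  have i: "integrable lebesgue (\<lambda>x. cmod (?p x) * cmod (?q x))"
    using integrable_norm[OF L2_mult_integrable[OF p(1) q(1)]] by (simp only: norm_mult)
  have mf: "f \<in> borel_measurable lebesgue" using u by (auto simp: magH1_def L2_def)
  have m: "(\<lambda>x. opnorm (B x) * (cmod (f x))\<^sup>2) \<in> borel_measurable lebesgue"
    using mf opnorm_measurable[OF B_measurable] by measurable
  have eq: "AE x in lebesgue. cmod (?p x) * cmod (?q x) = opnorm (B x) * (cmod (f x))\<^sup>2"
    using AE_neq_0
    by eventually_elim (simp add: norm_mult norm_inverse opnorm_nonneg power2_eq_square)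
  show "integrable lebesgue (\<lambda>x. opnorm (B x) * (cmod (f x))\<^sup>2)"
    by (rule integrable_cong_AE_imp[OF i m eq])
  have "(LINT x|lebesgue. opnorm (B x) * (cmod (f x))\<^sup>2) = (LINT x|lebesgue. cmod (?p x) * cmod (?q x))"
    by (rule integral_cong_AE[OF m borel_measurable_integrable[OF i]]) (use eq in \<open>eventually_elim, simp\<close>)
  also have "\<dots> \<le> sqrt (sqint ?p) * sqrt (sqint ?q)" by (rule L2_Cauchy_Schwarz_norm[OF p(1) q(1)])
  also have "\<dots> \<le> sqrt (c\<^sup>2 * ?S) * sqrt (h\<^sup>2 * ?S)"
    using p(2) q(2) S by (intro mult_mono real_sqrt_le_mono) (auto simp: sqint_nonneg)
  also have "\<dots> = c * h * ?S"
    using c h S by (simp add: real_sqrt_mult)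
  finally show "(LINT x|lebesgue. opnorm (B x) * (cmod (f x))\<^sup>2) \<le> c * h * ?S" .
qed

text \<open>After antisymmetrisation the quadratic form of \<open>D\<close> is that of \<open>\<nabla>\<^sub>A\<close> plus half the sum of the commutators of
  its components, which are given by \<open>B\<close>.\<close>

lemma coercivity:
  assumes u: "\<And>k. k < n \<Longrightarrow> magH1 A (f k) (w k)"
  shows "(1 - real CARD('d) / 2 * (c * h)) * (\<Sum>k<n. \<Sum>j\<in>UNIV. sqint (w k j)) \<le> (\<Sum>k<n. sqint (alpha_grad w k))"
proof -
  let ?S = "\<Sum>k<n. \<Sum>j\<in>UNIV. sqint (w k j)"
  have Lw: "L2 (w l j)" if "l < n" for l j using u[OF that] by (auto simp: magH1_def)
  define W where "W i j l m = ip (\<lambda>x. 1) (w l i) (w m j)" for i j l m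
  define E where "E = (\<lambda>i j l m x. complex_of_real (B x $ i $ j) * (cnj (f l x) * f m x))"
  define Q where "Q = (\<lambda>x. \<Sum>i\<in>UNIV. \<Sum>j\<in>UNIV. \<Sum>l<n. \<Sum>m<n. prod2 i j l m * E i j l m x)"
  have com: "W i j l m - W j i l m = - \<i> * (LINT x|lebesgue. E i j l m x)" "integrable lebesgue (E i j l m)"
    if "l < n" "m < n" for i j l m
  proof -
    have sm: "smooth (\<lambda>x :: real ^ 'd. 1 :: real)" by (intro allI Ck_const)
    have f1: "form_bounded A (\<lambda>x. norm x * B x $ i $ j) 0 (c\<^sup>2)"
    proof (rule form_bounded_mono[OF field])
      show "(\<lambda>x. norm x * B x $ i $ j) \<in> borel_measurable lebesgue"
        by (intro borel_measurable_times B_entry_measurable continuous_measurable_lebesgue continuous_intros)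
      show "\<bar>norm x * B x $ i $ j\<bar> \<le> \<bar>norm x * opnorm (B x)\<bar>" for x
        by (simp add: abs_mult opnorm_nonneg mult_left_mono abs_entry_le_opnorm)
    qed
    have ae: "AE x in lebesgue. 1 * B x $ i $ j = (norm x * B x $ i $ j) * inverse (norm x)"
      using AE_neq_0 by eventually_elim simp
    note m = magnetic_commutator[OF A B u[OF that(1)] u[OF that(2)] sm, where j = i and k = j and C = 1, OF _ _ _ f1 hardy ae]
    show "W i j l m - W j i l m = - \<i> * (LINT x|lebesgue. E i j l m x)"
      using m(1) by (simp add: W_def ip_def E_def)
    show "integrable lebesgue (E i j l m)"
      using m(2) by (simp add: E_def)
  qed
  have Qi: "(LINT x|lebesgue. Q x) = (\<Sum>i\<in>UNIV. \<Sum>j\<in>UNIV. \<Sum>l<n. \<Sum>m<n. prod2 i j l m * (LINT x|lebesgue. E i j l m x))"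
    "integrable lebesgue Q"
    unfolding Q_def by (rule integral_sum_prod2[OF com(2)]; assumption)+
  have "complex_of_real (\<Sum>k<n. sqint (alpha_grad w k)) = (\<Sum>k<n. LINT x|lebesgue. cnj (alpha_grad w k x) * alpha_grad w k x)"
    unfolding of_real_sum sqint_eq_integral_cnj ..
  also have "\<dots> = (LINT x|lebesgue. (\<Sum>k<n. cnj (alpha_grad w k x) * alpha_grad w k x))"
    by (rule Bochner_Integration.integral_sum[symmetric]) (intro L2_cnj_mult_integrable alpha_grad_L2 Lw)
  also have "\<dots> = (LINT x|lebesgue. (\<Sum>i\<in>UNIV. \<Sum>j\<in>UNIV. \<Sum>l<n. \<Sum>m<n. prod2 i j l m * (cnj (w l i x) * w m j x)))"
    unfolding alpha_grad_def sum_cnj_mult[of "\<lambda>i l. w l i x" "\<lambda>j m. w m j x" for x] ..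
  also have "\<dots> = (\<Sum>i\<in>UNIV. \<Sum>j\<in>UNIV. \<Sum>l<n. \<Sum>m<n. prod2 i j l m * W i j l m)"
    unfolding W_def ip_def of_real_1 mult_1_left
    by (rule integral_sum_prod2(1)) (intro L2_cnj_mult_integrable Lw)
  also have "\<dots> = (\<Sum>i\<in>UNIV. \<Sum>j\<in>UNIV. \<Sum>l<n. \<Sum>m<n. prod2 i j l m * (W i j l m - W j i l m)) / 2
      + (\<Sum>i\<in>UNIV. \<Sum>l<n. W i i l l)"
    by (rule sum_prod2_antisymmetrise)
  also have "(\<Sum>i\<in>UNIV. \<Sum>l<n. W i i l l) = complex_of_real ?S"
    unfolding W_def ip_self of_real_sum by (rule sum.swap)
  also have "(\<Sum>i\<in>UNIV. \<Sum>j\<in>UNIV. \<Sum>l<n. \<Sum>m<n. prod2 i j l m * (W i j l m - W j i l m))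
      = (\<Sum>i\<in>UNIV. \<Sum>j\<in>UNIV. \<Sum>l<n. \<Sum>m<n. - \<i> * (prod2 i j l m * (LINT x|lebesgue. E i j l m x)))"
    by (intro sum.cong[OF refl]) (simp add: com(1))
  also have "\<dots> = - \<i> * (LINT x|lebesgue. Q x)"
    unfolding Qi(1) by (simp only: sum_distrib_left)
  finally have id: "complex_of_real (\<Sum>k<n. sqint (alpha_grad w k)) = - \<i> * (LINT x|lebesgue. Q x) / 2 + complex_of_real ?S" .
  have fi1: "integrable lebesgue (\<lambda>x. opnorm (B x) * (cmod (f k x))\<^sup>2)" if "k < n" for k
    by (rule field_integral_le(1)[OF u[OF that]])
  have fi: "integrable lebesgue (\<lambda>x. \<Sum>k<n. opnorm (B x) * (cmod (f k x))\<^sup>2)"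
    by (intro Bochner_Integration.integrable_sum fi1) auto
  have "cmod (LINT x|lebesgue. Q x) \<le> (LINT x|lebesgue. cmod (Q x))"
    by (rule integral_norm_bound)
  also have "\<dots> \<le> (LINT x|lebesgue. real CARD('d) * (\<Sum>k<n. opnorm (B x) * (cmod (f k x))\<^sup>2))"
  proof (rule integral_mono)
    show "integrable lebesgue (\<lambda>x. cmod (Q x))" by (rule integrable_norm[OF Qi(2)])
    show "integrable lebesgue (\<lambda>x. real CARD('d) * (\<Sum>k<n. opnorm (B x) * (cmod (f k x))\<^sup>2))"
      by (intro integrable_mult_right fi)
    show "cmod (Q x) \<le> real CARD('d) * (\<Sum>k<n. opnorm (B x) * (cmod (f k x))\<^sup>2)" for x
      unfolding Q_def E_def sum_distrib_left[symmetric, of "opnorm (B x)"] by (rule cliff_commutator_bound)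
  qed
  also have "\<dots> = real CARD('d) * (\<Sum>k<n. LINT x|lebesgue. opnorm (B x) * (cmod (f k x))\<^sup>2)"
    by (simp add: Bochner_Integration.integral_sum fi1)
  also have "\<dots> \<le> real CARD('d) * (\<Sum>k<n. c * h * (\<Sum>j\<in>UNIV. sqint (w k j)))"
    by (intro mult_left_mono sum_mono field_integral_le u) auto
  also have "\<dots> = real CARD('d) * (c * h) * ?S" by (simp only: sum_distrib_left[symmetric] mult.assoc)
  finally have Q: "cmod (LINT x|lebesgue. Q x) \<le> real CARD('d) * (c * h) * ?S" .
  have "Re (complex_of_real (\<Sum>k<n. sqint (alpha_grad w k))) = ?S + Re (- \<i> * (LINT x|lebesgue. Q x) / 2)"
    unfolding id by simp
  moreover have "\<bar>Re (- \<i> * (LINT x|lebesgue. Q x) / 2)\<bar> \<le> cmod (LINT x|lebesgue. Q x) / 2"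
    using abs_Re_le_cmod[of "- \<i> * (LINT x|lebesgue. Q x) / 2"] by (simp add: norm_mult norm_divide)
  ultimately have "?S - cmod (LINT x|lebesgue. Q x) / 2 \<le> (\<Sum>k<n. sqint (alpha_grad w k))"
    unfolding Re_complex_of_real by linarith
  then show ?thesis using Q by (simp add: algebra_simps)
qed

lemma magH1_zero: "magH1 A (\<lambda>x. 0) (\<lambda>j x. 0)"
  by (simp add: magH1_def weak_magnetic_pderiv_def Lp_loc_def L2_zero)

lemma vanish_of_gradient_zero:
  assumes u: "magH1 A f w" and S: "(\<Sum>j\<in>UNIV. sqint (w j)) = 0"
  shows "AE x in lebesgue. f x = 0"
proof -
  note q = form_bounded_L2[OF A hardy u]
  have "sqint (\<lambda>x. complex_of_real (inverse (norm x)) * f x) = 0"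
    using q(2) S sqint_nonneg[of "\<lambda>x. complex_of_real (inverse (norm x)) * f x"] by simp
  then have "AE x in lebesgue. (cmod (complex_of_real (inverse (norm x)) * f x))\<^sup>2 = 0"
    unfolding sqint_def using integral_nonneg_eq_0_iff_AE[OF L2_integrable[OF q(1)]] by simp
  with AE_neq_0 show ?thesis by eventually_elim simp
qed

end

text \<open>The eigenvalue equation \<open>- i D u + \<beta> u / 2 = z u\<close>, solved for \<open>D u\<close>.\<close>

locale dirac_eigenfunction = magnetic_dirac n a s A B c h
  for n :: nat and a :: "'d::finite \<Rightarrow> nat \<Rightarrow> nat \<Rightarrow> complex" and s :: "nat \<Rightarrow> real"
    and A :: "real ^ 'd \<Rightarrow> real ^ 'd" and B :: "real ^ 'd \<Rightarrow> real ^ 'd ^ 'd" and c h :: real +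
  fixes f :: "nat \<Rightarrow> real ^ 'd \<Rightarrow> complex" and w :: "nat \<Rightarrow> 'd \<Rightarrow> real ^ 'd \<Rightarrow> complex" and z :: complex
  assumes u: "\<And>k. k < n \<Longrightarrow> magH1 A (f k) (w k)"
    and eigen: "\<And>k. k < n \<Longrightarrow> AE x in lebesgue. alpha_grad w k x = \<i> * (z - complex_of_real (s k) / 2) * f k x"
begin

definition M :: "nat \<Rightarrow> complex" where "M k = z - complex_of_real (s k) / 2"

text \<open>The sums \<open>N t\<close> and \<open>S t\<close> are the squared norms of \<open>v\<close> and of \<open>\<nabla>\<^sub>A v\<close>, where \<open>v\<close> is the part of the eigenfunction
  on which \<open>\<beta>\<close> equals \<open>t\<close>.\<close>

definition N :: "real \<Rightarrow> real" where "N t = (\<Sum>k<n. if s k = t then sqint (f k) else 0)"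

definition S :: "real \<Rightarrow> real" where "S t = (\<Sum>k<n. if s k = t then (\<Sum>j\<in>UNIV. sqint (w k j)) else 0)"

lemma Lw: "k < n \<Longrightarrow> L2 (w k j)" and Lf: "k < n \<Longrightarrow> L2 (f k)"
  using u[of k] by (auto simp: magH1_def)

lemma LD: "L2 (alpha_grad w k)"
  by (rule alpha_grad_L2) (rule Lw)

lemma ip_D_right:
  assumes b: "bounded_weight b" and g: "L2 g" and k: "k < n"
  shows "ip b g (alpha_grad w k) = \<i> * M k * ip b g (f k)"
proof -
  have "ip b g (alpha_grad w k) = ip b g (\<lambda>x. \<i> * M k * f k x)"
    by (rule ip_cong_AE_right[OF eigen[OF k, folded M_def] b g LD L2_cmult[OF Lf[OF k]]])
  then show ?thesis by (simp only: ip_scale_right)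
qed

lemma ip_D_left:
  assumes b: "bounded_weight b" and g: "L2 g" and k: "k < n"
  shows "ip b (alpha_grad w k) g = cnj (\<i> * M k) * ip b (f k) g"
proof -
  have "ip b (alpha_grad w k) g = cnj (ip b g (alpha_grad w k))" by (rule ip_cnj[symmetric])
  then show ?thesis by (simp only: ip_D_right[OF b g k] complex_cnj_mult ip_cnj)
qed

text \<open>Both sides are, up to the factor \<open>i\<close>, the scalar product of the lower part with \<open>D\<close> of the upper part, with
  \<open>D\<close> moved to either factor.\<close>

lemma symmetric_relation: "(z + 1 / 2) * complex_of_real (N (- 1)) = (cnj z - 1 / 2) * complex_of_real (N 1)"
proof -
  define d where "d t k = (if s k = t then 1 else 0 :: complex)" for t k
  have b1: "bounded_weight (\<lambda>x :: real ^ 'd. 1)" by (rule bounded_weight_const)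
  have flip: "d (- 1) k * (a j k l * ip (\<lambda>x. 1) (f k) (w l j)) = - (d 1 l * (a j k l * ip (\<lambda>x. 1) (w k j) (f l)))"
    if kl: "k < n" "l < n" for j k l
  proof -
    have sm: "smooth (\<lambda>x :: real ^ 'd. 1 :: real)" by (intro allI Ck_const)
    have "ip (\<lambda>x. 1) (w k j) (f l) + ip (\<lambda>x. 1) (f k) (w l j) = 0"
      using magnetic_pderiv_by_parts[OF A u[OF kl(1)] u[OF kl(2)] sm, where C = 1 and j = j] by (simp add: ip_def)
    then have e: "ip (\<lambda>x. 1) (f k) (w l j) = - ip (\<lambda>x. 1) (w k j) (f l)" by (simp add: eq_neg_iff_add_eq_0 add.commute)
    show ?thesis
    proof (cases "a j k l = 0")
      case False
      then have "d (- 1) k = d 1 l" using offdiagonal[OF kl] by (auto simp: d_def)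
      then show ?thesis by (simp add: e)
    qed simp
  qed
  have r: "(\<Sum>k<n. d t k * (g (s k) * complex_of_real (sqint (f k)))) = g t * complex_of_real (N t)" for t and g :: "real \<Rightarrow> complex"
    unfolding N_def of_real_sum sum_distrib_left by (rule sum.cong) (auto simp: d_def)
  have "(\<Sum>k<n. d (- 1) k * ip (\<lambda>x. 1) (f k) (alpha_grad w k))
      = (\<Sum>k<n. \<Sum>j\<in>UNIV. \<Sum>l<n. d (- 1) k * (a j k l * ip (\<lambda>x. 1) (f k) (w l j)))"
    by (intro sum.cong[OF refl]) (simp add: ip_alpha_grad_right[OF b1 Lf Lw] sum_distrib_left)
  also have "\<dots> = (\<Sum>k<n. \<Sum>j\<in>UNIV. \<Sum>l<n. - (d 1 l * (a j k l * ip (\<lambda>x. 1) (w k j) (f l))))"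
    by (intro sum.cong[OF refl] flip) auto
  also have "\<dots> = (\<Sum>j\<in>UNIV. \<Sum>l<n. \<Sum>k<n. - (d 1 l * (a j k l * ip (\<lambda>x. 1) (w k j) (f l))))"
    by (rule sum_rotate)
  also have "\<dots> = (\<Sum>l<n. \<Sum>j\<in>UNIV. \<Sum>k<n. - (d 1 l * (a j k l * ip (\<lambda>x. 1) (w k j) (f l))))"
    by (rule sum.swap)
  also have "\<dots> = - (\<Sum>l<n. d 1 l * ip (\<lambda>x. 1) (alpha_grad w l) (f l))"
    unfolding sum_negf[symmetric]
    by (intro sum.cong[OF refl]) (simp add: ip_alpha_grad_left[OF b1 Lf Lw] sum_distrib_left sum_negf)
  finally have "(\<Sum>k<n. d (- 1) k * ip (\<lambda>x. 1) (f k) (alpha_grad w k)) = - (\<Sum>l<n. d 1 l * ip (\<lambda>x. 1) (alpha_grad w l) (f l))" .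
  moreover have "(\<Sum>k<n. d (- 1) k * ip (\<lambda>x. 1) (f k) (alpha_grad w k))
      = (\<Sum>k<n. d (- 1) k * (\<i> * (z - complex_of_real (s k) / 2) * complex_of_real (sqint (f k))))"
    by (intro sum.cong[OF refl]) (simp add: ip_D_right[OF b1 Lf] ip_self M_def)
  moreover have "(\<Sum>k<n. d 1 k * ip (\<lambda>x. 1) (alpha_grad w k) (f k))
      = (\<Sum>k<n. d 1 k * (cnj (\<i> * (z - complex_of_real (s k) / 2)) * complex_of_real (sqint (f k))))"
    by (intro sum.cong[OF refl]) (simp add: ip_D_left[OF b1 Lf] ip_self M_def)
  ultimately have "\<i> * (z - complex_of_real (- 1) / 2) * complex_of_real (N (- 1)) = - (cnj (\<i> * (z - complex_of_real 1 / 2)) * complex_of_real (N 1))"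
    by (simp only: r[of _ "\<lambda>y. \<i> * (z - complex_of_real y / 2)"] r[of _ "\<lambda>y. cnj (\<i> * (z - complex_of_real y / 2))"])
  then have "\<i> * ((z + 1 / 2) * complex_of_real (N (- 1))) = \<i> * ((cnj z - 1 / 2) * complex_of_real (N 1))"
    by (simp add: algebra_simps)
  then show ?thesis by simp
qed

lemma N_sum: "N 1 + N (- 1) = (\<Sum>k<n. sqint (f k))"
  unfolding N_def sum.distrib[symmetric]
proof (rule sum.cong[OF refl])
  show "(if s k = 1 then sqint (f k) else 0) + (if s k = - 1 then sqint (f k) else 0) = sqint (f k)" for k
    using sign[of k] by auto
qed

lemma N_nonneg: "N t \<ge> 0" and S_nonneg: "S t \<ge> 0"
  unfolding N_def S_def by (auto intro!: sum_nonneg simp: sqint_nonneg)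

lemma eigenvalue_real:
  assumes "N 1 + N (- 1) \<noteq> 0"
  shows "Im z = 0"
proof -
  have "Im ((z + 1 / 2) * complex_of_real (N (- 1))) = Im ((cnj z - 1 / 2) * complex_of_real (N 1))"
    by (simp only: symmetric_relation)
  then have "Im z * (N 1 + N (- 1)) = 0" by (simp add: algebra_simps)
  then show ?thesis using assms by simp
qed

text \<open>The part with \<open>\<beta> = t\<close>, extended by zero, lies in the magnetic Sobolev space, and \<open>D\<close> maps it to the other half,
  where the eigenvalue equation evaluates it.\<close>

lemma part_coercivity:
  assumes t: "t = 1 \<or> t = - 1"
  shows "(1 - real CARD('d) / 2 * (c * h)) * S t \<le> (cmod (z + complex_of_real t / 2))\<^sup>2 * N (- t)"
proof -
  define g where "g k = (if s k = t then f k else (\<lambda>x. 0))" for k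
  define y where "y k = (if s k = t then w k else (\<lambda>j x. 0))" for k
  have gy: "magH1 A (g k) (y k)" if "k < n" for k
    using u[OF that] magH1_zero by (simp add: g_def y_def)
  have D: "sqint (alpha_grad y k) \<le> (if s k = - t then (cmod (z + complex_of_real t / 2))\<^sup>2 * sqint (f k) else 0)" if k: "k < n" for k
  proof (cases "s k = - t")
    case True
    have "alpha_grad y k x = alpha_grad w k x" for x
      unfolding alpha_grad_def
    proof (intro sum.cong[OF refl])
      show "a j k l * y l j x = a j k l * w l j x" if "l \<in> {..<n}" for j l
        using offdiagonal[OF k, of l j] that True by (cases "a j k l = 0") (auto simp: y_def)
    qed
    then have "alpha_grad y k = alpha_grad w k" by (rule ext)
    moreover have "sqint (alpha_grad w k) = sqint (\<lambda>x. \<i> * M k * f k x)"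
      by (rule sqint_cong_AE[OF LD L2_cmult[OF Lf[OF k]] eigen[OF k, folded M_def]])
    ultimately show ?thesis using True by (simp add: sqint_cmult norm_mult M_def)
  next
    case False
    then have st: "s k = t" using sign[of k] t by auto
    have "alpha_grad y k x = 0" for x
      unfolding alpha_grad_def
    proof (intro sum.neutral ballI)
      show "a j k l * y l j x = 0" if "l \<in> {..<n}" for j l
        using offdiagonal[OF k, of l j] that st t by (cases "a j k l = 0") (auto simp: y_def)
    qed
    then show ?thesis using False by (simp add: sqint_def)
  qed
  have St: "S t = (\<Sum>k<n. \<Sum>j\<in>UNIV. sqint (y k j))"
    unfolding S_def by (rule sum.cong) (auto simp: y_def sqint_def)
  have "(\<Sum>k<n. sqint (alpha_grad y k)) \<le> (\<Sum>k<n. if s k = - t then (cmod (z + complex_of_real t / 2))\<^sup>2 * sqint (f k) else 0)"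
    by (intro sum_mono D) simp
  also have "\<dots> = (cmod (z + complex_of_real t / 2))\<^sup>2 * N (- t)"
    unfolding N_def sum_distrib_left by (rule sum.cong) auto
  finally show ?thesis using coercivity[of g y, OF gy] unfolding St by linarith
qed

lemma part_vanishes:
  assumes "S t = 0"
  shows "N t = 0"
  unfolding N_def
proof (intro sum.neutral ballI)
  fix k assume "k \<in> {..<n}"
  then have k: "k < n" by simp
  show "(if s k = t then sqint (f k) else 0) = 0"
  proof (cases "s k = t")
    case True
    have "(if s k = t then (\<Sum>j\<in>UNIV. sqint (w k j)) else 0) = 0"
      by (rule sum_nonneg_le_0[of "{..<n}"]) (use assms k in \<open>auto simp: S_def intro!: sum_nonneg sqint_nonneg\<close>)
    then have ae: "AE x in lebesgue. f k x = 0" using True by (intro vanish_of_gradient_zero[OF u[OF k]]) simp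
    have "sqint (f k) = sqint (\<lambda>x :: real ^ 'd. 0)" by (rule sqint_cong_AE[OF Lf[OF k] L2_zero ae])
    then show ?thesis by (simp add: sqint_def)
  qed simp
qed

lemma sum_reorder: "(\<Sum>k\<in>K. \<Sum>j\<in>J. \<Sum>m\<in>I. \<Sum>l\<in>L. T k j m l) = (\<Sum>l\<in>L. \<Sum>k\<in>K. \<Sum>j\<in>J. \<Sum>m\<in>I. (T k j m l :: complex))"
proof -
  have "(\<Sum>l\<in>L. \<Sum>k\<in>K. \<Sum>j\<in>J. \<Sum>m\<in>I. T k j m l) = (\<Sum>k\<in>K. \<Sum>l\<in>L. \<Sum>j\<in>J. \<Sum>m\<in>I. T k j m l)"
    by (rule sum.swap)
  also have "\<dots> = (\<Sum>k\<in>K. \<Sum>j\<in>J. \<Sum>m\<in>I. \<Sum>l\<in>L. T k j m l)"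
    by (intro sum.cong[OF refl] sum_rotate)
  finally show ?thesis by (rule sym)
qed

text \<open>With \<open>F = x / (1 + \<epsilon> r\<^sup>2)\<close>, the commutator identity for \<open>\<psi> = F\<^sub>l\<close> and the indices \<open>j\<close>, \<open>l\<close> is multiplied by the
  matrix \<open>\<alpha>\<^sub>j\<close> and summed.  In the terms where \<open>\<alpha>\<^sub>j\<close> meets a derivative with index \<open>j\<close>, the sum is \<open>D u = i M u\<close>.
  For real \<open>z\<close> the matrix \<open>M\<close> is Hermitian, and one more integration by parts shows that these terms cancel.\<close>

lemma virial_identity:
  assumes e: "\<epsilon> > 0" and real: "Im z = 0"
  shows "(\<Sum>k<n. \<Sum>j\<in>UNIV. \<Sum>m<n. \<Sum>l\<in>UNIV. a j k m *
        (LINT x|lebesgue. complex_of_real (radial_field 1 \<epsilon> l x * B x $ j $ l) * (cnj (f k x) * f m x)))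
    = \<i> * (\<Sum>k<n. \<Sum>j\<in>UNIV. \<Sum>m<n. \<Sum>l\<in>UNIV. a j k m * ip (pderiv_at j (radial_field 1 \<epsilon> l)) (f k) (w m l))"
    "k < n \<Longrightarrow> m < n \<Longrightarrow> integrable lebesgue (\<lambda>x. complex_of_real (radial_field 1 \<epsilon> l x * B x $ j $ l) * (cnj (f k x) * f m x))"
proof -
  have e0: "\<epsilon> \<ge> 0" using e by simp
  define F where "F = (radial_field 1 \<epsilon> :: 'd \<Rightarrow> real ^ 'd \<Rightarrow> real)"
  have sF: "smooth (F l)" for l unfolding F_def using smooth_radial_field[OF real_one_pos e0] by blast
  define C where "C = 3 + inverse \<epsilon>"
  have FC: "\<bar>F l x\<bar> \<le> C" "\<bar>pderiv_at j (F l) x\<bar> \<le> C" for l j x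
  proof -
    have "inverse \<epsilon> > 0" using e by simp
    moreover have "\<bar>F l x\<bar> \<le> 1 + inverse \<epsilon>" "\<bar>pderiv_at j (F l) x\<bar> \<le> 3"
      using radial_field_bounds[OF real_one_pos e, where x = x and j = l] by (simp_all add: F_def)
    ultimately show "\<bar>F l x\<bar> \<le> C" "\<bar>pderiv_at j (F l) x\<bar> \<le> C"
      unfolding C_def by linarith+
  qed
  have Fx: "\<bar>F l x\<bar> \<le> norm x" for l x
  proof -
    have "\<bar>F l x\<bar> = \<bar>x $ l\<bar> * radial_weight 1 \<epsilon> x"
      using radial_weight_bounds(1)[OF real_one_pos e0, of x] by (simp add: F_def radial_field_def abs_mult)
    also have "\<dots> \<le> norm x * 1"
      using radial_weight_bounds[OF real_one_pos e0, of x] by (intro mult_mono component_le_norm_cart) auto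
    finally show ?thesis by simp
  qed
  have bF: "bounded_weight (F l)" for l
    by (rule bounded_weightI[OF smooth_continuous[OF sF] FC(1)])
  have bdF: "bounded_weight (pderiv_at j (F l))" for j l
    by (rule bounded_weightI[OF smooth_continuous[OF smooth_pderiv[OF sF]] FC(2)])
  \<comment> \<open>The five kinds of terms of the commutator identity, in the order in which they occur there.\<close>
  define X where "X k j m l = ip (F l) (w k j) (w m l)" for k j m l
  define Y where "Y k j m l = ip (F l) (w k l) (w m j)" for k j m l
  define Z where "Z k j m l = (LINT x|lebesgue. complex_of_real (F l x * B x $ j $ l) * (cnj (f k x) * f m x))" for k j m l
  define P where "P k j m l = ip (pderiv_at j (F l)) (f k) (w m l)" for k j m l
  define R where "R k j m l = ip (pderiv_at l (F l)) (f k) (w m j)" for k j m l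
  have com: "X k j m l - Y k j m l = - \<i> * Z k j m l - P k j m l + R k j m l"
    "integrable lebesgue (\<lambda>x. complex_of_real (F l x * B x $ j $ l) * (cnj (f k x) * f m x))"
    if "k < n" "m < n" for k j m l
  proof -
    have f1: "form_bounded A (\<lambda>x. F l x * B x $ j $ l) 0 (c\<^sup>2)"
    proof (rule form_bounded_mono[OF field])
      show "(\<lambda>x. F l x * B x $ j $ l) \<in> borel_measurable lebesgue"
        by (intro borel_measurable_times B_entry_measurable continuous_measurable_lebesgue smooth_continuous[OF sF])
      show "\<bar>F l x * B x $ j $ l\<bar> \<le> \<bar>norm x * opnorm (B x)\<bar>" for x
        unfolding abs_mult abs_norm_cancel abs_of_nonneg[OF opnorm_nonneg] by (intro mult_mono Fx abs_entry_le_opnorm) auto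
    qed
    have ae: "AE x in lebesgue. F l x * B x $ j $ l = (F l x * B x $ j $ l) * 1" by simp
    note m = magnetic_commutator[OF A B u[OF that(1)] u[OF that(2)] sF FC(1) FC(2) FC(2) f1 form_bounded_1 ae]
    show "X k j m l - Y k j m l = - \<i> * Z k j m l - P k j m l + R k j m l"
      using m(1) by (simp only: X_def Y_def Z_def P_def R_def ip_def)
    show "integrable lebesgue (\<lambda>x. complex_of_real (F l x * B x $ j $ l) * (cnj (f k x) * f m x))"
      by (rule m(2))
  qed
  then show "k < n \<Longrightarrow> m < n \<Longrightarrow> integrable lebesgue (\<lambda>x. complex_of_real (radial_field 1 \<epsilon> l x * B x $ j $ l) * (cnj (f k x) * f m x))"
    by (simp only: F_def)
  define \<Sigma> where "\<Sigma> T = (\<Sum>k<n. \<Sum>j\<in>UNIV. \<Sum>m<n. \<Sum>l\<in>UNIV. a j k m * T k j m l)" for T :: "nat \<Rightarrow> 'd \<Rightarrow> nat \<Rightarrow> 'd \<Rightarrow> complex"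
  have lin: "\<Sigma> X - \<Sigma> Y = - \<i> * \<Sigma> Z - \<Sigma> P + \<Sigma> R"
  proof -
    have "\<Sigma> X - \<Sigma> Y = (\<Sum>k<n. \<Sum>j\<in>UNIV. \<Sum>m<n. \<Sum>l\<in>UNIV. a j k m * (X k j m l - Y k j m l))"
      by (simp only: \<Sigma>_def sum_subtractf right_diff_distrib)
    also have "\<dots> = (\<Sum>k<n. \<Sum>j\<in>UNIV. \<Sum>m<n. \<Sum>l\<in>UNIV. - \<i> * (a j k m * Z k j m l) - a j k m * P k j m l + a j k m * R k j m l)"
      by (intro sum.cong[OF refl]) (simp add: com(1) algebra_simps)
    also have "\<dots> = - \<i> * \<Sigma> Z - \<Sigma> P + \<Sigma> R"
      by (simp only: \<Sigma>_def sum_subtractf sum.distrib sum_distrib_left)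
    finally show ?thesis .
  qed
  have cM: "cnj (\<i> * M k) = - (\<i> * M k)" for k
    using real by (simp add: complex_eq_iff M_def)
  have right: "(\<Sum>j\<in>UNIV. \<Sum>m<n. a j k m * ip b g (w m j)) = \<i> * M k * ip b g (f k)"
    if "k < n" "bounded_weight b" "L2 g" for k b g
    using ip_alpha_grad_right[OF that(2,3) Lw, where k = k] ip_D_right[OF that(2,3,1)] by simp
  have left: "(\<Sum>k<n. \<Sum>j\<in>UNIV. a j k m * ip b (w k j) g) = - (\<i> * M m) * ip b (f m) g"
    if "m < n" "bounded_weight b" "L2 g" for m b g
  proof -
    have "(\<Sum>k<n. \<Sum>j\<in>UNIV. a j k m * ip b (w k j) g) = (\<Sum>j\<in>UNIV. \<Sum>k<n. a j k m * ip b (w k j) g)"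
      by (rule sum.swap)
    then show ?thesis
      using ip_alpha_grad_left[OF that(2,3) Lw that(1)] ip_D_left[OF that(2,3,1)] unfolding cM by simp
  qed
  \<comment> \<open>In \<open>X\<close> the sum over \<open>j\<close> and \<open>k\<close> is \<open>D\<close> acting on the left factor, in \<open>Y\<close> and \<open>R\<close> the sum over \<open>j\<close> and \<open>m\<close> is \<open>D\<close> acting on the right one.\<close>
  have SX: "\<Sigma> X = (\<Sum>l\<in>UNIV. \<Sum>k<n. - (\<i> * M k) * ip (F l) (f k) (w k l))"
  proof -
    have "\<Sigma> X = (\<Sum>l\<in>UNIV. \<Sum>k<n. \<Sum>j\<in>UNIV. \<Sum>m<n. a j k m * ip (F l) (w k j) (w m l))"
      unfolding \<Sigma>_def X_def by (rule sum_reorder)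
    also have "\<dots> = (\<Sum>l\<in>UNIV. \<Sum>m<n. \<Sum>k<n. \<Sum>j\<in>UNIV. a j k m * ip (F l) (w k j) (w m l))"
      by (rule sum.cong[OF refl], rule sum_rotate[symmetric])
    finally show ?thesis by (simp add: left bF Lw)
  qed
  have SY: "\<Sigma> Y = (\<Sum>l\<in>UNIV. \<Sum>k<n. \<i> * M k * ip (F l) (w k l) (f k))"
    unfolding \<Sigma>_def Y_def sum_reorder[of _ _ _ _ "{..<n}"] by (simp add: right bF Lw)
  have SR: "\<Sigma> R = (\<Sum>l\<in>UNIV. \<Sum>k<n. \<i> * M k * ip (pderiv_at l (F l)) (f k) (f k))"
    unfolding \<Sigma>_def R_def sum_reorder[of _ _ _ _ "{..<n}"] by (simp add: right bdF Lf)
  have XY: "\<Sigma> X - \<Sigma> Y = \<Sigma> R"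
    unfolding SX SY SR sum_subtractf[symmetric]
  proof (intro sum.cong[OF refl])
    fix l k assume "k \<in> {..<n}"
    then have k: "k < n" by simp
    have bp: "ip (F l) (w k l) (f k) + ip (F l) (f k) (w k l) = - ip (pderiv_at l (F l)) (f k) (f k)"
      unfolding ip_def by (rule magnetic_pderiv_by_parts[OF A u[OF k] u[OF k] sF FC])
    have "- (\<i> * M k) * ip (F l) (f k) (w k l) - \<i> * M k * ip (F l) (w k l) (f k)
        = - (\<i> * M k) * (ip (F l) (w k l) (f k) + ip (F l) (f k) (w k l))" by (simp add: algebra_simps)
    then show "- (\<i> * M k) * ip (F l) (f k) (w k l) - \<i> * M k * ip (F l) (w k l) (f k)
        = \<i> * M k * ip (pderiv_at l (F l)) (f k) (f k)" unfolding bp by simp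
  qed
  have "- \<i> * \<Sigma> Z - \<Sigma> P = 0" using lin unfolding XY by (simp only: add_cancel_right_left)
  then have "- \<i> * \<Sigma> Z = \<Sigma> P" by (simp only: eq_iff_diff_eq_0[symmetric])
  then have "\<i> * (- \<i> * \<Sigma> Z) = \<i> * \<Sigma> P" by simp
  then have "\<Sigma> Z = \<i> * \<Sigma> P" by simp
  then show "(\<Sum>k<n. \<Sum>j\<in>UNIV. \<Sum>m<n. \<Sum>l\<in>UNIV. a j k m *
        (LINT x|lebesgue. complex_of_real (radial_field 1 \<epsilon> l x * B x $ j $ l) * (cnj (f k x) * f m x)))
    = \<i> * (\<Sum>k<n. \<Sum>j\<in>UNIV. \<Sum>m<n. \<Sum>l\<in>UNIV. a j k m * ip (pderiv_at j (radial_field 1 \<epsilon> l)) (f k) (w m l))"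
    by (simp only: \<Sigma>_def Z_def P_def F_def)
qed

text \<open>The field enters through the vector \<open>B F\<close> only, and \<open>\<bar>F\<bar> \<le> r\<close>; hence the bound is uniform in \<open>\<epsilon>\<close>.\<close>

lemma virial_field_bound:
  assumes e: "\<epsilon> > 0" and real: "Im z = 0" and t: "\<tau> > 0"
  shows "cmod (\<Sum>k<n. \<Sum>j\<in>UNIV. \<Sum>m<n. \<Sum>l\<in>UNIV. a j k m *
        (LINT x|lebesgue. complex_of_real (radial_field 1 \<epsilon> l x * B x $ j $ l) * (cnj (f k x) * f m x)))
    \<le> \<tau> * (c\<^sup>2 * S 1) + N (- 1) / \<tau>"
proof -
  have e0: "\<epsilon> \<ge> 0" using e by simp
  define F where "F = (radial_field 1 \<epsilon> :: 'd \<Rightarrow> real ^ 'd \<Rightarrow> real)"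
  define E where "E = (\<lambda>k j m l x. complex_of_real (F l x * B x $ j $ l) * (cnj (f k x) * f m x))"
  have Ei: "integrable lebesgue (E k j m l)" if "k < n" "m < n" for k j m l
    unfolding E_def F_def by (rule virial_identity(2)[OF e real that])
  define b where "b x j = (\<Sum>l\<in>UNIV. F l x * B x $ j $ l)" for x j
  define Q where "Q x = (\<Sum>k<n. \<Sum>j\<in>UNIV. \<Sum>m<n. \<Sum>l\<in>UNIV. a j k m * E k j m l x)" for x
  have H: "has_bochner_integral lebesgue Q (\<Sum>k<n. \<Sum>j\<in>UNIV. \<Sum>m<n. \<Sum>l\<in>UNIV. a j k m * (LINT x|lebesgue. E k j m l x))"
    unfolding Q_def
    by (intro has_bochner_integral_sum has_bochner_integral_mult_right has_bochner_integral_integrable Ei) auto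
  have Qc: "Q x = (\<Sum>k<n. cnj (f k x) * cliff (b x) (\<lambda>k. f k x) k)" for x
    unfolding Q_def E_def cliff_def b_def of_real_sum
    by (intro sum.cong[OF refl]) (simp add: sum_distrib_left sum_distrib_right mult_ac)
  have bM: "(\<Sum>j\<in>UNIV. (b x j)\<^sup>2) \<le> (norm x * opnorm (B x))\<^sup>2" for x
  proof -
    define V where "V = (\<chi> l. F l x)"
    have w: "0 < radial_weight 1 \<epsilon> x" "radial_weight 1 \<epsilon> x \<le> 1"
      using radial_weight_bounds[OF real_one_pos e0, of x] by auto
    have "(norm V)\<^sup>2 = (norm x)\<^sup>2 * (radial_weight 1 \<epsilon> x)\<^sup>2"
      unfolding sum_radial_field_sq[symmetric] norm_sq_eq_sum[of V] by (simp add: V_def F_def power2_eq_square)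
    then have "(norm V)\<^sup>2 = (norm x * radial_weight 1 \<epsilon> x)\<^sup>2" by (simp only: power_mult_distrib)
    then have "norm V = norm x * radial_weight 1 \<epsilon> x"
      using w by (subst (asm) power2_eq_iff_nonneg) auto
    also have "\<dots> \<le> norm x * 1" using w by (intro mult_left_mono) auto
    finally have V: "norm V \<le> norm x" by simp
    have "(\<Sum>j\<in>UNIV. (b x j)\<^sup>2) = (norm (B x *v V))\<^sup>2"
      unfolding norm_sq_eq_sum by (simp add: b_def V_def matrix_vector_mult_def mult.commute power2_eq_square)
    also have "\<dots> \<le> (opnorm (B x) * norm V)\<^sup>2" by (intro power_mono norm_matrix_vector_le) auto
    also have "\<dots> \<le> (norm x * opnorm (B x))\<^sup>2"
      unfolding mult.commute[of "norm x"] using V by (intro power_mono mult_left_mono) (auto simp: opnorm_nonneg)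
    finally show ?thesis .
  qed
  let ?p = "\<lambda>k x. complex_of_real (norm x * opnorm (B x)) * f k x"
  let ?R1 = "\<lambda>k x. if s k = 1 then (cmod (?p k x))\<^sup>2 else 0"
  let ?R2 = "\<lambda>k x. if s k = - 1 then (cmod (f k x))\<^sup>2 else 0"
  let ?R = "\<lambda>x. \<tau> * (\<Sum>k<n. ?R1 k x) + (\<Sum>k<n. ?R2 k x) / \<tau>"
  have p: "L2 (?p k)" "sqint (?p k) \<le> c\<^sup>2 * (\<Sum>j\<in>UNIV. sqint (w k j))" if "k < n" for k
    using form_bounded_L2[OF A field u[OF that]] by simp_all
  have h1: "has_bochner_integral lebesgue (?R1 k) (if s k = 1 then sqint (?p k) else 0)" if "k < n" for k
    using has_bochner_integral_integrable[OF L2_integrable[OF p(1)[OF that]]] by (simp add: sqint_def has_bochner_integral_zero)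
  have h2: "has_bochner_integral lebesgue (?R2 k) (if s k = - 1 then sqint (f k) else 0)" if "k < n" for k
    using has_bochner_integral_integrable[OF L2_integrable[OF Lf[OF that]]] by (simp add: sqint_def has_bochner_integral_zero)
  have HR: "has_bochner_integral lebesgue ?R
      (\<tau> * (\<Sum>k<n. if s k = 1 then sqint (?p k) else 0) + (\<Sum>k<n. if s k = - 1 then sqint (f k) else 0) / \<tau>)"
    by (intro has_bochner_integral_add has_bochner_integral_mult_right has_bochner_integral_divide has_bochner_integral_sum h1 h2) auto
  have "cmod (LINT x|lebesgue. Q x) \<le> (LINT x|lebesgue. cmod (Q x))" by (rule integral_norm_bound)
  also have "\<dots> \<le> (LINT x|lebesgue. ?R x)"
  proof (rule integral_mono)
    show "integrable lebesgue (\<lambda>x. cmod (Q x))" using H by (intro integrable_norm) (rule integrable.intros)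
    show "integrable lebesgue ?R" using HR by (rule integrable.intros)
    fix x :: "real ^ 'd"
    have M0: "0 \<le> norm x * opnorm (B x)" by (intro mult_nonneg_nonneg opnorm_nonneg) auto
    have "cmod (Q x) \<le> \<tau> * ((norm x * opnorm (B x))\<^sup>2 * (\<Sum>k<n. (cmod (part 1 (\<lambda>k. f k x) k))\<^sup>2))
        + (\<Sum>k<n. (cmod (part (- 1) (\<lambda>k. f k x) k))\<^sup>2) / \<tau>"
      unfolding Qc by (rule cliff_offdiagonal_bound[OF t bM M0])
    also have "(norm x * opnorm (B x))\<^sup>2 * (\<Sum>k<n. (cmod (part 1 (\<lambda>k. f k x) k))\<^sup>2) = (\<Sum>k<n. ?R1 k x)"
      unfolding sum_distrib_left part_def
      by (intro sum.cong[OF refl]) (simp add: norm_mult power_mult_distrib)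
    also have "(\<Sum>k<n. (cmod (part (- 1) (\<lambda>k. f k x) k))\<^sup>2) = (\<Sum>k<n. ?R2 k x)"
      unfolding part_def by (intro sum.cong[OF refl]) simp
    finally show "cmod (Q x) \<le> ?R x" .
  qed
  also have "\<dots> = \<tau> * (\<Sum>k<n. if s k = 1 then sqint (?p k) else 0) + N (- 1) / \<tau>"
    unfolding N_def by (rule has_bochner_integral_integral_eq[OF HR])
  also have "\<dots> \<le> \<tau> * (c\<^sup>2 * S 1) + N (- 1) / \<tau>"
    unfolding S_def sum_distrib_left[of "c\<^sup>2"]
    using t p(2) by (intro add_right_mono mult_left_mono sum_mono) auto
  finally show ?thesis
    unfolding has_bochner_integral_integral_eq[OF H] by (simp only: E_def F_def)
qed

text \<open>As \<open>\<epsilon>\<close> tends to zero, \<open>\<partial>\<^sub>j F\<^sub>l\<close> tends boundedly to the Kronecker delta, and the sum becomes \<open>\<langle>u, D u\<rangle>\<close>.\<close>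

lemma virial_limit:
  "(\<lambda>i. \<Sum>k<n. \<Sum>j\<in>UNIV. \<Sum>m<n. \<Sum>l\<in>UNIV. a j k m * ip (pderiv_at j (radial_field 1 (inverse (real (Suc i))) l)) (f k) (w m l))
    \<longlonglongrightarrow> (\<Sum>k<n. \<i> * M k * complex_of_real (sqint (f k)))"
proof -
  have pos: "inverse (real (Suc i)) > 0" for i by simp
  have l: "(\<lambda>i. ip (pderiv_at j (radial_field 1 (inverse (real (Suc i))) l)) (f k) (w m l))
      \<longlonglongrightarrow> ip (\<lambda>x. if j = l then 1 else 0) (f k) (w m l)" if "k < n" "m < n" for k m j l
  proof (rule ip_weight_tendsto[OF Lf[OF that(1)] Lw[OF that(2)], where C = 3])
    show "pderiv_at j (radial_field 1 (inverse (real (Suc i))) l) \<in> borel_measurable lebesgue" for i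
      by (rule continuous_measurable_lebesgue[OF smooth_continuous[OF smooth_pderiv]])
         (intro allI smooth_radial_field, simp_all)
    show "\<bar>pderiv_at j (radial_field 1 (inverse (real (Suc i))) l) x\<bar> \<le> 3" for i x
      using radial_field_bounds(2)[OF real_one_pos pos] by simp
    fix x :: "real ^ 'd"
    have e: "(\<lambda>i. inverse (real (Suc i))) \<longlonglongrightarrow> 0" by (rule LIMSEQ_inverse_real_of_nat)
    have w: "(\<lambda>i. radial_weight 1 (inverse (real (Suc i))) x) \<longlonglongrightarrow> 1"
      unfolding radial_weight_def by (rule tendsto_eq_intros e refl | simp)+
    have "(\<lambda>i. (if j = l then radial_weight 1 (inverse (real (Suc i))) x else 0)
        - 2 * inverse (real (Suc i)) * (x $ j * x $ l) * (radial_weight 1 (inverse (real (Suc i))) x)\<^sup>2)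
      \<longlonglongrightarrow> (if j = l then 1 else 0) - 2 * 0 * (x $ j * x $ l) * 1\<^sup>2"
    proof (intro tendsto_diff tendsto_mult tendsto_power tendsto_const e w)
      show "(\<lambda>i. if j = l then radial_weight 1 (inverse (real (Suc i))) x else 0) \<longlonglongrightarrow> (if j = l then 1 else 0)"
        using w by (cases "j = l") simp_all
    qed
    then show "(\<lambda>i. pderiv_at j (radial_field 1 (inverse (real (Suc i))) l) x) \<longlonglongrightarrow> (if j = l then 1 else 0)"
      unfolding pderiv_radial_field[OF real_one_pos less_imp_le[OF pos]] by simp
  qed
  have "(\<lambda>i. \<Sum>k<n. \<Sum>j\<in>UNIV. \<Sum>m<n. \<Sum>l\<in>UNIV. a j k m * ip (pderiv_at j (radial_field 1 (inverse (real (Suc i))) l)) (f k) (w m l))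
    \<longlonglongrightarrow> (\<Sum>k<n. \<Sum>j\<in>UNIV. \<Sum>m<n. \<Sum>l\<in>UNIV. a j k m * ip (\<lambda>x. if j = l then 1 else 0) (f k) (w m l))"
    by (intro tendsto_sum tendsto_mult_left l) auto
  also have "(\<Sum>k<n. \<Sum>j\<in>UNIV. \<Sum>m<n. \<Sum>l\<in>UNIV. a j k m * ip (\<lambda>x. if j = l then 1 else 0) (f k) (w m l))
      = (\<Sum>k<n. \<i> * M k * complex_of_real (sqint (f k)))"
  proof (intro sum.cong[OF refl])
    fix k assume "k \<in> {..<n}"
    then have k: "k < n" by simp
    have b1: "bounded_weight (\<lambda>x :: real ^ 'd. 1)" by (rule bounded_weight_const)
    have "(\<Sum>j\<in>UNIV. \<Sum>m<n. \<Sum>l\<in>UNIV. a j k m * ip (\<lambda>x. if j = l then 1 else 0) (f k) (w m l))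
        = (\<Sum>j\<in>UNIV. \<Sum>m<n. \<Sum>l\<in>UNIV. if j = l then a j k m * ip (\<lambda>x. 1) (f k) (w m l) else 0)"
      by (intro sum.cong[OF refl]) simp
    also have "\<dots> = (\<Sum>j\<in>UNIV. \<Sum>m<n. a j k m * ip (\<lambda>x. 1) (f k) (w m j))" by simp
    also have "\<dots> = ip (\<lambda>x. 1) (f k) (alpha_grad w k)" by (rule ip_alpha_grad_right[OF b1 Lf[OF k] Lw, symmetric])
    also have "\<dots> = \<i> * M k * complex_of_real (sqint (f k))" by (simp only: ip_D_right[OF b1 Lf[OF k] k] ip_self)
    finally show "(\<Sum>j\<in>UNIV. \<Sum>m<n. \<Sum>l\<in>UNIV. a j k m * ip (\<lambda>x. if j = l then 1 else 0) (f k) (w m l))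
      = \<i> * M k * complex_of_real (sqint (f k))" .
  qed
  finally show ?thesis .
qed

lemma virial_inequality:
  assumes real: "Im z = 0" and t: "\<tau> > 0"
  shows "2 * \<bar>Re z + 1 / 2\<bar> * N (- 1) \<le> \<tau> * (c\<^sup>2 * S 1) + N (- 1) / \<tau>"
proof -
  let ?L = "\<Sum>k<n. \<i> * M k * complex_of_real (sqint (f k))"
  have "cmod ?L \<le> \<tau> * (c\<^sup>2 * S 1) + N (- 1) / \<tau>"
  proof (rule LIMSEQ_le_const2[OF tendsto_norm[OF virial_limit]], intro exI allI impI)
    fix i :: nat
    have e: "inverse (real (Suc i)) > 0" by simp
    show "cmod (\<Sum>k<n. \<Sum>j\<in>UNIV. \<Sum>m<n. \<Sum>l\<in>UNIV. a j k m * ip (pderiv_at j (radial_field 1 (inverse (real (Suc i))) l)) (f k) (w m l))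
        \<le> \<tau> * (c\<^sup>2 * S 1) + N (- 1) / \<tau>"
      using virial_field_bound[OF e real t] unfolding virial_identity(1)[OF e real] norm_mult by simp
  qed
  moreover have "?L = \<i> * complex_of_real ((Re z + 1 / 2) * N (- 1) + (Re z - 1 / 2) * N 1)"
  proof -
    have "\<i> * M k * complex_of_real (sqint (f k)) = \<i> * complex_of_real
        ((Re z + 1 / 2) * (if s k = - 1 then sqint (f k) else 0) + (Re z - 1 / 2) * (if s k = 1 then sqint (f k) else 0))" for k
      using sign[of k] real by (auto simp: M_def complex_eq_iff)
    then have "?L = (\<Sum>k<n. \<i> * complex_of_real
        ((Re z + 1 / 2) * (if s k = - 1 then sqint (f k) else 0) + (Re z - 1 / 2) * (if s k = 1 then sqint (f k) else 0)))"
      by (intro sum.cong[OF refl])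
    also have "\<dots> = \<i> * complex_of_real (\<Sum>k<n.
        (Re z + 1 / 2) * (if s k = - 1 then sqint (f k) else 0) + (Re z - 1 / 2) * (if s k = 1 then sqint (f k) else 0))"
      by (simp only: of_real_sum sum_distrib_left)
    finally show ?thesis by (simp only: N_def sum.distrib sum_distrib_left)
  qed
  moreover have "(Re z - 1 / 2) * N 1 = (Re z + 1 / 2) * N (- 1)"
    using arg_cong[OF symmetric_relation, of Re] real by simp
  ultimately have "cmod (\<i> * complex_of_real (2 * ((Re z + 1 / 2) * N (- 1)))) \<le> \<tau> * (c\<^sup>2 * S 1) + N (- 1) / \<tau>"
    by (simp only: mult_2)
  then show ?thesis by (simp only: norm_mult norm_ii norm_of_real abs_mult abs_of_nonneg[OF N_nonneg] abs_numeral mult_1_left mult.assoc)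
qed

text \<open>By \<open>small\<close> the coercivity constant exceeds \<open>1/2\<close>, and \<open>c\<^sup>2 < 1/4\<close>.\<close>

lemma no_eigenfunction:
  assumes small: "real CARD('d) * (c * h) < 1" and c1: "2 * c < 1"
  shows "N 1 + N (- 1) = 0"
proof (rule ccontr)
  assume ne: "N 1 + N (- 1) \<noteq> 0"
  note real = eigenvalue_real[OF ne]
  let ?K = "1 - real CARD('d) / 2 * (c * h)"
  define r where "r = \<bar>Re z + 1 / 2\<bar>"
  have K: "?K > 1 / 2" using small by simp
  have cm: "cmod (z + complex_of_real t / 2) = \<bar>Re z + t / 2\<bar>" for t
    using real by (simp add: cmod_eq_Re)
  have S1: "?K * S 1 \<le> r\<^sup>2 * N (- 1)" and S2: "?K * S (- 1) \<le> \<bar>Re z - 1 / 2\<bar>\<^sup>2 * N 1"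
    using part_coercivity[of 1] part_coercivity[of "- 1"] unfolding cm by (auto simp: r_def)
  have zero: "S t = 0" if "?K * S t \<le> 0" for t
    using that S_nonneg[of t] K by (simp add: mult_le_0_iff)
  have "r\<^sup>2 * N (- 1) = 0"
  proof (cases "r = 0")
    case False
    then have r: "r > 0" by (simp add: r_def)
    \<comment> \<open>The choice \<open>\<tau> = 1 / \<bar>z + 1/2\<bar>\<close> leaves exactly half of the left-hand side.\<close>
    have "2 * r * N (- 1) \<le> inverse r * (c\<^sup>2 * S 1) + N (- 1) / inverse r"
      unfolding r_def by (rule virial_inequality[OF real]) (use r in \<open>simp add: r_def\<close>)
    then have "r * (2 * r * N (- 1)) \<le> r * (inverse r * (c\<^sup>2 * S 1) + N (- 1) / inverse r)"
      using r by (intro mult_left_mono) auto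
    then have a: "r\<^sup>2 * N (- 1) \<le> c\<^sup>2 * S 1" using r by (simp add: power2_eq_square field_simps)
    have "c\<^sup>2 \<le> (1 / 2)\<^sup>2" using c c1 by (intro power_mono) auto
    then have "c\<^sup>2 * S 1 \<le> 1 / 4 * S 1" using S_nonneg[of 1] by (intro mult_right_mono) (auto simp: power2_eq_square)
    moreover have "1 / 2 * S 1 \<le> ?K * S 1" using K S_nonneg[of 1] by (intro mult_right_mono) auto
    moreover have "r\<^sup>2 * N (- 1) \<ge> 0" by (simp add: N_nonneg)
    ultimately show ?thesis using a S1 S_nonneg[of 1] by linarith
  qed simp
  then have N1: "N 1 = 0" using S1 by (intro part_vanishes zero) linarith
  then have "N (- 1) = 0" using S2 by (intro part_vanishes zero) (simp only: mult_zero_right)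
  with N1 ne show False by simp
qed

end

section \<open>The Dirac matrices\<close>

lemma mat_adjoint_carrier: "a \<in> carrier_mat m m \<Longrightarrow> mat_adjoint a \<in> carrier_mat m m"
  unfolding mat_adjoint_def by auto

lemma mat_adjoint_index:
  "a \<in> carrier_mat m m \<Longrightarrow> i < m \<Longrightarrow> j < m \<Longrightarrow> mat_adjoint a $$ (i, j) = cnj (a $$ (j, i))" for a :: "complex mat"
  unfolding mat_adjoint_def by (auto simp: mat_of_rows_def)

lemma mat_adjoint_one: "mat_adjoint (1\<^sub>m m) = (1\<^sub>m m :: complex mat)"
  by (rule eq_matI) (use mat_adjoint_carrier[of "1\<^sub>m m :: complex mat" m] in \<open>auto simp: mat_adjoint_index[of _ m]\<close>)

lemma mat_adjoint_smult_i:
  assumes a: "a \<in> carrier_mat m m" shows "mat_adjoint (\<i> \<cdot>\<^sub>m a) = - \<i> \<cdot>\<^sub>m mat_adjoint a"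
proof (rule eq_matI)
  have ia: "\<i> \<cdot>\<^sub>m a \<in> carrier_mat m m" using a by simp
  show "dim_row (mat_adjoint (\<i> \<cdot>\<^sub>m a)) = dim_row (- \<i> \<cdot>\<^sub>m mat_adjoint a)"
    "dim_col (mat_adjoint (\<i> \<cdot>\<^sub>m a)) = dim_col (- \<i> \<cdot>\<^sub>m mat_adjoint a)"
    using mat_adjoint_carrier[OF ia] mat_adjoint_carrier[OF a] by auto
  fix i j assume "i < dim_row (- \<i> \<cdot>\<^sub>m mat_adjoint a)" "j < dim_col (- \<i> \<cdot>\<^sub>m mat_adjoint a)"
  then have "i < m" "j < m" using mat_adjoint_carrier[OF a] by auto
  then show "mat_adjoint (\<i> \<cdot>\<^sub>m a) $$ (i, j) = (- \<i> \<cdot>\<^sub>m mat_adjoint a) $$ (i, j)"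
    using a mat_adjoint_carrier[OF a] by (simp add: mat_adjoint_index[OF ia] mat_adjoint_index[OF a])
qed

text \<open>The block shapes of \<open>\<alpha>\<^sub>\<mu>\<close> and \<open>\<beta>\<close>.\<close>

definition offdiag :: "nat \<Rightarrow> complex mat \<Rightarrow> complex mat" where
  "offdiag m a = four_block_mat (0\<^sub>m m m) (mat_adjoint a) a (0\<^sub>m m m)"

definition beta :: "nat \<Rightarrow> complex mat" where
  "beta m = four_block_mat (1\<^sub>m m) (0\<^sub>m m m) (0\<^sub>m m m) (- 1\<^sub>m m)"

lemma uminus_zero_mat: "- 0\<^sub>m m k = (0\<^sub>m m k :: complex mat)"
  by (rule eq_matI) auto

lemma offdiag_carrier: "a \<in> carrier_mat m m \<Longrightarrow> offdiag m a \<in> carrier_mat (2 * m) (2 * m)"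
  unfolding offdiag_def mult_2 by (intro four_block_carrier_mat) auto

lemma beta_carrier: "beta m \<in> carrier_mat (2 * m) (2 * m)"
  unfolding beta_def mult_2 by (intro four_block_carrier_mat) auto

lemma beta_index:
  "i < 2 * m \<Longrightarrow> j < 2 * m \<Longrightarrow> beta m $$ (i, j) = (if i = j then (if i < m then 1 else - 1) else 0)"
  unfolding beta_def by auto

lemma offdiag_index:
  assumes a: "a \<in> carrier_mat m m" and ij: "i < 2 * m" "j < 2 * m"
  shows "offdiag m a $$ (i, j) = (if i < m then (if j < m then 0 else cnj (a $$ (j - m, i)))
      else (if j < m then a $$ (i - m, j) else 0))"
  unfolding offdiag_def using a ij by (simp add: mat_adjoint_index[OF a])

lemma offdiag_hermitian:
  assumes a: "a \<in> carrier_mat m m" and ij: "i < 2 * m" "j < 2 * m"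
  shows "cnj (offdiag m a $$ (i, j)) = offdiag m a $$ (j, i)"
  using ij by (simp add: offdiag_index[OF a])

lemma beta_hermitian: "i < 2 * m \<Longrightarrow> j < 2 * m \<Longrightarrow> cnj (beta m $$ (i, j)) = beta m $$ (j, i)"
  by (simp add: beta_index)

lemma smult_one_blocks:
  "c \<cdot>\<^sub>m 1\<^sub>m (2 * m) = four_block_mat (c \<cdot>\<^sub>m 1\<^sub>m m) (0\<^sub>m m m) (0\<^sub>m m m) (c \<cdot>\<^sub>m 1\<^sub>m m :: complex mat)"
  by (rule eq_matI) auto

lemma offdiag_mult:
  assumes a: "a \<in> carrier_mat m m" and b: "b \<in> carrier_mat m m"
  shows "offdiag m a * offdiag m b = four_block_mat (mat_adjoint a * b) (0\<^sub>m m m) (0\<^sub>m m m) (a * mat_adjoint b)"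
proof -
  note c = mat_adjoint_carrier[OF a] mat_adjoint_carrier[OF b]
  have "offdiag m a * offdiag m b = four_block_mat (0\<^sub>m m m * 0\<^sub>m m m + mat_adjoint a * b) (0\<^sub>m m m * mat_adjoint b + mat_adjoint a * 0\<^sub>m m m)
      (a * 0\<^sub>m m m + 0\<^sub>m m m * b) (a * mat_adjoint b + 0\<^sub>m m m * 0\<^sub>m m m)"
    unfolding offdiag_def by (rule mult_four_block_mat) (use a b c in auto)
  then show ?thesis using a b c by simp
qed

lemma offdiag_anticommute:
  assumes a: "a \<in> carrier_mat m m" and b: "b \<in> carrier_mat m m"
    and 1: "mat_adjoint a * b + mat_adjoint b * a = c \<cdot>\<^sub>m 1\<^sub>m m"
    and 2: "a * mat_adjoint b + b * mat_adjoint a = c \<cdot>\<^sub>m 1\<^sub>m m"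
  shows "offdiag m a * offdiag m b + offdiag m b * offdiag m a = c \<cdot>\<^sub>m 1\<^sub>m (2 * m)"
proof -
  note ca = mat_adjoint_carrier[OF a] mat_adjoint_carrier[OF b]
  have "offdiag m a * offdiag m b + offdiag m b * offdiag m a
      = four_block_mat (mat_adjoint a * b + mat_adjoint b * a) (0\<^sub>m m m + 0\<^sub>m m m) (0\<^sub>m m m + 0\<^sub>m m m) (a * mat_adjoint b + b * mat_adjoint a)"
    unfolding offdiag_mult[OF a b] offdiag_mult[OF b a]
    by (rule add_four_block_mat) (use a b ca in auto)
  then show ?thesis unfolding 1 2 smult_one_blocks by simp
qed

lemma offdiag_beta_anticommute:
  assumes a: "a \<in> carrier_mat m m"
  shows "offdiag m a * beta m + beta m * offdiag m a = 0 \<cdot>\<^sub>m 1\<^sub>m (2 * m)"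
    "beta m * offdiag m a + offdiag m a * beta m = 0 \<cdot>\<^sub>m 1\<^sub>m (2 * m)"
proof -
  note ca = mat_adjoint_carrier[OF a]
  have 1: "offdiag m a * beta m = four_block_mat (0\<^sub>m m m * 1\<^sub>m m + mat_adjoint a * 0\<^sub>m m m) (0\<^sub>m m m * 0\<^sub>m m m + mat_adjoint a * (- 1\<^sub>m m))
      (a * 1\<^sub>m m + 0\<^sub>m m m * 0\<^sub>m m m) (a * 0\<^sub>m m m + 0\<^sub>m m m * (- 1\<^sub>m m))"
    unfolding offdiag_def beta_def by (rule mult_four_block_mat) (use a ca in auto)
  have 2: "beta m * offdiag m a = four_block_mat (1\<^sub>m m * 0\<^sub>m m m + 0\<^sub>m m m * a) (1\<^sub>m m * mat_adjoint a + 0\<^sub>m m m * 0\<^sub>m m m)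
      (0\<^sub>m m m * 0\<^sub>m m m + (- 1\<^sub>m m) * a) (0\<^sub>m m m * mat_adjoint a + (- 1\<^sub>m m) * 0\<^sub>m m m)"
    unfolding offdiag_def beta_def by (rule mult_four_block_mat) (use a ca in auto)
  have neg: "mat_adjoint a * (- 1\<^sub>m m) = - mat_adjoint a" "(- 1\<^sub>m m) * a = - a"
    using a ca by (simp_all)
  have 3: "offdiag m a * beta m = four_block_mat (0\<^sub>m m m) (- mat_adjoint a) a (0\<^sub>m m m)"
    "beta m * offdiag m a = four_block_mat (0\<^sub>m m m) (mat_adjoint a) (- a) (0\<^sub>m m m)"
    unfolding 1 2 neg using a ca by (simp_all add: uminus_zero_mat)
  show "offdiag m a * beta m + beta m * offdiag m a = 0 \<cdot>\<^sub>m 1\<^sub>m (2 * m)"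
    "beta m * offdiag m a + offdiag m a * beta m = 0 \<cdot>\<^sub>m 1\<^sub>m (2 * m)"
    unfolding 3 by (rule eq_matI; use a ca in auto)+
qed

lemma beta_square: "beta m * beta m + beta m * beta m = 2 \<cdot>\<^sub>m 1\<^sub>m (2 * m)"
proof -
  have "beta m * beta m = four_block_mat (1\<^sub>m m * 1\<^sub>m m + 0\<^sub>m m m * 0\<^sub>m m m) (1\<^sub>m m * 0\<^sub>m m m + 0\<^sub>m m m * (- 1\<^sub>m m))
      (0\<^sub>m m m * 1\<^sub>m m + (- 1\<^sub>m m) * 0\<^sub>m m m) (0\<^sub>m m m * 0\<^sub>m m m + (- 1\<^sub>m m) * (- 1\<^sub>m m))"
    unfolding beta_def by (rule mult_four_block_mat) auto
  also have "\<dots> = 1\<^sub>m (2 * m)" by (simp add: mult_2 uminus_zero_mat)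
  finally show ?thesis by (simp, intro eq_matI) auto
qed

text \<open>Besides \<open>\<alpha>\<^sub>1, \<dots>, \<alpha>\<^sub>d\<close> the family contains \<open>\<beta>\<close> as its last member, because \<open>\<beta>\<close> of one dimension becomes a
  lower left block in a higher one.\<close>

definition clifford_family :: "nat \<Rightarrow> nat \<Rightarrow> (nat \<Rightarrow> complex mat) \<Rightarrow> bool" where
  "clifford_family n r D \<longleftrightarrow> (\<forall>\<mu>\<in>{1..r}. D \<mu> \<in> carrier_mat n n \<and> mat_adjoint (D \<mu>) = D \<mu>) \<and>
     (\<forall>\<mu>\<in>{1..r}. \<forall>\<nu>\<in>{1..r}. D \<mu> * D \<nu> + D \<nu> * D \<mu> = (if \<mu> = \<nu> then 2 else 0) \<cdot>\<^sub>m 1\<^sub>m n)"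

lemma mat_adjoint_eqI:
  assumes "X \<in> carrier_mat n n" "\<And>i j. i < n \<Longrightarrow> j < n \<Longrightarrow> cnj (X $$ (j, i)) = X $$ (i, j)"
  shows "mat_adjoint X = X"
  by (rule eq_matI) (use assms mat_adjoint_carrier[OF assms(1)] mat_adjoint_index[OF assms(1)] in auto)

text \<open>The blocks need not be Hermitian: in even dimensions \<open>a\<^sub>1 = 1\<close>, but \<open>a\<^sub>\<mu>\<^sub>+\<^sub>1 = i \<alpha>\<^sub>\<mu>\<close> is skew-Hermitian.  What the products
  of the block matrices require are the relations for \<open>a\<^sub>\<mu>\<^sup>* a\<^sub>\<nu>\<close> and for \<open>a\<^sub>\<mu> a\<^sub>\<nu>\<^sup>*\<close>.\<close>

lemma clifford_family_blocks:
  assumes a: "\<And>\<mu>. \<mu> \<in> {1..d} \<Longrightarrow> a \<mu> \<in> carrier_mat m m"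
    and 1: "\<And>\<mu> \<nu>. \<mu> \<in> {1..d} \<Longrightarrow> \<nu> \<in> {1..d} \<Longrightarrow>
        mat_adjoint (a \<mu>) * a \<nu> + mat_adjoint (a \<nu>) * a \<mu> = (if \<mu> = \<nu> then 2 else 0) \<cdot>\<^sub>m 1\<^sub>m m"
    and 2: "\<And>\<mu> \<nu>. \<mu> \<in> {1..d} \<Longrightarrow> \<nu> \<in> {1..d} \<Longrightarrow>
        a \<mu> * mat_adjoint (a \<nu>) + a \<nu> * mat_adjoint (a \<mu>) = (if \<mu> = \<nu> then 2 else 0) \<cdot>\<^sub>m 1\<^sub>m m"
    and D: "\<And>\<mu>. \<mu> \<in> {1..d} \<Longrightarrow> D \<mu> = offdiag m (a \<mu>)" "D (d + 1) = beta m"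
  shows "clifford_family (2 * m) (d + 1) D"
  unfolding clifford_family_def
proof (intro conjI ballI)
  fix \<mu> assume "\<mu> \<in> {1..d + 1}"
  then consider "\<mu> \<in> {1..d}" | "\<mu> = d + 1" by force
  then have "D \<mu> \<in> carrier_mat (2 * m) (2 * m) \<and> mat_adjoint (D \<mu>) = D \<mu>"
  proof cases
    case 1
    note am = a[OF 1]
    show ?thesis unfolding D(1)[OF 1]
      using offdiag_carrier[OF am] mat_adjoint_eqI[OF offdiag_carrier[OF am] offdiag_hermitian[OF am]] by simp
  next
    case 2
    show ?thesis unfolding 2 D(2)
      using beta_carrier mat_adjoint_eqI[OF beta_carrier beta_hermitian] by simp
  qed
  then show "D \<mu> \<in> carrier_mat (2 * m) (2 * m)" "mat_adjoint (D \<mu>) = D \<mu>" by auto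
next
  fix \<mu> \<nu> assume mn: "\<mu> \<in> {1..d + 1}" "\<nu> \<in> {1..d + 1}"
  consider "\<mu> \<in> {1..d}" "\<nu> \<in> {1..d}" | "\<mu> \<in> {1..d}" "\<nu> = d + 1" | "\<mu> = d + 1" "\<nu> \<in> {1..d}" | "\<mu> = d + 1" "\<nu> = d + 1"
    using mn by force
  then show "D \<mu> * D \<nu> + D \<nu> * D \<mu> = (if \<mu> = \<nu> then 2 else 0) \<cdot>\<^sub>m 1\<^sub>m (2 * m)"
  proof cases
    case 1
    show ?thesis unfolding D(1)[OF 1(1)] D(1)[OF 1(2)]
      by (rule offdiag_anticommute[OF a[OF 1(1)] a[OF 1(2)] assms(2)[OF 1] assms(3)[OF 1]])
  next
    case 2
    then show ?thesis using offdiag_beta_anticommute(1)[OF a[OF 2(1)]] by (simp add: D(1) D(2)[simplified])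
  next
    case 3
    then show ?thesis using offdiag_beta_anticommute(2)[OF a[OF 3(2)]] by (simp add: D(1) D(2)[simplified])
  next
    case 4
    then show ?thesis using beta_square by (simp add: D(1) D(2)[simplified])
  qed
qed

lemma spinor_dim_odd: "odd d \<Longrightarrow> spinor_dim d = 2 * spinor_dim (d - 1)"
  by (auto simp: spinor_dim_def elim!: oddE)

lemma spinor_dim_even: "even d \<Longrightarrow> d \<noteq> 0 \<Longrightarrow> spinor_dim d = 2 * spinor_dim (d - 2)"
proof -
  assume "even d" "d \<noteq> 0"
  then obtain k where "d = 2 * k" "k \<noteq> 0" by (auto elim!: evenE)
  then obtain i where "d = 2 * Suc i" by (cases k) auto
  then show ?thesis by (simp add: spinor_dim_def)
qed

definition dirac_block :: "nat \<Rightarrow> nat \<Rightarrow> complex mat" where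
  "dirac_block d \<mu> = (if odd d then dirac_matrix (d - 1) \<mu>
     else if \<mu> = 1 then 1\<^sub>m (spinor_dim d div 2) else \<i> \<cdot>\<^sub>m dirac_matrix (d - 2) (\<mu> - 1))"

lemma dirac_matrix_blocks:
  assumes "d \<noteq> 0"
  shows "\<mu> \<in> {1..d} \<Longrightarrow> dirac_matrix d \<mu> = offdiag (spinor_dim d div 2) (dirac_block d \<mu>)"
    "dirac_matrix d (d + 1) = beta (spinor_dim d div 2)"
  using assms by (auto simp: dirac_matrix.simps[of d] Let_def offdiag_def beta_def dirac_block_def)

lemma dirac_matrix_0: "dirac_matrix 0 \<mu> = 1\<^sub>m 1"
  by (simp add: dirac_matrix.simps[of 0])

lemma smult_smult_mult_mat:
  fixes a b :: "complex mat"
  assumes "a \<in> carrier_mat m m" "b \<in> carrier_mat m m"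
  shows "(x \<cdot>\<^sub>m a) * (y \<cdot>\<^sub>m b) = (x * y) \<cdot>\<^sub>m (a * b)"
proof -
  have "y \<cdot>\<^sub>m (x \<cdot>\<^sub>m (a * b)) = (x * y) \<cdot>\<^sub>m (a * b)" by (rule eq_matI) auto
  then show ?thesis
    using assms by (simp add: mult_smult_assoc_mat[of _ m m _ m] mult_smult_distrib[of _ m m _ m])
qed

text \<open>Odd dimensions use the Hermitian family of dimension \<open>d - 1\<close> itself; in even dimensions the identity is
  anticommuting, in the sense of \<open>clifford_family_blocks\<close>, with the skew-Hermitian matrices \<open>i \<alpha>\<^sub>\<mu>\<close> of
  dimension \<open>d - 2\<close>.\<close>

lemma clifford_family_dirac: "clifford_family (spinor_dim d) (d + 1) (dirac_matrix d)"
  and dirac_block_carrier: "d \<noteq> 0 \<Longrightarrow> \<mu> \<in> {1..d} \<Longrightarrow> dirac_block d \<mu> \<in> carrier_mat (spinor_dim d div 2) (spinor_dim d div 2)"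
proof -
  have "clifford_family (spinor_dim d) (d + 1) (dirac_matrix d) \<and>
    (d \<noteq> 0 \<longrightarrow> (\<forall>\<mu>\<in>{1..d}. dirac_block d \<mu> \<in> carrier_mat (spinor_dim d div 2) (spinor_dim d div 2)))"
  proof (induction d rule: less_induct)
    case (less d)
    show ?case
    proof (cases "d = 0")
      case True
      have "1\<^sub>m 1 + 1\<^sub>m 1 = 2 \<cdot>\<^sub>m (1\<^sub>m 1 :: complex mat)" by (rule eq_matI) auto
      then show ?thesis using True
        by (auto simp: clifford_family_def dirac_matrix_0 spinor_dim_def mat_adjoint_one)
    next
      case d: False
      define m where "m = spinor_dim d div 2"
      note bl = dirac_matrix_blocks[OF d, folded m_def]
      show ?thesis
      proof (cases "odd d")
        case True
        have m: "m = spinor_dim (d - 1)" "spinor_dim d = 2 * m" using spinor_dim_odd[OF True] by (auto simp: m_def)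
        have "clifford_family m d (dirac_matrix (d - 1))"
          using less.IH[of "d - 1"] d by (simp add: m(1))
        then have C: "\<mu> \<in> {1..d} \<Longrightarrow> dirac_matrix (d - 1) \<mu> \<in> carrier_mat m m" "\<mu> \<in> {1..d} \<Longrightarrow> mat_adjoint (dirac_matrix (d - 1) \<mu>) = dirac_matrix (d - 1) \<mu>"
          "\<mu> \<in> {1..d} \<Longrightarrow> \<nu> \<in> {1..d} \<Longrightarrow> dirac_matrix (d - 1) \<mu> * dirac_matrix (d - 1) \<nu> + dirac_matrix (d - 1) \<nu> * dirac_matrix (d - 1) \<mu>
            = (if \<mu> = \<nu> then 2 else 0) \<cdot>\<^sub>m 1\<^sub>m m" for \<mu> \<nu>
          unfolding clifford_family_def by blast+
        have bk: "dirac_block d \<mu> = dirac_matrix (d - 1) \<mu>" for \<mu> using True by (simp add: dirac_block_def)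
        have "clifford_family (2 * m) (d + 1) (dirac_matrix d)"
          by (rule clifford_family_blocks[of d "dirac_block d"]) (simp_all only: bk C bl)
        then show ?thesis unfolding m(2) using C(1) by (simp add: bk)
      next
        case False
        then have ev: "even d" by simp
        have m: "m = spinor_dim (d - 2)" "spinor_dim d = 2 * m" using spinor_dim_even[OF ev d] by (auto simp: m_def)
        have d2: "d \<ge> 2" using ev d by (cases "d = 1") auto
        define E where "E \<mu> = dirac_matrix (d - 2) (\<mu> - 1)" for \<mu>
        have "clifford_family m (d - 1) (dirac_matrix (d - 2))"
          using less.IH[of "d - 2"] d d2 by (simp add: m(1) Suc_diff_Suc numeral_2_eq_2)
        then have C: "\<mu> \<in> {2..d} \<Longrightarrow> E \<mu> \<in> carrier_mat m m" "\<mu> \<in> {2..d} \<Longrightarrow> mat_adjoint (E \<mu>) = E \<mu>"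
          "\<mu> \<in> {2..d} \<Longrightarrow> \<nu> \<in> {2..d} \<Longrightarrow> E \<mu> * E \<nu> + E \<nu> * E \<mu> = (if \<mu> = \<nu> then 2 else 0) \<cdot>\<^sub>m 1\<^sub>m m" for \<mu> \<nu>
          unfolding clifford_family_def E_def by (auto simp: Suc_le_eq)
        have b1: "dirac_block d 1 = 1\<^sub>m m" using ev by (simp add: dirac_block_def m_def)
        have b2: "dirac_block d \<mu> = \<i> \<cdot>\<^sub>m E \<mu>" "mat_adjoint (\<i> \<cdot>\<^sub>m E \<mu>) = - \<i> \<cdot>\<^sub>m E \<mu>" if "\<mu> \<in> {2..d}" for \<mu>
        proof -
          show "dirac_block d \<mu> = \<i> \<cdot>\<^sub>m E \<mu>" using ev that by (simp add: dirac_block_def E_def)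
          show "mat_adjoint (\<i> \<cdot>\<^sub>m E \<mu>) = - \<i> \<cdot>\<^sub>m E \<mu>"
            unfolding mat_adjoint_smult_i[OF C(1)[OF that]] C(2)[OF that] ..
        qed
        have car: "dirac_block d \<mu> \<in> carrier_mat m m" if "\<mu> \<in> {1..d}" for \<mu>
          using that b1 b2(1)[of \<mu>] C(1)[of \<mu>] by (cases "\<mu> = 1") auto
        have i1: "\<i> \<cdot>\<^sub>m X + - \<i> \<cdot>\<^sub>m X = 0 \<cdot>\<^sub>m 1\<^sub>m m" "- \<i> \<cdot>\<^sub>m X + \<i> \<cdot>\<^sub>m X = 0 \<cdot>\<^sub>m 1\<^sub>m m" if "X \<in> carrier_mat m m" for X
          using that by (auto intro!: eq_matI)
        have two: "1\<^sub>m m + 1\<^sub>m m = 2 \<cdot>\<^sub>m (1\<^sub>m m :: complex mat)" by (rule eq_matI) auto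
        have one_smult: "1 \<cdot>\<^sub>m X = X" for X :: "complex mat" by (rule eq_matI) auto
        have rel: "mat_adjoint (dirac_block d \<mu>) * dirac_block d \<nu> + mat_adjoint (dirac_block d \<nu>) * dirac_block d \<mu> = (if \<mu> = \<nu> then 2 else 0) \<cdot>\<^sub>m 1\<^sub>m m
          \<and> dirac_block d \<mu> * mat_adjoint (dirac_block d \<nu>) + dirac_block d \<nu> * mat_adjoint (dirac_block d \<mu>) = (if \<mu> = \<nu> then 2 else 0) \<cdot>\<^sub>m 1\<^sub>m m"
          if mn: "\<mu> \<in> {1..d}" "\<nu> \<in> {1..d}" for \<mu> \<nu>
        proof -
          consider "\<mu> = 1" "\<nu> = 1" | "\<mu> = 1" "\<nu> \<in> {2..d}" | "\<mu> \<in> {2..d}" "\<nu> = 1" | "\<mu> \<in> {2..d}" "\<nu> \<in> {2..d}"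
            using mn by force
          then show ?thesis
          proof cases
            case 1
            then show ?thesis by (simp add: b1 mat_adjoint_one two flip: One_nat_def)
          next
            case 2
            have "\<mu> \<noteq> \<nu>" using 2 by auto
            then show ?thesis using C(1)[OF 2(2)] i1[OF C(1)[OF 2(2)]] unfolding 2(1) b1 b2(2)[OF 2(2)] b2(1)[OF 2(2)] mat_adjoint_one by simp
          next
            case 3
            have "\<mu> \<noteq> \<nu>" using 3 by auto
            then show ?thesis using C(1)[OF 3(1)] i1[OF C(1)[OF 3(1)]] unfolding 3(2) b1 b2(2)[OF 3(1)] b2(1)[OF 3(1)] mat_adjoint_one by simp
          next
            case 4
            show ?thesis unfolding b2(2)[OF 4(1)] b2(2)[OF 4(2)] b2(1)[OF 4(1)] b2(1)[OF 4(2)]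
              using C(3)[OF 4] by (simp add: smult_smult_mult_mat[OF C(1)[OF 4(1)] C(1)[OF 4(2)]] smult_smult_mult_mat[OF C(1)[OF 4(2)] C(1)[OF 4(1)]] one_smult)
          qed
        qed
        have "clifford_family (2 * m) (d + 1) (dirac_matrix d)"
          by (rule clifford_family_blocks[of d "dirac_block d"]) (simp_all only: rel bl car)
        then show ?thesis unfolding m(2) using car by simp
      qed
    qed
  qed
  then show "clifford_family (spinor_dim d) (d + 1) (dirac_matrix d)"
    "d \<noteq> 0 \<Longrightarrow> \<mu> \<in> {1..d} \<Longrightarrow> dirac_block d \<mu> \<in> carrier_mat (spinor_dim d div 2) (spinor_dim d div 2)" by auto
qed

lemma sum_mult_mat_entry:
  fixes X Y :: "complex mat"
  assumes "X \<in> carrier_mat n n" "Y \<in> carrier_mat n n" "k < n" "m < n"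
  shows "(X * Y) $$ (k, m) = (\<Sum>l<n. X $$ (k, l) * Y $$ (l, m))"
  using assms by (simp add: scalar_prod_def atLeast0LessThan)

lemma mult_mat_vec_entry:
  fixes X :: "complex mat"
  assumes "X \<in> carrier_mat n n" "v \<in> carrier_vec n" "k < n"
  shows "(X *\<^sub>v v) $v k = (\<Sum>l<n. X $$ (k, l) * v $v l)"
  using assms by (simp add: scalar_prod_def atLeast0LessThan)

lemma dirac_matrix_carrier: "\<mu> \<in> {1..d + 1} \<Longrightarrow> dirac_matrix d \<mu> \<in> carrier_mat (spinor_dim d) (spinor_dim d)"
  using clifford_family_dirac[of d] by (auto simp: clifford_family_def)

lemma dirac_coefficients_dirac_matrix:
  fixes e :: "nat \<Rightarrow> 'd::finite"
  assumes d: "d \<noteq> 0" and e: "bij_betw e {1..d} UNIV"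
  shows "dirac_coefficients (spinor_dim d) (\<lambda>j k l. dirac_matrix d (inv_into {1..d} e j) $$ (k, l))
    (\<lambda>k. if k < spinor_dim d div 2 then 1 else - 1)"
proof
  let ?n = "spinor_dim d" and ?i = "inv_into {1..d} e"
  have i: "?i j \<in> {1..d}" for j
    using bij_betw_imp_surj_on[OF e] by (intro inv_into_into) simp
  have ii: "?i j = ?i k \<longleftrightarrow> j = k" for j k
    using bij_betw_inv_into[OF e] by (auto simp: bij_betw_def inj_on_def)
  have i': "?i j \<in> {1..d + 1}" for j using i[of j] by simp
  note car = dirac_matrix_carrier[OF i']
  have n: "2 * (?n div 2) = ?n"
    using spinor_dim_odd[of d] spinor_dim_even[of d] d by (cases "odd d") auto
  have fam: "mat_adjoint (dirac_matrix d (?i j)) = dirac_matrix d (?i j)"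
    "dirac_matrix d (?i j) * dirac_matrix d (?i k) + dirac_matrix d (?i k) * dirac_matrix d (?i j) = (if j = k then 2 else 0) \<cdot>\<^sub>m 1\<^sub>m ?n" for j k
    using clifford_family_dirac[of d] i'[of j] i'[of k] unfolding clifford_family_def ii[symmetric] by blast+
  fix j :: 'd and k l :: nat
  show "(if k < ?n div 2 then 1 else - 1) = (1 :: real) \<or> (if k < ?n div 2 then 1 else - 1) = (- 1 :: real)" by simp
  assume k: "k < ?n" and l: "l < ?n"
  show "cnj (dirac_matrix d (?i j) $$ (k, l)) = dirac_matrix d (?i j) $$ (l, k)"
    using mat_adjoint_index[OF car l k, of j] unfolding fam(1) by simp
  show "(if l < ?n div 2 then 1 else - 1) = - (if k < ?n div 2 then 1 else - 1 :: real)" if nz: "dirac_matrix d (?i j) $$ (k, l) \<noteq> 0"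
  proof -
    have kl: "k < 2 * (?n div 2)" "l < 2 * (?n div 2)" using n k l by simp_all
    show ?thesis
      using nz unfolding dirac_matrix_blocks(1)[OF d i] offdiag_index[OF dirac_block_carrier[OF d i] kl] by (auto split: if_splits)
  qed
  fix i j
  show "(\<Sum>m<?n. dirac_matrix d (?i i) $$ (k, m) * dirac_matrix d (?i j) $$ (m, l) + dirac_matrix d (?i j) $$ (k, m) * dirac_matrix d (?i i) $$ (m, l))
      = (if i = j \<and> k = l then 2 else 0)"
  proof -
    have "(\<Sum>m<?n. dirac_matrix d (?i i) $$ (k, m) * dirac_matrix d (?i j) $$ (m, l) + dirac_matrix d (?i j) $$ (k, m) * dirac_matrix d (?i i) $$ (m, l))
        = (dirac_matrix d (?i i) * dirac_matrix d (?i j)) $$ (k, l) + (dirac_matrix d (?i j) * dirac_matrix d (?i i)) $$ (k, l)"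
      by (simp only: sum.distrib sum_mult_mat_entry[OF car car k l])
    also have "\<dots> = (dirac_matrix d (?i i) * dirac_matrix d (?i j) + dirac_matrix d (?i j) * dirac_matrix d (?i i)) $$ (k, l)"
      using k l car[of i] car[of j] by (intro index_add_mat(1)[symmetric]) auto
    also have "\<dots> = (if i = j \<and> k = l then 2 else 0)"
      unfolding fam(2) using k l by auto
    finally show ?thesis .
  qed
qed

section \<open>Absence of eigenvalues\<close>

theorem theorem3p6:
  fixes A :: "real ^ 'd::finite \<Rightarrow> real ^ 'd"
    and B :: "real ^ 'd \<Rightarrow> real ^ 'd ^ 'd"
    and e :: "nat \<Rightarrow> 'd"
    and c :: real
    and d n :: nat
  assumes d_def: "d = CARD('d)"
    and n_def: "n = spinor_dim d"
    and d_ge: "d \<ge> 3"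
    and coordinates: "bij_betw e {1..d} UNIV"
    and A_L2: "Lp_loc 2 A"
    and B_field: "magnetic_field A B"
    and B_L2: "Lp_loc 2 B"
    and c_range: "0 \<le> c" "c < 1"
    and c_small1: "2 * real d / (real d - 2) * c < 1"
    and c_small2: "2 * c + real d * (2 * real d - 3) / (real d - 2) * c
                     + sqrt 2 / sqrt (real d - 2) * (real d / 2 * c) powr (3 / 2) < 1"
    and B_bound: "\<And>u :: real ^ 'd \<Rightarrow> complex Matrix.vec.
       (\<forall>x. u x \<in> carrier_vec n) \<Longrightarrow> (\<forall>k<n. test_function (\<lambda>x. u x $v k)) \<Longrightarrow>
       (\<integral>\<^sup>+ x. ennreal ((norm x)\<^sup>2 * (onorm ((*v) (B x)))\<^sup>2 * (\<Sum>k<n. (cmod (u x $v k))\<^sup>2)) \<partial>lebesgue)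
         \<le> ennreal (c\<^sup>2) *
           (\<integral>\<^sup>+ x. ennreal (\<Sum>k<n. \<Sum>j\<in>UNIV. (cmod (magnetic_pderiv A j (\<lambda>y. u y $v k) x))\<^sup>2) \<partial>lebesgue)"
    and A_W1d: "W1p_loc d A"
  shows "point_spectrum n (dirac_operator e A) = {}"
proof (rule ccontr)
  assume "point_spectrum n (dirac_operator e A) \<noteq> {}"
  then obtain z u where zu: "(u, \<lambda>x. z \<cdot>\<^sub>v u x) \<in> dirac_operator e A" and ne: "\<not> (AE x in lebesgue. u x = 0\<^sub>v n)"
    by (auto simp: point_spectrum_def)
  obtain w where uL: "u \<in> L2_spinor n" and w: "L2_magnetic_gradient n A u w"
    and eq: "AE x in lebesgue. \<forall>k<n. (z \<cdot>\<^sub>v u x) $v k = - \<i> * (\<Sum>\<mu>=1..d. (dirac_matrix d \<mu> *\<^sub>v w (e \<mu>) x) $v k)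
                         + 1 / 2 * (dirac_matrix d (d + 1) *\<^sub>v u x) $v k"
    using zu unfolding dirac_operator_def Let_def d_def[symmetric] n_def[symmetric] magnetic_sobolev_def by blast
  have d0: "d \<noteq> 0" using d_ge by simp
  have n1: "n \<ge> 1" by (simp add: n_def spinor_dim_def)
  define a where "a = (\<lambda>j k l. dirac_matrix d (inv_into {1..d} e j) $$ (k, l))"
  define s where "s = (\<lambda>k. if k < n div 2 then 1 else - 1 :: real)"
  define f where "f k x = u x $v k" for k x
  define g where "g k j x = w j x $v k" for k j x
  let ?h = "2 / (real d - 2)"
  have ux: "u x \<in> carrier_vec n" for x using uL by (simp add: L2_spinor_def)
  have wx: "w j x \<in> carrier_vec n" for j x using w by (simp add: L2_magnetic_gradient_def L2_spinor_def)
  interpret magnetic_dirac n a s A B c ?h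
  proof (rule magnetic_dirac.intro)
    show "dirac_coefficients n a s"
      unfolding a_def s_def n_def by (rule dirac_coefficients_dirac_matrix[OF d0 coordinates])
    show "magnetic_dirac_axioms A B c ?h"
    proof
      show "form_bounded A (\<lambda>x. norm x * opnorm (B x)) 0 (c\<^sup>2)"
        using B_field by (intro form_bounded_field[OF A_L2 _ n1 B_bound]) (auto simp: magnetic_field_def Lp_loc_def)
      show "form_bounded A (\<lambda>x. inverse (norm x)) 0 (?h\<^sup>2)"
        using form_bounded_hardy[OF A_L2] d_ge unfolding d_def by simp
    qed (use A_L2 B_field c_range d_ge in auto)
  qed
  have "dirac_eigenfunction n a s A B c ?h f g z"
  proof
    fix k assume k: "k < n"
    show "magH1 A (f k) (g k)"
      using uL w k by (auto simp: magH1_def L2_def L2_spinor_def L2_magnetic_gradient_def f_def[abs_def] g_def[abs_def])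
    have ds: "(\<Sum>\<mu>=1..d. (dirac_matrix d \<mu> *\<^sub>v w (e \<mu>) x) $v k) = alpha_grad g k x" for x
    proof -
      have "(\<Sum>\<mu>=1..d. (dirac_matrix d \<mu> *\<^sub>v w (e \<mu>) x) $v k) = (\<Sum>\<mu>=1..d. \<Sum>l<n. a (e \<mu>) k l * g l (e \<mu>) x)"
      proof (rule sum.cong[OF refl])
        fix \<mu> assume m: "\<mu> \<in> {1..d}"
        have inv: "inv_into {1..d} e (e \<mu>) = \<mu>" using inv_into_f_f[OF bij_betw_imp_inj_on[OF coordinates] m] .
        have "dirac_matrix d \<mu> \<in> carrier_mat n n" unfolding n_def using m by (intro dirac_matrix_carrier) simp
        from mult_mat_vec_entry[OF this wx k]
        show "(dirac_matrix d \<mu> *\<^sub>v w (e \<mu>) x) $v k = (\<Sum>l<n. a (e \<mu>) k l * g l (e \<mu>) x)"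
          by (simp only: a_def g_def inv)
      qed
      also have "\<dots> = (\<Sum>j\<in>UNIV. \<Sum>l<n. a j k l * g l j x)"
        by (rule sum.reindex_bij_betw[OF coordinates])
      finally show ?thesis by (simp only: alpha_grad_def)
    qed
    have be: "(dirac_matrix d (d + 1) *\<^sub>v u x) $v k = complex_of_real (s k) * f k x" for x
    proof -
      have n2: "2 * (n div 2) = n"
        using spinor_dim_odd[of d] spinor_dim_even[of d] d0 unfolding n_def by (cases "odd d") auto
      have b: "beta (n div 2) $$ (k, l) = (if k = l then complex_of_real (s k) else 0)" if "l < n" for l
        using beta_index[of k "n div 2" l] that k unfolding n2 by (simp add: s_def)
      have bc: "beta (n div 2) \<in> carrier_mat n n" using beta_carrier[of "n div 2"] unfolding n2 .
      have "(dirac_matrix d (d + 1) *\<^sub>v u x) $v k = (\<Sum>l<n. beta (n div 2) $$ (k, l) * u x $v l)"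
        unfolding dirac_matrix_blocks(2)[OF d0] n_def[symmetric] by (rule mult_mat_vec_entry[OF bc ux k])
      also have "\<dots> = (\<Sum>l<n. if k = l then complex_of_real (s k) * f l x else 0)"
        by (rule sum.cong) (auto simp: b f_def)
      finally show ?thesis using k by simp
    qed
    show "AE x in lebesgue. alpha_grad g k x = \<i> * (z - complex_of_real (s k) / 2) * f k x"
      using eq
    proof eventually_elim
      case (elim x)
      have "z * f k x = - \<i> * alpha_grad g k x + 1 / 2 * (complex_of_real (s k) * f k x)"
        using spec[OF elim, of k] k ux[of x] unfolding ds be by (simp add: f_def)
      then have "\<i> * (- \<i> * alpha_grad g k x) = \<i> * (z * f k x - 1 / 2 * (complex_of_real (s k) * f k x))" by simp
      then show ?case by (simp add: algebra_simps)
    qed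
  qed
  then interpret dirac_eigenfunction n a s A B c ?h f g z .
  have dp: "real d - 2 > 0" using d_ge by simp
  have "2 * real d * c < real d - 2" using c_small1 dp by (simp add: field_simps)
  moreover have "real d * c \<ge> 0" using c_range by simp
  ultimately have "real CARD('d) * (c * ?h) < 1" "2 * c < 1"
  proof -
    assume 1: "2 * real d * c < real d - 2"
    show "real CARD('d) * (c * ?h) < 1" using 1 dp unfolding d_def[symmetric] by (simp add: field_simps)
    show "2 * c < 1"
    proof (rule ccontr)
      assume "\<not> 2 * c < 1"
      then have "real d * 1 \<le> real d * (2 * c)" by (intro mult_left_mono) auto
      then show False using 1 by simp
    qed
  qed
  from no_eigenfunction[OF this] have "(\<Sum>k<n. sqint (f k)) = 0" by (simp only: N_sum)
  then have "AE x in lebesgue. f k x = 0" if "k < n" for k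
    using sum_nonneg_eq_0_iff[of "{..<n}" "\<lambda>k. sqint (f k)"] that sqint_nonneg
      integral_nonneg_eq_0_iff_AE[OF L2_integrable[OF Lf[OF that]]] by (simp add: sqint_def)
  then have "AE x in lebesgue. \<forall>k\<in>{..<n}. f k x = 0" by (intro AE_finite_allI) auto
  then have "AE x in lebesgue. u x = 0\<^sub>v n"
    by eventually_elim (rule eq_vecI, use ux in \<open>auto simp: f_def\<close>)
  with ne show False ..
qed

end
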